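(* Let $\mathbf{k}$ be a differential field of characteristic $0$ with derivation $\partial$, let $G$ be a linear differential algebraic group over $\mathbf{k}$ with differential coordinate ring $A=\mathbf{k}\{G\}$, let $\mathcal{A}$ be the differential algebra constructed from $\mathbf{Rep}_G$ as described in the context, with the operations $\tilde\Delta,\tilde\varepsilon,\tilde S$, and let $\Phi:\mathcal{A}\to A$ be the $\partial$-$\mathbf{k}$-algebra homomorphism with $\Phi\circ a_V=\psi_V$ for all differential $G$-modules $V$. Then $\Phi$ is a differential Hopf algebra homomorphism.
   Context: A $\partial$-$\mathbf{k}$-algebra is a commutative $\mathbf{k}$-algebra with $1$ with a derivation $\partial$ extending that of $\mathbf{k}$; homomorphisms commute with $\partial$. A differential Hopf algebra is a commutative Hopf algebra that is a $\partial$-$\mathbf{k}$-algebra and whose comultiplication, counit and coinverse are $\partial$-$\mathbf{k}$-algebra homomorphisms. A linear differential algebraic group $G$ over $\mathbf{k}$ is a subgroup of $\mathbf{GL}_n(\mathcal{U})$ defined by differential polynomial equations over $\mathbf{k}$, where $\mathcal{U}\supset\mathbf{k}$ is a semi-universal differential field (every differentially finitely generated differential field extension of $\mathbf{k}$ embeds in $\mathcal{U}$ over $\mathbf{k}$). Its coordinate ring $A=\mathbf{k}\{G\}$ is the quotient of $\mathbf{k}\{X_{ij},1/\det\}$ (differential polynomial ring in $n^2$ differential indeterminates with $\det$ inverted) by the radical differential ideal of $G$; it is a differential Hopf algebra ($\Delta,\varepsilon,S$), and $G$ is viewed as the functor $B\mapsto G(B)=\mathrm{Hom}_{\mathbf{k}[\partial]}(A,B)$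 from $\partial$-$\mathbf{k}$-algebras to groups, with $(\varphi_1\varphi_2)(a)=(\varphi_1\otimes\varphi_2)(\Delta(a))$. $\mathbf{Rep}_G$ is the category of differential representations (differential $G$-modules): finite dimensional $\mathbf{k}$-vector spaces $V$ with a morphism of group functors $r_V:G\to\mathbf{GL}(V)$, $\mathbf{GL}(V)(B)=\mathrm{Aut}_B(V\otimes B)$, equivalently an $A$-comodule structure $\rho_V:V\to V\otimes A$; morphisms are $\mathbf{k}$-linear maps commuting with $G$. Tensor products and duals carry the usual actions; $\underline{1}$ is the trivial representation. Prolongation: let $\mathbf{k}[\partial]$ be the ring of linear differential operators ($\partial a=a\partial+\partial(a)$). $V^{(1)}:=\mathbf{k}[\partial]_{\le1}\otimes_{\mathbf{k}}V$ (right $\mathbf{k}$-structure on $\mathbf{k}[\partial]_{\le 1}$ for the tensor product, left one for the vector space structure); write $v=1\otimes v$, $\partial v=\partial\otimes v$. If $V$ has basis $v_1,\dots,v_n$ and $\rho_V(v_j)=\sum_iv_i\otimes a_{ij}$, then $V^{(1)}$ is a $G$-module via $\rho(v_j)=\sum_iv_i\otimes a_{ij}$, $\rho(\partial v_j)=\sum_i(\partial v_i\otimes a_{ij}+v_i\otimes\partial a_{ij})$. For $u\in V^*$ define $F(u)\in(V^{(1)})^*$ by $F(u)(v)=u(v)$, $F(u)(\partial\otimes v)=\partial(u(v))$ for $v\in V$. The linear map $\psi_V:V\otimes V^*\to A$ is $\psi_V(v\otimes u)(g)=u(r_V(g)\cdot v)$, i.e. $\psi_V(v\otimes u)=(u\otimes\mathrm{id}_A)(\rho_V(v))$.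 Construction of $\mathcal{A}$: $\mathcal{F}=\bigoplus_{V\in\mathrm{Ob}(\mathbf{Rep}_G)}V\otimes V^*$ with canonical injections $i_V$; $\mathcal{R}\subset\mathcal{F}$ is the subspace spanned by all $(i_V\circ(\mathrm{id}\otimes\phi^* )-i_W\circ(\phi\otimes\mathrm{id}))(z)$ with $V,W\in\mathrm{Ob}(\mathbf{Rep}_G)$, $\phi\in\mathrm{Hom}_G(V,W)$, $z\in V\otimes W^*$; $\mathcal{A}=\mathcal{F}/\mathcal{R}$, and $a_V:V\otimes V^*\to\mathcal{A}$ is $i_V$ followed by the quotient map. Operations on $\mathcal{A}$: product $a_V(v\otimes u)\cdot a_W(w\otimes t)=a_{V\otimes W}((v\otimes w)\otimes(u\otimes t))$; unit $a_{\underline{1}}(e\otimes f)$ with $0\neq e\in\underline{1}$, $f(e)=1$; derivation $\partial(a_V(v\otimes u))=a_{V^{(1)}}(\partial v\otimes F(u))$; comultiplication $\tilde\Delta(a_V(v\otimes u))=\sum_ja_V(v_j\otimes u)\otimes a_V(v\otimes u_j)$, where $\{v_j\}$ is a basis of $V$ with dual basis $\{u_j\}$; counit $\tilde\varepsilon(a_V(v\otimes u))=u(v)$; coinverse $\tilde S(a_V(v\otimes u))=a_{V^*}(u\otimes v)$ with $v$ viewed in $V^{**}$. The map $\Phi$ is defined by $\Phi(a_V(v\otimes u))=\psi_V(v\otimes u)$ (it is a well-defined $\partial$-$\mathbf{k}$-algebra homomorphism). *)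

theory Defs
  imports
    "HOL-Algebra.QuotRing"
    "HOL-Algebra.Subrings"
    "HOL-Library.Poly_Mapping"
    "HOL-Library.Product_Lexorder"
    "HOL-Computational_Algebra.Fraction_Field"
    "Jordan_Normal_Form.Determinant"
    "Jordan_Normal_Form.VS_Connect"
begin

text \<open>The base field is a type \<open>'k\<close>; as a ring record it is \<^term>\<open>class_ring\<close>. Vector spaces are
  \<open>module\<close> records over it, whose fields \<open>mult\<close> and \<open>one\<close> are irrelevant.\<close>

section \<open>Linear algebra: spaces, quotients, tensor products, duals\<close>

definition mk_space ::
  "'v set \<Rightarrow> 'v \<Rightarrow> ('v \<Rightarrow> 'v \<Rightarrow> 'v) \<Rightarrow> ('k \<Rightarrow> 'v \<Rightarrow> 'v) \<Rightarrow> ('k, 'v) module" where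
  "mk_space C z a s =
    \<lparr>carrier = C, mult = undefined, one = undefined, zero = z, add = a, smult = s\<rparr>"

definition field_space :: "('k::field, 'k) module" where
  "field_space = \<lparr>carrier = UNIV, mult = (*), one = 1, zero = 0, add = (+), smult = (*)\<rparr>"

definition quot_module ::
  "('k, 'v, 'c) module_scheme \<Rightarrow> 'v set \<Rightarrow> ('k, 'v set) module" where
  "quot_module M N = \<lparr>carrier = a_rcosets\<^bsub>M\<^esub> N, mult = rcoset_mult M N, one = N +>\<^bsub>M\<^esub> \<one>\<^bsub>M\<^esub>,
     zero = N, add = set_add M, smult = (\<lambda>c X. \<Union>x\<in>X. N +>\<^bsub>M\<^esub> (c \<odot>\<^bsub>M\<^esub> x))\<rparr>"

text \<open>\<open>additive_ext M N I x y\<close> is the additive map from \<open>M\<close> to \<open>N\<close> sending \<open>x i\<close> to \<open>y i\<close> for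
  all \<open>i \<in> I\<close>. It is used only where the \<open>x i\<close> generate \<open>M\<close> as an abelian group, so that there is at
  most one such map. Additivity instead of linearity makes it applicable to derivations.\<close>

definition additive_ext ::
  "('m, 'c) ring_scheme \<Rightarrow> ('n, 'd) ring_scheme \<Rightarrow> 'i set \<Rightarrow> ('i \<Rightarrow> 'm) \<Rightarrow> ('i \<Rightarrow> 'n) \<Rightarrow> 'm \<Rightarrow> 'n" where
  "additive_ext M N I x y =
    (THE f. f \<in> extensional (carrier M) \<and> f \<in> hom (add_monoid M) (add_monoid N) \<and>
            (\<forall>i\<in>I. f (x i) = y i))"

definition free_space :: "'b set \<Rightarrow> ('k::field, 'b \<Rightarrow>\<^sub>0 'k) module" where
  "free_space B = mk_space {p. Poly_Mapping.keys p \<subseteq> B} 0 (+) (\<lambda>c. Poly_Mapping.map (\<lambda>x. c * x))"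

definition tensor_rel ::
  "('k::field, 'v, 'c) module_scheme \<Rightarrow> ('k, 'w, 'd) module_scheme \<Rightarrow> ('v \<times> 'w \<Rightarrow>\<^sub>0 'k) set" where
  "tensor_rel V W = module.span class_ring (free_space (carrier V \<times> carrier W))
     ({Poly_Mapping.single (v \<oplus>\<^bsub>V\<^esub> v', w) 1 - Poly_Mapping.single (v, w) 1
         - Poly_Mapping.single (v', w) 1
        | v v' w. v \<in> carrier V \<and> v' \<in> carrier V \<and> w \<in> carrier W} \<union>
      {Poly_Mapping.single (v, w \<oplus>\<^bsub>W\<^esub> w') 1 - Poly_Mapping.single (v, w) 1
         - Poly_Mapping.single (v, w') 1
        | v w w'. v \<in> carrier V \<and> w \<in> carrier W \<and> w' \<in> carrier W} \<union>
      {Poly_Mapping.single (c \<odot>\<^bsub>V\<^esub> v, w) 1 - Poly_Mapping.single (v, w) c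
        | c v w. v \<in> carrier V \<and> w \<in> carrier W} \<union>
      {Poly_Mapping.single (v, c \<odot>\<^bsub>W\<^esub> w) 1 - Poly_Mapping.single (v, w) c
        | c v w. v \<in> carrier V \<and> w \<in> carrier W})"

type_synonym ('k, 'v, 'w) tensor = "('v \<times> 'w \<Rightarrow>\<^sub>0 'k) set"

definition tensor ::
  "('k::field, 'v, 'c) module_scheme \<Rightarrow> ('k, 'w, 'd) module_scheme \<Rightarrow>
   ('k, ('k, 'v, 'w) tensor) module" where
  "tensor V W = quot_module (free_space (carrier V \<times> carrier W)) (tensor_rel V W)"

text \<open>The element $v \otimes w$ of $V \otimes W$.\<close>

definition tens ::
  "('k::field, 'v, 'c) module_scheme \<Rightarrow> ('k, 'w, 'd) module_scheme \<Rightarrow> 'v \<Rightarrow> 'w \<Rightarrow>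
   ('k, 'v, 'w) tensor" where
  "tens V W v w = tensor_rel V W +>\<^bsub>free_space (carrier V \<times> carrier W)\<^esub> Poly_Mapping.single (v, w) 1"

definition tensor_ext ::
  "('k::field, 'v, 'c) module_scheme \<Rightarrow> ('k, 'w, 'd) module_scheme \<Rightarrow> ('n, 'e) ring_scheme \<Rightarrow>
   ('v \<Rightarrow> 'w \<Rightarrow> 'n) \<Rightarrow> ('k, 'v, 'w) tensor \<Rightarrow> 'n" where
  "tensor_ext V W N \<beta> = additive_ext (tensor V W) N (carrier V \<times> carrier W)
     (\<lambda>(v, w). tens V W v w) (\<lambda>(v, w). \<beta> v w)"

definition tensor_map ::
  "('k::field, 'v, 'c) module_scheme \<Rightarrow> ('k, 'w, 'd) module_scheme \<Rightarrow>
   ('k, 'v2, 'c2) module_scheme \<Rightarrow> ('k, 'w2, 'd2) module_scheme \<Rightarrow>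
   ('v \<Rightarrow> 'v2) \<Rightarrow> ('w \<Rightarrow> 'w2) \<Rightarrow> ('k, 'v, 'w) tensor \<Rightarrow> ('k, 'v2, 'w2) tensor" where
  "tensor_map V W V2 W2 f g = tensor_ext V W (tensor V2 W2) (\<lambda>v w. tens V2 W2 (f v) (g w))"

text \<open>$(V \otimes W) \otimes U \to V \otimes (W \otimes U)$\<close>

definition tensor_assoc ::
  "('k::field, 'v, 'c) module_scheme \<Rightarrow> ('k, 'w, 'd) module_scheme \<Rightarrow> ('k, 'u, 'e) module_scheme \<Rightarrow>
   ('k, ('k, 'v, 'w) tensor, 'u) tensor \<Rightarrow> ('k, 'v, ('k, 'w, 'u) tensor) tensor" where
  "tensor_assoc V W U =
     additive_ext (tensor (tensor V W) U) (tensor V (tensor W U)) (carrier V \<times> carrier W \<times> carrier U)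
       (\<lambda>(v, w, u). tens (tensor V W) U (tens V W v w) u)
       (\<lambda>(v, w, u). tens V (tensor W U) v (tens W U w u))"

definition dual_space :: "('k::field, 'v, 'c) module_scheme \<Rightarrow> ('k, 'v \<Rightarrow> 'k) module" where
  "dual_space V = mk_space
     {u. u \<in> extensional (carrier V) \<and> u \<in> module_hom class_ring V field_space}
     (\<lambda>v\<in>carrier V. 0) (\<lambda>u t. \<lambda>v\<in>carrier V. u v + t v) (\<lambda>c u. \<lambda>v\<in>carrier V. c * u v)"

definition some_basis :: "('k::field, 'v, 'c) module_scheme \<Rightarrow> 'v set" where
  "some_basis V = (SOME B. finite B \<and> vectorspace.basis class_ring V B)"

definition dual_vec :: "('k::field, 'v, 'c) module_scheme \<Rightarrow> 'v set \<Rightarrow> 'v \<Rightarrow> 'v \<Rightarrow> 'k" where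
  "dual_vec V B b = (THE u. u \<in> carrier (dual_space V) \<and> (\<forall>b'\<in>B. u b' = (if b' = b then 1 else 0)))"

definition direct_sum_space ::
  "'i set \<Rightarrow> ('i \<Rightarrow> ('k, 'v) module) \<Rightarrow> ('k, 'i \<Rightarrow> 'v) module" where
  "direct_sum_space I M = mk_space
     {f \<in> (\<Pi>\<^sub>E i\<in>I. carrier (M i)). finite {i \<in> I. f i \<noteq> \<zero>\<^bsub>M i\<^esub>}}
     (\<lambda>i\<in>I. \<zero>\<^bsub>M i\<^esub>) (\<lambda>f g. \<lambda>i\<in>I. f i \<oplus>\<^bsub>M i\<^esub> g i) (\<lambda>c f. \<lambda>i\<in>I. c \<odot>\<^bsub>M i\<^esub> f i)"

definition direct_sum_inj :: "'i set \<Rightarrow> ('i \<Rightarrow> ('k, 'v) module) \<Rightarrow> 'i \<Rightarrow> 'v \<Rightarrow> 'i \<Rightarrow> 'v" where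
  "direct_sum_inj I M i x = (\<lambda>j\<in>I. if j = i then x else \<zero>\<^bsub>M j\<^esub>)"

section \<open>Differential algebras and differential Hopf algebras\<close>

definition derivation :: "('a, 'c) ring_scheme \<Rightarrow> ('a \<Rightarrow> 'a) \<Rightarrow> bool" where
  "derivation R d \<longleftrightarrow> d \<in> carrier R \<rightarrow> carrier R \<and>
     (\<forall>x\<in>carrier R. \<forall>y\<in>carrier R. d (x \<oplus>\<^bsub>R\<^esub> y) = d x \<oplus>\<^bsub>R\<^esub> d y \<and>
        d (x \<otimes>\<^bsub>R\<^esub> y) = d x \<otimes>\<^bsub>R\<^esub> y \<oplus>\<^bsub>R\<^esub> x \<otimes>\<^bsub>R\<^esub> d y)"

record ('k, 'a) dalg = "('k, 'a) module" +
  deriv :: "'a \<Rightarrow> 'a"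

definition mk_dalg ::
  "('k, 'a, 'c) module_scheme \<Rightarrow> ('a \<Rightarrow> 'a \<Rightarrow> 'a) \<Rightarrow> 'a \<Rightarrow> ('a \<Rightarrow> 'a) \<Rightarrow> ('k, 'a) dalg" where
  "mk_dalg M m e d = \<lparr>carrier = carrier M, mult = m, one = e, zero = zero M, add = add M,
     smult = smult M, deriv = d\<rparr>"

definition field_dalg :: "('k::field \<Rightarrow> 'k) \<Rightarrow> ('k, 'k) dalg" where
  "field_dalg dk = mk_dalg field_space (*) 1 dk"

locale diff_algebra = algebra class_ring A
  for dk :: "'k::field \<Rightarrow> 'k" and A :: "('k, 'a, 'c) dalg_scheme" (structure) +
  assumes derivation_deriv: "derivation A (deriv A)"
    and deriv_smult: "x \<in> carrier A \<Longrightarrow> deriv A (c \<odot> x) = dk c \<odot> x \<oplus> c \<odot> deriv A x"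

definition dalg_hom ::
  "('k::field, 'a, 'c) dalg_scheme \<Rightarrow> ('k, 'b, 'd) dalg_scheme \<Rightarrow> ('a \<Rightarrow> 'b) set" where
  "dalg_hom A B = {f \<in> Ring.ring_hom A B. f \<in> module_hom class_ring A B \<and>
     (\<forall>x\<in>carrier A. f (deriv A x) = deriv B (f x))}"

definition tensor_dalg ::
  "('k::field, 'a, 'c) dalg_scheme \<Rightarrow> ('k, 'b, 'd) dalg_scheme \<Rightarrow>
   ('k, ('k, 'a, 'b) tensor) dalg" where
  "tensor_dalg A B = mk_dalg (tensor A B)
     (\<lambda>x y. tensor_ext A B (tensor A B)
        (\<lambda>a b. tensor_ext A B (tensor A B)
           (\<lambda>a' b'. tens A B (a \<otimes>\<^bsub>A\<^esub> a') (b \<otimes>\<^bsub>B\<^esub> b')) y) x)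
     (tens A B \<one>\<^bsub>A\<^esub> \<one>\<^bsub>B\<^esub>)
     (tensor_ext A B (tensor A B)
        (\<lambda>a b. tens A B (deriv A a) b \<oplus>\<^bsub>tensor A B\<^esub> tens A B a (deriv B b)))"

record (overloaded) ('k::zero, 'a) hopf = "('k, 'a) dalg" +
  comult :: "'a \<Rightarrow> ('k, 'a, 'a) tensor"
  counit :: "'a \<Rightarrow> 'k"
  coinv :: "'a \<Rightarrow> 'a"

locale diff_hopf_algebra = diff_algebra dk A
  for dk :: "'k::field \<Rightarrow> 'k" and A :: "('k, 'a, 'c) hopf_scheme" (structure) +
  assumes comult_hom: "comult A \<in> dalg_hom A (tensor_dalg A A)"
    and counit_hom: "counit A \<in> dalg_hom A (field_dalg dk)"
    and coinv_hom: "coinv A \<in> dalg_hom A A"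
    and coassoc: "x \<in> carrier A \<Longrightarrow>
      tensor_assoc A A A (tensor_map A A (tensor A A) A (comult A) id (comult A x)) =
      tensor_map A A A (tensor A A) id (comult A) (comult A x)"
    and counit_left: "x \<in> carrier A \<Longrightarrow> tensor_ext A A A (\<lambda>a b. counit A a \<odot> b) (comult A x) = x"
    and counit_right: "x \<in> carrier A \<Longrightarrow> tensor_ext A A A (\<lambda>a b. counit A b \<odot> a) (comult A x) = x"
    and coinv_left: "x \<in> carrier A \<Longrightarrow>
      tensor_ext A A A (\<lambda>a b. coinv A a \<otimes> b) (comult A x) = counit A x \<odot> \<one>"
    and coinv_right: "x \<in> carrier A \<Longrightarrow>
      tensor_ext A A A (\<lambda>a b. a \<otimes> coinv A b) (comult A x) = counit A x \<odot> \<one>"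

locale diff_hopf_hom = A?: diff_hopf_algebra dk A + B?: diff_hopf_algebra dk B
  for dk :: "'k::field \<Rightarrow> 'k" and A :: "('k, 'a, 'c) hopf_scheme" and B :: "('k, 'b, 'd) hopf_scheme" +
  fixes f :: "'a \<Rightarrow> 'b"
  assumes dalg_hom: "f \<in> dalg_hom A B"
    and comult_comm: "x \<in> carrier A \<Longrightarrow> comult B (f x) = tensor_map A A B B f f (comult A x)"
    and counit_comm: "x \<in> carrier A \<Longrightarrow> counit B (f x) = counit A x"
    and coinv_comm: "x \<in> carrier A \<Longrightarrow> coinv B (f x) = f (coinv A x)"

section \<open>Linear differential algebraic groups and their coordinate rings\<close>

text \<open>The variable \<open>(i, j, r)\<close> stands for the derivative $\partial^r X_{ij}$.\<close>

type_synonym 'k dpoly = "((nat \<times> nat \<times> nat) \<Rightarrow>\<^sub>0 nat) \<Rightarrow>\<^sub>0 'k"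

definition dpolys :: "nat \<Rightarrow> 'k::field dpoly set" where
  "dpolys n = {p. \<forall>m\<in>Poly_Mapping.keys p. \<forall>(i, j, r)\<in>Poly_Mapping.keys m. i < n \<and> j < n}"

definition dvar :: "nat \<Rightarrow> nat \<Rightarrow> 'k::field dpoly" where
  "dvar i j = Poly_Mapping.single (Poly_Mapping.single (i, j, 0) 1) 1"

definition dpoly_deriv :: "('k::field \<Rightarrow> 'k) \<Rightarrow> 'k dpoly \<Rightarrow> 'k dpoly" where
  "dpoly_deriv dk p = (\<Sum>m\<in>Poly_Mapping.keys p.
     Poly_Mapping.single m (dk (Poly_Mapping.lookup p m)) +
     (\<Sum>(i, j, r)\<in>Poly_Mapping.keys m.
        Poly_Mapping.single
          (m - Poly_Mapping.single (i, j, r) 1 + Poly_Mapping.single (i, j, Suc r) 1)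
          (Poly_Mapping.lookup p m * of_nat (Poly_Mapping.lookup m (i, j, r)))))"

definition dpoly_eval ::
  "('k::field \<Rightarrow> 'u::field) \<Rightarrow> ('u \<Rightarrow> 'u) \<Rightarrow> 'u mat \<Rightarrow> 'k dpoly \<Rightarrow> 'u" where
  "dpoly_eval emb dU g p = (\<Sum>m\<in>Poly_Mapping.keys p. emb (Poly_Mapping.lookup p m) *
     (\<Prod>(i, j, r)\<in>Poly_Mapping.keys m. ((dU ^^ r) (g $$ (i, j))) ^ Poly_Mapping.lookup m (i, j, r)))"

definition generic_det :: "nat \<Rightarrow> 'k::field dpoly" where
  "generic_det n = det (mat n n (\<lambda>(i, j). dvar i j))"

definition fract_deriv :: "('a::idom \<Rightarrow> 'a) \<Rightarrow> 'a fract \<Rightarrow> 'a fract" where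
  "fract_deriv d q =
    (THE r. \<forall>a b. b \<noteq> 0 \<longrightarrow> q = Fract a b \<longrightarrow> r = Fract (d a * b - a * d b) (b * b))"

text \<open>$\mathbf{k}\{X_{ij}, 1/\det\}$, inside the fraction field of the differential polynomials.\<close>

definition GL_dalg :: "('k::field \<Rightarrow> 'k) \<Rightarrow> nat \<Rightarrow> ('k, 'k dpoly fract) dalg" where
  "GL_dalg dk n = \<lparr>carrier = {Fract p (generic_det n ^ m) | p m. p \<in> dpolys n},
     mult = (*), one = 1, zero = 0, add = (+),
     smult = (\<lambda>c q. Fract (Poly_Mapping.single 0 c) 1 * q),
     deriv = fract_deriv (dpoly_deriv dk)\<rparr>"

text \<open>$G \subseteq \mathbf{GL}_n(\mathcal{U})$ is a subgroup defined by differential polynomial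
  equations over the base field, which is embedded into $\mathcal{U}$ by \<open>emb\<close>. Since the determinant
  is invertible on $\mathbf{GL}_n$, equations involving $1/\det$ can be cleared of denominators.\<close>

definition linear_diff_alg_group ::
  "('k::field \<Rightarrow> 'u::field) \<Rightarrow> ('u \<Rightarrow> 'u) \<Rightarrow> nat \<Rightarrow> 'u mat set \<Rightarrow> bool" where
  "linear_diff_alg_group emb dU n G \<longleftrightarrow>
     subgroup G (units_of (ring_mat TYPE('u) n ())) \<and>
     (\<exists>E\<subseteq>dpolys n. G = {g \<in> Units (ring_mat TYPE('u) n ()). \<forall>p\<in>E. dpoly_eval emb dU g p = 0})"

definition vanishing_ideal ::
  "('k::field \<Rightarrow> 'u::field) \<Rightarrow> ('u \<Rightarrow> 'u) \<Rightarrow> nat \<Rightarrow> 'u mat set \<Rightarrow> 'k dpoly fract set" where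
  "vanishing_ideal emb dU n G =
     {Fract p (generic_det n ^ m) | p m. p \<in> dpolys n \<and> (\<forall>g\<in>G. dpoly_eval emb dU g p = 0)}"

definition quot_dalg :: "('k, 'a) dalg \<Rightarrow> 'a set \<Rightarrow> ('k, 'a set) dalg" where
  "quot_dalg A I = mk_dalg (quot_module A I) (mult (A Quot I)) (one (A Quot I))
     (\<lambda>X. \<Union>x\<in>X. I +>\<^bsub>A\<^esub> deriv A x)"

definition coordinate_ring ::
  "('k::field \<Rightarrow> 'k) \<Rightarrow> ('u::field \<Rightarrow> 'u) \<Rightarrow> ('k \<Rightarrow> 'u) \<Rightarrow> nat \<Rightarrow> 'u mat set \<Rightarrow>
   ('k, 'k dpoly fract set) dalg" where
  "coordinate_ring dk dU emb n G = quot_dalg (GL_dalg dk n) (vanishing_ideal emb dU n G)"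

definition coord ::
  "('k::field \<Rightarrow> 'k) \<Rightarrow> ('u::field \<Rightarrow> 'u) \<Rightarrow> ('k \<Rightarrow> 'u) \<Rightarrow> nat \<Rightarrow> 'u mat set \<Rightarrow>
   nat \<Rightarrow> nat \<Rightarrow> 'k dpoly fract set" where
  "coord dk dU emb n G i j = vanishing_ideal emb dU n G +>\<^bsub>GL_dalg dk n\<^esub> Fract (dvar i j) 1"

text \<open>\<open>H\<close> is the differential Hopf algebra $\mathbf{k}\{G\}$: the coordinate ring together with the
  comultiplication dual to matrix multiplication. The latter is determined by its values on the
  $X_{ij}$, and the counit and coinverse are determined by the comultiplication.\<close>

definition is_coordinate_hopf_algebra ::
  "('k::field \<Rightarrow> 'k) \<Rightarrow> ('u::field \<Rightarrow> 'u) \<Rightarrow> ('k \<Rightarrow> 'u) \<Rightarrow> nat \<Rightarrow> 'u mat set \<Rightarrow>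
   ('k, 'k dpoly fract set) hopf \<Rightarrow> bool" where
  "is_coordinate_hopf_algebra dk dU emb n G H \<longleftrightarrow>
     dalg.truncate H = coordinate_ring dk dU emb n G \<and>
     diff_hopf_algebra dk H \<and>
     (\<forall>i<n. \<forall>j<n. comult H (coord dk dU emb n G i j) =
        (\<Oplus>\<^bsub>tensor H H\<^esub>l\<in>{..<n}. tens H H (coord dk dU emb n G i l) (coord dk dU emb n G l j)))"

definition diff_finitely_generated :: "'l ring \<Rightarrow> ('l \<Rightarrow> 'l) \<Rightarrow> 'l set \<Rightarrow> bool" where
  "diff_finitely_generated L dL K \<longleftrightarrow> (\<exists>S. finite S \<and> S \<subseteq> carrier L \<and>
     (\<forall>F. subfield F L \<and> dL ` F \<subseteq> F \<and> K \<union> S \<subseteq> F \<longrightarrow> F = carrier L))"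

text \<open>A differentially finitely generated extension of the infinite field \<open>'k\<close> has the cardinality
  of \<open>'k\<close>. Hence, up to isomorphism, all of them are obtained with carriers inside the type \<open>'k\<close>
  (with field operations unrelated to those of \<open>'k\<close>).\<close>

definition semi_universal ::
  "('k::field_char_0 \<Rightarrow> 'k) \<Rightarrow> ('u::field \<Rightarrow> 'u) \<Rightarrow> ('k \<Rightarrow> 'u) \<Rightarrow> bool" where
  "semi_universal dk dU emb \<longleftrightarrow>
     derivation class_ring dU \<and> emb \<in> Ring.ring_hom class_ring class_ring \<and>
     (\<forall>c. emb (dk c) = dU (emb c)) \<and>
     (\<forall>(L :: 'k ring) dL i. field L \<and> derivation L dL \<and> i \<in> Ring.ring_hom class_ring L \<and>
        (\<forall>c. i (dk c) = dL (i c)) \<and> diff_finitely_generated L dL (range i) \<longrightarrow>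
        (\<exists>\<sigma>\<in>Ring.ring_hom L class_ring. (\<forall>x\<in>carrier L. \<sigma> (dL x) = dU (\<sigma> x)) \<and>
           (\<forall>c. \<sigma> (i c) = emb c)))"

section \<open>Differential representations\<close>

record (overloaded) ('k::zero, 'v, 'a) comod = "('k, 'v) module" +
  coact :: "'v \<Rightarrow> ('k, 'v, 'a) tensor"

definition mk_comod ::
  "('k::field, 'v, 'c) module_scheme \<Rightarrow> ('v \<Rightarrow> ('k, 'v, 'a) tensor) \<Rightarrow> ('k, 'v, 'a) comod" where
  "mk_comod M \<rho> = \<lparr>carrier = carrier M, mult = mult M, one = one M, zero = zero M, add = add M,
     smult = smult M, coact = \<rho>\<rparr>"

locale diff_rep =
  fixes H :: "('k::field, 'a) hopf" and V :: "('k, 'v, 'a) comod"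
  assumes vectorspace: "vectorspace class_ring V"
    and fin_dim: "vectorspace.fin_dim class_ring V"
    and coact_linear: "coact V \<in> module_hom class_ring V (tensor V H)"
    and coact_coassoc: "v \<in> carrier V \<Longrightarrow>
      tensor_assoc V H H (tensor_map V H (tensor V H) H (coact V) id (coact V v)) =
      tensor_map V H V (tensor H H) id (comult H) (coact V v)"
    and coact_counit: "v \<in> carrier V \<Longrightarrow>
      tensor_ext V H V (\<lambda>w a. counit H a \<odot>\<^bsub>V\<^esub> w) (coact V v) = v"

definition Rep :: "('k::field, 'a) hopf \<Rightarrow> ('k, 'v, 'a) comod set" where
  "Rep H = {V. diff_rep H V}"

definition rep_hom ::
  "('k::field, 'a) hopf \<Rightarrow> ('k, 'v, 'a) comod \<Rightarrow> ('k, 'w, 'a) comod \<Rightarrow> ('v \<Rightarrow> 'w) set" where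
  "rep_hom H V W = {\<phi> \<in> module_hom class_ring V W.
     \<forall>v\<in>carrier V. coact W (\<phi> v) = tensor_map V H W H \<phi> id (coact V v)}"

definition matrix_coeff ::
  "('k::field, 'a) hopf \<Rightarrow> ('k, 'v, 'a) comod \<Rightarrow> 'v \<Rightarrow> ('v \<Rightarrow> 'k) \<Rightarrow> 'a" where
  "matrix_coeff H V v u = tensor_ext V H H (\<lambda>w a. u w \<odot>\<^bsub>H\<^esub> a) (coact V v)"

definition trivial_rep :: "('k::field, 'a) hopf \<Rightarrow> ('k, 'k, 'a) comod" where
  "trivial_rep H = mk_comod field_space (\<lambda>c. tens field_space H c \<one>\<^bsub>H\<^esub>)"

definition tensor_rep ::
  "('k::field, 'a) hopf \<Rightarrow> ('k, 'v, 'a) comod \<Rightarrow> ('k, 'w, 'a) comod \<Rightarrow>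
   ('k, ('k, 'v, 'w) tensor, 'a) comod" where
  "tensor_rep H V W = mk_comod (tensor V W)
     (tensor_ext V W (tensor (tensor V W) H)
        (\<lambda>v w. tensor_ext V H (tensor (tensor V W) H)
           (\<lambda>v' a. tensor_ext W H (tensor (tensor V W) H)
              (\<lambda>w' b. tens (tensor V W) H (tens V W v' w') (a \<otimes>\<^bsub>H\<^esub> b)) (coact W w)) (coact V v)))"

text \<open>The functional $u \otimes t$ on $V \otimes W$.\<close>

definition tensor_functional ::
  "('k::field, 'v, 'c) module_scheme \<Rightarrow> ('k, 'w, 'd) module_scheme \<Rightarrow> ('v \<Rightarrow> 'k) \<Rightarrow> ('w \<Rightarrow> 'k) \<Rightarrow>
   ('k, 'v, 'w) tensor \<Rightarrow> 'k" where
  "tensor_functional V W u t = tensor_ext V W field_space (\<lambda>v w. u v * t w)"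

text \<open>$(g u)(v) = u(g^{-1} v)$, i.e. $\rho(u) = \sum_j u_j \otimes S(\psi_V(v_j \otimes u))$ for a basis
  $(v_j)$ with dual basis $(u_j)$.\<close>

definition dual_rep ::
  "('k::field, 'a) hopf \<Rightarrow> ('k, 'v, 'a) comod \<Rightarrow> ('k, 'v \<Rightarrow> 'k, 'a) comod" where
  "dual_rep H V = mk_comod (dual_space V)
     (\<lambda>u. \<Oplus>\<^bsub>tensor (dual_space V) H\<^esub>b\<in>some_basis V.
        tens (dual_space V) H (dual_vec V (some_basis V) b) (coinv H (matrix_coeff H V b u)))"

text \<open>$\mathbf{k}[\partial]_{\le 1}$ with its right structure, \<open>(a, b)\<close> standing for $a + b\partial$:
  $(a + b\partial)c = (ac + b\,\partial(c)) + bc\,\partial$.\<close>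

definition diff_ops1 :: "('k::field \<Rightarrow> 'k) \<Rightarrow> ('k, 'k \<times> 'k) module" where
  "diff_ops1 dk = mk_space UNIV (0, 0) (\<lambda>(a, b) (a', b'). (a + a', b + b'))
     (\<lambda>c (a, b). (a * c + b * dk c, b * c))"

definition prolong_space ::
  "('k::field \<Rightarrow> 'k) \<Rightarrow> ('k, 'v, 'c) module_scheme \<Rightarrow> ('k, ('k, 'k \<times> 'k, 'v) tensor) module" where
  "prolong_space dk V = (tensor (diff_ops1 dk) V)\<lparr>smult :=
     (\<lambda>c. tensor_ext (diff_ops1 dk) V (tensor (diff_ops1 dk) V)
        (\<lambda>(a, b) v. tens (diff_ops1 dk) V (c * a, c * b) v))\<rparr>"

text \<open>The elements $v = 1 \otimes v$ and $\partial v = \partial \otimes v$ of $V^{(1)}$.\<close>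

definition prol0 ::
  "('k::field \<Rightarrow> 'k) \<Rightarrow> ('k, 'v, 'c) module_scheme \<Rightarrow> 'v \<Rightarrow> ('k, 'k \<times> 'k, 'v) tensor" where
  "prol0 dk V v = tens (diff_ops1 dk) V (1, 0) v"

definition prol1 ::
  "('k::field \<Rightarrow> 'k) \<Rightarrow> ('k, 'v, 'c) module_scheme \<Rightarrow> 'v \<Rightarrow> ('k, 'k \<times> 'k, 'v) tensor" where
  "prol1 dk V v = tens (diff_ops1 dk) V (0, 1) v"

text \<open>If $\rho_V(v) = \sum_i w_i \otimes a_i$, then the coaction of $V^{(1)}$ is
  $v \mapsto \sum_i w_i \otimes a_i$ and
  $\partial v \mapsto \sum_i (\partial w_i \otimes a_i + w_i \otimes \partial a_i)$.\<close>

definition prolong_rep ::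
  "('k::field \<Rightarrow> 'k) \<Rightarrow> ('k, 'a) hopf \<Rightarrow> ('k, 'v, 'a) comod \<Rightarrow>
   ('k, ('k, 'k \<times> 'k, 'v) tensor, 'a) comod" where
  "prolong_rep dk H V = mk_comod (prolong_space dk V)
     (let T = tensor (prolong_space dk V) H;
          \<rho>0 = (\<lambda>v. tensor_ext V H T
                  (\<lambda>w a. tens (prolong_space dk V) H (prol0 dk V w) a) (coact V v));
          \<rho>1 = (\<lambda>v. tensor_ext V H T
                  (\<lambda>w a. tens (prolong_space dk V) H (prol1 dk V w) a \<oplus>\<^bsub>T\<^esub>
                         tens (prolong_space dk V) H (prol0 dk V w) (deriv H a)) (coact V v))
      in tensor_ext (diff_ops1 dk) V T (\<lambda>(a, b) v. a \<odot>\<^bsub>T\<^esub> \<rho>0 v \<oplus>\<^bsub>T\<^esub> b \<odot>\<^bsub>T\<^esub> \<rho>1 v))"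

text \<open>The functional $F(u)$ on $V^{(1)}$.\<close>

definition prolong_functional ::
  "('k::field \<Rightarrow> 'k) \<Rightarrow> ('k, 'v, 'c) module_scheme \<Rightarrow> ('v \<Rightarrow> 'k) \<Rightarrow>
   ('k, 'k \<times> 'k, 'v) tensor \<Rightarrow> 'k" where
  "prolong_functional dk V u =
     tensor_ext (diff_ops1 dk) V field_space (\<lambda>(a, b) v. a * u v + b * dk (u v))"

section \<open>The differential Hopf algebra constructed from the representations\<close>

text \<open>The objects of the category are all differential representations with carrier inside a
  fixed, sufficiently large type \<open>'v\<close>. Trivial representations, tensor products, duals and
  prolongations of such objects are built on other types; the following isomorphic copies inside
  \<open>'v\<close> turn them into objects. They exist for all finite-dimensional spaces as soon as \<open>'k list\<close>
  embeds into \<open>'v\<close>. By the relations imposed below, the choice of the copy does not matter.\<close>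

definition copy_map :: "('k, 'x, 'c) module_scheme \<Rightarrow> 'x \<Rightarrow> 'v" where
  "copy_map V = (SOME e. inj_on e (carrier V))"

definition copy_space :: "('k, 'x, 'c) module_scheme \<Rightarrow> ('k, 'v) module" where
  "copy_space V =
     (let e = copy_map V; e' = inv_into (carrier V) e
      in mk_space (e ` carrier V) (e \<zero>\<^bsub>V\<^esub>) (\<lambda>x y. e (e' x \<oplus>\<^bsub>V\<^esub> e' y)) (\<lambda>c x. e (c \<odot>\<^bsub>V\<^esub> e' x)))"

definition copy_rep :: "('k::field, 'a) hopf \<Rightarrow> ('k, 'x, 'a) comod \<Rightarrow> ('k, 'v, 'a) comod" where
  "copy_rep H V = mk_comod (copy_space V)
     (\<lambda>x. tensor_map V H (copy_space V :: ('k, 'v) module) H (copy_map V) id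
            (coact V (inv_into (carrier V) (copy_map V) x)))"

definition copy_functional :: "('k, 'x, 'c) module_scheme \<Rightarrow> ('x \<Rightarrow> 'k) \<Rightarrow> 'v \<Rightarrow> 'k" where
  "copy_functional V u =
     (\<lambda>x\<in>copy_map V ` carrier V. u (inv_into (carrier V) (copy_map V) x))"

type_synonym ('k, 'v, 'a) rep_sum = "('k, 'v, 'a) comod \<Rightarrow> ('k, 'v, 'v \<Rightarrow> 'k) tensor"
type_synonym ('k, 'v, 'a) rep_elt = "('k, 'v, 'a) rep_sum set"

text \<open>$\mathcal{F} = \bigoplus_V V \otimes V^*$ and the injections $i_V$.\<close>

definition rep_sum_space :: "('k::field, 'a) hopf \<Rightarrow> ('k, ('k, 'v, 'a) rep_sum) module" where
  "rep_sum_space H = direct_sum_space (Rep H) (\<lambda>V. tensor V (dual_space V))"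

definition rep_sum_inj ::
  "('k::field, 'a) hopf \<Rightarrow> ('k, 'v, 'a) comod \<Rightarrow> ('k, 'v, 'v \<Rightarrow> 'k) tensor \<Rightarrow>
   ('k, 'v, 'a) rep_sum" where
  "rep_sum_inj H V = direct_sum_inj (Rep H) (\<lambda>V. tensor V (dual_space V)) V"

definition rep_rel :: "('k::field, 'a) hopf \<Rightarrow> ('k, 'v, 'a) rep_sum set" where
  "rep_rel H = module.span class_ring (rep_sum_space H)
     {rep_sum_inj H V
        (tensor_map V (dual_space W) V (dual_space V) id (\<lambda>t. \<lambda>v\<in>carrier V. t (\<phi> v)) z)
      \<ominus>\<^bsub>rep_sum_space H\<^esub>
      rep_sum_inj H W
        (tensor_map V (dual_space W) W (dual_space W) \<phi> id z)
      | V W \<phi> z. V \<in> Rep H \<and> W \<in> Rep H \<and> \<phi> \<in> rep_hom H V W \<and>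
          z \<in> carrier (tensor V (dual_space W))}"

definition rep_quot :: "('k::field, 'a) hopf \<Rightarrow> ('k, ('k, 'v, 'a) rep_elt) module" where
  "rep_quot H = quot_module (rep_sum_space H) (rep_rel H)"

text \<open>$a_V(v \otimes u)$, first for objects \<open>V\<close> and then for a representation on any type.\<close>

definition rep_coeff0 ::
  "('k::field, 'a) hopf \<Rightarrow> ('k, 'v, 'a) comod \<Rightarrow> 'v \<Rightarrow> ('v \<Rightarrow> 'k) \<Rightarrow> ('k, 'v, 'a) rep_elt" where
  "rep_coeff0 H V v u = rep_rel H +>\<^bsub>rep_sum_space H\<^esub> rep_sum_inj H V (tens V (dual_space V) v u)"

definition rep_coeff ::
  "('k::field, 'a) hopf \<Rightarrow> ('k, 'x, 'a) comod \<Rightarrow> 'x \<Rightarrow> ('x \<Rightarrow> 'k) \<Rightarrow> ('k, 'v, 'a) rep_elt" where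
  "rep_coeff H V v u = rep_coeff0 H (copy_rep H V) (copy_map V v) (copy_functional V u)"

text \<open>The additive map on $\mathcal{A}$ with prescribed values at all $a_V(v \otimes u)$.\<close>

definition rep_coeff_ext ::
  "('k::field, 'a) hopf \<Rightarrow> ('n, 'e) ring_scheme \<Rightarrow>
   (('k, 'v, 'a) comod \<Rightarrow> 'v \<Rightarrow> ('v \<Rightarrow> 'k) \<Rightarrow> 'n) \<Rightarrow> ('k, 'v, 'a) rep_elt \<Rightarrow> 'n" where
  "rep_coeff_ext H N y = additive_ext (rep_quot H) N
     {(V, v, u). V \<in> Rep H \<and> v \<in> carrier V \<and> u \<in> carrier (dual_space V)}
     (\<lambda>(V, v, u). rep_coeff0 H V v u) (\<lambda>(V, v, u). y V v u)"

definition rep_algebra ::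
  "('k::field \<Rightarrow> 'k) \<Rightarrow> ('k, 'a) hopf \<Rightarrow> ('k, ('k, 'v, 'a) rep_elt) hopf" where
  "rep_algebra dk H = \<lparr>
     carrier = carrier (rep_quot H),
     mult = (\<lambda>x y. rep_coeff_ext H (rep_quot H)
        (\<lambda>V v u. rep_coeff_ext H (rep_quot H)
           (\<lambda>W w t. rep_coeff H (tensor_rep H V W) (tens V W v w) (tensor_functional V W u t)) y) x),
     one = rep_coeff H (trivial_rep H) 1 id,
     zero = zero (rep_quot H),
     add = add (rep_quot H),
     smult = smult (rep_quot H),
     deriv = rep_coeff_ext H (rep_quot H)
        (\<lambda>V v u. rep_coeff H (prolong_rep dk H V) (prol1 dk V v) (prolong_functional dk V u)),
     comult = rep_coeff_ext H (tensor (rep_quot H) (rep_quot H))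
        (\<lambda>V v u. \<Oplus>\<^bsub>tensor (rep_quot H) (rep_quot H)\<^esub>b\<in>some_basis V.
           tens (rep_quot H) (rep_quot H) (rep_coeff0 H V b u)
             (rep_coeff0 H V v (dual_vec V (some_basis V) b))),
     counit = rep_coeff_ext H (field_space :: ('k, 'k) module) (\<lambda>V v u. u v),
     coinv = rep_coeff_ext H (rep_quot H)
        (\<lambda>V v u. rep_coeff H (dual_rep H V) u (\<lambda>t\<in>carrier (dual_space V). t v))\<rparr>"

text \<open>The map $\Phi$.\<close>

definition rep_coeff_map :: "('k::field, 'a) hopf \<Rightarrow> ('k, 'v, 'a) rep_elt \<Rightarrow> 'a" where
  "rep_coeff_map H = rep_coeff_ext H H (\<lambda>V v u. matrix_coeff H V v u)"

end

theory Submission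
  imports Defs
begin

text \<open>
  The map \<open>\<Phi>\<close> is a linear bijection, and every operation of \<open>\<A>\<close> corresponds to one of \<open>A\<close>, so that
  the Hopf axioms are transported along it. By direct sums, every element of \<open>\<A>\<close> has the form
  \<open>a\<^sub>V(v \<otimes> u)\<close>. If \<open>\<psi>\<^sub>V(v \<otimes> u) = 0\<close>, then \<open>u\<close> vanishes on the subcomodule generated by \<open>v\<close>, and the
  relation given by its inclusion into \<open>V\<close> yields \<open>a\<^sub>V(v \<otimes> u) = 0\<close>. Surjectivity follows as every
  element of \<open>A\<close> lies in a finite-dimensional subcomodule of \<open>A\<close>, on which \<open>\<epsilon>\<close> is a functional.
\<close>

text \<open>Only \<Phi> is ever tested against the relations R. Once \<Phi> has an inverse \<Psi>,
  an operation op of \<open>H\<close> gives the additive map \<Psi> \<circ> op \<circ> \<Phi> on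
  \<A>. It takes the values prescribed on the generators as soon as the coefficients of tensor
  products, prolongations and duals are op applied to the given coefficients, and additive maps
  agreeing on generators are equal.

  The obstacle is the finiteness behind bijectivity. A shortest expression \<rho>(v) = \<Sum> e_i
  \<otimes> h_i has both families independent. Functionals dual to the h_i show that the e_i span a
  subcomodule containing v, and \<psi>(v \<otimes> u) = \<Sum> u(e_i) h_i vanishes only if every
  u(e_i) does. This subcomodule is replaced by the coordinate space of I with the matrix of the
  coaction, so that no subspace has to be tensored. New representations are checked on matrices too:
  the comodule axioms hold on a spanning family if \<Delta>(a_ij) = \<Sum> a_ik \<otimes> a_kj and
  \<epsilon>(a_ij) = \<delta>_ij.\<close>

section \<open>Vector spaces as records, additive and linear maps\<close>

definition kspace :: "('k::field, 'v, 'c) module_scheme \<Rightarrow> bool" where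
  "kspace V \<longleftrightarrow> module class_ring V"

text \<open>Additivity is singled out because the derivation of \<open>H\<close> and the map v
  \<mapsto> \<partial>v into the prolongation are additive without being linear.\<close>

definition add_hom :: "('m, 'c) ring_scheme \<Rightarrow> ('n, 'd) ring_scheme \<Rightarrow> ('m \<Rightarrow> 'n) \<Rightarrow> bool" where
  "add_hom M N f \<longleftrightarrow> (\<forall>x\<in>carrier M. f x \<in> carrier N) \<and>
     (\<forall>x\<in>carrier M. \<forall>y\<in>carrier M. f (x \<oplus>\<^bsub>M\<^esub> y) = f x \<oplus>\<^bsub>N\<^esub> f y)"

definition lin_hom :: "('k, 'm, 'c) module_scheme \<Rightarrow> ('k, 'n, 'd) module_scheme \<Rightarrow> ('m \<Rightarrow> 'n) \<Rightarrow> bool" where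
  "lin_hom M N f \<longleftrightarrow> add_hom M N f \<and> (\<forall>c. \<forall>x\<in>carrier M. f (c \<odot>\<^bsub>M\<^esub> x) = c \<odot>\<^bsub>N\<^esub> f x)"

lemma cring_class_ring: "cring (class_ring :: 'k::field ring)"
  using class_field by (blast dest: field.axioms(1) domain.axioms(1))

text \<open>Negatives come for free: (1 + (-1)) v = 0 v = 0 makes (-1) v the inverse of v.\<close>

lemma kspaceI:
  fixes V :: "('k::field, 'v, 'c) module_scheme" (structure)
  assumes "\<zero> \<in> carrier V"
    and "\<And>v w. v \<in> carrier V \<Longrightarrow> w \<in> carrier V \<Longrightarrow> v \<oplus> w \<in> carrier V"
    and "\<And>c v. v \<in> carrier V \<Longrightarrow> c \<odot> v \<in> carrier V"
    and "\<And>v w. v \<in> carrier V \<Longrightarrow> w \<in> carrier V \<Longrightarrow> v \<oplus> w = w \<oplus> v"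
    and "\<And>v w x. v \<in> carrier V \<Longrightarrow> w \<in> carrier V \<Longrightarrow> x \<in> carrier V \<Longrightarrow> (v \<oplus> w) \<oplus> x = v \<oplus> (w \<oplus> x)"
    and "\<And>v. v \<in> carrier V \<Longrightarrow> v \<oplus> \<zero> = v"
    and zl: "\<And>v. v \<in> carrier V \<Longrightarrow> 0 \<odot> v = \<zero>"
    and "\<And>a b v. v \<in> carrier V \<Longrightarrow> (a * b) \<odot> v = a \<odot> (b \<odot> v)"
    and one: "\<And>v. v \<in> carrier V \<Longrightarrow> 1 \<odot> v = v"
    and dist: "\<And>a b v. v \<in> carrier V \<Longrightarrow> (a + b) \<odot> v = a \<odot> v \<oplus> b \<odot> v"
    and "\<And>a v w. v \<in> carrier V \<Longrightarrow> w \<in> carrier V \<Longrightarrow> a \<odot> (v \<oplus> w) = a \<odot> v \<oplus> a \<odot> w"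
  shows "kspace V"
proof -
  have "\<exists>w\<in>carrier V. v \<oplus> w = \<zero>" if "v \<in> carrier V" for v
    using dist[OF that, of 1 "- 1"] assms(3)[OF that, of "- 1"] that by (auto simp: zl one)
  then show ?thesis
    unfolding kspace_def using assms
    by (intro module_criteria cring_class_ring) auto
qed

context
  fixes V :: "('k::field, 'v, 'c) module_scheme" (structure)
  assumes V: "kspace V"
begin

interpretation V: module class_ring V
  using V by (simp add: kspace_def)

lemma ks_abelian_group [simp]: "abelian_group V"
  by (rule V.abelian_group_axioms)

lemma ks_zero_closed [simp]: "\<zero> \<in> carrier V"
  and ks_add_closed [simp]: "v \<in> carrier V \<Longrightarrow> w \<in> carrier V \<Longrightarrow> v \<oplus> w \<in> carrier V"
  and ks_smult_closed [simp]: "v \<in> carrier V \<Longrightarrow> c \<odot> v \<in> carrier V"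
  and ks_minus_closed [simp]: "v \<in> carrier V \<Longrightarrow> w \<in> carrier V \<Longrightarrow> v \<ominus> w \<in> carrier V"
  and ks_neg_closed [simp]: "v \<in> carrier V \<Longrightarrow> \<ominus> v \<in> carrier V"
  and ks_add_0 [simp]: "v \<in> carrier V \<Longrightarrow> v \<oplus> \<zero> = v"
  and ks_0_add [simp]: "v \<in> carrier V \<Longrightarrow> \<zero> \<oplus> v = v"
  by auto

lemma ks_add_comm: "v \<in> carrier V \<Longrightarrow> w \<in> carrier V \<Longrightarrow> v \<oplus> w = w \<oplus> v"
  and ks_add_assoc: "v \<in> carrier V \<Longrightarrow> w \<in> carrier V \<Longrightarrow> x \<in> carrier V \<Longrightarrow> (v \<oplus> w) \<oplus> x = v \<oplus> (w \<oplus> x)"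
  and ks_add_lcomm: "v \<in> carrier V \<Longrightarrow> w \<in> carrier V \<Longrightarrow> x \<in> carrier V \<Longrightarrow> v \<oplus> (w \<oplus> x) = w \<oplus> (v \<oplus> x)"
  by (auto simp: V.M.a_ac)

lemma ks_one [simp]: "v \<in> carrier V \<Longrightarrow> 1 \<odot> v = v"
  and ks_0_smult [simp]: "v \<in> carrier V \<Longrightarrow> 0 \<odot> v = \<zero>"
  and ks_smult_0 [simp]: "c \<odot> \<zero> = \<zero>"
  and ks_smult_assoc: "v \<in> carrier V \<Longrightarrow> a \<odot> (b \<odot> v) = (a * b) \<odot> v"
  and ks_smult_ldistr: "v \<in> carrier V \<Longrightarrow> (a + b) \<odot> v = a \<odot> v \<oplus> b \<odot> v"
  and ks_smult_rdistr: "v \<in> carrier V \<Longrightarrow> w \<in> carrier V \<Longrightarrow> a \<odot> (v \<oplus> w) = a \<odot> v \<oplus> a \<odot> w"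
  using V.smult_one[of v] V.smult_l_null[of v] V.smult_r_null[of c] V.smult_assoc1[of a b v]
    V.smult_l_distr[of a b v] V.smult_r_distr[of a v w]
  by auto

lemma ks_neg: "v \<in> carrier V \<Longrightarrow> \<ominus> v = (- 1) \<odot> v"
  using V.smult_l_minus[of 1 v] by (simp add: class_ring_simps)

lemma ks_minus_eq_zero: "v \<in> carrier V \<Longrightarrow> w \<in> carrier V \<Longrightarrow> v \<ominus> w = \<zero> \<longleftrightarrow> v = w"
  using V.M.a_assoc[of v "\<ominus> w" w] by (auto simp: a_minus_def V.M.r_neg V.M.l_neg)

lemma ks_minus_self [simp]: "v \<in> carrier V \<Longrightarrow> v \<ominus> v = \<zero>"
  by (simp add: ks_minus_eq_zero)

lemma ks_smult_minus: "v \<in> carrier V \<Longrightarrow> w \<in> carrier V \<Longrightarrow> c \<odot> (v \<ominus> w) = c \<odot> v \<ominus> c \<odot> w"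
  using V.smult_r_distr[of c v "\<ominus> w"] V.smult_r_minus[of c w] by (simp add: a_minus_def)

lemma ks_minus_def: "v \<ominus> w = v \<oplus> (\<ominus> w)"
  by (simp add: a_minus_def)

lemma ks_neg_r [simp]: "v \<in> carrier V \<Longrightarrow> v \<oplus> \<ominus> v = \<zero>"
  and ks_neg_l [simp]: "v \<in> carrier V \<Longrightarrow> \<ominus> v \<oplus> v = \<zero>"
  by (simp_all add: V.M.r_neg V.M.l_neg)

lemma ks_add_cancel: "v \<in> carrier V \<Longrightarrow> w \<in> carrier V \<Longrightarrow> x \<in> carrier V \<Longrightarrow> v \<oplus> w = v \<oplus> x \<longleftrightarrow> w = x"
  by simp

lemma ks_finsum_closed [simp]: "(\<And>i. i \<in> A \<Longrightarrow> f i \<in> carrier V) \<Longrightarrow> finsum V f A \<in> carrier V"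
  by (rule V.M.finsum_closed) auto

lemma ks_finsum_cong:
  "A = B \<Longrightarrow> (\<And>i. i \<in> B \<Longrightarrow> f i = g i) \<Longrightarrow> (\<And>i. i \<in> B \<Longrightarrow> g i \<in> carrier V) \<Longrightarrow> finsum V f A = finsum V g B"
  by (rule V.M.finsum_cong') auto

lemma ks_finsum_empty [simp]: "finsum V f {} = \<zero>"
  by simp

lemma ks_finsum_infinite: "infinite A \<Longrightarrow> finsum V f A = \<zero>"
  by (simp add: finsum_def finprod_def)

lemma ks_finsum_insert:
  "finite A \<Longrightarrow> a \<notin> A \<Longrightarrow> (\<And>i. i \<in> A \<Longrightarrow> f i \<in> carrier V) \<Longrightarrow> f a \<in> carrier V \<Longrightarrow>
   finsum V f (insert a A) = f a \<oplus> finsum V f A"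
  by (rule V.M.finsum_insert) auto

lemma ks_finsum_add:
  "(\<And>i. i \<in> A \<Longrightarrow> f i \<in> carrier V) \<Longrightarrow> (\<And>i. i \<in> A \<Longrightarrow> g i \<in> carrier V) \<Longrightarrow>
   (\<Oplus>i\<in>A. f i \<oplus> g i) = finsum V f A \<oplus> finsum V g A"
  by (rule V.M.finsum_addf) auto

lemma ks_finsum_zero: "(\<And>i. i \<in> A \<Longrightarrow> f i = \<zero>) \<Longrightarrow> finsum V f A = \<zero>"
  using V.M.finsum_zero[of A] ks_finsum_cong[of A A f "\<lambda>_. \<zero>"] by simp

lemma ks_finsum_mono_neutral:
  assumes "finite B" "A \<subseteq> B" "\<And>i. i \<in> A \<Longrightarrow> f i \<in> carrier V" "\<And>i. i \<in> B - A \<Longrightarrow> f i = \<zero>"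
  shows "finsum V f A = finsum V f B"
proof -
  have "finsum V f A = finsum V f (A \<union> (B - A))"
    using assms finite_subset[OF assms(2,1)] ks_finsum_zero[of "B - A" f]
    by (subst V.M.finsum_Un_disjoint) (auto simp: Pi_def)
  also have "A \<union> (B - A) = B" using assms by auto
  finally show ?thesis .
qed

lemma ks_finsum_delta:
  assumes "finite A" "a \<in> A" "f a \<in> carrier V" "\<And>i. i \<in> A \<Longrightarrow> i \<noteq> a \<Longrightarrow> f i = \<zero>"
  shows "finsum V f A = f a"
proof -
  have "finsum V f {a} = finsum V f A"
    using assms by (intro ks_finsum_mono_neutral) auto
  then show ?thesis using assms by (simp add: ks_finsum_insert)
qed

lemma ks_finsum_swap:
  assumes "finite A" "finite B" "\<And>i j. i \<in> A \<Longrightarrow> j \<in> B \<Longrightarrow> f i j \<in> carrier V"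
  shows "(\<Oplus>i\<in>A. \<Oplus>j\<in>B. f i j) = (\<Oplus>j\<in>B. \<Oplus>i\<in>A. f i j)"
  using assms(1,3)
proof (induction A rule: finite_induct)
  case empty
  then show ?case by (simp add: ks_finsum_zero)
next
  case (insert a A)
  have "(\<Oplus>i\<in>insert a A. \<Oplus>j\<in>B. f i j) = (\<Oplus>j\<in>B. f a j) \<oplus> (\<Oplus>j\<in>B. \<Oplus>i\<in>A. f i j)"
    using insert by (simp add: ks_finsum_insert)
  also have "\<dots> = (\<Oplus>j\<in>B. f a j \<oplus> (\<Oplus>i\<in>A. f i j))"
    using insert by (intro ks_finsum_add[symmetric]) auto
  also have "\<dots> = (\<Oplus>j\<in>B. \<Oplus>i\<in>insert a A. f i j)"
    using insert by (intro ks_finsum_cong) (auto simp: ks_finsum_insert)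
  finally show ?case .
qed

lemma ks_finsum_reindex:
  "inj_on h A \<Longrightarrow> (\<And>i. i \<in> A \<Longrightarrow> f (h i) \<in> carrier V) \<Longrightarrow> finsum V f (h ` A) = (\<Oplus>i\<in>A. f (h i))"
  by (rule V.M.finsum_reindex) auto

lemma ks_finsum_Un_disjoint:
  "finite A \<Longrightarrow> finite B \<Longrightarrow> A \<inter> B = {} \<Longrightarrow> (\<And>i. i \<in> A \<union> B \<Longrightarrow> f i \<in> carrier V) \<Longrightarrow>
   finsum V f (A \<union> B) = finsum V f A \<oplus> finsum V f B"
  by (rule V.M.finsum_Un_disjoint) auto

lemma ks_finsum_smult:
  "finite A \<Longrightarrow> (\<And>i. i \<in> A \<Longrightarrow> f i \<in> carrier V) \<Longrightarrow> c \<odot> finsum V f A = (\<Oplus>i\<in>A. c \<odot> f i)"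
  using V.finsum_smult_ldistr[of A c f] by auto

end

lemmas ks_ac = ks_add_assoc ks_add_comm ks_add_lcomm

lemma add_homD:
  assumes "add_hom M N f"
  shows "x \<in> carrier M \<Longrightarrow> f x \<in> carrier N"
    and "x \<in> carrier M \<Longrightarrow> y \<in> carrier M \<Longrightarrow> f (x \<oplus>\<^bsub>M\<^esub> y) = f x \<oplus>\<^bsub>N\<^esub> f y"
  using assms by (auto simp: add_hom_def)

lemma lin_homD:
  assumes "lin_hom M N f"
  shows "x \<in> carrier M \<Longrightarrow> f x \<in> carrier N"
    and "x \<in> carrier M \<Longrightarrow> y \<in> carrier M \<Longrightarrow> f (x \<oplus>\<^bsub>M\<^esub> y) = f x \<oplus>\<^bsub>N\<^esub> f y"
    and "x \<in> carrier M \<Longrightarrow> f (c \<odot>\<^bsub>M\<^esub> x) = c \<odot>\<^bsub>N\<^esub> f x"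
    and "add_hom M N f"
  using assms by (auto simp: lin_hom_def add_hom_def)

lemma add_homI:
  "(\<And>x. x \<in> carrier M \<Longrightarrow> f x \<in> carrier N) \<Longrightarrow>
   (\<And>x y. x \<in> carrier M \<Longrightarrow> y \<in> carrier M \<Longrightarrow> f (x \<oplus>\<^bsub>M\<^esub> y) = f x \<oplus>\<^bsub>N\<^esub> f y) \<Longrightarrow> add_hom M N f"
  by (auto simp: add_hom_def)

lemma lin_homI:
  "(\<And>x. x \<in> carrier M \<Longrightarrow> f x \<in> carrier N) \<Longrightarrow>
   (\<And>x y. x \<in> carrier M \<Longrightarrow> y \<in> carrier M \<Longrightarrow> f (x \<oplus>\<^bsub>M\<^esub> y) = f x \<oplus>\<^bsub>N\<^esub> f y) \<Longrightarrow>
   (\<And>c x. x \<in> carrier M \<Longrightarrow> f (c \<odot>\<^bsub>M\<^esub> x) = c \<odot>\<^bsub>N\<^esub> f x) \<Longrightarrow> lin_hom M N f"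
  by (auto simp: add_hom_def lin_hom_def)

lemma lin_hom_iff: "lin_hom V W f \<longleftrightarrow> f \<in> module_hom class_ring V W"
  by (auto simp: lin_hom_def add_hom_def module_hom_def)

lemma add_hom_zero:
  assumes "kspace V" "kspace W" "add_hom V W f"
  shows "f \<zero>\<^bsub>V\<^esub> = \<zero>\<^bsub>W\<^esub>"
proof -
  have "f \<zero>\<^bsub>V\<^esub> \<oplus>\<^bsub>W\<^esub> f \<zero>\<^bsub>V\<^esub> = f \<zero>\<^bsub>V\<^esub> \<oplus>\<^bsub>W\<^esub> \<zero>\<^bsub>W\<^esub>"
    using assms add_homD(2)[OF assms(3), of "\<zero>\<^bsub>V\<^esub>" "\<zero>\<^bsub>V\<^esub>"] add_homD(1)[OF assms(3)] by simp
  then show ?thesis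
    using assms add_homD(1)[OF assms(3)] by (simp add: ks_add_cancel del: ks_add_0)
qed

lemma add_hom_neg:
  assumes "kspace V" "kspace W" "add_hom V W f" "x \<in> carrier V"
  shows "f (\<ominus>\<^bsub>V\<^esub> x) = \<ominus>\<^bsub>W\<^esub> f x"
proof -
  note D = add_homD[OF assms(3)]
  have "f x \<oplus>\<^bsub>W\<^esub> f (\<ominus>\<^bsub>V\<^esub> x) = f x \<oplus>\<^bsub>W\<^esub> \<ominus>\<^bsub>W\<^esub> f x"
    using assms by (simp add: D D(2)[symmetric] add_hom_zero[OF assms(1-3)])
  then show ?thesis
    using assms D by (simp add: ks_add_cancel del: ks_neg_r)
qed

lemma add_hom_minus:
  assumes "kspace V" "kspace W" "add_hom V W f" "x \<in> carrier V" "y \<in> carrier V"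
  shows "f (x \<ominus>\<^bsub>V\<^esub> y) = f x \<ominus>\<^bsub>W\<^esub> f y"
  using assms add_homD[OF assms(3)] by (simp add: ks_minus_def add_hom_neg)

lemma add_hom_finsum:
  assumes "kspace V" "kspace W" "add_hom V W f" "\<And>i. i \<in> A \<Longrightarrow> g i \<in> carrier V"
  shows "f (finsum V g A) = (\<Oplus>\<^bsub>W\<^esub>i\<in>A. f (g i))"
  using assms(4)
proof (induction A rule: infinite_finite_induct)
  case (infinite A)
  then show ?case
    using assms by (simp add: ks_finsum_infinite add_hom_zero[OF assms(1-3)])
next
  case empty
  then show ?case using assms by (simp add: add_hom_zero[OF assms(1-3)])
next
  case (insert a A)
  then show ?case
    using assms add_homD[OF assms(3)] by (simp add: ks_finsum_insert)
qed

lemma add_hom_comp: "add_hom M N f \<Longrightarrow> add_hom N P g \<Longrightarrow> add_hom M P (\<lambda>x. g (f x))"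
  by (simp add: add_hom_def)

lemma lin_hom_comp: "lin_hom M N f \<Longrightarrow> lin_hom N P g \<Longrightarrow> lin_hom M P (\<lambda>x. g (f x))"
  by (simp add: add_hom_def lin_hom_def)

lemma lin_hom_id [simp]: "lin_hom M M id"
  by (simp add: lin_hom_def add_hom_def)

lemma kspace_field_space [simp]: "kspace (field_space :: ('k::field, 'k) module)"
  by (rule kspaceI) (auto simp: field_space_def algebra_simps)

lemma field_space_simps [simp]:
  "carrier field_space = UNIV" "\<zero>\<^bsub>field_space\<^esub> = 0" "x \<oplus>\<^bsub>field_space\<^esub> y = x + y" "c \<odot>\<^bsub>field_space\<^esub> x = c * x"
  by (auto simp: field_space_def)

lemma finsum_field_space: "finsum (field_space :: ('k::field, 'k) module) f A = sum f A"
  by (induction A rule: infinite_finite_induct) (auto simp: ks_finsum_insert ks_finsum_infinite)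

section \<open>Subspaces and quotient spaces\<close>

definition ksub :: "('k::field, 'v, 'c) module_scheme \<Rightarrow> 'v set \<Rightarrow> bool" where
  "ksub M N \<longleftrightarrow> N \<subseteq> carrier M \<and> \<zero>\<^bsub>M\<^esub> \<in> N \<and> (\<forall>x\<in>N. \<forall>y\<in>N. x \<oplus>\<^bsub>M\<^esub> y \<in> N) \<and> (\<forall>c. \<forall>x\<in>N. c \<odot>\<^bsub>M\<^esub> x \<in> N)"

lemma kspace_module: "kspace M \<Longrightarrow> module class_ring M"
  by (simp add: kspace_def)

lemma ksub_span:
  assumes "kspace M" "S \<subseteq> carrier M"
  shows "ksub M (module.span class_ring M S)"
proof -
  interpret module class_ring M using assms by (simp add: kspace_def)
  interpret s: LinearCombinations.submodule class_ring "span S" M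
    using span_is_submodule[OF assms(2)] .
  show ?thesis using s.subset by (auto simp: ksub_def)
qed

lemma span_le_ksub:
  assumes "kspace M" "ksub M N" "S \<subseteq> N"
  shows "module.span class_ring M S \<subseteq> N"
proof -
  interpret module class_ring M using assms by (simp add: kspace_def)
  have "LinearCombinations.submodule class_ring N M"
    using assms by unfold_locales (auto simp: ksub_def)
  then show ?thesis using span_is_subset assms by blast
qed

lemma span_superset:
  assumes "kspace M" "S \<subseteq> carrier M"
  shows "S \<subseteq> module.span class_ring M S"
proof -
  interpret module class_ring M using assms by (simp add: kspace_def)
  show ?thesis using in_own_span assms by blast
qed

lemma add_hom_eq_hom: "add_hom M N f \<longleftrightarrow> f \<in> hom (add_monoid M) (add_monoid N)"
  by (auto simp: add_hom_def hom_def)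

text \<open>Turns the description by \<open>THE\<close> into a usable equation. The map
  \<open>g\<close> supplies existence, and the premise \<open>u\<close> is uniqueness, which is
  available whenever the \<open>x i\<close> generate \<open>M\<close> additively.\<close>

lemma additive_ext_eq:
  assumes M: "kspace M" and g: "add_hom M N g" and gi: "\<And>i. i \<in> I \<Longrightarrow> g (x i) = y i"
    and x: "\<And>i. i \<in> I \<Longrightarrow> x i \<in> carrier M"
    and u: "\<And>f z. add_hom M N f \<Longrightarrow> (\<And>i. i \<in> I \<Longrightarrow> f (x i) = g (x i)) \<Longrightarrow> z \<in> carrier M \<Longrightarrow> f z = g z"
    and z: "z \<in> carrier M"
  shows "additive_ext M N I x y z = g z"
proof -
  have "additive_ext M N I x y = restrict g (carrier M)"
    unfolding additive_ext_def add_hom_eq_hom[symmetric]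
  proof (rule the_equality, intro conjI)
    show "add_hom M N (restrict g (carrier M))"
      using g M by (simp add: add_hom_def)
    fix f assume f: "f \<in> extensional (carrier M) \<and> add_hom M N f \<and> (\<forall>i\<in>I. f (x i) = y i)"
    then show "f = restrict g (carrier M)"
      using u[of f] gi by (intro extensionalityI[of _ "carrier M"]) auto
  qed (use gi x in auto)
  then show ?thesis using z by simp
qed

text \<open>The axioms are equations, so they pass to any surjective image with compatible
  operations. This serves for quotients and for the copies inside \<open>'v\<close>.\<close>

lemma kspace_image:
  assumes M: "kspace M" and c: "carrier Q = q ` carrier M"
    and "\<And>x y. x \<in> carrier M \<Longrightarrow> y \<in> carrier M \<Longrightarrow> q x \<oplus>\<^bsub>Q\<^esub> q y = q (x \<oplus>\<^bsub>M\<^esub> y)"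
    and "\<And>c x. x \<in> carrier M \<Longrightarrow> c \<odot>\<^bsub>Q\<^esub> q x = q (c \<odot>\<^bsub>M\<^esub> x)"
    and "\<zero>\<^bsub>Q\<^esub> = q \<zero>\<^bsub>M\<^esub>"
  shows "kspace Q"
  by (rule kspaceI)
     (use M in \<open>auto simp: assms ks_ac[OF M] ks_smult_assoc[OF M] ks_smult_ldistr[OF M] ks_smult_rdistr[OF M]\<close>)

lemma quot_module_simps [simp]:
  "carrier (quot_module M N) = a_rcosets\<^bsub>M\<^esub> N" "add (quot_module M N) = set_add M"
  "zero (quot_module M N) = N"
  "smult (quot_module M N) = (\<lambda>c X. \<Union>x\<in>X. N +>\<^bsub>M\<^esub> (c \<odot>\<^bsub>M\<^esub> x))"
  by (simp_all add: quot_module_def)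

context
  fixes M :: "('k::field, 'v, 'c) module_scheme" (structure) and N
  assumes M: "kspace M" and N: "ksub M N"
begin

interpretation M: module class_ring M
  using M by (rule kspace_module)

lemma ksub_neg: "x \<in> N \<Longrightarrow> \<ominus> x \<in> N"
  using M N by (auto simp: ksub_def ks_neg subset_iff)

lemma ksub_abelian_subgroup: "abelian_subgroup N M"
proof (rule abelian_subgroupI3)
  show "additive_subgroup N M"
    using N ksub_neg by (intro additive_subgroup.intro subgroup.intro) (auto simp: ksub_def a_inv_def)
qed (rule M.abelian_group_axioms)

interpretation N: abelian_subgroup N M
  by (rule ksub_abelian_subgroup)

lemma coset_eq_iff:
  assumes "x \<in> carrier M" "y \<in> carrier M"
  shows "N +> x = N +> y \<longleftrightarrow> x \<ominus> y \<in> N"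
proof -
  have "N +> x = N +> y \<longleftrightarrow> x \<in> N +> y"
    using assms N.a_rcos_self N.a_repr_independence' by blast
  then show ?thesis using N.a_rcos_module assms by (simp add: a_minus_def)
qed

lemma carrier_quot: "carrier (quot_module M N) = (\<lambda>x. N +> x) ` carrier M"
  by (auto simp: A_RCOSETS_def')

lemma coset_closed: "x \<in> carrier M \<Longrightarrow> N +> x \<in> carrier (quot_module M N)"
  by (simp add: carrier_quot del: quot_module_simps)

lemma coset_add: "x \<in> carrier M \<Longrightarrow> y \<in> carrier M \<Longrightarrow>
    (N +> x) \<oplus>\<^bsub>quot_module M N\<^esub> (N +> y) = N +> (x \<oplus> y)"
  using N.a_rcos_sum by simp

lemma coset_zero: "\<zero>\<^bsub>quot_module M N\<^esub> = N +> \<zero>"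
  using N M.abelian_group_axioms by (simp add: ksub_def M.a_coset_add_zero)

lemma mem_coset_iff: "x \<in> carrier M \<Longrightarrow> y \<in> N +> x \<longleftrightarrow> y \<in> carrier M \<and> y \<ominus> x \<in> N"
  using N.a_rcos_module[of x y] M.a_r_coset_subset_G[of N x] N by (auto simp: ksub_def a_minus_def)

lemma coset_smult:
  assumes "x \<in> carrier M"
  shows "c \<odot>\<^bsub>quot_module M N\<^esub> (N +> x) = N +> (c \<odot> x)"
proof -
  have "N +> (c \<odot> y) = N +> (c \<odot> x)" if "y \<in> N +> x" for y
  proof -
    have y: "y \<in> carrier M" "y \<ominus> x \<in> N" using that assms by (auto simp: mem_coset_iff)
    have "c \<odot> y \<ominus> c \<odot> x = c \<odot> (y \<ominus> x)"
      using y assms M by (simp add: ks_smult_minus)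
    then show ?thesis using y assms N M by (simp add: coset_eq_iff ksub_def)
  qed
  \<comment> \<open>The union defining scalar multiplication on the quotient runs over all
    representatives. Its members coincide and the index set is nonempty, so it is a single
    coset.\<close>
  then have "(\<Union>y\<in>N +> x. N +> (c \<odot> y)) = (\<Union>y\<in>N +> x. N +> (c \<odot> x))" by (intro SUP_cong refl)
  moreover have "x \<in> N +> x" using assms N M by (simp add: mem_coset_iff ksub_def)
  ultimately show ?thesis by (metis UN_constant empty_iff quot_module_simps(4))
qed

lemma kspace_quot: "kspace (quot_module M N)"
  by (rule kspace_image[OF M carrier_quot]) (simp_all only: coset_add coset_smult coset_zero)

lemma quot_factor:
  assumes P: "kspace P" and L: "add_hom M P L" and L0: "\<And>x. x \<in> N \<Longrightarrow> L x = \<zero>\<^bsub>P\<^esub>"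
  obtains f where "add_hom (quot_module M N) P f" "\<And>x. x \<in> carrier M \<Longrightarrow> f (N +> x) = L x"
proof
  \<comment> \<open>Any representative gives the same value: two of them differ by an element of
    \<open>N\<close>, where \<open>L\<close> vanishes.\<close>
  define f where "f X = L (SOME x. x \<in> X)" for X
  show f: "f (N +> x) = L x" if x: "x \<in> carrier M" for x
  proof -
    have "x \<in> N +> x" using x N M by (simp add: mem_coset_iff ksub_def)
    then have "(SOME y. y \<in> N +> x) \<in> N +> x" by (rule someI)
    then have y: "(SOME y. y \<in> N +> x) \<in> carrier M" "(SOME y. y \<in> N +> x) \<ominus> x \<in> N"
      using x by (auto simp: mem_coset_iff)
    have "L (SOME y. y \<in> N +> x) \<ominus>\<^bsub>P\<^esub> L x = \<zero>\<^bsub>P\<^esub>"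
      using L0[OF y(2)] add_hom_minus[OF M P L y(1) x] by simp
    then show ?thesis using y(1) x add_homD[OF L] P by (simp add: f_def ks_minus_eq_zero)
  qed
  show "add_hom (quot_module M N) P f"
    by (rule add_homI; clarsimp simp only: carrier_quot image_iff)
       (simp_all add: f coset_add add_homD[OF L] M del: quot_module_simps)
qed

end

section \<open>Free spaces and the universal property of the tensor product\<close>

definition pscale :: "'k::field \<Rightarrow> ('b \<Rightarrow>\<^sub>0 'k) \<Rightarrow> 'b \<Rightarrow>\<^sub>0 'k" where
  "pscale c = Poly_Mapping.map (\<lambda>x. c * x)"

lemma lookup_pscale [simp]: "Poly_Mapping.lookup (pscale c p) b = c * Poly_Mapping.lookup p b"
  by (simp add: pscale_def Poly_Mapping.map.rep_eq when_def)

lemma pscale_simps: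
  "pscale c (p - q) = pscale c p - pscale c q" "pscale c (p + q) = pscale c p + pscale c q"
  "pscale c (Poly_Mapping.single b d) = Poly_Mapping.single b (c * d)"
  "pscale c (pscale d p) = pscale (c * d) p" "pscale (c + d) p = pscale c p + pscale d p"
  "pscale 1 p = p" "pscale 0 p = 0" "pscale c 0 = 0"
  by (rule poly_mapping_eqI; simp add: lookup_minus lookup_add lookup_single when_def algebra_simps)+

lemma keys_pscale: "Poly_Mapping.keys (pscale c p) \<subseteq> Poly_Mapping.keys p"
  by (auto simp: in_keys_iff)

lemma free_space_simps [simp]:
  "carrier (free_space B) = {p. Poly_Mapping.keys p \<subseteq> B}" "\<zero>\<^bsub>free_space B\<^esub> = 0"
  "p \<oplus>\<^bsub>free_space B\<^esub> q = p + q" "c \<odot>\<^bsub>free_space B\<^esub> p = pscale c p"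
  by (simp_all add: free_space_def mk_space_def pscale_def)

lemma kspace_free_space [simp]: "kspace (free_space B)"
  by (rule kspaceI)
     (use Poly_Mapping.keys_add in \<open>fastforce simp: pscale_simps algebra_simps dest: subsetD[OF keys_pscale]\<close>)+

lemma free_space_minus: "p \<in> carrier (free_space B) \<Longrightarrow> q \<in> carrier (free_space B) \<Longrightarrow> p \<ominus>\<^bsub>free_space B\<^esub> q = p - q"
proof -
  assume q: "q \<in> carrier (free_space B)" "p \<in> carrier (free_space B)"
  have "pscale (- 1) q = - q" by (rule poly_mapping_eqI) simp
  then show ?thesis using q by (simp add: a_minus_def ks_neg del: free_space_simps(1))
qed

text \<open>Scalars may cross from one argument to the other, while the scalar multiplication of
  \<open>N\<close> does not occur. This is the right generality for derivations of a tensor product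
  and for prolongations, whose defining expressions are not linear.\<close>

definition balanced ::
  "('k::field, 'v, 'c) module_scheme \<Rightarrow> ('k, 'w, 'd) module_scheme \<Rightarrow> ('n, 'e) ring_scheme \<Rightarrow>
   ('v \<Rightarrow> 'w \<Rightarrow> 'n) \<Rightarrow> bool" where
  "balanced V W N \<beta> \<longleftrightarrow>
     (\<forall>v\<in>carrier V. \<forall>w\<in>carrier W. \<beta> v w \<in> carrier N) \<and>
     (\<forall>v\<in>carrier V. \<forall>v'\<in>carrier V. \<forall>w\<in>carrier W. \<beta> (v \<oplus>\<^bsub>V\<^esub> v') w = \<beta> v w \<oplus>\<^bsub>N\<^esub> \<beta> v' w) \<and>
     (\<forall>v\<in>carrier V. \<forall>w\<in>carrier W. \<forall>w'\<in>carrier W. \<beta> v (w \<oplus>\<^bsub>W\<^esub> w') = \<beta> v w \<oplus>\<^bsub>N\<^esub> \<beta> v w') \<and>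
     (\<forall>c. \<forall>v\<in>carrier V. \<forall>w\<in>carrier W. \<beta> (c \<odot>\<^bsub>V\<^esub> v) w = \<beta> v (c \<odot>\<^bsub>W\<^esub> w))"

definition bilinear ::
  "('k::field, 'v, 'c) module_scheme \<Rightarrow> ('k, 'w, 'd) module_scheme \<Rightarrow> ('k, 'n, 'e) module_scheme \<Rightarrow>
   ('v \<Rightarrow> 'w \<Rightarrow> 'n) \<Rightarrow> bool" where
  "bilinear V W N \<beta> \<longleftrightarrow> balanced V W N \<beta> \<and>
     (\<forall>c. \<forall>v\<in>carrier V. \<forall>w\<in>carrier W. \<beta> (c \<odot>\<^bsub>V\<^esub> v) w = c \<odot>\<^bsub>N\<^esub> \<beta> v w)"

lemma balancedI:
  assumes "\<And>v w. v \<in> carrier V \<Longrightarrow> w \<in> carrier W \<Longrightarrow> \<beta> v w \<in> carrier N"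
    "\<And>v v' w. v \<in> carrier V \<Longrightarrow> v' \<in> carrier V \<Longrightarrow> w \<in> carrier W \<Longrightarrow> \<beta> (v \<oplus>\<^bsub>V\<^esub> v') w = \<beta> v w \<oplus>\<^bsub>N\<^esub> \<beta> v' w"
    "\<And>v w w'. v \<in> carrier V \<Longrightarrow> w \<in> carrier W \<Longrightarrow> w' \<in> carrier W \<Longrightarrow> \<beta> v (w \<oplus>\<^bsub>W\<^esub> w') = \<beta> v w \<oplus>\<^bsub>N\<^esub> \<beta> v w'"
    "\<And>c v w. v \<in> carrier V \<Longrightarrow> w \<in> carrier W \<Longrightarrow> \<beta> (c \<odot>\<^bsub>V\<^esub> v) w = \<beta> v (c \<odot>\<^bsub>W\<^esub> w)"
  shows "balanced V W N \<beta>"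
  using assms by (auto simp: balanced_def)

lemma bilinearI:
  assumes "\<And>v w. v \<in> carrier V \<Longrightarrow> w \<in> carrier W \<Longrightarrow> \<beta> v w \<in> carrier N"
    "\<And>v v' w. v \<in> carrier V \<Longrightarrow> v' \<in> carrier V \<Longrightarrow> w \<in> carrier W \<Longrightarrow> \<beta> (v \<oplus>\<^bsub>V\<^esub> v') w = \<beta> v w \<oplus>\<^bsub>N\<^esub> \<beta> v' w"
    "\<And>v w w'. v \<in> carrier V \<Longrightarrow> w \<in> carrier W \<Longrightarrow> w' \<in> carrier W \<Longrightarrow> \<beta> v (w \<oplus>\<^bsub>W\<^esub> w') = \<beta> v w \<oplus>\<^bsub>N\<^esub> \<beta> v w'"
    "\<And>c v w. v \<in> carrier V \<Longrightarrow> w \<in> carrier W \<Longrightarrow> \<beta> (c \<odot>\<^bsub>V\<^esub> v) w = c \<odot>\<^bsub>N\<^esub> \<beta> v w"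
    "\<And>c v w. v \<in> carrier V \<Longrightarrow> w \<in> carrier W \<Longrightarrow> \<beta> v (c \<odot>\<^bsub>W\<^esub> w) = c \<odot>\<^bsub>N\<^esub> \<beta> v w"
  shows "bilinear V W N \<beta>"
  using assms by (auto simp: balanced_def bilinear_def)

lemma balancedD:
  assumes "balanced V W N \<beta>"
  shows "v \<in> carrier V \<Longrightarrow> w \<in> carrier W \<Longrightarrow> \<beta> v w \<in> carrier N"
    "v \<in> carrier V \<Longrightarrow> v' \<in> carrier V \<Longrightarrow> w \<in> carrier W \<Longrightarrow> \<beta> (v \<oplus>\<^bsub>V\<^esub> v') w = \<beta> v w \<oplus>\<^bsub>N\<^esub> \<beta> v' w"
    "v \<in> carrier V \<Longrightarrow> w \<in> carrier W \<Longrightarrow> w' \<in> carrier W \<Longrightarrow> \<beta> v (w \<oplus>\<^bsub>W\<^esub> w') = \<beta> v w \<oplus>\<^bsub>N\<^esub> \<beta> v w'"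
    "v \<in> carrier V \<Longrightarrow> w \<in> carrier W \<Longrightarrow> \<beta> (c \<odot>\<^bsub>V\<^esub> v) w = \<beta> v (c \<odot>\<^bsub>W\<^esub> w)"
  using assms by (auto simp: balanced_def)

lemma bilinear_balanced: "bilinear V W N \<beta> \<Longrightarrow> balanced V W N \<beta>"
  by (simp add: bilinear_def)

definition tensor_gens ::
  "('k::field, 'v, 'c) module_scheme \<Rightarrow> ('k, 'w, 'd) module_scheme \<Rightarrow> ('v \<times> 'w \<Rightarrow>\<^sub>0 'k) set" where
  "tensor_gens V W =
     {Poly_Mapping.single (v \<oplus>\<^bsub>V\<^esub> v', w) 1 - Poly_Mapping.single (v, w) 1
         - Poly_Mapping.single (v', w) 1
        | v v' w. v \<in> carrier V \<and> v' \<in> carrier V \<and> w \<in> carrier W} \<union>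
      {Poly_Mapping.single (v, w \<oplus>\<^bsub>W\<^esub> w') 1 - Poly_Mapping.single (v, w) 1
         - Poly_Mapping.single (v, w') 1
        | v w w'. v \<in> carrier V \<and> w \<in> carrier W \<and> w' \<in> carrier W} \<union>
      {Poly_Mapping.single (c \<odot>\<^bsub>V\<^esub> v, w) 1 - Poly_Mapping.single (v, w) c
        | c v w. v \<in> carrier V \<and> w \<in> carrier W} \<union>
      {Poly_Mapping.single (v, c \<odot>\<^bsub>W\<^esub> w) 1 - Poly_Mapping.single (v, w) c
        | c v w. v \<in> carrier V \<and> w \<in> carrier W}"

lemma keys_minus_subset: "Poly_Mapping.keys p \<subseteq> B \<Longrightarrow> Poly_Mapping.keys q \<subseteq> B \<Longrightarrow> Poly_Mapping.keys (p - q :: _ \<Rightarrow>\<^sub>0 'k::field) \<subseteq> B"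
  using Poly_Mapping.keys_diff[of p q] by blast

lemma keys_add_subset: "Poly_Mapping.keys p \<subseteq> B \<Longrightarrow> Poly_Mapping.keys q \<subseteq> B \<Longrightarrow> Poly_Mapping.keys (p + q :: _ \<Rightarrow>\<^sub>0 'k::field) \<subseteq> B"
  using Poly_Mapping.keys_add[of p q] by blast

lemma keys_single_subset: "b \<in> B \<Longrightarrow> Poly_Mapping.keys (Poly_Mapping.single b c) \<subseteq> B"
  by simp

lemma tensor_rel_span: "tensor_rel V W = module.span class_ring (free_space (carrier V \<times> carrier W)) (tensor_gens V W)"
  by (simp add: tensor_rel_def tensor_gens_def)

context
  fixes V :: "('k::field, 'v, 'c) module_scheme" and W :: "('k, 'w, 'd) module_scheme"
  assumes V: "kspace V" and W: "kspace W"
begin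

lemma tensor_gens_subset: "tensor_gens V W \<subseteq> carrier (free_space (carrier V \<times> carrier W))"
  unfolding tensor_gens_def using V W
  by (simp only: Un_subset_iff)
     (intro conjI; clarify; simp only: free_space_simps mem_Collect_eq;
       intro keys_minus_subset keys_single_subset; simp)

lemma ksub_tensor_rel: "ksub (free_space (carrier V \<times> carrier W)) (tensor_rel V W)"
  unfolding tensor_rel_span by (intro ksub_span tensor_gens_subset) simp

lemma kspace_tensor [simp]: "kspace (tensor V W)"
  unfolding tensor_def by (intro kspace_quot ksub_tensor_rel) simp

lemma tens_closed [simp]: "v \<in> carrier V \<Longrightarrow> w \<in> carrier W \<Longrightarrow> tens V W v w \<in> carrier (tensor V W)"
  unfolding tensor_def tens_def by (intro coset_closed ksub_tensor_rel) simp_all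

text \<open>Each defining relation is a basis element minus the expression to which it becomes
  equal, so this one rule yields additivity and homogeneity in both arguments.\<close>

lemma tens_eqI:
  assumes "Poly_Mapping.single (v, w) 1 - p \<in> tensor_gens V W" "v \<in> carrier V" "w \<in> carrier W"
    "Poly_Mapping.keys p \<subseteq> carrier V \<times> carrier W"
  shows "tens V W v w = tensor_rel V W +>\<^bsub>free_space (carrier V \<times> carrier W)\<^esub> p"
proof -
  have "Poly_Mapping.single (v, w) 1 - p \<in> tensor_rel V W"
    using assms(1) span_superset[OF kspace_free_space tensor_gens_subset] by (auto simp: tensor_rel_span)
  then show ?thesis
    using assms unfolding tens_def by (subst coset_eq_iff[OF _ ksub_tensor_rel]) (auto simp: free_space_minus)
qed

lemma tens_add_left:
  assumes "v \<in> carrier V" "v' \<in> carrier V" "w \<in> carrier W"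
  shows "tens V W (v \<oplus>\<^bsub>V\<^esub> v') w = tens V W v w \<oplus>\<^bsub>tensor V W\<^esub> tens V W v' w"
proof -
  have "tens V W (v \<oplus>\<^bsub>V\<^esub> v') w = tensor_rel V W +>\<^bsub>free_space (carrier V \<times> carrier W)\<^esub>
      (Poly_Mapping.single (v, w) 1 + Poly_Mapping.single (v', w) 1)"
    using assms V by (intro tens_eqI keys_add_subset keys_single_subset)
      (auto simp: tensor_gens_def diff_diff_eq)
  then show ?thesis
    using assms coset_add[OF kspace_free_space ksub_tensor_rel,
        of "Poly_Mapping.single (v, w) 1" "Poly_Mapping.single (v', w) 1"]
    by (simp add: tensor_def tens_def del: quot_module_simps)
qed

lemma tens_add_right:
  assumes "v \<in> carrier V" "w \<in> carrier W" "w' \<in> carrier W"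
  shows "tens V W v (w \<oplus>\<^bsub>W\<^esub> w') = tens V W v w \<oplus>\<^bsub>tensor V W\<^esub> tens V W v w'"
proof -
  have "tens V W v (w \<oplus>\<^bsub>W\<^esub> w') = tensor_rel V W +>\<^bsub>free_space (carrier V \<times> carrier W)\<^esub>
      (Poly_Mapping.single (v, w) 1 + Poly_Mapping.single (v, w') 1)"
    using assms W by (intro tens_eqI keys_add_subset keys_single_subset)
      (auto simp: tensor_gens_def diff_diff_eq)
  then show ?thesis
    using assms coset_add[OF kspace_free_space ksub_tensor_rel,
        of "Poly_Mapping.single (v, w) 1" "Poly_Mapping.single (v, w') 1"]
    by (simp add: tensor_def tens_def del: quot_module_simps)
qed

lemma tens_coset_single:
  assumes "v \<in> carrier V" "w \<in> carrier W"
  shows "tensor_rel V W +>\<^bsub>free_space (carrier V \<times> carrier W)\<^esub> Poly_Mapping.single (v, w) c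
    = c \<odot>\<^bsub>tensor V W\<^esub> tens V W v w"
  using assms coset_smult[OF kspace_free_space ksub_tensor_rel, of "Poly_Mapping.single (v, w) 1" c]
  by (simp add: tensor_def tens_def pscale_simps del: quot_module_simps)

lemma tens_smult_left:
  assumes "v \<in> carrier V" "w \<in> carrier W"
  shows "tens V W (c \<odot>\<^bsub>V\<^esub> v) w = c \<odot>\<^bsub>tensor V W\<^esub> tens V W v w"
  unfolding tens_coset_single[OF assms, symmetric]
  using assms V by (intro tens_eqI keys_single_subset) (auto simp: tensor_gens_def)

lemma tens_smult_right:
  assumes "v \<in> carrier V" "w \<in> carrier W"
  shows "tens V W v (c \<odot>\<^bsub>W\<^esub> w) = c \<odot>\<^bsub>tensor V W\<^esub> tens V W v w"
  unfolding tens_coset_single[OF assms, symmetric]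
  using assms W by (intro tens_eqI keys_single_subset) (auto simp: tensor_gens_def)

lemma tens_bilinear: "bilinear V W (tensor V W) (tens V W)"
  by (rule bilinearI) (simp_all add: tens_add_left tens_add_right tens_smult_left tens_smult_right)

text \<open>Pure tensors and sums suffice: a scalar is absorbed into the left factor, and the zero
  tensor is itself pure. The induction is on the size of the support of a representative in the free
  space.\<close>

lemma tensor_induct [consumes 1, case_names tens add]:
  assumes "x \<in> carrier (tensor V W)"
    and t: "\<And>v w. v \<in> carrier V \<Longrightarrow> w \<in> carrier W \<Longrightarrow> P (tens V W v w)"
    and a: "\<And>x y. x \<in> carrier (tensor V W) \<Longrightarrow> y \<in> carrier (tensor V W) \<Longrightarrow> P x \<Longrightarrow> P y \<Longrightarrow> P (x \<oplus>\<^bsub>tensor V W\<^esub> y)"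
  shows "P x"
proof -
  let ?F = "free_space (carrier V \<times> carrier W)"
  let ?q = "\<lambda>p. tensor_rel V W +>\<^bsub>?F\<^esub> p"
  have "P (?q p)" if "Poly_Mapping.keys p \<subseteq> carrier V \<times> carrier W" for p :: "'v \<times> 'w \<Rightarrow>\<^sub>0 'k"
    using that
  proof (induction "card (Poly_Mapping.keys p)" arbitrary: p)
    case 0
    have "?q p = 0 \<odot>\<^bsub>tensor V W\<^esub> tens V W \<zero>\<^bsub>V\<^esub> \<zero>\<^bsub>W\<^esub>"
      using 0 V W tens_coset_single[of "\<zero>\<^bsub>V\<^esub>" "\<zero>\<^bsub>W\<^esub>" 0] by simp
    then show ?case using t V W by (simp add: tens_smult_left[symmetric] del: ks_0_smult)
  next
    case (Suc n)
    then obtain v w where vw: "(v, w) \<in> Poly_Mapping.keys p"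
      by (metis card.empty ex_in_conv old.nat.distinct(1) surj_pair)
    define c where "c = Poly_Mapping.lookup p (v, w)"
    define r where "r = p - Poly_Mapping.single (v, w) c"
    have k: "Poly_Mapping.keys r = Poly_Mapping.keys p - {(v, w)}"
      by (auto simp: r_def in_keys_iff lookup_minus lookup_single c_def when_def split: if_splits)
    have vwc: "v \<in> carrier V" "w \<in> carrier W" using vw Suc.prems by auto
    have "P (?q r)"
      using Suc vw k by (intro Suc.hyps(1)) auto
    moreover have rF: "r \<in> carrier ?F" "Poly_Mapping.single (v, w) c \<in> carrier ?F"
      using Suc.prems k vwc by auto
    have "?q p = ?q r \<oplus>\<^bsub>tensor V W\<^esub> tens V W (c \<odot>\<^bsub>V\<^esub> v) w"
      using coset_add[OF kspace_free_space ksub_tensor_rel, folded tensor_def, OF rF]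
      by (simp add: tens_smult_left tens_coset_single[symmetric] vwc) (simp add: r_def)
    ultimately show ?case
      using a[of "?q r" "tens V W (c \<odot>\<^bsub>V\<^esub> v) w"] t vwc V W
        coset_closed[OF kspace_free_space ksub_tensor_rel, folded tensor_def, OF rF(1)]
      by simp
  qed
  moreover have "carrier (tensor V W) = ?q ` carrier ?F"
    unfolding tensor_def by (intro carrier_quot kspace_free_space ksub_tensor_rel)
  ultimately show ?thesis using assms(1) by auto
qed

lemma tensor_hom_eqI:
  assumes "add_hom (tensor V W) N f" "add_hom (tensor V W) N g"
    and "\<And>v w. v \<in> carrier V \<Longrightarrow> w \<in> carrier W \<Longrightarrow> f (tens V W v w) = g (tens V W v w)"
    and "x \<in> carrier (tensor V W)"
  shows "f x = g x"
  using assms(4) by (induction rule: tensor_induct) (simp_all add: assms(3) add_homD[OF assms(1)] add_homD[OF assms(2)])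

text \<open>The coefficient enters through the left argument of \<open>\<beta>\<close>, because a
  balanced map need not be compatible with the scalar multiplication of \<open>N\<close>.\<close>

definition tensor_lift :: "('n, 'e) ring_scheme \<Rightarrow> ('v \<Rightarrow> 'w \<Rightarrow> 'n) \<Rightarrow> ('v \<times> 'w \<Rightarrow>\<^sub>0 'k) \<Rightarrow> 'n" where
  "tensor_lift N \<beta> p = (\<Oplus>\<^bsub>N\<^esub>x\<in>Poly_Mapping.keys p. \<beta> (Poly_Mapping.lookup p x \<odot>\<^bsub>V\<^esub> fst x) (snd x))"

context
  fixes N :: "('k, 'n, 'e) module_scheme" and \<beta>
  assumes N: "kspace N" and \<beta>: "balanced V W N \<beta>"
begin

lemma balanced_zero: "w \<in> carrier W \<Longrightarrow> \<beta> \<zero>\<^bsub>V\<^esub> w = \<zero>\<^bsub>N\<^esub>"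
  using add_hom_zero[OF V N, of "\<lambda>v. \<beta> v w"] balancedD[OF \<beta>] by (simp add: add_hom_def)

text \<open>Needed to compare the lifts of p, q and p + q, whose supports differ, over one index
  set.\<close>

lemma tensor_lift_superset:
  assumes "finite A" "Poly_Mapping.keys p \<subseteq> A" "A \<subseteq> carrier V \<times> carrier W"
  shows "tensor_lift N \<beta> p = (\<Oplus>\<^bsub>N\<^esub>x\<in>A. \<beta> (Poly_Mapping.lookup p x \<odot>\<^bsub>V\<^esub> fst x) (snd x))"
  unfolding tensor_lift_def
proof (rule ks_finsum_mono_neutral)
  have A: "fst x \<in> carrier V" "snd x \<in> carrier W" if "x \<in> A" for x
    using that assms(3) by auto
  show "\<beta> (Poly_Mapping.lookup p x \<odot>\<^bsub>V\<^esub> fst x) (snd x) \<in> carrier N" if "x \<in> Poly_Mapping.keys p" for x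
    using that assms(2) A[of x] V by (auto intro!: balancedD(1)[OF \<beta>])
  show "\<beta> (Poly_Mapping.lookup p x \<odot>\<^bsub>V\<^esub> fst x) (snd x) = \<zero>\<^bsub>N\<^esub>" if "x \<in> A - Poly_Mapping.keys p" for x
    using that A[of x] V by (simp add: in_keys_iff balanced_zero)
qed (use assms N in auto)

lemma add_hom_tensor_lift: "add_hom (free_space (carrier V \<times> carrier W)) N (tensor_lift N \<beta>)"
proof (rule add_homI)
  fix p q :: "'v \<times> 'w \<Rightarrow>\<^sub>0 'k"
  assume "p \<in> carrier (free_space (carrier V \<times> carrier W))" "q \<in> carrier (free_space (carrier V \<times> carrier W))"
  then have pq: "Poly_Mapping.keys p \<subseteq> carrier V \<times> carrier W" "Poly_Mapping.keys q \<subseteq> carrier V \<times> carrier W"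
    by auto
  let ?A = "Poly_Mapping.keys p \<union> Poly_Mapping.keys q"
  have A: "x \<in> ?A \<Longrightarrow> fst x \<in> carrier V \<and> snd x \<in> carrier W" for x using pq by auto
  have "tensor_lift N \<beta> (p + q) = (\<Oplus>\<^bsub>N\<^esub>x\<in>?A. \<beta> (Poly_Mapping.lookup (p + q) x \<odot>\<^bsub>V\<^esub> fst x) (snd x))"
    using pq Poly_Mapping.keys_add[of p q] by (intro tensor_lift_superset) auto
  also have "\<dots> = (\<Oplus>\<^bsub>N\<^esub>x\<in>?A. \<beta> (Poly_Mapping.lookup p x \<odot>\<^bsub>V\<^esub> fst x) (snd x) \<oplus>\<^bsub>N\<^esub>
      \<beta> (Poly_Mapping.lookup q x \<odot>\<^bsub>V\<^esub> fst x) (snd x))"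
    using A V N balancedD(1,2)[OF \<beta>] by (intro ks_finsum_cong) (auto simp: lookup_add ks_smult_ldistr)
  also have "\<dots> = tensor_lift N \<beta> p \<oplus>\<^bsub>N\<^esub> tensor_lift N \<beta> q"
    using A V N balancedD(1)[OF \<beta>] pq
    by (subst (1 2) tensor_lift_superset[of ?A]) (auto intro!: ks_finsum_add)
  finally show "tensor_lift N \<beta> (p \<oplus>\<^bsub>free_space (carrier V \<times> carrier W)\<^esub> q) = tensor_lift N \<beta> p \<oplus>\<^bsub>N\<^esub> tensor_lift N \<beta> q"
    by simp
qed (use V W N balancedD(1)[OF \<beta>] in \<open>auto simp: tensor_lift_def intro!: ks_finsum_closed\<close>)

lemma tensor_lift_single:
  assumes "v \<in> carrier V" "w \<in> carrier W"
  shows "tensor_lift N \<beta> (Poly_Mapping.single (v, w) c) = \<beta> (c \<odot>\<^bsub>V\<^esub> v) w"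
  using assms V N balancedD(1)[OF \<beta>]
  by (subst tensor_lift_superset[of "{(v, w)}"]; (subst ks_finsum_delta[of N _ "(v, w)"])?) auto

lemma tensor_lift_gens:
  assumes "p \<in> tensor_gens V W"
  shows "tensor_lift N \<beta> (pscale c p) = \<zero>\<^bsub>N\<^esub>"
proof -
  let ?F = "free_space (carrier V \<times> carrier W) :: ('k, _) module"
  have m: "tensor_lift N \<beta> (p - q) = tensor_lift N \<beta> p \<ominus>\<^bsub>N\<^esub> tensor_lift N \<beta> q"
    if "Poly_Mapping.keys p \<subseteq> carrier V \<times> carrier W" "Poly_Mapping.keys q \<subseteq> carrier V \<times> carrier W" for p q
    using add_hom_minus[OF kspace_free_space N add_hom_tensor_lift, of p q] that by (simp add: free_space_minus)
  have s: "Poly_Mapping.keys (Poly_Mapping.single (v, w) c :: _ \<Rightarrow>\<^sub>0 'k) \<subseteq> carrier V \<times> carrier W"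
    if "v \<in> carrier V" "w \<in> carrier W" for v w c
    using that by simp
  note [simp] = balancedD(1)[OF \<beta>]
  have z: "(x \<oplus>\<^bsub>N\<^esub> y) \<ominus>\<^bsub>N\<^esub> x \<ominus>\<^bsub>N\<^esub> y = \<zero>\<^bsub>N\<^esub>" if "x \<in> carrier N" "y \<in> carrier N" for x y
    using that N ks_add_assoc[of N y x "\<ominus>\<^bsub>N\<^esub> x"] ks_add_comm[of N x y] by (simp add: a_minus_def)
  from assms show ?thesis
    unfolding tensor_gens_def
    by (elim UnE CollectE exE conjE)
       (use V W N in \<open>simp_all add: pscale_simps m s keys_minus_subset[OF s s] tensor_lift_single z
          ks_smult_rdistr balancedD(2,3)[OF \<beta>] ks_smult_assoc ks_minus_eq_zero balancedD(4)[OF \<beta>, symmetric]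
          mult.commute\<close>)
qed

lemma tensor_lift_rel:
  assumes "p \<in> tensor_rel V W"
  shows "tensor_lift N \<beta> p = \<zero>\<^bsub>N\<^esub>"
proof -
  let ?F = "free_space (carrier V \<times> carrier W) :: ('k, _) module"
  \<comment> \<open>The lift is only additive, so its kernel is not visibly closed under scalars.
    The elements all of whose multiples lie in the kernel do form a subspace, and that subspace can
    absorb the span of the relations.\<close>
  let ?K = "{p \<in> carrier ?F. \<forall>c. tensor_lift N \<beta> (pscale c p) = \<zero>\<^bsub>N\<^esub>}"
  have z: "tensor_lift N \<beta> 0 = \<zero>\<^bsub>N\<^esub>" using N by (simp add: tensor_lift_def)
  have k: "Poly_Mapping.keys (pscale c p) \<subseteq> carrier V \<times> carrier W" if "p \<in> carrier ?F" for p c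
    using that keys_pscale[of c p] by simp
  have "ksub ?F ?K"
    using N k z add_homD(2)[OF add_hom_tensor_lift]
    by (auto simp: ksub_def pscale_simps keys_add_subset simp del: subset_iff intro!: keys_add_subset)
  moreover have "tensor_gens V W \<subseteq> ?K" using tensor_lift_gens tensor_gens_subset by auto
  ultimately have "tensor_rel V W \<subseteq> ?K" unfolding tensor_rel_span by (intro span_le_ksub) auto
  then have "tensor_lift N \<beta> (pscale 1 p) = \<zero>\<^bsub>N\<^esub>" using assms by blast
  then show ?thesis by (simp add: pscale_simps)
qed

text \<open>The universal property for balanced maps. The lift vanishes on the relations and so
  factors through the quotient; uniqueness comes from \<open>tensor_hom_eqI\<close>, and the two
  together give meaning to the \<open>THE\<close> behind \<open>tensor_ext\<close>.\<close>

lemma tensor_ext_exists: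
  obtains f where "add_hom (tensor V W) N f" "\<And>v w. v \<in> carrier V \<Longrightarrow> w \<in> carrier W \<Longrightarrow> f (tens V W v w) = \<beta> v w"
    "\<And>x. x \<in> carrier (tensor V W) \<Longrightarrow> tensor_ext V W N \<beta> x = f x"
proof -
  obtain f where f: "add_hom (tensor V W) N f"
    "\<And>x. x \<in> carrier (free_space (carrier V \<times> carrier W)) \<Longrightarrow>
       f (tensor_rel V W +>\<^bsub>free_space (carrier V \<times> carrier W)\<^esub> x) = tensor_lift N \<beta> x"
    using quot_factor[OF kspace_free_space ksub_tensor_rel N add_hom_tensor_lift tensor_lift_rel]
    unfolding tensor_def by blast
  have t: "f (tens V W v w) = \<beta> v w" if "v \<in> carrier V" "w \<in> carrier W" for v w
    using that f(2)[of "Poly_Mapping.single (v, w) 1"] V by (simp add: tens_def tensor_lift_single)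
  have "tensor_ext V W N \<beta> x = f x" if "x \<in> carrier (tensor V W)" for x
    unfolding tensor_ext_def
  proof (rule additive_ext_eq[OF kspace_tensor f(1)])
    show "g z = f z" if "add_hom (tensor V W) N g" "z \<in> carrier (tensor V W)"
      "\<And>i. i \<in> carrier V \<times> carrier W \<Longrightarrow> g (case i of (v, w) \<Rightarrow> tens V W v w) = f (case i of (v, w) \<Rightarrow> tens V W v w)" for g z
      using that(3)[of "(_, _)"] by (intro tensor_hom_eqI[OF that(1) f(1) _ that(2)]) auto
  qed (use that t in auto)
  with f(1) t show thesis by (rule that)
qed

lemma tensor_ext_tens:
  "v \<in> carrier V \<Longrightarrow> w \<in> carrier W \<Longrightarrow> tensor_ext V W N \<beta> (tens V W v w) = \<beta> v w"
  by (rule tensor_ext_exists) (metis tens_closed)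

lemma tensor_ext_add_hom: "add_hom (tensor V W) N (tensor_ext V W N \<beta>)"
  by (rule tensor_ext_exists) (simp add: add_hom_def)

lemmas tensor_ext_add = add_homD(2)[OF tensor_ext_add_hom]
lemmas tensor_ext_closed = add_homD(1)[OF tensor_ext_add_hom]

end

lemma tensor_ext_smult:
  assumes N: "kspace N" and \<beta>: "bilinear V W N \<beta>" and "x \<in> carrier (tensor V W)"
  shows "tensor_ext V W N \<beta> (c \<odot>\<^bsub>tensor V W\<^esub> x) = c \<odot>\<^bsub>N\<^esub> tensor_ext V W N \<beta> x"
  using assms(3)
proof (induction rule: tensor_induct)
  case (tens v w)
  then show ?case
    using V \<beta> by (simp add: tens_smult_left[symmetric] tensor_ext_tens[OF N bilinear_balanced[OF \<beta>]] bilinear_def)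
next
  case (add x y)
  then show ?case
    using N tensor_ext_add[OF N bilinear_balanced[OF \<beta>]] tensor_ext_closed[OF N bilinear_balanced[OF \<beta>]]
    by (simp add: ks_smult_rdistr)
qed

lemma tensor_ext_lin_hom:
  assumes "kspace N" "bilinear V W N \<beta>"
  shows "lin_hom (tensor V W) N (tensor_ext V W N \<beta>)"
  using assms by (simp add: lin_hom_def tensor_ext_add_hom bilinear_balanced tensor_ext_smult)

end

section \<open>Maps between tensor products\<close>

lemma tens_hom_left: "kspace V \<Longrightarrow> kspace W \<Longrightarrow> w \<in> carrier W \<Longrightarrow> lin_hom V (tensor V W) (\<lambda>v. tens V W v w)"
  by (rule lin_homI) (simp_all add: tens_add_left tens_smult_left)

lemma tens_hom_right: "kspace V \<Longrightarrow> kspace W \<Longrightarrow> v \<in> carrier V \<Longrightarrow> lin_hom W (tensor V W) (tens V W v)"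
  by (rule lin_homI) (simp_all add: tens_add_right tens_smult_right)

context
  fixes V :: "('k::field, 'v, 'c) module_scheme" and W :: "('k, 'w, 'd) module_scheme"
    and V2 :: "('k, 'v2, 'c2) module_scheme" and W2 :: "('k, 'w2, 'd2) module_scheme" and f g
  assumes V: "kspace V" and W: "kspace W" and V2: "kspace V2" and W2: "kspace W2"
    and f: "lin_hom V V2 f" and g: "lin_hom W W2 g"
begin

lemma tensor_map_bilinear: "bilinear V W (tensor V2 W2) (\<lambda>v w. tens V2 W2 (f v) (g w))"
  using V W V2 W2 lin_homD[OF f] lin_homD[OF g]
  by (intro bilinearI) (simp_all add: tens_add_left tens_add_right tens_smult_left tens_smult_right)

lemma tensor_map_tens: "v \<in> carrier V \<Longrightarrow> w \<in> carrier W \<Longrightarrow>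
    tensor_map V W V2 W2 f g (tens V W v w) = tens V2 W2 (f v) (g w)"
  unfolding tensor_map_def using V W V2 W2
  by (intro tensor_ext_tens bilinear_balanced tensor_map_bilinear kspace_tensor)

lemma tensor_map_lin_hom: "lin_hom (tensor V W) (tensor V2 W2) (tensor_map V W V2 W2 f g)"
  unfolding tensor_map_def using V W V2 W2
  by (intro tensor_ext_lin_hom tensor_map_bilinear kspace_tensor)

lemmas tensor_map_closed = lin_homD(1)[OF tensor_map_lin_hom]
lemmas tensor_map_add = lin_homD(2)[OF tensor_map_lin_hom]
lemmas tensor_map_add_hom = lin_homD(4)[OF tensor_map_lin_hom]

lemma tensor_ext_tensor_map:
  fixes N :: "('k, 'n, 'e) module_scheme"
  assumes N: "kspace N" and \<beta>: "balanced V2 W2 N \<beta>" and x: "x \<in> carrier (tensor V W)"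
  shows "tensor_ext V2 W2 N \<beta> (tensor_map V W V2 W2 f g x) = tensor_ext V W N (\<lambda>v w. \<beta> (f v) (g w)) x"
proof -
  have b: "balanced V W N (\<lambda>v w. \<beta> (f v) (g w))"
    using lin_homD[OF f] lin_homD[OF g] balancedD[OF \<beta>] by (intro balancedI) simp_all
  show ?thesis
    by (rule tensor_hom_eqI[OF V W _ tensor_ext_add_hom[OF V W N b] _ x],
        rule add_hom_comp[OF tensor_map_add_hom tensor_ext_add_hom[OF V2 W2 N \<beta>]])
       (use lin_homD(1)[OF f] lin_homD(1)[OF g] in
         \<open>simp add: tensor_map_tens tensor_ext_tens[OF V2 W2 N \<beta>] tensor_ext_tens[OF V W N b]\<close>)
qed

end

lemma tensor_map_comp:
  assumes "kspace V" "kspace W" "kspace V2" "kspace W2" "kspace V3" "kspace W3"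
    "lin_hom V V2 f" "lin_hom W W2 g" "lin_hom V2 V3 f'" "lin_hom W2 W3 g'" "x \<in> carrier (tensor V W)"
  shows "tensor_map V2 W2 V3 W3 f' g' (tensor_map V W V2 W2 f g x) = tensor_map V W V3 W3 (\<lambda>v. f' (f v)) (\<lambda>w. g' (g w)) x"
  unfolding tensor_map_def[of V2 W2 V3 W3] tensor_map_def[of V W V3 W3]
  using assms by (intro tensor_ext_tensor_map bilinear_balanced tensor_map_bilinear kspace_tensor)

lemma tensor_ext_cong:
  fixes V :: "('k::field, 'v, 'c) module_scheme" and N :: "('k, 'n, 'e) module_scheme"
  assumes V: "kspace V" and W: "kspace W" and N: "kspace N" and \<beta>: "balanced V W N \<beta>"
    and eq: "\<And>v w. v \<in> carrier V \<Longrightarrow> w \<in> carrier W \<Longrightarrow> \<beta> v w = \<gamma> v w"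
    and x: "x \<in> carrier (tensor V W)"
  shows "tensor_ext V W N \<gamma> x = tensor_ext V W N \<beta> x"
proof -
  have \<gamma>: "balanced V W N \<gamma>"
    using balancedD[OF \<beta>] V W by (intro balancedI) (simp_all flip: eq)
  show ?thesis
    by (rule tensor_hom_eqI[OF V W tensor_ext_add_hom[OF V W N \<gamma>] tensor_ext_add_hom[OF V W N \<beta>] _ x])
       (simp add: tensor_ext_tens[OF V W N] \<beta> \<gamma> eq)
qed

lemma tensor_map_cong:
  assumes "kspace V" "kspace W" "kspace V2" "kspace W2" "lin_hom V V2 f" "lin_hom W W2 g"
    "\<And>v. v \<in> carrier V \<Longrightarrow> f v = f' v" "\<And>w. w \<in> carrier W \<Longrightarrow> g w = g' w" "x \<in> carrier (tensor V W)"
  shows "tensor_map V W V2 W2 f' g' x = tensor_map V W V2 W2 f g x"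
  unfolding tensor_map_def using assms
  by (intro tensor_ext_cong bilinear_balanced tensor_map_bilinear kspace_tensor) auto

lemma tensor_map_id:
  assumes "kspace V" "kspace W" "\<And>v. v \<in> carrier V \<Longrightarrow> f v = v" "\<And>w. w \<in> carrier W \<Longrightarrow> g w = w"
    "x \<in> carrier (tensor V W)"
  shows "tensor_map V W V W f g x = x"
proof -
  have fg: "lin_hom V V f" "lin_hom W W g" using assms by (auto intro!: lin_homI)
  show ?thesis
    using assms(5) by (induction rule: tensor_induct[OF assms(1,2), consumes 1])
      (simp_all add: tensor_map_tens[OF assms(1,2,1,2) fg] tensor_map_add[OF assms(1,2,1,2) fg] assms)
qed

context
  fixes V :: "('k::field, 'v, 'c) module_scheme" and W :: "('k, 'w, 'd) module_scheme" and U :: "('k, 'u, 'e) module_scheme"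
  assumes V: "kspace V" and W: "kspace W" and U: "kspace U"
begin

text \<open>The associator arises from two uses of the universal property: for fixed u on V
  \<otimes> W, and then in the pair (z, u). The two bilinearity lemmas are the respective
  hypotheses.\<close>

lemma tensor_assoc_inner_bilinear:
  "u \<in> carrier U \<Longrightarrow> bilinear V W (tensor V (tensor W U)) (\<lambda>v w. tens V (tensor W U) v (tens W U w u))"
  using V W U by (intro bilinearI)
    (simp_all add: tens_add_left tens_add_right tens_smult_left tens_smult_right)

lemma tensor_assoc_outer_bilinear:
  "bilinear (tensor V W) U (tensor V (tensor W U))
     (\<lambda>z u. tensor_ext V W (tensor V (tensor W U)) (\<lambda>v w. tens V (tensor W U) v (tens W U w u)) z)"
proof -
  let ?T = "tensor V (tensor W U)"
  let ?f = "\<lambda>z u. tensor_ext V W ?T (\<lambda>v w. tens V (tensor W U) v (tens W U w u)) z"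
  have T: "kspace ?T" using V W U by simp
  note b = tensor_assoc_inner_bilinear
  note h = tensor_ext_lin_hom[OF V W T b]
  note t = tensor_ext_tens[OF V W T bilinear_balanced[OF b]]
  have "?f z (u \<oplus>\<^bsub>U\<^esub> u') = ?f z u \<oplus>\<^bsub>?T\<^esub> ?f z u'"
    if "z \<in> carrier (tensor V W)" "u \<in> carrier U" "u' \<in> carrier U" for z u u'
    using that(1)
    by (induction rule: tensor_induct[OF V W, consumes 1])
       (use that V W U in \<open>simp_all add: t tens_add_right lin_homD(1,2)[OF h] ks_ac[OF T] ks_ac\<close>)
  moreover have "?f z (c \<odot>\<^bsub>U\<^esub> u) = c \<odot>\<^bsub>?T\<^esub> ?f z u"
    if "z \<in> carrier (tensor V W)" "u \<in> carrier U" for z u c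
    using that(1)
    by (induction rule: tensor_induct[OF V W, consumes 1])
       (use that V W U in \<open>simp_all add: t tens_smult_right lin_homD(1,2)[OF h] ks_smult_rdistr\<close>)
  ultimately show ?thesis
    using U by (intro bilinearI) (simp_all add: lin_homD[OF h])
qed

lemma tensor_assoc_props:
  shows tensor_assoc_tens: "v \<in> carrier V \<Longrightarrow> w \<in> carrier W \<Longrightarrow> u \<in> carrier U \<Longrightarrow>
      tensor_assoc V W U (tens (tensor V W) U (tens V W v w) u) = tens V (tensor W U) v (tens W U w u)"
    and tensor_assoc_lin_hom: "lin_hom (tensor (tensor V W) U) (tensor V (tensor W U)) (tensor_assoc V W U)"
proof -
  let ?T = "tensor V (tensor W U)"
  define F where "F = tensor_ext (tensor V W) U ?T
     (\<lambda>z u. tensor_ext V W ?T (\<lambda>v w. tens V (tensor W U) v (tens W U w u)) z)"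
  have T: "kspace ?T" "kspace (tensor V W)" "kspace (tensor (tensor V W) U)" using V W U by simp_all
  note b = tensor_assoc_outer_bilinear
  have F: "lin_hom (tensor (tensor V W) U) ?T F"
    unfolding F_def by (rule tensor_ext_lin_hom[OF T(2) U T(1) b])
  have Ft: "F (tens (tensor V W) U (tens V W v w) u) = tens V (tensor W U) v (tens W U w u)"
    if "v \<in> carrier V" "w \<in> carrier W" "u \<in> carrier U" for v w u
    unfolding F_def using that V W U
    by (simp add: tensor_ext_tens[OF T(2) U T(1) bilinear_balanced[OF b]]
        tensor_ext_tens[OF V W T(1) bilinear_balanced[OF tensor_assoc_inner_bilinear]])
  have eq: "tensor_assoc V W U x = F x" if "x \<in> carrier (tensor (tensor V W) U)" for x
    unfolding tensor_assoc_def
  proof (rule additive_ext_eq[OF T(3) lin_homD(4)[OF F] _ _ _ that])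
    fix f z assume f: "add_hom (tensor (tensor V W) U) ?T f"
      and fi: "\<And>i. i \<in> carrier V \<times> carrier W \<times> carrier U \<Longrightarrow>
        f (case i of (v, w, u) \<Rightarrow> tens (tensor V W) U (tens V W v w) u) =
        F (case i of (v, w, u) \<Rightarrow> tens (tensor V W) U (tens V W v w) u)"
      and z: "z \<in> carrier (tensor (tensor V W) U)"
    have "f (tens (tensor V W) U y u) = F (tens (tensor V W) U y u)"
      if y: "y \<in> carrier (tensor V W)" and u: "u \<in> carrier U" for y u
      by (rule tensor_hom_eqI[OF V W
            add_hom_comp[OF lin_homD(4)[OF tens_hom_left[OF T(2) U u]] f]
            add_hom_comp[OF lin_homD(4)[OF tens_hom_left[OF T(2) U u]] lin_homD(4)[OF F]] _ y])
         (use fi[of "(_, _, u)"] u in simp)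
    then show "f z = F z" by (rule tensor_hom_eqI[OF T(2) U f lin_homD(4)[OF F] _ z])
  qed (use Ft V W U in auto)
  show "tensor_assoc V W U (tens (tensor V W) U (tens V W v w) u) = tens V (tensor W U) v (tens W U w u)"
    if "v \<in> carrier V" "w \<in> carrier W" "u \<in> carrier U"
    using that V W U by (simp add: eq Ft)
  show "lin_hom (tensor (tensor V W) U) ?T (tensor_assoc V W U)"
    using F eq T by (auto simp: lin_hom_def add_hom_def)
qed

lemmas tensor_assoc_closed = lin_homD(1)[OF tensor_assoc_lin_hom]
lemmas tensor_assoc_add_hom = lin_homD(4)[OF tensor_assoc_lin_hom]

lemma tensor3_hom_eqI:
  assumes "add_hom (tensor (tensor V W) U) N f" "add_hom (tensor (tensor V W) U) N g"
    and eq: "\<And>v w u. v \<in> carrier V \<Longrightarrow> w \<in> carrier W \<Longrightarrow> u \<in> carrier U \<Longrightarrow>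
      f (tens (tensor V W) U (tens V W v w) u) = g (tens (tensor V W) U (tens V W v w) u)"
    and x: "x \<in> carrier (tensor (tensor V W) U)"
  shows "f x = g x"
proof (rule tensor_hom_eqI[OF kspace_tensor[OF V W] U assms(1,2) _ x])
  fix y u assume y: "y \<in> carrier (tensor V W)" and u: "u \<in> carrier U"
  note h = lin_homD(4)[OF tens_hom_left[OF kspace_tensor[OF V W] U u]]
  show "f (tens (tensor V W) U y u) = g (tens (tensor V W) U y u)"
    by (rule tensor_hom_eqI[OF V W add_hom_comp[OF h assms(1)] add_hom_comp[OF h assms(2)] _ y])
       (use eq u in simp)
qed

end

section \<open>Linear functionals\<close>

abbreviation functional :: "('k::field, 'v, 'c) module_scheme \<Rightarrow> ('v \<Rightarrow> 'k) \<Rightarrow> bool" where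
  "functional V \<equiv> lin_hom V field_space"

lemma functionalD:
  assumes "functional V u"
  shows "x \<in> carrier V \<Longrightarrow> y \<in> carrier V \<Longrightarrow> u (x \<oplus>\<^bsub>V\<^esub> y) = u x + u y"
    and "x \<in> carrier V \<Longrightarrow> u (c \<odot>\<^bsub>V\<^esub> x) = c * u x"
  using lin_homD[OF assms] by simp_all

lemma functionalI:
  "(\<And>x y. x \<in> carrier V \<Longrightarrow> y \<in> carrier V \<Longrightarrow> u (x \<oplus>\<^bsub>V\<^esub> y) = u x + u y) \<Longrightarrow>
   (\<And>c x. x \<in> carrier V \<Longrightarrow> u (c \<odot>\<^bsub>V\<^esub> x) = c * u x) \<Longrightarrow> functional V u"
  by (rule lin_homI) simp_all

lemma functional_finsum:
  assumes "kspace V" "functional V u" "\<And>i. i \<in> A \<Longrightarrow> g i \<in> carrier V"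
  shows "u (finsum V g A) = (\<Sum>i\<in>A. u (g i))"
  using add_hom_finsum[OF assms(1) kspace_field_space lin_homD(4)[OF assms(2)] assms(3)]
  by (simp add: finsum_field_space)

text \<open>The contraction u \<otimes> id, with the base field tensored with \<open>W\<close>
  identified with \<open>W\<close>. Applied to \<rho>(v) it gives the matrix coefficient \<psi>(v
  \<otimes> u).\<close>

definition slice ::
  "('k::field, 'v, 'c) module_scheme \<Rightarrow> ('k, 'w, 'd) module_scheme \<Rightarrow> ('v \<Rightarrow> 'k) \<Rightarrow> ('k, 'v, 'w) tensor \<Rightarrow> 'w" where
  "slice V W u = tensor_ext V W W (\<lambda>v w. u v \<odot>\<^bsub>W\<^esub> w)"

context
  fixes V :: "('k::field, 'v, 'c) module_scheme" and W :: "('k, 'w, 'd) module_scheme" and u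
  assumes V: "kspace V" and W: "kspace W" and u: "functional V u"
begin

lemma slice_bilinear: "bilinear V W W (\<lambda>v w. u v \<odot>\<^bsub>W\<^esub> w)"
  using V W functionalD[OF u]
  by (intro bilinearI) (simp_all add: ks_smult_ldistr ks_smult_rdistr ks_smult_assoc mult.commute)

lemma slice_tens: "v \<in> carrier V \<Longrightarrow> w \<in> carrier W \<Longrightarrow> slice V W u (tens V W v w) = u v \<odot>\<^bsub>W\<^esub> w"
  unfolding slice_def by (rule tensor_ext_tens[OF V W W bilinear_balanced[OF slice_bilinear]])

lemma slice_lin_hom: "lin_hom (tensor V W) W (slice V W u)"
  unfolding slice_def by (rule tensor_ext_lin_hom[OF V W W slice_bilinear])

lemmas slice_closed = lin_homD(1)[OF slice_lin_hom]
lemmas slice_add = lin_homD(2)[OF slice_lin_hom]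

end

lemma slice_tensor_map:
  assumes "kspace V" "kspace W" "kspace V2" "kspace W2" "lin_hom V V2 f" "lin_hom W W2 g" "functional V2 u"
    "x \<in> carrier (tensor V W)"
  shows "slice V2 W2 u (tensor_map V W V2 W2 f g x) = g (slice V W (\<lambda>v. u (f v)) x)"
proof -
  have fu: "functional V (\<lambda>v. u (f v))" using lin_hom_comp assms by blast
  show ?thesis
    by (rule tensor_hom_eqI[OF assms(1,2) _ _ _ assms(8)],
        rule add_hom_comp[OF tensor_map_add_hom[OF assms(1-6)] lin_homD(4)[OF slice_lin_hom[OF assms(3,4,7)]]],
        rule add_hom_comp[OF lin_homD(4)[OF slice_lin_hom[OF assms(1,2) fu]] lin_homD(4)[OF assms(6)]])
       (use assms lin_homD[OF assms(5)] lin_homD[OF assms(6)] in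
         \<open>simp add: tensor_map_tens slice_tens[OF assms(1,2) fu] slice_tens\<close>)
qed

text \<open>A finite basis as an indexed family together with its coordinate functionals; the last
  clause is spanning with explicit coefficients.\<close>

definition frame :: "('k::field, 'v, 'c) module_scheme \<Rightarrow> 'i set \<Rightarrow> ('i \<Rightarrow> 'v) \<Rightarrow> ('i \<Rightarrow> 'v \<Rightarrow> 'k) \<Rightarrow> bool" where
  "frame V I e f \<longleftrightarrow> finite I \<and> (\<forall>i\<in>I. e i \<in> carrier V \<and> functional V (f i)) \<and>
     (\<forall>i\<in>I. \<forall>j\<in>I. f i (e j) = (if i = j then 1 else 0)) \<and>
     (\<forall>v\<in>carrier V. (\<Oplus>\<^bsub>V\<^esub>i\<in>I. f i v \<odot>\<^bsub>V\<^esub> e i) = v)"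

text \<open>Coordinates of a tensor with respect to a basis of the left factor. For a coaction this
  reads \<rho>(v) = \<Sum> e_i \<otimes> \<psi>(v \<otimes> f_i), the source of all matrices of
  coactions below.\<close>

lemma frame_tensor:
  assumes V: "kspace V" and W: "kspace W" and fr: "frame V I e f" and x: "x \<in> carrier (tensor V W)"
  shows "(\<Oplus>\<^bsub>tensor V W\<^esub>i\<in>I. tens V W (e i) (slice V W (f i) x)) = x"
  using x
proof (induction rule: tensor_induct[OF V W, consumes 1])
  case (1 v w)
  have I: "i \<in> I \<Longrightarrow> e i \<in> carrier V" "i \<in> I \<Longrightarrow> functional V (f i)" for i
    using fr by (auto simp: frame_def)
  have "(\<Oplus>\<^bsub>tensor V W\<^esub>i\<in>I. tens V W (e i) (slice V W (f i) (tens V W v w))) =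
      (\<Oplus>\<^bsub>tensor V W\<^esub>i\<in>I. tens V W (f i v \<odot>\<^bsub>V\<^esub> e i) w)"
    using 1 I V W by (intro ks_finsum_cong) (simp_all add: slice_tens tens_smult_left tens_smult_right)
  also have "\<dots> = tens V W (\<Oplus>\<^bsub>V\<^esub>i\<in>I. f i v \<odot>\<^bsub>V\<^esub> e i) w"
    using 1 I V W add_hom_finsum[OF V kspace_tensor[OF V W] lin_homD(4)[OF tens_hom_left[OF V W 1(2)]],
        of I "\<lambda>i. f i v \<odot>\<^bsub>V\<^esub> e i"] by simp
  finally show ?case using fr 1 by (simp add: frame_def)
next
  case (2 x y)
  have I: "i \<in> I \<Longrightarrow> e i \<in> carrier V" "i \<in> I \<Longrightarrow> functional V (f i)" for i
    using fr by (auto simp: frame_def)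
  note s = slice_closed[OF V W I(2)] slice_add[OF V W I(2)]
  have "(\<Oplus>\<^bsub>tensor V W\<^esub>i\<in>I. tens V W (e i) (slice V W (f i) (x \<oplus>\<^bsub>tensor V W\<^esub> y))) =
      (\<Oplus>\<^bsub>tensor V W\<^esub>i\<in>I. tens V W (e i) (slice V W (f i) x) \<oplus>\<^bsub>tensor V W\<^esub> tens V W (e i) (slice V W (f i) y))"
    using 2 V W I by (intro ks_finsum_cong) (simp_all add: s tens_add_right)
  then show ?case using 2 V W I by (simp add: ks_finsum_add s)
qed

text \<open>A subspace M maximal among those that contain \<open>U\<close> and miss \<open>v\<close>
  is a complement of the line through \<open>v\<close>, and u is the coefficient along that line.
  Zorn's lemma is the tool because the statement is applied to \<open>H\<close>, whose dimension may
  be infinite.\<close>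

lemma functional_extension:
  assumes V: "kspace V" and U: "ksub V U" and v: "v \<in> carrier V" "v \<notin> U"
  obtains u where "functional V u" "\<And>x. x \<in> U \<Longrightarrow> u x = 0" "u v = 1"
proof -
  let ?A = "{M. ksub V M \<and> U \<subseteq> M \<and> v \<notin> M}"
  have "\<exists>M\<in>?A. \<forall>X\<in>?A. M \<subseteq> X \<longrightarrow> X = M"
  proof (rule subset_Zorn_nonempty)
    show "\<Union>\<C> \<in> ?A" if C: "\<C> \<noteq> {}" "subset.chain ?A \<C>" for \<C>
    proof -
      have A: "X \<in> ?A" if "X \<in> \<C>" for X using C that by (auto simp: subset.chain_def)
      have d: "X \<subseteq> Y \<or> Y \<subseteq> X" if "X \<in> \<C>" "Y \<in> \<C>" for X Y
        using C that by (auto simp: subset.chain_def)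
      have k: "Z \<subseteq> carrier V" "\<zero>\<^bsub>V\<^esub> \<in> Z" "\<And>x y. x \<in> Z \<Longrightarrow> y \<in> Z \<Longrightarrow> x \<oplus>\<^bsub>V\<^esub> y \<in> Z"
        "\<And>c x. x \<in> Z \<Longrightarrow> c \<odot>\<^bsub>V\<^esub> x \<in> Z" if "Z \<in> \<C>" for Z
        using A[OF that] by (auto simp: ksub_def)
      have a: "x \<oplus>\<^bsub>V\<^esub> y \<in> \<Union>\<C>" if xy: "x \<in> X" "X \<in> \<C>" "y \<in> Y" "Y \<in> \<C>" for x y X Y
        using d[OF xy(2,4)]
      proof
        assume "X \<subseteq> Y"
        then show ?thesis using xy by (intro UnionI[OF xy(4)] k(3)) auto
      next
        assume "Y \<subseteq> X"
        then show ?thesis using xy by (intro UnionI[OF xy(2)] k(3)) auto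
      qed
      obtain Z where Z: "Z \<in> \<C>" using C(1) by blast
      have "ksub V (\<Union>\<C>)"
        unfolding ksub_def
      proof (intro conjI ballI allI)
        show "\<Union>\<C> \<subseteq> carrier V" using k(1) by (rule Union_least)
        show "\<zero>\<^bsub>V\<^esub> \<in> \<Union>\<C>" using k(2)[OF Z] Z by (rule UnionI[rotated])
        show "x \<oplus>\<^bsub>V\<^esub> y \<in> \<Union>\<C>" if "x \<in> \<Union>\<C>" "y \<in> \<Union>\<C>" for x y
          using that by (elim UnionE) (rule a)
        show "c \<odot>\<^bsub>V\<^esub> x \<in> \<Union>\<C>" if "x \<in> \<Union>\<C>" for c x
          using that by (elim UnionE) (rule UnionI, assumption, rule k(4))
      qed
      moreover have "U \<subseteq> \<Union>\<C>" using A[OF Z] Z by auto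
      moreover have "v \<notin> \<Union>\<C>" using A by simp
      ultimately show ?thesis by simp
    qed
  qed (use U v in auto)
  then obtain M where MA: "M \<in> ?A" and max': "\<forall>X\<in>?A. M \<subseteq> X \<longrightarrow> X = M" by (rule bexE)
  have M: "ksub V M" "U \<subseteq> M" "v \<notin> M" using MA by auto
  have max: "X = M" if "ksub V X" "v \<notin> X" "M \<subseteq> X" for X
    using max'[rule_format, of X] that M(2) by auto
  have Mc: "x \<in> carrier V" if "x \<in> M" for x using M that by (auto simp: ksub_def)
  have Ma: "x \<oplus>\<^bsub>V\<^esub> y \<in> M" if "x \<in> M" "y \<in> M" for x y using M that by (auto simp: ksub_def)
  have Ms: "c \<odot>\<^bsub>V\<^esub> x \<in> M" if "x \<in> M" for x c using M that by (auto simp: ksub_def)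
  have M0: "\<zero>\<^bsub>V\<^esub> \<in> M" using M by (auto simp: ksub_def)
  \<comment> \<open>M together with v is everything. For w outside M, the larger subspace M + k w
    must contain v by maximality, and v = m + c w can be solved for w.\<close>
  have ex: "\<exists>c. \<exists>m\<in>M. w = m \<oplus>\<^bsub>V\<^esub> c \<odot>\<^bsub>V\<^esub> v" if w: "w \<in> carrier V" for w
  proof (cases "w \<in> M")
    case True
    then show ?thesis using w v V by (intro exI[of _ 0] bexI[of _ w]) auto
  next
    case False
    let ?X = "{m \<oplus>\<^bsub>V\<^esub> c \<odot>\<^bsub>V\<^esub> w |m c. m \<in> M}"
    have "ksub V ?X"
      unfolding ksub_def
    proof (intro conjI ballI allI)
      show "\<zero>\<^bsub>V\<^esub> \<in> ?X" using M0 w V by (auto intro!: exI[of _ "\<zero>\<^bsub>V\<^esub>"] exI[of _ 0])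
      show "x \<oplus>\<^bsub>V\<^esub> y \<in> ?X" if "x \<in> ?X" "y \<in> ?X" for x y
      proof -
        obtain m c m' c' where "x = m \<oplus>\<^bsub>V\<^esub> c \<odot>\<^bsub>V\<^esub> w" "y = m' \<oplus>\<^bsub>V\<^esub> c' \<odot>\<^bsub>V\<^esub> w" "m \<in> M" "m' \<in> M"
          using \<open>x \<in> ?X\<close> \<open>y \<in> ?X\<close> by blast
        then show ?thesis using V w Ma[of m m'] Mc
          by (auto intro!: exI[of _ "m \<oplus>\<^bsub>V\<^esub> m'"] exI[of _ "c + c'"] simp: ks_smult_ldistr ks_ac)
      qed
      show "d \<odot>\<^bsub>V\<^esub> x \<in> ?X" if x: "x \<in> ?X" for d x
      proof -
        obtain m c where "x = m \<oplus>\<^bsub>V\<^esub> c \<odot>\<^bsub>V\<^esub> w" "m \<in> M" using x by blast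
        then show ?thesis using V w Ms[of m d] Mc
          by (auto intro!: exI[of _ "d \<odot>\<^bsub>V\<^esub> m"] exI[of _ "d * c"] simp: ks_smult_rdistr ks_smult_assoc)
      qed
    qed (use Mc w V in auto)
    moreover have "M \<subseteq> ?X"
    proof
      fix m assume "m \<in> M"
      then show "m \<in> ?X" using w V Mc by (auto intro!: exI[of _ m] exI[of _ 0])
    qed
    moreover have "w \<in> ?X" using w V M0 by (auto intro!: exI[of _ "\<zero>\<^bsub>V\<^esub>"] exI[of _ 1])
    ultimately have "v \<in> ?X" using max False by blast
    then obtain m c where mc: "v = m \<oplus>\<^bsub>V\<^esub> c \<odot>\<^bsub>V\<^esub> w" "m \<in> M" by blast
    \<comment> \<open>Otherwise v = m would lie in M.\<close>
    have c: "c \<noteq> 0" using mc M(3) Mc w V by (metis ks_0_smult ks_add_0)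
    have "w = (- (1 / c)) \<odot>\<^bsub>V\<^esub> m \<oplus>\<^bsub>V\<^esub> (1 / c) \<odot>\<^bsub>V\<^esub> v"
    proof -
      have "(- (1 / c)) \<odot>\<^bsub>V\<^esub> m \<oplus>\<^bsub>V\<^esub> (1 / c) \<odot>\<^bsub>V\<^esub> v
        = ((- (1 / c)) \<odot>\<^bsub>V\<^esub> m \<oplus>\<^bsub>V\<^esub> (1 / c) \<odot>\<^bsub>V\<^esub> m) \<oplus>\<^bsub>V\<^esub> w"
        using mc Mc w V c by (simp add: ks_smult_rdistr ks_smult_assoc ks_add_assoc)
      also have "(- (1 / c)) \<odot>\<^bsub>V\<^esub> m \<oplus>\<^bsub>V\<^esub> (1 / c) \<odot>\<^bsub>V\<^esub> m = \<zero>\<^bsub>V\<^esub>"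
        using Mc[OF mc(2)] V by (simp flip: ks_smult_ldistr)
      finally show ?thesis using w V by simp
    qed
    then show ?thesis using Ms[OF mc(2)] by blast
  qed
  \<comment> \<open>Two different coefficients would put a nonzero multiple of v into M, hence v
    itself.\<close>
  have uniq: "c = d" if "m \<oplus>\<^bsub>V\<^esub> c \<odot>\<^bsub>V\<^esub> v = m' \<oplus>\<^bsub>V\<^esub> d \<odot>\<^bsub>V\<^esub> v" "m \<in> M" "m' \<in> M" for m m' c d
  proof (rule ccontr)
    assume "c \<noteq> d"
    have "(- 1) \<odot>\<^bsub>V\<^esub> m \<oplus>\<^bsub>V\<^esub> (m \<oplus>\<^bsub>V\<^esub> c \<odot>\<^bsub>V\<^esub> v) \<oplus>\<^bsub>V\<^esub> (- d) \<odot>\<^bsub>V\<^esub> v = (c - d) \<odot>\<^bsub>V\<^esub> v"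
    proof -
      have "(- 1) \<odot>\<^bsub>V\<^esub> m \<oplus>\<^bsub>V\<^esub> (m \<oplus>\<^bsub>V\<^esub> c \<odot>\<^bsub>V\<^esub> v) = ((- 1) \<odot>\<^bsub>V\<^esub> m \<oplus>\<^bsub>V\<^esub> m) \<oplus>\<^bsub>V\<^esub> c \<odot>\<^bsub>V\<^esub> v"
        using that Mc V v by (simp add: ks_add_assoc)
      also have "(- 1) \<odot>\<^bsub>V\<^esub> m \<oplus>\<^bsub>V\<^esub> m = \<zero>\<^bsub>V\<^esub>"
        using that Mc V by (simp flip: ks_neg)
      finally show ?thesis using v V by (simp flip: ks_smult_ldistr)
    qed
    moreover have "(- 1) \<odot>\<^bsub>V\<^esub> m \<oplus>\<^bsub>V\<^esub> (m' \<oplus>\<^bsub>V\<^esub> d \<odot>\<^bsub>V\<^esub> v) \<oplus>\<^bsub>V\<^esub> (- d) \<odot>\<^bsub>V\<^esub> v \<in> M"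
    proof -
      have "(m' \<oplus>\<^bsub>V\<^esub> d \<odot>\<^bsub>V\<^esub> v) \<oplus>\<^bsub>V\<^esub> (- d) \<odot>\<^bsub>V\<^esub> v = m' \<oplus>\<^bsub>V\<^esub> (d \<odot>\<^bsub>V\<^esub> v \<oplus>\<^bsub>V\<^esub> (- d) \<odot>\<^bsub>V\<^esub> v)"
        using that Mc V v by (simp add: ks_add_assoc)
      also have "d \<odot>\<^bsub>V\<^esub> v \<oplus>\<^bsub>V\<^esub> (- d) \<odot>\<^bsub>V\<^esub> v = \<zero>\<^bsub>V\<^esub>" using v V by (simp flip: ks_smult_ldistr)
      finally show ?thesis using that Mc V v Ma Ms by (simp add: ks_add_assoc)
    qed
    ultimately have "(c - d) \<odot>\<^bsub>V\<^esub> v \<in> M" using that(1) by simp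
    then have "(1 / (c - d)) \<odot>\<^bsub>V\<^esub> ((c - d) \<odot>\<^bsub>V\<^esub> v) \<in> M" by (rule Ms)
    then show False using v V \<open>c \<noteq> d\<close> M(3) by (simp add: ks_smult_assoc)
  qed
  define u where "u w = (THE c. \<exists>m\<in>M. w = m \<oplus>\<^bsub>V\<^esub> c \<odot>\<^bsub>V\<^esub> v)" for w
  have uI: "u (m \<oplus>\<^bsub>V\<^esub> c \<odot>\<^bsub>V\<^esub> v) = c" if "m \<in> M" for m c
    unfolding u_def using that uniq by (intro the_equality) blast+
  show thesis
  proof (rule that)
    show "functional V u"
    proof (rule functionalI)
      show "u (x \<oplus>\<^bsub>V\<^esub> y) = u x + u y" if "x \<in> carrier V" "y \<in> carrier V" for x y
      proof -
        obtain m c m' c' where e: "x = m \<oplus>\<^bsub>V\<^esub> c \<odot>\<^bsub>V\<^esub> v" "y = m' \<oplus>\<^bsub>V\<^esub> c' \<odot>\<^bsub>V\<^esub> v" "m \<in> M" "m' \<in> M"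
          using ex \<open>x \<in> carrier V\<close> \<open>y \<in> carrier V\<close> by metis
        have "x \<oplus>\<^bsub>V\<^esub> y = (m \<oplus>\<^bsub>V\<^esub> m') \<oplus>\<^bsub>V\<^esub> (c + c') \<odot>\<^bsub>V\<^esub> v"
          using e V v Mc by (simp add: ks_smult_ldistr ks_ac)
        then show ?thesis using e uI Ma by simp
      qed
      show "u (d \<odot>\<^bsub>V\<^esub> x) = d * u x" if "x \<in> carrier V" for d x
      proof -
        obtain m c where e: "x = m \<oplus>\<^bsub>V\<^esub> c \<odot>\<^bsub>V\<^esub> v" "m \<in> M"
          using ex \<open>x \<in> carrier V\<close> by metis
        have "d \<odot>\<^bsub>V\<^esub> x = d \<odot>\<^bsub>V\<^esub> m \<oplus>\<^bsub>V\<^esub> (d * c) \<odot>\<^bsub>V\<^esub> v"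
          using e V v Mc by (simp add: ks_smult_rdistr ks_smult_assoc)
        then show ?thesis using e uI Ms by simp
      qed
    qed
    show "u x = 0" if "x \<in> U" for x
      using uI[of x 0] M that Mc[of x] V v by auto
    show "u v = 1"
      using uI[OF M0, of 1] V v by simp
  qed
qed

section \<open>Independent families and shortest expressions of a tensor\<close>

lemma ksub_combinations:
  assumes V: "kspace V" and I: "finite I" "\<And>i. i \<in> I \<Longrightarrow> e i \<in> carrier V"
  shows "ksub V {\<Oplus>\<^bsub>V\<^esub>i\<in>I. c i \<odot>\<^bsub>V\<^esub> e i |c. True}" (is "ksub V ?U")
  unfolding ksub_def
proof (intro conjI ballI allI)
  have cl: "(\<Oplus>\<^bsub>V\<^esub>i\<in>I. c i \<odot>\<^bsub>V\<^esub> e i) \<in> carrier V" for c using V I by (intro ks_finsum_closed) simp_all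
  then show "?U \<subseteq> carrier V" by auto
  have "\<zero>\<^bsub>V\<^esub> = (\<Oplus>\<^bsub>V\<^esub>i\<in>I. 0 \<odot>\<^bsub>V\<^esub> e i)" using V I by (intro ks_finsum_zero[symmetric]) simp_all
  then show "\<zero>\<^bsub>V\<^esub> \<in> ?U" by (intro CollectI exI[of _ "\<lambda>_. 0"]) simp
  show "x \<oplus>\<^bsub>V\<^esub> y \<in> ?U" if x: "x \<in> ?U" and y: "y \<in> ?U" for x y
  proof -
    obtain c where c: "x = (\<Oplus>\<^bsub>V\<^esub>i\<in>I. c i \<odot>\<^bsub>V\<^esub> e i)" using x by (elim CollectE exE conjE)
    obtain d where d: "y = (\<Oplus>\<^bsub>V\<^esub>i\<in>I. d i \<odot>\<^bsub>V\<^esub> e i)" using y by (elim CollectE exE conjE)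
    have "x \<oplus>\<^bsub>V\<^esub> y = (\<Oplus>\<^bsub>V\<^esub>i\<in>I. c i \<odot>\<^bsub>V\<^esub> e i \<oplus>\<^bsub>V\<^esub> d i \<odot>\<^bsub>V\<^esub> e i)"
      unfolding c d by (rule ks_finsum_add[OF V, symmetric]) (use V I in simp_all)
    also have "\<dots> = (\<Oplus>\<^bsub>V\<^esub>i\<in>I. (c i + d i) \<odot>\<^bsub>V\<^esub> e i)"
      by (rule ks_finsum_cong[OF V refl]) (use V I in \<open>simp_all add: ks_smult_ldistr\<close>)
    finally show ?thesis by (intro CollectI exI[of _ "\<lambda>i. c i + d i"]) simp
  qed
  show "d \<odot>\<^bsub>V\<^esub> x \<in> ?U" if x: "x \<in> ?U" for d x
  proof -
    obtain c where c: "x = (\<Oplus>\<^bsub>V\<^esub>i\<in>I. c i \<odot>\<^bsub>V\<^esub> e i)" using x by (elim CollectE exE conjE)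
    have "d \<odot>\<^bsub>V\<^esub> x = (\<Oplus>\<^bsub>V\<^esub>i\<in>I. d \<odot>\<^bsub>V\<^esub> (c i \<odot>\<^bsub>V\<^esub> e i))"
      unfolding c by (rule ks_finsum_smult[OF V]) (use V I in simp_all)
    also have "\<dots> = (\<Oplus>\<^bsub>V\<^esub>i\<in>I. (d * c i) \<odot>\<^bsub>V\<^esub> e i)"
      by (rule ks_finsum_cong[OF V refl]) (use V I in \<open>simp_all add: ks_smult_assoc\<close>)
    finally show ?thesis by (intro CollectI exI[of _ "\<lambda>i. d * c i"]) simp
  qed
qed

definition indep :: "('k::field, 'v, 'c) module_scheme \<Rightarrow> 'i set \<Rightarrow> ('i \<Rightarrow> 'v) \<Rightarrow> bool" where
  "indep V I v \<longleftrightarrow> (\<forall>c. (\<Oplus>\<^bsub>V\<^esub>i\<in>I. c i \<odot>\<^bsub>V\<^esub> v i) = \<zero>\<^bsub>V\<^esub> \<longrightarrow> (\<forall>i\<in>I. c i = 0))"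

text \<open>Independence keeps each \<open>v i\<close> outside the span of the remaining members, so
  \<open>functional_extension\<close> gives a functional that is 1 there and kills that span. The
  dimension of \<open>V\<close> is arbitrary.\<close>

lemma indep_dual:
  assumes V: "kspace V" and I: "finite I" "\<And>i. i \<in> I \<Longrightarrow> v i \<in> carrier V" and "indep V I v"
  obtains f where "\<And>i. i \<in> I \<Longrightarrow> functional V (f i)"
    "\<And>i j. i \<in> I \<Longrightarrow> j \<in> I \<Longrightarrow> f i (v j) = (if i = j then 1 else 0)"
proof -
  have "\<exists>f. functional V f \<and> (\<forall>j\<in>I. f (v j) = (if i = j then 1 else 0))" if i: "i \<in> I" for i
  proof -
    let ?J = "I - {i}"
    let ?U = "{\<Oplus>\<^bsub>V\<^esub>j\<in>?J. c j \<odot>\<^bsub>V\<^esub> v j |c. True}"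
    have "ksub V ?U" by (rule ksub_combinations[OF V]) (use I in auto)
    moreover have "v i \<notin> ?U"
    proof
      assume "v i \<in> ?U"
      then obtain c where c: "v i = (\<Oplus>\<^bsub>V\<^esub>j\<in>?J. c j \<odot>\<^bsub>V\<^esub> v j)" by blast
      \<comment> \<open>The coefficient -1 at i turns v_i = \<Sum> c_j v_j into a linear relation
        among all members of the family.\<close>
      define d where "d = c(i := - 1)"
      have "(\<Oplus>\<^bsub>V\<^esub>j\<in>insert i ?J. d j \<odot>\<^bsub>V\<^esub> v j) = d i \<odot>\<^bsub>V\<^esub> v i \<oplus>\<^bsub>V\<^esub> (\<Oplus>\<^bsub>V\<^esub>j\<in>?J. d j \<odot>\<^bsub>V\<^esub> v j)"
        using V I i by (intro ks_finsum_insert) auto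
      also have "(\<Oplus>\<^bsub>V\<^esub>j\<in>?J. d j \<odot>\<^bsub>V\<^esub> v j) = v i"
        unfolding c using V I by (intro ks_finsum_cong) (auto simp: d_def)
      also have "d i \<odot>\<^bsub>V\<^esub> v i \<oplus>\<^bsub>V\<^esub> v i = \<zero>\<^bsub>V\<^esub>"
        using V I i by (simp add: d_def flip: ks_neg)
      also have "insert i ?J = I" using i by auto
      finally have "d i = 0" using \<open>indep V I v\<close> i unfolding indep_def by blast
      then show False by (simp add: d_def)
    qed
    ultimately obtain u where u: "functional V u" "\<And>x. x \<in> ?U \<Longrightarrow> u x = 0" "u (v i) = 1"
      using functional_extension[OF V _ I(2)[OF i]] by blast
    have "u (v j) = 0" if j: "j \<in> I" "j \<noteq> i" for j
    proof (rule u(2))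
      have "v j = (\<Oplus>\<^bsub>V\<^esub>k\<in>?J. (if k = j then 1 else 0) \<odot>\<^bsub>V\<^esub> v k)"
        using V I j by (subst ks_finsum_delta[of V _ j]) auto
      then show "v j \<in> ?U" by (auto intro!: exI[of _ "\<lambda>k. if k = j then 1 else 0"])
    qed
    then show ?thesis using u by (intro exI[of _ u]) auto
  qed
  then obtain f where "\<forall>i\<in>I. functional V (f i) \<and> (\<forall>j\<in>I. f i (v j) = (if i = j then 1 else 0))" by metis
  then show thesis by (intro that[of f]) auto
qed

text \<open>A dependency expresses one v_j as \<Sum> d_i v_i; substituting it and moving d_i to the
  right factor replaces w_i by w_i + d_i w_j and saves one term. A general bilinear
  \<open>\<beta>\<close> allows the use on either factor of a tensor product.\<close>

lemma dependent_reduce: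
  assumes V: "kspace V" and W: "kspace W" and N: "kspace N" and \<beta>: "bilinear V W N \<beta>"
    and I: "finite I" "\<And>i. i \<in> I \<Longrightarrow> v i \<in> carrier V" "\<And>i. i \<in> I \<Longrightarrow> w i \<in> carrier W"
    and dep: "\<not> indep V I v"
  obtains j w' where "j \<in> I" "\<And>i. i \<in> I - {j} \<Longrightarrow> w' i \<in> carrier W"
    "(\<Oplus>\<^bsub>N\<^esub>i\<in>I. \<beta> (v i) (w i)) = (\<Oplus>\<^bsub>N\<^esub>i\<in>I - {j}. \<beta> (v i) (w' i))"
proof -
  obtain c j where c: "(\<Oplus>\<^bsub>V\<^esub>i\<in>I. c i \<odot>\<^bsub>V\<^esub> v i) = \<zero>\<^bsub>V\<^esub>" and j: "j \<in> I" "c j \<noteq> 0"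
    using dep by (auto simp: indep_def)
  let ?J = "I - {j}"
  define d where "d i = - (c i / c j)" for i
  have ins: "insert j ?J = I" using j by auto
  have J: "finite ?J" "j \<notin> ?J" using I by auto
  note D = balancedD[OF bilinear_balanced[OF \<beta>]]
  have vj: "v j = (\<Oplus>\<^bsub>V\<^esub>i\<in>?J. d i \<odot>\<^bsub>V\<^esub> v i)"
  proof -
    let ?s = "\<Oplus>\<^bsub>V\<^esub>i\<in>?J. (c i / c j) \<odot>\<^bsub>V\<^esub> v i"
    have "(1 / c j) \<odot>\<^bsub>V\<^esub> (\<Oplus>\<^bsub>V\<^esub>i\<in>I. c i \<odot>\<^bsub>V\<^esub> v i) = (\<Oplus>\<^bsub>V\<^esub>i\<in>insert j ?J. (c i / c j) \<odot>\<^bsub>V\<^esub> v i)"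
      unfolding ins using I V by (subst ks_finsum_smult) (auto simp: ks_smult_assoc intro!: ks_finsum_cong)
    also have "\<dots> = v j \<oplus>\<^bsub>V\<^esub> ?s"
      using I V J j by (subst ks_finsum_insert) auto
    finally have 0: "v j \<oplus>\<^bsub>V\<^esub> ?s = \<zero>\<^bsub>V\<^esub>" using c V by simp
    have s: "?s \<in> carrier V" using I V by (intro ks_finsum_closed ks_smult_closed) auto
    have "(\<Oplus>\<^bsub>V\<^esub>i\<in>?J. d i \<odot>\<^bsub>V\<^esub> v i) = (- 1) \<odot>\<^bsub>V\<^esub> ?s"
      using I V by (subst ks_finsum_smult) (auto simp: ks_smult_assoc d_def intro!: ks_finsum_cong)
    also have "\<dots> = \<ominus>\<^bsub>V\<^esub> ?s" using s V by (simp add: ks_neg)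
    also have "\<dots> = (v j \<oplus>\<^bsub>V\<^esub> ?s) \<oplus>\<^bsub>V\<^esub> \<ominus>\<^bsub>V\<^esub> ?s" using 0 s V by simp
    also have "\<dots> = v j" using s V I(2)[OF j(1)] by (simp add: ks_add_assoc)
    finally show ?thesis by simp
  qed
  define w' where "w' i = w i \<oplus>\<^bsub>W\<^esub> d i \<odot>\<^bsub>W\<^esub> w j" for i
  have "(\<Oplus>\<^bsub>N\<^esub>i\<in>insert j ?J. \<beta> (v i) (w i)) = \<beta> (v j) (w j) \<oplus>\<^bsub>N\<^esub> (\<Oplus>\<^bsub>N\<^esub>i\<in>?J. \<beta> (v i) (w i))"
    using I N J j D(1) by (subst ks_finsum_insert) auto
  also have "\<beta> (v j) (w j) = (\<Oplus>\<^bsub>N\<^esub>i\<in>?J. \<beta> (d i \<odot>\<^bsub>V\<^esub> v i) (w j))"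
    unfolding vj using add_hom_finsum[OF V N, of "\<lambda>x. \<beta> x (w j)" ?J "\<lambda>i. d i \<odot>\<^bsub>V\<^esub> v i"] I j V D
    by (simp add: add_hom_def)
  also have "\<dots> \<oplus>\<^bsub>N\<^esub> (\<Oplus>\<^bsub>N\<^esub>i\<in>?J. \<beta> (v i) (w i)) = (\<Oplus>\<^bsub>N\<^esub>i\<in>?J. \<beta> (d i \<odot>\<^bsub>V\<^esub> v i) (w j) \<oplus>\<^bsub>N\<^esub> \<beta> (v i) (w i))"
    using I N V j D(1) by (subst ks_finsum_add) auto
  also have "\<dots> = (\<Oplus>\<^bsub>N\<^esub>i\<in>?J. \<beta> (v i) (w' i))"
    using I N V W j D(1,3,4) by (intro ks_finsum_cong) (auto simp: w'_def ks_add_comm)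
  finally show thesis
    using I W j by (intro that[of j w']) (auto simp: insert_absorb w'_def)
qed

lemma tensor_presentation:
  assumes V: "kspace V" and W: "kspace W" and z: "z \<in> carrier (tensor V W)"
  shows "\<exists>I v w. finite (I :: nat set) \<and> (\<forall>i\<in>I. v i \<in> carrier V \<and> w i \<in> carrier W) \<and>
    z = (\<Oplus>\<^bsub>tensor V W\<^esub>i\<in>I. tens V W (v i) (w i))"
  using z
proof (induction rule: tensor_induct[OF V W, consumes 1])
  case (1 v w)
  then show ?case using V W
    by (intro exI[of _ "{0}"] exI[of _ "\<lambda>_. v"] exI[of _ "\<lambda>_. w"]) (simp add: ks_finsum_insert)
next
  case (2 x y)
  obtain I v w where x: "finite (I :: nat set)" "\<forall>i\<in>I. v i \<in> carrier V \<and> w i \<in> carrier W"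
    "x = (\<Oplus>\<^bsub>tensor V W\<^esub>i\<in>I. tens V W (v i) (w i))" using 2(3) by blast
  obtain J v' w' where y: "finite (J :: nat set)" "\<forall>i\<in>J. v' i \<in> carrier V \<and> w' i \<in> carrier W"
    "y = (\<Oplus>\<^bsub>tensor V W\<^esub>i\<in>J. tens V W (v' i) (w' i))" using 2(4) by blast
  \<comment> \<open>Even and odd indices realize the disjoint union of two finite index sets inside
    the natural numbers.\<close>
  let ?I = "(\<lambda>i. 2 * i) ` I" and ?J = "(\<lambda>i. Suc (2 * i)) ` J"
  let ?v = "\<lambda>i. if even i then v (i div 2) else v' (i div 2)"
  let ?w = "\<lambda>i. if even i then w (i div 2) else w' (i div 2)"
  have "(\<Oplus>\<^bsub>tensor V W\<^esub>i\<in>?I \<union> ?J. tens V W (?v i) (?w i)) =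
      (\<Oplus>\<^bsub>tensor V W\<^esub>i\<in>?I. tens V W (?v i) (?w i)) \<oplus>\<^bsub>tensor V W\<^esub> (\<Oplus>\<^bsub>tensor V W\<^esub>i\<in>?J. tens V W (?v i) (?w i))"
    using x y V W by (intro ks_finsum_Un_disjoint) (auto, presburger)
  also have "(\<Oplus>\<^bsub>tensor V W\<^esub>i\<in>?I. tens V W (?v i) (?w i)) = x"
    unfolding x(3) using x V W by (subst ks_finsum_reindex) (auto simp: inj_on_def intro!: ks_finsum_cong)
  also have "(\<Oplus>\<^bsub>tensor V W\<^esub>i\<in>?J. tens V W (?v i) (?w i)) = y"
    unfolding y(3) using y V W by (subst ks_finsum_reindex) (auto simp: inj_on_def intro!: ks_finsum_cong)
  finally show ?case
    using x y by (intro exI[of _ "?I \<union> ?J"] exI[of _ ?v] exI[of _ ?w]) auto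
qed

text \<open>With the least possible number of terms, a dependency on either side would allow a
  shorter expression. Independence on both sides is what makes the later extraction of a subcomodule
  work.\<close>

lemma tensor_minimal_presentation:
  assumes V: "kspace V" and W: "kspace W" and z: "z \<in> carrier (tensor V W)"
  obtains I v w where "finite (I :: nat set)" "\<And>i. i \<in> I \<Longrightarrow> v i \<in> carrier V" "\<And>i. i \<in> I \<Longrightarrow> w i \<in> carrier W"
    "z = (\<Oplus>\<^bsub>tensor V W\<^esub>i\<in>I. tens V W (v i) (w i))" "indep V I v" "indep W I w"
proof -
  define P where "P n \<longleftrightarrow> (\<exists>I v w. finite (I :: nat set) \<and> card I = n \<and> (\<forall>i\<in>I. v i \<in> carrier V \<and> w i \<in> carrier W) \<and>
    z = (\<Oplus>\<^bsub>tensor V W\<^esub>i\<in>I. tens V W (v i) (w i)))" for n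
  obtain I v w where "finite (I :: nat set)" "\<forall>i\<in>I. v i \<in> carrier V \<and> w i \<in> carrier W"
    "z = (\<Oplus>\<^bsub>tensor V W\<^esub>i\<in>I. tens V W (v i) (w i))"
    using tensor_presentation[OF assms] by (elim exE conjE) (rule that)
  then have "P (card I)" unfolding P_def by (intro exI[of _ I] exI[of _ v] exI[of _ w] conjI refl)
  then have "\<exists>n. P n" by (rule exI)
  then have "P (LEAST n. P n)" by (rule LeastI_ex)
  then obtain I v w where I: "finite (I :: nat set)" "card I = (LEAST n. P n)"
    "\<And>i. i \<in> I \<Longrightarrow> v i \<in> carrier V" "\<And>i. i \<in> I \<Longrightarrow> w i \<in> carrier W"
    "z = (\<Oplus>\<^bsub>tensor V W\<^esub>i\<in>I. tens V W (v i) (w i))"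
    unfolding P_def[of "LEAST n. P n"] by (elim exE conjE) (rule that; simp)
  have min: "\<not> P n" if "n < card I" for n using that I(2) not_less_Least[of n P] by simp
  have lt: "card (I - {j}) < card I" if "j \<in> I" for j by (rule card_Diff1_less[OF I(1) that])
  have "indep V I v"
  proof (rule ccontr)
    assume *: "\<not> indep V I v"
    obtain j w' where j: "j \<in> I" "\<And>i. i \<in> I - {j} \<Longrightarrow> w' i \<in> carrier W"
      "z = (\<Oplus>\<^bsub>tensor V W\<^esub>i\<in>I - {j}. tens V W (v i) (w' i))"
      by (rule dependent_reduce[where v = v and w = w, OF V W kspace_tensor[OF V W] tens_bilinear[OF V W] I(1) _ _ *])
        (erule I(3), erule I(4), rule that, assumption, assumption, simp only: I(5))
    then have "P (card (I - {j}))"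
      unfolding P_def using I by (intro exI[of _ "I - {j}"] exI[of _ v] exI[of _ w']) auto
    then show False using min lt[OF j(1)] by blast
  qed
  moreover have "indep W I w"
  proof (rule ccontr)
    assume *: "\<not> indep W I w"
    \<comment> \<open>The tensor with its arguments exchanged, so that the same reduction now
      removes a dependency on the right.\<close>
    have b: "bilinear W V (tensor V W) (\<lambda>w v. tens V W v w)"
      using V W by (intro bilinearI) (simp_all add: tens_add_left tens_add_right tens_smult_left tens_smult_right)
    obtain j v' where j: "j \<in> I" "\<And>i. i \<in> I - {j} \<Longrightarrow> v' i \<in> carrier V"
      "z = (\<Oplus>\<^bsub>tensor V W\<^esub>i\<in>I - {j}. tens V W (v' i) (w i))"
      by (rule dependent_reduce[where v = w and w = v, OF W V kspace_tensor[OF V W] b I(1) _ _ *])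
        (erule I(4), erule I(3), rule that, assumption, assumption, simp only: I(5))
    then have "P (card (I - {j}))"
      unfolding P_def using I by (intro exI[of _ "I - {j}"] exI[of _ v'] exI[of _ w]) auto
    then show False using min lt[OF j(1)] by blast
  qed
  ultimately show thesis using I by (intro that) auto
qed

lemma lin_hom_ident [simp]: "lin_hom M M (\<lambda>x. x)"
  by (simp add: lin_hom_def add_hom_def)

text \<open>The contraction id \<otimes> u. For u the counit it expresses the counit axiom of a
  comodule.\<close>

definition slice_right ::
  "('k::field, 'v, 'c) module_scheme \<Rightarrow> ('k, 'w, 'd) module_scheme \<Rightarrow> ('w \<Rightarrow> 'k) \<Rightarrow> ('k, 'v, 'w) tensor \<Rightarrow> 'v" where
  "slice_right V W u = tensor_ext V W V (\<lambda>v w. u w \<odot>\<^bsub>V\<^esub> v)"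

context
  fixes V :: "('k::field, 'v, 'c) module_scheme" and W :: "('k, 'w, 'd) module_scheme" and u
  assumes V: "kspace V" and W: "kspace W" and u: "functional W u"
begin

lemma slice_right_bilinear: "bilinear V W V (\<lambda>v w. u w \<odot>\<^bsub>V\<^esub> v)"
  using V W functionalD[OF u]
  by (intro bilinearI) (simp_all add: ks_smult_ldistr ks_smult_rdistr ks_smult_assoc mult.commute)

lemma slice_right_tens: "v \<in> carrier V \<Longrightarrow> w \<in> carrier W \<Longrightarrow> slice_right V W u (tens V W v w) = u w \<odot>\<^bsub>V\<^esub> v"
  unfolding slice_right_def by (rule tensor_ext_tens[OF V W V bilinear_balanced[OF slice_right_bilinear]])

lemma slice_right_lin_hom: "lin_hom (tensor V W) V (slice_right V W u)"
  unfolding slice_right_def by (rule tensor_ext_lin_hom[OF V W V slice_right_bilinear])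

end

lemma slice_right_tensor_map:
  assumes "kspace V" "kspace W" "kspace V2" "lin_hom V V2 f" "functional W u" "x \<in> carrier (tensor V W)"
  shows "slice_right V2 W u (tensor_map V W V2 W f (\<lambda>x. x) x) = f (slice_right V W u x)"
  by (rule tensor_hom_eqI[OF assms(1,2) _ _ _ assms(6)],
      rule add_hom_comp[OF tensor_map_add_hom[OF assms(1,2,3,2,4) lin_hom_ident] lin_homD(4)[OF slice_right_lin_hom[OF assms(3,2,5)]]],
      rule add_hom_comp[OF lin_homD(4)[OF slice_right_lin_hom[OF assms(1,2,5)]] lin_homD(4)[OF assms(4)]])
     (use assms lin_homD[OF assms(4)] in
         \<open>simp add: tensor_map_tens slice_right_tens\<close>)

section \<open>Frames and dual spaces\<close>

lemma ksub_finsum: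
  assumes "kspace V" "ksub V U" "\<And>i. i \<in> A \<Longrightarrow> f i \<in> U"
  shows "finsum V f A \<in> U"
  using assms(3)
proof (induction A rule: infinite_finite_induct)
  case (insert a A)
  then have "f i \<in> carrier V" if "i \<in> insert a A" for i using assms(2) that by (auto simp: ksub_def)
  then show ?case using insert assms(1,2) by (simp add: ks_finsum_insert ksub_def)
qed (use assms in \<open>auto simp: ks_finsum_infinite ksub_def\<close>)

definition spans :: "('k::field, 'v, 'c) module_scheme \<Rightarrow> 'i set \<Rightarrow> ('i \<Rightarrow> 'v) \<Rightarrow> bool" where
  "spans V I e \<longleftrightarrow> finite I \<and> (\<forall>i\<in>I. e i \<in> carrier V) \<and>
     (\<forall>v\<in>carrier V. \<exists>c. v = (\<Oplus>\<^bsub>V\<^esub>i\<in>I. c i \<odot>\<^bsub>V\<^esub> e i))"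

lemma spansE:
  assumes "spans V I e" "v \<in> carrier V"
  obtains c where "v = (\<Oplus>\<^bsub>V\<^esub>i\<in>I. c i \<odot>\<^bsub>V\<^esub> e i)"
  using assms unfolding spans_def by (elim conjE) (drule bspec, assumption, elim exE, rule that)

lemma spans_fin_dim:
  assumes V: "kspace V" and s: "spans V I e"
  shows "vectorspace class_ring V" "vectorspace.fin_dim class_ring V"
proof -
  show vs: "vectorspace class_ring V"
    using V class_field by (simp add: vectorspace_def kspace_def)
  interpret vectorspace class_ring V by (rule vs)
  have sub: "e ` I \<subseteq> carrier V" using s by (auto simp: spans_def)
  have k: "ksub V (span (e ` I))" by (rule ksub_span[OF V sub])
  have "v \<in> span (e ` I)" if v: "v \<in> carrier V" for v
  proof -
    obtain c where c: "v = (\<Oplus>\<^bsub>V\<^esub>i\<in>I. c i \<odot>\<^bsub>V\<^esub> e i)" using spansE[OF s v] .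
    have "e i \<in> span (e ` I)" if "i \<in> I" for i
      using span_superset[OF V sub] that by (meson imageI subsetD)
    then show ?thesis unfolding c using k by (intro ksub_finsum[OF V k]) (simp add: ksub_def)
  qed
  then have "span (e ` I) = carrier V" using k by (auto simp: ksub_def)
  then show fin_dim unfolding fin_dim_def using s sub by (intro exI[of _ "e ` I"]) (simp add: spans_def)
qed

text \<open>Reduces identities of linear maps, in particular the comodule axioms, to a spanning
  family.\<close>

lemma spans_hom_eqI:
  assumes V: "kspace V" and N: "kspace N" and s: "spans V I e" and f: "lin_hom V N f" and g: "lin_hom V N g"
    and eq: "\<And>i. i \<in> I \<Longrightarrow> f (e i) = g (e i)" and v: "v \<in> carrier V"
  shows "f v = g v"
proof -
  obtain c where c: "v = (\<Oplus>\<^bsub>V\<^esub>i\<in>I. c i \<odot>\<^bsub>V\<^esub> e i)" using spansE[OF s v] .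
  have e: "e i \<in> carrier V" if "i \<in> I" for i using s that by (simp add: spans_def)
  show ?thesis
    unfolding c using e V N lin_homD[OF f] lin_homD[OF g] eq
    by (simp add: add_hom_finsum[OF V N lin_homD(4)[OF f]] add_hom_finsum[OF V N lin_homD(4)[OF g]])
       (intro ks_finsum_cong; simp)
qed

lemma frame_spans:
  assumes "frame V I e f"
  shows "spans V I e"
  unfolding spans_def
proof (intro conjI ballI)
  fix v assume "v \<in> carrier V"
  then have "v = (\<Oplus>\<^bsub>V\<^esub>i\<in>I. f i v \<odot>\<^bsub>V\<^esub> e i)" using assms by (simp add: frame_def)
  then show "\<exists>c. v = (\<Oplus>\<^bsub>V\<^esub>i\<in>I. c i \<odot>\<^bsub>V\<^esub> e i)" by (rule exI[of _ "\<lambda>i. f i v"])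
qed (use assms in \<open>auto simp: frame_def\<close>)

lemma frameD:
  assumes "frame V I e f"
  shows "finite I" "i \<in> I \<Longrightarrow> e i \<in> carrier V" "i \<in> I \<Longrightarrow> functional V (f i)"
    "i \<in> I \<Longrightarrow> j \<in> I \<Longrightarrow> f i (e j) = (if i = j then 1 else 0)"
    "v \<in> carrier V \<Longrightarrow> (\<Oplus>\<^bsub>V\<^esub>i\<in>I. f i v \<odot>\<^bsub>V\<^esub> e i) = v"
  using assms by (auto simp: frame_def)

lemma dual_space_simps [simp]:
  "carrier (dual_space V) = {u \<in> extensional (carrier V). functional V u}"
  "\<zero>\<^bsub>dual_space V\<^esub> = (\<lambda>v\<in>carrier V. 0)"
  "u \<oplus>\<^bsub>dual_space V\<^esub> t = (\<lambda>v\<in>carrier V. u v + t v)"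
  "c \<odot>\<^bsub>dual_space V\<^esub> u = (\<lambda>v\<in>carrier V. c * u v)"
  by (auto simp: dual_space_def mk_space_def lin_hom_iff)

lemma functional_restrict:
  assumes "kspace V"
  shows "functional V (restrict u (carrier V)) \<longleftrightarrow> functional V u"
  using assms by (simp add: lin_hom_def add_hom_def)

lemma functional_add: "kspace V \<Longrightarrow> functional V u \<Longrightarrow> functional V t \<Longrightarrow> functional V (\<lambda>v. u v + t v)"
  by (simp add: lin_hom_def add_hom_def algebra_simps)

lemma functional_smult: "functional V u \<Longrightarrow> functional V (\<lambda>v. c * u v)"
  by (simp add: lin_hom_def add_hom_def algebra_simps)

lemma functional_zero: "functional V (\<lambda>v. 0)"
  by (simp add: lin_hom_def add_hom_def)

lemma kspace_dual_space [simp]: "kspace V \<Longrightarrow> kspace (dual_space V)"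
  by (rule kspaceI)
     (auto simp: functional_restrict functional_add functional_smult functional_zero algebra_simps
       intro!: restrict_ext extensionalityI[of _ "carrier V"])

text \<open>Ties the choices made in \<open>some_basis\<close> and \<open>dual_vec\<close> to
  frames. The \<open>THE\<close> in \<open>dual_vec\<close> is legitimate: a functional with the
  prescribed values exists by \<open>indep_dual\<close>, and it is determined by its values on a
  spanning family.\<close>

lemma frame_some_basis:
  assumes vs: "vectorspace class_ring V" and fd: "vectorspace.fin_dim class_ring V"
  shows "frame V (some_basis V) (\<lambda>b. b) (dual_vec V (some_basis V))"
    and "b \<in> some_basis V \<Longrightarrow> dual_vec V (some_basis V) b \<in> carrier (dual_space V)"
proof -
  interpret vectorspace class_ring V by (rule vs)
  have V: "kspace V" using module_axioms by (simp add: kspace_def)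
  let ?B = "some_basis V"
  have "\<exists>B. finite B \<and> basis B" using finite_basis_exists fd by blast
  then have B: "finite ?B" "basis ?B" unfolding some_basis_def by (metis (mono_tags, lifting) someI_ex)+
  have Bc: "?B \<subseteq> carrier V" "span ?B = carrier V" "lin_indpt ?B" using B(2) by (auto simp: basis_def)
  have sp: "spans V ?B (\<lambda>b. b)"
    unfolding spans_def
  proof (intro conjI ballI)
    fix v assume "v \<in> carrier V"
    then have "v \<in> span ?B" using Bc by simp
    then obtain a where "v = lincomb a ?B"
      using finite_in_span[OF B(1) Bc(1), of v] by auto
    then show "\<exists>c. v = (\<Oplus>\<^bsub>V\<^esub>i\<in>?B. c i \<odot>\<^bsub>V\<^esub> i)" unfolding lincomb_def by (rule exI[of _ a])
  qed (use B(1) Bc in auto)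
  have ind: "indep V ?B (\<lambda>b. b)"
    unfolding indep_def
  proof (intro allI impI ballI)
    fix c b assume c: "(\<Oplus>\<^bsub>V\<^esub>i\<in>?B. c i \<odot>\<^bsub>V\<^esub> i) = \<zero>\<^bsub>V\<^esub>" and b: "b \<in> ?B"
    show "c b = 0"
    proof (rule ccontr)
      assume "c b \<noteq> 0"
      then have "lin_dep ?B"
        unfolding lin_dep_def lincomb_def using B(1) c b
        by (intro exI[of _ ?B] exI[of _ c] exI[of _ b]) simp
      then show False using Bc(3) by simp
    qed
  qed
  obtain f where f: "\<And>b. b \<in> ?B \<Longrightarrow> functional V (f b)"
    "\<And>b b'. b \<in> ?B \<Longrightarrow> b' \<in> ?B \<Longrightarrow> f b b' = (if b = b' then 1 else 0)"
    by (rule indep_dual[OF V B(1) _ ind]) (use Bc in auto)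
  have dv: "dual_vec V ?B b = restrict (f b) (carrier V)" if b: "b \<in> ?B" for b
    unfolding dual_vec_def
  proof (rule the_equality)
    fix u assume u: "u \<in> carrier (dual_space V) \<and> (\<forall>b'\<in>?B. u b' = (if b' = b then 1 else 0))"
    have "u v = f b v" if v: "v \<in> carrier V" for v
      by (rule spans_hom_eqI[OF V kspace_field_space sp _ f(1)[OF b] _ v])
         (use u f(2) b in \<open>auto split: if_splits\<close>)
    then show "u = restrict (f b) (carrier V)"
      using u by (intro extensionalityI[of _ "carrier V"]) auto
  qed (use b f Bc in \<open>auto simp: functional_restrict[OF V]\<close>)
  show d: "b \<in> some_basis V \<Longrightarrow> dual_vec V (some_basis V) b \<in> carrier (dual_space V)" for b
    using f(1) by (simp add: dv functional_restrict[OF V])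
  show "frame V (some_basis V) (\<lambda>b. b) (dual_vec V (some_basis V))"
    unfolding frame_def
  proof (intro conjI ballI)
    fix v assume v: "v \<in> carrier V"
    show "(\<Oplus>\<^bsub>V\<^esub>i\<in>some_basis V. dual_vec V (some_basis V) i v \<odot>\<^bsub>V\<^esub> i) = v"
    proof -
      obtain c where c: "v = (\<Oplus>\<^bsub>V\<^esub>i\<in>?B. c i \<odot>\<^bsub>V\<^esub> i)" using spansE[OF sp v] .
      have "f b v = c b" if b: "b \<in> ?B" for b
      proof -
        have "f b v = (\<Sum>i\<in>?B. f b (c i \<odot>\<^bsub>V\<^esub> i))"
          unfolding c using Bc V by (intro functional_finsum[OF V f(1)[OF b]]) auto
        also have "\<dots> = (\<Sum>i\<in>?B. if i = b then c i else 0)"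
          using Bc functionalD(2)[OF f(1)[OF b]] f(2)[OF b] by (intro sum.cong) auto
        also have "\<dots> = c b" using B(1) b by simp
        finally show ?thesis .
      qed
      then have "(\<Oplus>\<^bsub>V\<^esub>i\<in>?B. dual_vec V ?B i v \<odot>\<^bsub>V\<^esub> i) = (\<Oplus>\<^bsub>V\<^esub>i\<in>?B. c i \<odot>\<^bsub>V\<^esub> i)"
        using v V Bc by (intro ks_finsum_cong) (auto simp: dv)
      then show ?thesis using c by simp
    qed
  next
    fix i j assume "i \<in> ?B" "j \<in> ?B"
    then show "dual_vec V ?B i j = (if i = j then 1 else 0)" using f(2)[of i j] Bc by (auto simp: dv)
  qed (use B(1) Bc d in auto)
qed

section \<open>Differential Hopf algebras\<close>

lemma mk_dalg_simps [simp]: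
  "carrier (mk_dalg M m e d) = carrier M" "\<zero>\<^bsub>mk_dalg M m e d\<^esub> = \<zero>\<^bsub>M\<^esub>"
  "x \<oplus>\<^bsub>mk_dalg M m e d\<^esub> y = x \<oplus>\<^bsub>M\<^esub> y" "c \<odot>\<^bsub>mk_dalg M m e d\<^esub> x = c \<odot>\<^bsub>M\<^esub> x"
  "x \<otimes>\<^bsub>mk_dalg M m e d\<^esub> y = m x y" "\<one>\<^bsub>mk_dalg M m e d\<^esub> = e" "deriv (mk_dalg M m e d) = d"
  by (simp_all add: mk_dalg_def)

context
  fixes A :: "('k::field, 'a, 'c) dalg_scheme" and B :: "('k, 'b, 'd) dalg_scheme"
  assumes A: "kspace A" and B: "kspace B"
    and mA: "bilinear A A A (mult A)" and mB: "bilinear B B B (mult B)"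
begin

lemma tensor_mult_inner:
  assumes "a \<in> carrier A" "b \<in> carrier B"
  shows "bilinear A B (tensor A B) (\<lambda>a' b'. tens A B (a \<otimes>\<^bsub>A\<^esub> a') (b \<otimes>\<^bsub>B\<^esub> b'))"
proof -
  note DA = balancedD[OF bilinear_balanced[OF mA]]
  note DB = balancedD[OF bilinear_balanced[OF mB]]
  have sA: "a \<otimes>\<^bsub>A\<^esub> (c \<odot>\<^bsub>A\<^esub> a') = c \<odot>\<^bsub>A\<^esub> (a \<otimes>\<^bsub>A\<^esub> a')" if "a' \<in> carrier A" for c a'
    using mA assms that DA(4)[of a a' c] by (simp add: bilinear_def)
  have sB: "b \<otimes>\<^bsub>B\<^esub> (c \<odot>\<^bsub>B\<^esub> b') = c \<odot>\<^bsub>B\<^esub> (b \<otimes>\<^bsub>B\<^esub> b')" if "b' \<in> carrier B" for c b'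
    using mB assms that DB(4)[of b b' c] by (simp add: bilinear_def)
  show ?thesis
    using assms A B DA(1,3) DB(1,3)
    by (intro bilinearI) (simp_all add: sA sB tens_add_left tens_add_right tens_smult_left tens_smult_right)
qed

text \<open>The product on a tensor product is a nested extension, inside over the right operand and
  outside over the left one. This bilinearity, for a fixed right operand, is what the outer
  extension requires; it is shown by induction on that operand.\<close>

lemma tensor_mult_outer:
  assumes y: "y \<in> carrier (tensor A B)"
  shows "bilinear A B (tensor A B) (\<lambda>a b. tensor_ext A B (tensor A B)
           (\<lambda>a' b'. tens A B (a \<otimes>\<^bsub>A\<^esub> a') (b \<otimes>\<^bsub>B\<^esub> b')) y)"
proof -
  let ?T = "tensor A B"
  let ?f = "\<lambda>a b. tensor_ext A B ?T (\<lambda>a' b'. tens A B (a \<otimes>\<^bsub>A\<^esub> a') (b \<otimes>\<^bsub>B\<^esub> b'))"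
  note DA = balancedD[OF bilinear_balanced[OF mA]]
  note DB = balancedD[OF bilinear_balanced[OF mB]]
  have T: "kspace ?T" using A B by simp
  note h = tensor_ext_lin_hom[OF A B T tensor_mult_inner]
  note t = tensor_ext_tens[OF A B T bilinear_balanced[OF tensor_mult_inner]]
  have sA: "(c \<odot>\<^bsub>A\<^esub> a) \<otimes>\<^bsub>A\<^esub> a' = c \<odot>\<^bsub>A\<^esub> (a \<otimes>\<^bsub>A\<^esub> a')" if "a \<in> carrier A" "a' \<in> carrier A" for c a a'
    using mA that by (simp add: bilinear_def)
  have sB: "(c \<odot>\<^bsub>B\<^esub> b) \<otimes>\<^bsub>B\<^esub> b' = c \<odot>\<^bsub>B\<^esub> (b \<otimes>\<^bsub>B\<^esub> b')" if "b \<in> carrier B" "b' \<in> carrier B" for c b b'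
    using mB that by (simp add: bilinear_def)
  have 1: "?f (a \<oplus>\<^bsub>A\<^esub> a') b y = ?f a b y \<oplus>\<^bsub>?T\<^esub> ?f a' b y"
    if "a \<in> carrier A" "a' \<in> carrier A" "b \<in> carrier B" for a a' b
    using y by (induction rule: tensor_induct[OF A B, consumes 1])
      (use that A B in \<open>simp_all add: t DA(1,2) DB(1) tens_add_left lin_homD(1,2)[OF h] ks_ac[OF T]\<close>)
  have 2: "?f a (b \<oplus>\<^bsub>B\<^esub> b') y = ?f a b y \<oplus>\<^bsub>?T\<^esub> ?f a b' y"
    if "a \<in> carrier A" "b' \<in> carrier B" "b \<in> carrier B" for a b b'
    using y by (induction rule: tensor_induct[OF A B, consumes 1])
      (use that A B in \<open>simp_all add: t DB(1,2) DA(1) tens_add_right lin_homD(1,2)[OF h] ks_ac[OF T]\<close>)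
  have 3: "?f (c \<odot>\<^bsub>A\<^esub> a) b y = c \<odot>\<^bsub>?T\<^esub> ?f a b y"
    if "a \<in> carrier A" "b \<in> carrier B" for a b c
    using y by (induction rule: tensor_induct[OF A B, consumes 1])
      (use that A B in \<open>simp_all add: t sA DA(1) DB(1) tens_smult_left lin_homD(1,2)[OF h] ks_smult_rdistr[OF T]\<close>)
  have 4: "?f a (c \<odot>\<^bsub>B\<^esub> b) y = c \<odot>\<^bsub>?T\<^esub> ?f a b y"
    if "a \<in> carrier A" "b \<in> carrier B" for a b c
    using y by (induction rule: tensor_induct[OF A B, consumes 1])
      (use that A B in \<open>simp_all add: t sB DA(1) DB(1) tens_smult_right lin_homD(1,2)[OF h] ks_smult_rdistr[OF T]\<close>)
  show ?thesis
    by (rule bilinearI) (simp_all add: 1 2 3 4 y lin_homD(1)[OF h])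
qed

lemma tensor_mult_tens:
  assumes "a \<in> carrier A" "a' \<in> carrier A" "b \<in> carrier B" "b' \<in> carrier B"
  shows "tens A B a b \<otimes>\<^bsub>tensor_dalg A B\<^esub> tens A B a' b' = tens A B (a \<otimes>\<^bsub>A\<^esub> a') (b \<otimes>\<^bsub>B\<^esub> b')"
  using assms A B unfolding tensor_dalg_def mk_dalg_simps
  by (subst tensor_ext_tens[OF A B kspace_tensor[OF A B] bilinear_balanced[OF tensor_mult_outer]];
      (subst tensor_ext_tens[OF A B kspace_tensor[OF A B] bilinear_balanced[OF tensor_mult_inner]])?) simp_all

lemma tensor_mult_hom_left:
  assumes "y \<in> carrier (tensor A B)"
  shows "lin_hom (tensor A B) (tensor A B) (\<lambda>x. x \<otimes>\<^bsub>tensor_dalg A B\<^esub> y)"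
  unfolding tensor_dalg_def mk_dalg_simps
  using tensor_ext_lin_hom[OF A B kspace_tensor[OF A B] tensor_mult_outer[OF assms]] .

lemma tensor_mult_hom_right:
  assumes x: "x \<in> carrier (tensor A B)"
  shows "add_hom (tensor A B) (tensor A B) (\<lambda>y. x \<otimes>\<^bsub>tensor_dalg A B\<^esub> y)"
proof (rule add_homI)
  note h = tensor_mult_hom_left
  show "x \<otimes>\<^bsub>tensor_dalg A B\<^esub> y \<in> carrier (tensor A B)" if "y \<in> carrier (tensor A B)" for y
    using lin_homD(1)[OF h[OF that] x] .
  fix y z assume yz: "y \<in> carrier (tensor A B)" "z \<in> carrier (tensor A B)"
  have T: "kspace (tensor A B)" using A B by simp
  note t = tensor_ext_tens[OF A B T bilinear_balanced[OF tensor_mult_outer]]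
  note i = lin_homD(2)[OF tensor_ext_lin_hom[OF A B T tensor_mult_inner]]
  show "x \<otimes>\<^bsub>tensor_dalg A B\<^esub> (y \<oplus>\<^bsub>tensor A B\<^esub> z) = x \<otimes>\<^bsub>tensor_dalg A B\<^esub> y \<oplus>\<^bsub>tensor A B\<^esub> x \<otimes>\<^bsub>tensor_dalg A B\<^esub> z"
    using x
  proof (induction rule: tensor_induct[OF A B, consumes 1])
    case (1 v w)
    then show ?case
      unfolding tensor_dalg_def mk_dalg_simps using yz T by (simp add: t i)
  next
    case (2 p q)
    then show ?case
      using yz T by (simp add: lin_homD(1,2)[OF h] ks_ac[OF T])
  qed
qed

end

locale dhopf =
  fixes dk :: "'k::field \<Rightarrow> 'k" and H :: "('k, 'a, 'c) hopf_scheme"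
  assumes hopf: "diff_hopf_algebra dk H"
begin

sublocale A: diff_hopf_algebra dk H by (rule hopf)

lemma H: "kspace H"
  unfolding kspace_def by (rule A.module_axioms)

lemma HH: "kspace (tensor H H)"
  using H by simp

lemma mult_smult_right: "x \<in> carrier H \<Longrightarrow> y \<in> carrier H \<Longrightarrow> x \<otimes>\<^bsub>H\<^esub> (c \<odot>\<^bsub>H\<^esub> y) = c \<odot>\<^bsub>H\<^esub> (x \<otimes>\<^bsub>H\<^esub> y)"
  using A.smult_assoc2[of c y x] A.m_comm[of x "c \<odot>\<^bsub>H\<^esub> y"] A.m_comm[of x y] H by simp

lemma mult_bilinear: "bilinear H H H (mult H)"
  using H A.smult_assoc2 mult_smult_right by (intro bilinearI) (simp_all add: A.l_distr A.r_distr)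

lemma comult_hom: "lin_hom H (tensor H H) (comult H)"
  using A.comult_hom by (auto simp: dalg_hom_def module_hom_def lin_hom_def add_hom_def tensor_dalg_def)

lemma comult_mult: "x \<in> carrier H \<Longrightarrow> y \<in> carrier H \<Longrightarrow>
    comult H (x \<otimes>\<^bsub>H\<^esub> y) = comult H x \<otimes>\<^bsub>tensor_dalg H H\<^esub> comult H y"
  and comult_one: "comult H \<one>\<^bsub>H\<^esub> = tens H H \<one>\<^bsub>H\<^esub> \<one>\<^bsub>H\<^esub>"
  and comult_deriv: "x \<in> carrier H \<Longrightarrow> comult H (deriv H x) = deriv (tensor_dalg H H) (comult H x)"
  using A.comult_hom by (auto simp: dalg_hom_def Ring.ring_hom_def tensor_dalg_def)

lemma counit_functional: "functional H (counit H)"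
  using A.counit_hom by (auto simp: dalg_hom_def module_hom_def lin_hom_def add_hom_def field_dalg_def)

lemma counit_mult: "x \<in> carrier H \<Longrightarrow> y \<in> carrier H \<Longrightarrow> counit H (x \<otimes>\<^bsub>H\<^esub> y) = counit H x * counit H y"
  and counit_one: "counit H \<one>\<^bsub>H\<^esub> = 1"
  and counit_deriv: "x \<in> carrier H \<Longrightarrow> counit H (deriv H x) = dk (counit H x)"
  using A.counit_hom by (auto simp: dalg_hom_def Ring.ring_hom_def field_dalg_def)

lemma coinv_lin_hom: "lin_hom H H (coinv H)"
  using A.coinv_hom by (auto simp: dalg_hom_def module_hom_def lin_hom_def add_hom_def)

lemma deriv_add_hom: "add_hom H H (deriv H)"
  using A.derivation_deriv by (auto simp: derivation_def add_hom_def)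

lemma deriv_mult: "x \<in> carrier H \<Longrightarrow> y \<in> carrier H \<Longrightarrow>
    deriv H (x \<otimes>\<^bsub>H\<^esub> y) = deriv H x \<otimes>\<^bsub>H\<^esub> y \<oplus>\<^bsub>H\<^esub> x \<otimes>\<^bsub>H\<^esub> deriv H y"
  using A.derivation_deriv by (auto simp: derivation_def)

section \<open>Comodules, their matrices and finite subcomodules\<close>

text \<open>The coaction is an argument of its own and the dimension is arbitrary, so that
  \<open>H\<close> coacted on by its comultiplication is covered along with the
  representations.\<close>

definition comodule :: "('k, 'v, 'd) module_scheme \<Rightarrow> ('v \<Rightarrow> ('k, 'v, 'a) tensor) \<Rightarrow> bool" where
  "comodule V \<rho> \<longleftrightarrow> kspace V \<and> lin_hom V (tensor V H) \<rho> \<and>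
     (\<forall>v\<in>carrier V. tensor_assoc V H H (tensor_map V H (tensor V H) H \<rho> (\<lambda>x. x) (\<rho> v)) =
        tensor_map V H V (tensor H H) (\<lambda>x. x) (comult H) (\<rho> v)) \<and>
     (\<forall>v\<in>carrier V. tensor_ext V H V (\<lambda>w a. counit H a \<odot>\<^bsub>V\<^esub> w) (\<rho> v) = v)"

lemma comoduleD:
  assumes "comodule V \<rho>"
  shows "kspace V" "lin_hom V (tensor V H) \<rho>"
    "v \<in> carrier V \<Longrightarrow> tensor_assoc V H H (tensor_map V H (tensor V H) H \<rho> (\<lambda>x. x) (\<rho> v)) =
        tensor_map V H V (tensor H H) (\<lambda>x. x) (comult H) (\<rho> v)"
    "v \<in> carrier V \<Longrightarrow> slice_right V H (counit H) (\<rho> v) = v"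
  using assms by (auto simp: comodule_def slice_right_def)

lemma comodule_self: "comodule H (comult H)"
  using H comult_hom A.coassoc A.counit_right by (simp add: comodule_def id_def)

text \<open>This is u \<otimes> id \<otimes> id applied to coassociativity at v. It says that v
  \<mapsto> \<psi>(v \<otimes> u) is a comodule map into \<open>H\<close>, and with a basis it
  becomes \<Delta>(a_ij) = \<Sum> a_ik \<otimes> a_kj.\<close>

lemma comult_slice:
  assumes V: "comodule V \<rho>" and u: "functional V u" and v: "v \<in> carrier V"
  shows "comult H (slice V H u (\<rho> v)) = tensor_map V H H H (\<lambda>w. slice V H u (\<rho> w)) (\<lambda>x. x) (\<rho> v)"
proof -
  note C = comoduleD[OF V]
  have VH: "kspace (tensor V H)" using C H by simp
  have \<rho>v: "\<rho> v \<in> carrier (tensor V H)" using lin_homD(1)[OF C(2) v] .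
  note sl = slice_lin_hom[OF C(1) H u]
  have key: "slice V (tensor H H) u (tensor_assoc V H H z) = tensor_map (tensor V H) H H H (slice V H u) (\<lambda>x. x) z"
    if z: "z \<in> carrier (tensor (tensor V H) H)" for z
    by (rule tensor3_hom_eqI[OF C(1) H H
          add_hom_comp[OF tensor_assoc_add_hom[OF C(1) H H] lin_homD(4)[OF slice_lin_hom[OF C(1) HH u]]]
          tensor_map_add_hom[OF VH H H H sl lin_hom_ident] _ z])
       (use C(1) H HH u in \<open>simp add: tensor_assoc_tens slice_tens tensor_map_tens[OF VH H H H sl lin_hom_ident] tens_smult_left\<close>)
  have "comult H (slice V H u (\<rho> v)) = slice V (tensor H H) u (tensor_map V H V (tensor H H) (\<lambda>x. x) (comult H) (\<rho> v))"
    using slice_tensor_map[OF C(1) H C(1) HH lin_hom_ident comult_hom u \<rho>v] by simp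
  also have "\<dots> = slice V (tensor H H) u (tensor_assoc V H H (tensor_map V H (tensor V H) H \<rho> (\<lambda>x. x) (\<rho> v)))"
    using C(3)[OF v] by simp
  also have "\<dots> = tensor_map (tensor V H) H H H (slice V H u) (\<lambda>x. x) (tensor_map V H (tensor V H) H \<rho> (\<lambda>x. x) (\<rho> v))"
    using tensor_map_closed[OF C(1) H VH H C(2) lin_hom_ident \<rho>v] by (rule key)
  also have "\<dots> = tensor_map V H H H (\<lambda>w. slice V H u (\<rho> w)) (\<lambda>x. x) (\<rho> v)"
    using tensor_map_comp[OF C(1) H VH H H H C(2) lin_hom_ident sl lin_hom_ident \<rho>v] by (simp add: id_def)
  finally show ?thesis .
qed

text \<open>Both sides are u \<otimes> \<epsilon> applied to \<rho>(v); contracting the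
  \<open>H\<close> factor first turns this into u of the counit axiom.\<close>

lemma counit_slice:
  assumes V: "comodule V \<rho>" and u: "functional V u" and v: "v \<in> carrier V"
  shows "counit H (slice V H u (\<rho> v)) = u v"
proof -
  note C = comoduleD[OF V]
  have \<rho>v: "\<rho> v \<in> carrier (tensor V H)" using lin_homD(1)[OF C(2) v] .
  have "counit H (slice V H u z) = u (slice_right V H (counit H) z)" if z: "z \<in> carrier (tensor V H)" for z
    by (rule tensor_hom_eqI[OF C(1) H
        add_hom_comp[OF lin_homD(4)[OF slice_lin_hom[OF C(1) H u]] lin_homD(4)[OF counit_functional]]
        add_hom_comp[OF lin_homD(4)[OF slice_right_lin_hom[OF C(1) H counit_functional]] lin_homD(4)[OF u]] _ z])
       (use C(1) H functionalD[OF u] functionalD[OF counit_functional] in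
         \<open>simp add: slice_tens[OF C(1) H u] slice_right_tens[OF C(1) H counit_functional]\<close>)
  from this[OF \<rho>v] show ?thesis using C(4)[OF v] by simp
qed

text \<open>The family \<open>e\<close> may span a proper subspace of \<open>V\<close>, so the
  predicate also describes a finite-dimensional subcomodule by its matrix.\<close>

definition matrix_comodule ::
  "('k, 'v, 'd) module_scheme \<Rightarrow> ('v \<Rightarrow> ('k, 'v, 'a) tensor) \<Rightarrow> 'i set \<Rightarrow> ('i \<Rightarrow> 'v) \<Rightarrow> ('i \<Rightarrow> 'i \<Rightarrow> 'a) \<Rightarrow> bool" where
  "matrix_comodule V \<rho> I e a \<longleftrightarrow> finite I \<and> (\<forall>i\<in>I. e i \<in> carrier V) \<and> (\<forall>i\<in>I. \<forall>j\<in>I. a i j \<in> carrier H) \<and>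
     (\<forall>j\<in>I. \<rho> (e j) = (\<Oplus>\<^bsub>tensor V H\<^esub>i\<in>I. tens V H (e i) (a i j))) \<and>
     (\<forall>i\<in>I. \<forall>j\<in>I. comult H (a i j) = (\<Oplus>\<^bsub>tensor H H\<^esub>k\<in>I. tens H H (a i k) (a k j))) \<and>
     (\<forall>i\<in>I. \<forall>j\<in>I. counit H (a i j) = (if i = j then 1 else 0))"

lemma matrix_comoduleD:
  assumes "matrix_comodule V \<rho> I e a"
  shows "finite I" "i \<in> I \<Longrightarrow> e i \<in> carrier V" "i \<in> I \<Longrightarrow> j \<in> I \<Longrightarrow> a i j \<in> carrier H"
    "j \<in> I \<Longrightarrow> \<rho> (e j) = (\<Oplus>\<^bsub>tensor V H\<^esub>i\<in>I. tens V H (e i) (a i j))"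
    "i \<in> I \<Longrightarrow> j \<in> I \<Longrightarrow> comult H (a i j) = (\<Oplus>\<^bsub>tensor H H\<^esub>k\<in>I. tens H H (a i k) (a k j))"
    "i \<in> I \<Longrightarrow> j \<in> I \<Longrightarrow> counit H (a i j) = (if i = j then 1 else 0)"
  using assms by (auto simp: matrix_comodule_def)

text \<open>Both axioms are linear in v. On the members of the spanning family they are the formulas
  for \<Delta>(a_ij) and \<epsilon>(a_ij), up to interchanging two finite sums. Tensor products,
  duals and prolongations are all recognized as representations in this way.\<close>

lemma comoduleI_matrix:
  assumes V: "kspace V" and \<rho>: "lin_hom V (tensor V H) \<rho>" and s: "spans V I e" and m: "matrix_comodule V \<rho> I e a"
  shows "comodule V \<rho>"
proof -
  note M = matrix_comoduleD[OF m]
  have VH: "kspace (tensor V H)" and VHH: "kspace (tensor V (tensor H H))" using V H by simp_all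
  have 1: "lin_hom V (tensor V (tensor H H)) (\<lambda>v. tensor_assoc V H H (tensor_map V H (tensor V H) H \<rho> (\<lambda>x. x) (\<rho> v)))"
    by (rule lin_hom_comp[OF lin_hom_comp[OF \<rho> tensor_map_lin_hom[OF V H VH H \<rho> lin_hom_ident]] tensor_assoc_lin_hom[OF V H H]])
  have 2: "lin_hom V (tensor V (tensor H H)) (\<lambda>v. tensor_map V H V (tensor H H) (\<lambda>x. x) (comult H) (\<rho> v))"
    by (rule lin_hom_comp[OF \<rho> tensor_map_lin_hom[OF V H V HH lin_hom_ident comult_hom]])
  have 3: "lin_hom V V (\<lambda>v. slice_right V H (counit H) (\<rho> v))"
    by (rule lin_hom_comp[OF \<rho> slice_right_lin_hom[OF V H counit_functional]])
  have co: "tensor_assoc V H H (tensor_map V H (tensor V H) H \<rho> (\<lambda>x. x) (\<rho> (e j))) =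
      tensor_map V H V (tensor H H) (\<lambda>x. x) (comult H) (\<rho> (e j))" if j: "j \<in> I" for j
  proof -
    let ?t = "\<lambda>k i. tens V (tensor H H) (e k) (tens H H (a k i) (a i j))"
    have "tensor_assoc V H H (tensor_map V H (tensor V H) H \<rho> (\<lambda>x. x) (\<rho> (e j))) =
        (\<Oplus>\<^bsub>tensor V (tensor H H)\<^esub>i\<in>I. tensor_assoc V H H (tens (tensor V H) H (\<rho> (e i)) (a i j)))"
      using V H VH VHH M(1-3) j lin_homD(1)[OF \<rho>]
      by (simp add: M(4) add_hom_finsum[OF VH VHH add_hom_comp[OF tensor_map_add_hom[OF V H VH H \<rho> lin_hom_ident] tensor_assoc_add_hom[OF V H H]]])
         (intro ks_finsum_cong; simp add: tensor_map_tens[OF V H VH H \<rho> lin_hom_ident] tensor_assoc_closed[OF V H H])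
    also have "\<dots> = (\<Oplus>\<^bsub>tensor V (tensor H H)\<^esub>i\<in>I. \<Oplus>\<^bsub>tensor V (tensor H H)\<^esub>k\<in>I. ?t k i)"
    proof (rule ks_finsum_cong[OF VHH refl])
      fix i assume i: "i \<in> I"
      have h: "add_hom (tensor V H) (tensor V (tensor H H)) (\<lambda>y. tensor_assoc V H H (tens (tensor V H) H y (a i j)))"
        using lin_homD(4)[OF tens_hom_left[OF VH H M(3)[OF i j]]] tensor_assoc_add_hom[OF V H H] by (rule add_hom_comp)
      show "tensor_assoc V H H (tens (tensor V H) H (\<rho> (e i)) (a i j)) = (\<Oplus>\<^bsub>tensor V (tensor H H)\<^esub>k\<in>I. ?t k i)"
        using V H VH VHH M(1-3) i j
        by (simp add: M(4) add_hom_finsum[OF VH VHH h]) (intro ks_finsum_cong; simp add: tensor_assoc_tens[OF V H H])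
      show "(\<Oplus>\<^bsub>tensor V (tensor H H)\<^esub>k\<in>I. ?t k i) \<in> carrier (tensor V (tensor H H))"
        using V H VH VHH M(1-3) i j by (intro ks_finsum_closed) simp_all
    qed
    also have "\<dots> = (\<Oplus>\<^bsub>tensor V (tensor H H)\<^esub>k\<in>I. \<Oplus>\<^bsub>tensor V (tensor H H)\<^esub>i\<in>I. ?t k i)"
      using V H VHH M(1-3) j by (intro ks_finsum_swap) simp_all
    also have "\<dots> = (\<Oplus>\<^bsub>tensor V (tensor H H)\<^esub>k\<in>I. tens V (tensor H H) (e k) (comult H (a k j)))"
    proof (rule ks_finsum_cong[OF VHH refl])
      fix k assume k: "k \<in> I"
      show "(\<Oplus>\<^bsub>tensor V (tensor H H)\<^esub>i\<in>I. ?t k i) = tens V (tensor H H) (e k) (comult H (a k j))"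
        using V H HH VHH M(1-3) j k
        by (simp add: M(5) add_hom_finsum[OF HH VHH lin_homD(4)[OF tens_hom_right[OF V HH M(2)[OF k]]]])
      show "tens V (tensor H H) (e k) (comult H (a k j)) \<in> carrier (tensor V (tensor H H))"
        using V HH M(2,3) j k lin_homD(1)[OF comult_hom] by simp
    qed
    also have "\<dots> = tensor_map V H V (tensor H H) (\<lambda>x. x) (comult H) (\<rho> (e j))"
      using V H VH VHH HH M(1-3) j lin_homD(1)[OF comult_hom]
      by (simp add: M(4) add_hom_finsum[OF VH VHH tensor_map_add_hom[OF V H V HH lin_hom_ident comult_hom]])
         (intro ks_finsum_cong; simp add: tensor_map_tens[OF V H V HH lin_hom_ident comult_hom])
    finally show ?thesis .
  qed
  have cu: "slice_right V H (counit H) (\<rho> (e j)) = e j" if j: "j \<in> I" for j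
  proof -
    have "slice_right V H (counit H) (\<rho> (e j)) = (\<Oplus>\<^bsub>V\<^esub>i\<in>I. (if i = j then 1 else 0) \<odot>\<^bsub>V\<^esub> e i)"
      using V H VH M(1-3) j
      by (simp add: M(4) add_hom_finsum[OF VH V lin_homD(4)[OF slice_right_lin_hom[OF V H counit_functional]]])
         (intro ks_finsum_cong; simp add: slice_right_tens[OF V H counit_functional] M(6))
    also have "\<dots> = e j" using V M(1,2) j by (subst ks_finsum_delta[of V _ j]) auto
    finally show ?thesis .
  qed
  show ?thesis
    unfolding comodule_def slice_right_def[symmetric]
    using V \<rho> spans_hom_eqI[OF V VHH s 1 2 co] spans_hom_eqI[OF V V s 3 lin_hom_ident] cu by simp
qed

text \<open>The converse direction: \<open>comult_slice\<close> and \<open>counit_slice\<close>,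
  read in a basis, are the matrix identities.\<close>

lemma comodule_matrix:
  assumes V: "comodule V \<rho>" and fr: "frame V I e f"
  shows "matrix_comodule V \<rho> I e (\<lambda>i j. slice V H (f i) (\<rho> (e j)))"
proof -
  note C = comoduleD[OF V] and F = frameD[OF fr]
  have \<rho>e: "\<rho> v \<in> carrier (tensor V H)" if "v \<in> carrier V" for v using lin_homD(1)[OF C(2) that] .
  have cl: "slice V H (f i) (\<rho> v) \<in> carrier H" if "i \<in> I" "v \<in> carrier V" for i v
    using slice_closed[OF C(1) H F(3)[OF that(1)] \<rho>e[OF that(2)]] .
  have e: "\<rho> (e j) = (\<Oplus>\<^bsub>tensor V H\<^esub>i\<in>I. tens V H (e i) (slice V H (f i) (\<rho> (e j))))" if "j \<in> I" for j
    using frame_tensor[OF C(1) H fr \<rho>e[OF F(2)[OF that]]] by simp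
  have VH: "kspace (tensor V H)" using C(1) H by simp
  show ?thesis
    unfolding matrix_comodule_def
  proof (intro conjI ballI)
    fix i j assume i: "i \<in> I" and j: "j \<in> I"
    have l: "lin_hom V H (\<lambda>w. slice V H (f i) (\<rho> w))"
      by (rule lin_hom_comp[OF C(2) slice_lin_hom[OF C(1) H F(3)[OF i]]])
    have "comult H (slice V H (f i) (\<rho> (e j))) =
        tensor_map V H H H (\<lambda>w. slice V H (f i) (\<rho> w)) (\<lambda>x. x) (\<Oplus>\<^bsub>tensor V H\<^esub>k\<in>I. tens V H (e k) (slice V H (f k) (\<rho> (e j))))"
      using comult_slice[OF V F(3)[OF i] F(2)[OF j]] e[OF j] by simp
    also have "\<dots> = (\<Oplus>\<^bsub>tensor H H\<^esub>k\<in>I. tens H H (slice V H (f i) (\<rho> (e k))) (slice V H (f k) (\<rho> (e j))))"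
      using C(1) H HH VH F(1,2) i j cl
      by (subst add_hom_finsum[OF VH HH tensor_map_add_hom[OF C(1) H H H l lin_hom_ident]], simp)
         (intro ks_finsum_cong; simp add: tensor_map_tens[OF C(1) H H H l lin_hom_ident])
    finally show "comult H (slice V H (f i) (\<rho> (e j))) =
      (\<Oplus>\<^bsub>tensor H H\<^esub>k\<in>I. tens H H (slice V H (f i) (\<rho> (e k))) (slice V H (f k) (\<rho> (e j))))" .
    show "counit H (slice V H (f i) (\<rho> (e j))) = (if i = j then 1 else 0)"
      using counit_slice[OF V F(3)[OF i] F(2)[OF j]] F(4)[OF i j] by simp
  qed (use F e cl in auto)
qed

text \<open>Local finiteness, in a form that also controls annihilators. In a shortest expression
  \<rho>(v) = \<Sum> e_i \<otimes> h_i, independence of the h_i makes the e_i span a subcomodule.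
  The same independence gives the last conclusion, on which the injectivity of \<Phi> rests.\<close>

lemma finite_subcomodule:
  assumes V: "comodule V \<rho>" and v: "v \<in> carrier V"
  obtains I e a c where "matrix_comodule V \<rho> (I :: nat set) e a" "v = (\<Oplus>\<^bsub>V\<^esub>i\<in>I. c i \<odot>\<^bsub>V\<^esub> e i)"
    "\<And>u i. functional V u \<Longrightarrow> slice V H u (\<rho> v) = \<zero>\<^bsub>H\<^esub> \<Longrightarrow> i \<in> I \<Longrightarrow> u (e i) = 0"
proof -
  note C = comoduleD[OF V]
  have VH: "kspace (tensor V H)" and VHH: "kspace (tensor V (tensor H H))" using C(1) H by simp_all
  have \<rho>c: "\<rho> w \<in> carrier (tensor V H)" if "w \<in> carrier V" for w using lin_homD(1)[OF C(2) that] .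
  obtain I e h where I: "finite (I :: nat set)" "\<And>i. i \<in> I \<Longrightarrow> e i \<in> carrier V" "\<And>i. i \<in> I \<Longrightarrow> h i \<in> carrier H"
    and \<rho>v: "\<rho> v = (\<Oplus>\<^bsub>tensor V H\<^esub>i\<in>I. tens V H (e i) (h i))" and ie: "indep V I e" and ih: "indep H I h"
    by (rule tensor_minimal_presentation[OF C(1) H \<rho>c[OF v]]) (rule that)
  \<comment> \<open>Functionals on \<open>H\<close> dual to the h_i extract the e_i from \<rho>(v);
    functionals on \<open>V\<close> dual to the e_i, chosen next, read off the entries of the
    matrix.\<close>
  obtain f where f: "\<And>i. i \<in> I \<Longrightarrow> functional H (f i)"
    "\<And>i j. i \<in> I \<Longrightarrow> j \<in> I \<Longrightarrow> f i (h j) = (if i = j then 1 else 0)"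
    by (rule indep_dual[where v = h, OF H I(1) _ ih]) (erule I(3), rule that)
  obtain g where g: "\<And>i. i \<in> I \<Longrightarrow> functional V (g i)"
    "\<And>i j. i \<in> I \<Longrightarrow> j \<in> I \<Longrightarrow> g i (e j) = (if i = j then 1 else 0)"
    by (rule indep_dual[where v = e, OF C(1) I(1) _ ie]) (erule I(2), rule that)
  define a where "a i j = slice_right H H (f j) (comult H (h i))" for i j
  have sr: "slice_right V H u (\<rho> v) = (\<Oplus>\<^bsub>V\<^esub>i\<in>I. u (h i) \<odot>\<^bsub>V\<^esub> e i)" if u: "functional H u" for u
    unfolding \<rho>v using C(1) H VH I
    by (simp add: add_hom_finsum[OF VH C(1) lin_homD(4)[OF slice_right_lin_hom[OF C(1) H u]]])
       (intro ks_finsum_cong; simp add: slice_right_tens[OF C(1) H u])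
  have sl: "slice V H u (\<rho> v) = (\<Oplus>\<^bsub>H\<^esub>i\<in>I. u (e i) \<odot>\<^bsub>H\<^esub> h i)" if u: "functional V u" for u
    unfolding \<rho>v using C(1) H VH I
    by (simp add: add_hom_finsum[OF VH H lin_homD(4)[OF slice_lin_hom[OF C(1) H u]]])
       (intro ks_finsum_cong; simp add: slice_tens[OF C(1) H u])
  have ej: "slice_right V H (f j) (\<rho> v) = e j" if j: "j \<in> I" for j
    unfolding sr[OF f(1)[OF j]] using C(1) I j f(2)[OF j]
    by (subst ks_finsum_delta[of V _ j]) auto
  have ac: "a i j \<in> carrier H" if "i \<in> I" "j \<in> I" for i j
    unfolding a_def using lin_homD(1)[OF slice_right_lin_hom[OF H H f(1)[OF that(2)]] lin_homD(1)[OF comult_hom I(3)[OF that(1)]]] .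
  have \<rho>e: "\<rho> (e j) = (\<Oplus>\<^bsub>tensor V H\<^esub>i\<in>I. tens V H (e i) (a i j))" if j: "j \<in> I" for j
  proof -
    note fj = f(1)[OF j]
    note srh = slice_right_lin_hom[OF H H fj]
    note srT = tensor_map_lin_hom[OF C(1) HH C(1) H lin_hom_ident srh]
    \<comment> \<open>Contracting the last factor commutes with rebracketing. Applied to
      coassociativity at v, this evaluates \<rho>(e_j) = (id \<otimes> id \<otimes> f_j)(id
      \<otimes> \<Delta>)(\<rho>(v)), and the entry is a_ij = (id \<otimes>
      f_j)(\<Delta>(h_i)).\<close>
    have key: "slice_right (tensor V H) H (f j) z = tensor_map V (tensor H H) V H (\<lambda>x. x) (slice_right H H (f j)) (tensor_assoc V H H z)"
      if z: "z \<in> carrier (tensor (tensor V H) H)" for z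
      by (rule tensor3_hom_eqI[OF C(1) H H
            lin_homD(4)[OF slice_right_lin_hom[OF VH H fj]]
            add_hom_comp[OF tensor_assoc_add_hom[OF C(1) H H] lin_homD(4)[OF srT]] _ z])
         (use C(1) H HH VH in \<open>simp add: slice_right_tens[OF VH H fj] tensor_assoc_tens slice_right_tens[OF H H fj]
            tensor_map_tens[OF C(1) HH C(1) H lin_hom_ident srh] tens_smult_right\<close>)
    have "\<rho> (e j) = slice_right (tensor V H) H (f j) (tensor_map V H (tensor V H) H \<rho> (\<lambda>x. x) (\<rho> v))"
      using slice_right_tensor_map[OF C(1) H VH C(2) fj \<rho>c[OF v]] ej[OF j] by simp
    also have "\<dots> = tensor_map V (tensor H H) V H (\<lambda>x. x) (slice_right H H (f j)) (tensor_assoc V H H (tensor_map V H (tensor V H) H \<rho> (\<lambda>x. x) (\<rho> v)))"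
      by (rule key, rule tensor_map_closed[OF C(1) H VH H C(2) lin_hom_ident \<rho>c[OF v]])
    also have "\<dots> = tensor_map V (tensor H H) V H (\<lambda>x. x) (slice_right H H (f j)) (tensor_map V H V (tensor H H) (\<lambda>x. x) (comult H) (\<rho> v))"
      using C(3)[OF v] by simp
    also have "\<dots> = tensor_map V H V H (\<lambda>x. x) (\<lambda>x. slice_right H H (f j) (comult H x)) (\<rho> v)"
      using tensor_map_comp[OF C(1) H C(1) HH C(1) H lin_hom_ident comult_hom lin_hom_ident srh \<rho>c[OF v]] by (simp add: id_def)
    also have "\<dots> = (\<Oplus>\<^bsub>tensor V H\<^esub>i\<in>I. tens V H (e i) (a i j))"
      unfolding \<rho>v using C(1) H VH I ac[OF _ j]
      by (simp add: add_hom_finsum[OF VH VH tensor_map_add_hom[OF C(1) H C(1) H lin_hom_ident lin_hom_comp[OF comult_hom srh]]])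
         (intro ks_finsum_cong; simp add: tensor_map_tens[OF C(1) H C(1) H lin_hom_ident lin_hom_comp[OF comult_hom srh]] a_def)
    finally show ?thesis .
  qed
  \<comment> \<open>Identifies the entry as the coefficient of e_j at the functional g_k, so that
    \<open>comult_slice\<close> and \<open>counit_slice\<close> give its comultiplication and
    counit.\<close>
  have gk: "slice V H (g k) (\<rho> (e j)) = a k j" if k: "k \<in> I" and j: "j \<in> I" for k j
  proof -
    have "slice V H (g k) (\<rho> (e j)) = (\<Oplus>\<^bsub>H\<^esub>i\<in>I. g k (e i) \<odot>\<^bsub>H\<^esub> a i j)"
      unfolding \<rho>e[OF j] using C(1) H VH I ac j
      by (simp add: add_hom_finsum[OF VH H lin_homD(4)[OF slice_lin_hom[OF C(1) H g(1)[OF k]]]])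
         (intro ks_finsum_cong; simp add: slice_tens[OF C(1) H g(1)[OF k]])
    also have "\<dots> = a k j" using H I(1) ac k j g(2)[OF k] by (subst ks_finsum_delta[of H _ k]) auto
    finally show ?thesis .
  qed
  have "matrix_comodule V \<rho> I e a"
    unfolding matrix_comodule_def
  proof (intro conjI ballI)
    fix k j assume k: "k \<in> I" and j: "j \<in> I"
    have l: "lin_hom V H (\<lambda>w. slice V H (g k) (\<rho> w))"
      by (rule lin_hom_comp[OF C(2) slice_lin_hom[OF C(1) H g(1)[OF k]]])
    have "comult H (a k j) = tensor_map V H H H (\<lambda>w. slice V H (g k) (\<rho> w)) (\<lambda>x. x) (\<Oplus>\<^bsub>tensor V H\<^esub>i\<in>I. tens V H (e i) (a i j))"
      using comult_slice[OF V g(1)[OF k] I(2)[OF j]] gk[OF k j] \<rho>e[OF j] by simp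
    also have "\<dots> = (\<Oplus>\<^bsub>tensor H H\<^esub>i\<in>I. tens H H (a k i) (a i j))"
      using C(1) H HH VH I k j ac
      by (subst add_hom_finsum[OF VH HH tensor_map_add_hom[OF C(1) H H H l lin_hom_ident]], simp)
         (intro ks_finsum_cong; simp add: tensor_map_tens[OF C(1) H H H l lin_hom_ident] gk)
    finally show "comult H (a k j) = (\<Oplus>\<^bsub>tensor H H\<^esub>i\<in>I. tens H H (a k i) (a i j))" .
    show "counit H (a k j) = (if k = j then 1 else 0)"
      using counit_slice[OF V g(1)[OF k] I(2)[OF j]] g(2)[OF k j] gk[OF k j] by simp
  qed (use I ac \<rho>e in auto)
  \<comment> \<open>The counit axiom places v in the span, with coefficients
    \<epsilon>(h_i).\<close>
  moreover have "v = (\<Oplus>\<^bsub>V\<^esub>i\<in>I. counit H (h i) \<odot>\<^bsub>V\<^esub> e i)"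
    using C(4)[OF v] sr[OF counit_functional] by simp
  \<comment> \<open>The coefficient is \<Sum> u(e_i) h_i, and the h_i are independent.\<close>
  moreover have "u (e i) = 0" if u: "functional V u" "slice V H u (\<rho> v) = \<zero>\<^bsub>H\<^esub>" and i: "i \<in> I" for u i
    using ih[unfolded indep_def, rule_format, of "\<lambda>i. u (e i)" i] sl[OF u(1)] u(2) i by simp
  ultimately show thesis by (rule that)
qed

end

section \<open>Representations as comodules\<close>

lemma mk_comod_simps [simp]:
  "carrier (mk_comod M \<rho>) = carrier M" "\<zero>\<^bsub>mk_comod M \<rho>\<^esub> = \<zero>\<^bsub>M\<^esub>"
  "add (mk_comod M \<rho>) = add M" "smult (mk_comod M \<rho>) = smult M" "coact (mk_comod M \<rho>) = \<rho>"
  by (simp_all add: mk_comod_def)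

text \<open>Tensor products see only carrier, addition and scalar multiplication. The additional
  record fields of comodules and of \<A> are therefore transparent to them, which the simplification
  rules that follow exploit.\<close>

lemma tensor_cong:
  assumes "carrier V = carrier V'" "add V = add V'" "smult V = smult V'"
    "carrier W = carrier W'" "add W = add W'" "smult W = smult W'"
  shows "tensor V W = tensor V' W'" "tens V W = tens V' W'" "tensor_rel V W = tensor_rel V' W'"
proof -
  show "tensor_rel V W = tensor_rel V' W'" using assms by (simp add: tensor_rel_def)
  then show "tensor V W = tensor V' W'" "tens V W = tens V' W'" using assms by (simp_all add: tensor_def tens_def fun_eq_iff)
qed

lemma tensor_mk_comod [simp]:
  "tensor (mk_comod M \<rho>) W = tensor M W" "tens (mk_comod M \<rho>) W = tens M W"
  by (rule tensor_cong; simp)+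

lemma tensor_ext_mk_comod [simp]: "tensor_ext (mk_comod M \<rho>) W N = tensor_ext M W N"
  by (simp add: tensor_ext_def fun_eq_iff)

lemma tensor_map_mk_comod [simp]:
  "tensor_map (mk_comod M \<rho>) W V2 W2 = tensor_map M W V2 W2"
  "tensor_map V W (mk_comod V2 \<sigma>) W2 = tensor_map V W V2 W2"
  by (simp_all add: tensor_map_def fun_eq_iff)

lemma slice_mk_comod [simp]: "slice (mk_comod M \<rho>) W = slice M W"
  by (simp add: slice_def fun_eq_iff)

lemma add_hom_mk_comod [simp]:
  "add_hom (mk_comod M \<rho>) N f = add_hom M N f" "add_hom V (mk_comod W \<sigma>) g = add_hom V W g"
  by (simp_all add: add_hom_def)

lemma lin_hom_mk_comod [simp]:
  "lin_hom (mk_comod M \<rho>) N f = lin_hom M N f" "lin_hom V (mk_comod W \<sigma>) g = lin_hom V W g"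
  by (simp_all add: lin_hom_def)

lemma additive_ext_mk_comod [simp]:
  "additive_ext M (mk_comod V \<rho>) I x y = additive_ext M V I x y"
  unfolding additive_ext_def add_hom_eq_hom[symmetric] by simp

lemma finsum_mk_comod [simp]: "finsum (mk_comod M \<rho>) f A = finsum M f A"
  by (simp add: finsum_def finprod_def)

lemma spans_mk_comod [simp]: "spans (mk_comod M \<rho>) I e = spans M I e"
  by (simp add: spans_def)

lemma kspace_cong:
  assumes V: "kspace V" and eq: "carrier W = carrier V" "\<zero>\<^bsub>W\<^esub> = \<zero>\<^bsub>V\<^esub>" "add W = add V" "smult W = smult V"
  shows "kspace W"
  by (rule kspaceI) (simp_all add: eq V ks_ac[OF V] ks_smult_assoc[OF V] ks_smult_ldistr[OF V] ks_smult_rdistr[OF V])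

lemma kspace_mk_comod [simp]: "kspace (mk_comod M \<rho>) = kspace M"
  using kspace_cong[of M "mk_comod M \<rho>"] kspace_cong[of "mk_comod M \<rho>" M] by auto

locale rep_hopf = dhopf dk H for dk :: "'k::field \<Rightarrow> 'k" and H :: "('k, 'a) hopf"
begin

lemma tensor_assoc_mk_comod [simp]: "tensor_assoc (mk_comod M \<rho>) H H = tensor_assoc M H H"
  by (simp add: tensor_assoc_def)

lemma comodule_mk_comod [simp]: "comodule (mk_comod M \<rho>') \<rho> = comodule M \<rho>"
  by (simp add: comodule_def tensor_ext_def)

lemma diff_rep_comodule:
  assumes "diff_rep H V"
  shows "comodule V (coact V)" "kspace V" "vectorspace class_ring V" "vectorspace.fin_dim class_ring V"
    "frame V (some_basis V) (\<lambda>b. b) (dual_vec V (some_basis V))"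
proof -
  interpret diff_rep H V by fact
  show "vectorspace class_ring V" "vectorspace.fin_dim class_ring V" by (rule vectorspace fin_dim)+
  show k: "kspace V" using vectorspace by (simp add: vectorspace_def kspace_def)
  show "comodule V (coact V)"
    unfolding comodule_def lin_hom_iff
    using k coact_linear coact_coassoc[unfolded id_def] coact_counit by (intro conjI ballI)
  show "frame V (some_basis V) (\<lambda>b. b) (dual_vec V (some_basis V))"
    by (rule frame_some_basis(1)[OF vectorspace fin_dim])
qed

lemma diff_repI:
  assumes "comodule V (coact V)" "spans V I e"
  shows "diff_rep H V"
proof -
  note C = comoduleD[OF assms(1)]
  show ?thesis
  proof (rule diff_rep.intro)
    show "vectorspace class_ring V" "vectorspace.fin_dim class_ring V"
      by (rule spans_fin_dim[OF C(1) assms(2)])+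
    show "coact V \<in> module_hom class_ring V (tensor V H)" using C(2) by (simp add: lin_hom_iff)
    show "tensor_assoc V H H (tensor_map V H (tensor V H) H (coact V) id (coact V v)) =
        tensor_map V H V (tensor H H) id (comult H) (coact V v)" if "v \<in> carrier V" for v
      unfolding id_def using that by (rule C(3))
    show "tensor_ext V H V (\<lambda>w a. counit H a \<odot>\<^bsub>V\<^esub> w) (coact V v) = v" if "v \<in> carrier V" for v
      unfolding slice_right_def[symmetric] using that by (rule C(4))
  qed
qed

lemma matrix_coeff_slice: "matrix_coeff H V v u = slice V H u (coact V v)"
  by (simp add: matrix_coeff_def slice_def)

text \<open>Stated for spaces with separately given coactions, so that maps from a representation
  into \<open>H\<close> itself are morphisms too.\<close>

definition comod_hom ::
  "('k, 'v, 'c) module_scheme \<Rightarrow> ('v \<Rightarrow> ('k, 'v, 'a) tensor) \<Rightarrow>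
   ('k, 'w, 'd) module_scheme \<Rightarrow> ('w \<Rightarrow> ('k, 'w, 'a) tensor) \<Rightarrow> ('v \<Rightarrow> 'w) \<Rightarrow> bool" where
  "comod_hom V \<rho> W \<sigma> \<theta> \<longleftrightarrow> lin_hom V W \<theta> \<and>
     (\<forall>v\<in>carrier V. \<sigma> (\<theta> v) = tensor_map V H W H \<theta> (\<lambda>x. x) (\<rho> v))"

lemma comod_homD:
  assumes "comod_hom V \<rho> W \<sigma> \<theta>"
  shows "lin_hom V W \<theta>" "v \<in> carrier V \<Longrightarrow> \<sigma> (\<theta> v) = tensor_map V H W H \<theta> (\<lambda>x. x) (\<rho> v)"
  using assms by (simp_all add: comod_hom_def)

lemma rep_hom_iff: "\<phi> \<in> rep_hom H V W \<longleftrightarrow> comod_hom V (coact V) W (coact W) \<phi>"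
  by (simp add: rep_hom_def comod_hom_def lin_hom_iff id_def)

lemma comod_hom_comp:
  assumes "kspace V" "kspace W" "kspace U" "lin_hom V (tensor V H) \<rho>"
    and f: "comod_hom V \<rho> W \<sigma> f" and g: "comod_hom W \<sigma> U \<tau> g"
  shows "comod_hom V \<rho> U \<tau> (\<lambda>v. g (f v))"
  using comod_homD[OF f] comod_homD[OF g] assms(1-3) H lin_homD(1)[OF assms(4)]
    lin_hom_comp[OF comod_homD(1)[OF f] comod_homD(1)[OF g]] lin_homD(1)[OF comod_homD(1)[OF f]]
  by (simp add: comod_hom_def tensor_map_comp[OF _ H _ H _ H])

lemma slice_comod_hom:
  assumes "kspace V" "kspace W" "lin_hom V (tensor V H) \<rho>" "comod_hom V \<rho> W \<sigma> \<theta>" "functional W t" "v \<in> carrier V"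
  shows "slice W H t (\<sigma> (\<theta> v)) = slice V H (\<lambda>x. t (\<theta> x)) (\<rho> v)"
  using slice_tensor_map[OF assms(1) H assms(2) H comod_homD(1)[OF assms(4)] lin_hom_ident assms(5) lin_homD(1)[OF assms(3,6)]]
    comod_homD(2)[OF assms(4,6)] by simp

lemma slice_cong:
  assumes "kspace V" "functional V u" "\<And>v. v \<in> carrier V \<Longrightarrow> t v = u v" "z \<in> carrier (tensor V H)"
  shows "slice V H t z = slice V H u z"
  unfolding slice_def using assms
  by (intro tensor_ext_cong[OF assms(1) H H bilinear_balanced[OF slice_bilinear[OF assms(1) H assms(2)]]]) auto

text \<open>At \<theta>(v) both axioms are the images under \<theta> of the axioms at v. Only
  linearity of \<sigma> enters, hence the lemma serves to establish that \<open>S\<close> is a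
  comodule.\<close>

lemma comodule_image:
  assumes V: "comodule V \<rho>" and S: "kspace S" and \<sigma>: "lin_hom S (tensor S H) \<sigma>"
    and \<theta>: "comod_hom V \<rho> S \<sigma> \<theta>" and v: "v \<in> carrier V"
  shows "tensor_assoc S H H (tensor_map S H (tensor S H) H \<sigma> (\<lambda>x. x) (\<sigma> (\<theta> v))) =
      tensor_map S H S (tensor H H) (\<lambda>x. x) (comult H) (\<sigma> (\<theta> v))" (is ?A)
    and "slice_right S H (counit H) (\<sigma> (\<theta> v)) = \<theta> v"
proof -
  note C = comoduleD[OF V] and T = comod_homD[OF \<theta>]
  have VH: "kspace (tensor V H)" and SH: "kspace (tensor S H)" using C(1) S H by simp_all
  have \<rho>v: "\<rho> v \<in> carrier (tensor V H)" using lin_homD(1)[OF C(2) v] .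
  define m where "m = tensor_map V H S H \<theta> (\<lambda>x. x)"
  have m: "lin_hom (tensor V H) (tensor S H) m"
    unfolding m_def by (rule tensor_map_lin_hom[OF C(1) H S H T(1) lin_hom_ident])
  have mt: "m (tens V H x h) = tens S H (\<theta> x) h" if "x \<in> carrier V" "h \<in> carrier H" for x h
    unfolding m_def using that by (rule tensor_map_tens[OF C(1) H S H T(1) lin_hom_ident])
  define m2 where "m2 = tensor_map V (tensor H H) S (tensor H H) \<theta> (\<lambda>x. x)"
  have m2: "lin_hom (tensor V (tensor H H)) (tensor S (tensor H H)) m2"
    unfolding m2_def by (rule tensor_map_lin_hom[OF C(1) HH S HH T(1) lin_hom_ident])
  \<comment> \<open>Naturality of the associator in its first argument.\<close>
  have nat: "tensor_assoc S H H (tensor_map (tensor V H) H (tensor S H) H m (\<lambda>x. x) z) = m2 (tensor_assoc V H H z)"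
    if z: "z \<in> carrier (tensor (tensor V H) H)" for z
    by (rule tensor3_hom_eqI[OF C(1) H H
          add_hom_comp[OF tensor_map_add_hom[OF VH H SH H m lin_hom_ident] tensor_assoc_add_hom[OF S H H]]
          add_hom_comp[OF tensor_assoc_add_hom[OF C(1) H H] lin_homD(4)[OF m2]] _ z])
       (use C(1) S H HH VH SH lin_homD(1)[OF T(1)] in
         \<open>simp add: tensor_map_tens[OF VH H SH H m lin_hom_ident] mt m2_def
            tensor_assoc_tens[OF S H H] tensor_assoc_tens[OF C(1) H H]
            tensor_map_tens[OF C(1) HH S HH T(1) lin_hom_ident]\<close>)
  have "tensor_map S H (tensor S H) H \<sigma> (\<lambda>x. x) (\<sigma> (\<theta> v)) = tensor_map V H (tensor S H) H (\<lambda>x. \<sigma> (\<theta> x)) (\<lambda>x. x) (\<rho> v)"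
    unfolding T(2)[OF v] by (rule tensor_map_comp[OF C(1) H S H SH H T(1) lin_hom_ident \<sigma> lin_hom_ident \<rho>v])
  also have "\<dots> = tensor_map V H (tensor S H) H (\<lambda>x. m (\<rho> x)) (\<lambda>x. x) (\<rho> v)"
    using T(2) by (intro tensor_map_cong[OF C(1) H SH H lin_hom_comp[OF C(2) m] lin_hom_ident _ _ \<rho>v]) (simp_all add: m_def)
  also have "\<dots> = tensor_map (tensor V H) H (tensor S H) H m (\<lambda>x. x) (tensor_map V H (tensor V H) H \<rho> (\<lambda>x. x) (\<rho> v))"
    by (rule tensor_map_comp[OF C(1) H VH H SH H C(2) lin_hom_ident m lin_hom_ident \<rho>v, symmetric])
  finally have "tensor_assoc S H H (tensor_map S H (tensor S H) H \<sigma> (\<lambda>x. x) (\<sigma> (\<theta> v))) =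
      m2 (tensor_assoc V H H (tensor_map V H (tensor V H) H \<rho> (\<lambda>x. x) (\<rho> v)))"
    using nat[OF tensor_map_closed[OF C(1) H VH H C(2) lin_hom_ident \<rho>v]] by simp
  also have "\<dots> = m2 (tensor_map V H V (tensor H H) (\<lambda>x. x) (comult H) (\<rho> v))" using C(3)[OF v] by simp
  also have "\<dots> = tensor_map V H S (tensor H H) \<theta> (comult H) (\<rho> v)"
    unfolding m2_def by (rule tensor_map_comp[OF C(1) H C(1) HH S HH lin_hom_ident comult_hom T(1) lin_hom_ident \<rho>v])
  also have "\<dots> = tensor_map S H S (tensor H H) (\<lambda>x. x) (comult H) (\<sigma> (\<theta> v))"
    unfolding T(2)[OF v]
    by (rule tensor_map_comp[OF C(1) H S H S HH T(1) lin_hom_ident lin_hom_ident comult_hom \<rho>v, symmetric])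
  finally show ?A .
  show "slice_right S H (counit H) (\<sigma> (\<theta> v)) = \<theta> v"
    unfolding T(2)[OF v]
    using slice_right_tensor_map[OF C(1) H S T(1) counit_functional \<rho>v] C(4)[OF v] by simp
qed

lemma comodule_image_surj:
  assumes V: "comodule V \<rho>" and S: "kspace S" and \<sigma>: "lin_hom S (tensor S H) \<sigma>"
    and \<theta>: "comod_hom V \<rho> S \<sigma> \<theta>" and surj: "\<theta> ` carrier V = carrier S"
  shows "comodule S \<sigma>"
  unfolding comodule_def slice_right_def[symmetric]
  using S \<sigma> comodule_image[OF V S \<sigma> \<theta>] by (auto simp: surj[symmetric])

lemma ks_finsum_Plus:
  assumes V: "kspace V" and "finite A" "finite B" "\<And>s. s \<in> A <+> B \<Longrightarrow> f s \<in> carrier V"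
  shows "finsum V f (A <+> B) = (\<Oplus>\<^bsub>V\<^esub>a\<in>A. f (Inl a)) \<oplus>\<^bsub>V\<^esub> (\<Oplus>\<^bsub>V\<^esub>b\<in>B. f (Inr b))"
proof -
  have "finsum V f (Inl ` A) = (\<Oplus>\<^bsub>V\<^esub>a\<in>A. f (Inl a))"
    by (rule ks_finsum_reindex[OF V]) (use assms in auto)
  moreover have "finsum V f (Inr ` B) = (\<Oplus>\<^bsub>V\<^esub>b\<in>B. f (Inr b))"
    by (rule ks_finsum_reindex[OF V]) (use assms in auto)
  moreover have "finsum V f (A <+> B) = finsum V f (Inl ` A) \<oplus>\<^bsub>V\<^esub> finsum V f (Inr ` B)"
    unfolding Plus_def by (rule ks_finsum_Un_disjoint[OF V]) (use assms in \<open>auto simp: Plus_def\<close>)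
  ultimately show ?thesis by simp
qed

section \<open>The direct sum of two representations\<close>

definition sum_space :: "('k, 'v, 'c) module_scheme \<Rightarrow> ('k, 'w, 'd) module_scheme \<Rightarrow> ('k, 'v \<times> 'w) module" where
  "sum_space V W = mk_space (carrier V \<times> carrier W) (\<zero>\<^bsub>V\<^esub>, \<zero>\<^bsub>W\<^esub>)
     (\<lambda>x y. (fst x \<oplus>\<^bsub>V\<^esub> fst y, snd x \<oplus>\<^bsub>W\<^esub> snd y)) (\<lambda>c x. (c \<odot>\<^bsub>V\<^esub> fst x, c \<odot>\<^bsub>W\<^esub> snd x))"

lemma sum_space_simps [simp]:
  "carrier (sum_space V W) = carrier V \<times> carrier W" "\<zero>\<^bsub>sum_space V W\<^esub> = (\<zero>\<^bsub>V\<^esub>, \<zero>\<^bsub>W\<^esub>)"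
  "x \<oplus>\<^bsub>sum_space V W\<^esub> y = (fst x \<oplus>\<^bsub>V\<^esub> fst y, snd x \<oplus>\<^bsub>W\<^esub> snd y)"
  "c \<odot>\<^bsub>sum_space V W\<^esub> x = (c \<odot>\<^bsub>V\<^esub> fst x, c \<odot>\<^bsub>W\<^esub> snd x)"
  by (simp_all add: sum_space_def mk_space_def)

lemma kspace_sum_space [simp]: "kspace V \<Longrightarrow> kspace W \<Longrightarrow> kspace (sum_space V W)"
  by (rule kspaceI) (auto simp: ks_ac ks_smult_assoc ks_smult_ldistr ks_smult_rdistr)

definition sum_rep :: "('k, 'v, 'a) comod \<Rightarrow> ('k, 'w, 'a) comod \<Rightarrow> ('k, 'v \<times> 'w, 'a) comod" where
  "sum_rep V W = mk_comod (sum_space V W)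
     (\<lambda>x. tensor_map V H (sum_space V W) H (\<lambda>v. (v, \<zero>\<^bsub>W\<^esub>)) (\<lambda>a. a) (coact V (fst x)) \<oplus>\<^bsub>tensor (sum_space V W) H\<^esub>
          tensor_map W H (sum_space V W) H (\<lambda>w. (\<zero>\<^bsub>V\<^esub>, w)) (\<lambda>a. a) (coact W (snd x)))"

text \<open>Both injections are compatible with the coactions, so \<open>comodule_image\<close>
  gives the axioms on their images. The axioms are additive, and (v, w) = (v, 0) + (0, w).\<close>

lemma sum_rep:
  assumes V: "diff_rep H V" and W: "diff_rep H W"
  shows "diff_rep H (sum_rep V W)"
    and "comod_hom V (coact V) (sum_space V W) (coact (sum_rep V W)) (\<lambda>v. (v, \<zero>\<^bsub>W\<^esub>))"
    and "comod_hom W (coact W) (sum_space V W) (coact (sum_rep V W)) (\<lambda>w. (\<zero>\<^bsub>V\<^esub>, w))"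
proof -
  let ?S = "sum_space V W" and ?i = "\<lambda>v. (v, \<zero>\<^bsub>W\<^esub>)" and ?j = "\<lambda>w. (\<zero>\<^bsub>V\<^esub>, w)"
  let ?\<sigma> = "coact (sum_rep V W)"
  note V' = diff_rep_comodule[OF V] and W' = diff_rep_comodule[OF W]
  note CV = comoduleD(2)[OF V'(1)] and CW = comoduleD(2)[OF W'(1)]
  have S: "kspace ?S" and SH: "kspace (tensor ?S H)" and VH: "kspace (tensor V H)" and WH: "kspace (tensor W H)"
    using V'(2) W'(2) H by simp_all
  have i: "lin_hom V ?S ?i" and j: "lin_hom W ?S ?j" using V'(2) W'(2) by (auto intro!: lin_homI)
  note mi = tensor_map_lin_hom[OF V'(2) H S H i lin_hom_ident] and mj = tensor_map_lin_hom[OF W'(2) H S H j lin_hom_ident]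
  note hi = lin_hom_comp[OF CV mi] and hj = lin_hom_comp[OF CW mj]
  have \<sigma>: "lin_hom ?S (tensor ?S H) ?\<sigma>"
    unfolding sum_rep_def mk_comod_simps
    by (rule lin_homI) (use SH in \<open>auto simp: lin_homD[OF hi] lin_homD[OF hj] ks_ac ks_smult_rdistr\<close>)
  have z: "tensor_map W H ?S H ?j (\<lambda>a. a) (coact W \<zero>\<^bsub>W\<^esub>) = \<zero>\<^bsub>tensor ?S H\<^esub>"
    using add_hom_zero[OF W'(2) SH lin_homD(4)[OF hj]] .
  have z': "tensor_map V H ?S H ?i (\<lambda>a. a) (coact V \<zero>\<^bsub>V\<^esub>) = \<zero>\<^bsub>tensor ?S H\<^esub>"
    using add_hom_zero[OF V'(2) SH lin_homD(4)[OF hi]] .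
  show hi': "comod_hom V (coact V) ?S ?\<sigma> ?i"
    unfolding comod_hom_def using i SH lin_homD(1)[OF hi] by (simp add: sum_rep_def z)
  show hj': "comod_hom W (coact W) ?S ?\<sigma> ?j"
    unfolding comod_hom_def using j SH lin_homD(1)[OF hj] by (simp add: sum_rep_def z')
  have SHH: "kspace (tensor ?S (tensor H H))" using S HH by simp
  have split: "x = ?i (fst x) \<oplus>\<^bsub>?S\<^esub> ?j (snd x)" if "x \<in> carrier ?S" for x
    using that V'(2) W'(2) by auto
  have "comodule ?S ?\<sigma>"
    unfolding comodule_def slice_right_def[symmetric]
  proof (intro conjI ballI)
    fix x assume x: "x \<in> carrier ?S"
    then have x': "fst x \<in> carrier V" "snd x \<in> carrier W" by auto
    note xi = lin_homD(1)[OF i x'(1)] and xj = lin_homD(1)[OF j x'(2)]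
    have a1: "add_hom ?S (tensor ?S (tensor H H)) (\<lambda>v. tensor_assoc ?S H H (tensor_map ?S H (tensor ?S H) H ?\<sigma> (\<lambda>x. x) (?\<sigma> v)))"
      by (rule lin_homD(4)[OF lin_hom_comp[OF lin_hom_comp[OF \<sigma> tensor_map_lin_hom[OF S H SH H \<sigma> lin_hom_ident]] tensor_assoc_lin_hom[OF S H H]]])
    have a2: "add_hom ?S (tensor ?S (tensor H H)) (\<lambda>v. tensor_map ?S H ?S (tensor H H) (\<lambda>x. x) (comult H) (?\<sigma> v))"
      by (rule lin_homD(4)[OF lin_hom_comp[OF \<sigma> tensor_map_lin_hom[OF S H S HH lin_hom_ident comult_hom]]])
    have a3: "add_hom ?S ?S (\<lambda>v. slice_right ?S H (counit H) (?\<sigma> v))"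
      by (rule lin_homD(4)[OF lin_hom_comp[OF \<sigma> slice_right_lin_hom[OF S H counit_functional]]])
    note ci = comodule_image[OF V'(1) S \<sigma> hi' x'(1)] and cj = comodule_image[OF W'(1) S \<sigma> hj' x'(2)]
    show "tensor_assoc ?S H H (tensor_map ?S H (tensor ?S H) H ?\<sigma> (\<lambda>x. x) (?\<sigma> x)) =
        tensor_map ?S H ?S (tensor H H) (\<lambda>x. x) (comult H) (?\<sigma> x)"
      by (subst (1 2) split[OF x]) (simp only: add_homD(2)[OF a1 xi xj] add_homD(2)[OF a2 xi xj] ci cj)
    show "slice_right ?S H (counit H) (?\<sigma> x) = x"
      by (subst (1 2) split[OF x]) (simp only: add_homD(2)[OF a3 xi xj] ci cj)
  qed (use S \<sigma> in auto)
  moreover have "spans ?S (some_basis V <+> some_basis W) (case_sum ?i ?j)"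
  proof -
    note sV = frame_spans[OF V'(5)] and sW = frame_spans[OF W'(5)]
    have f: "finite (some_basis V)" "finite (some_basis W)" using sV sW by (auto simp: spans_def)
    have b: "b \<in> some_basis V \<Longrightarrow> b \<in> carrier V" "b' \<in> some_basis W \<Longrightarrow> b' \<in> carrier W" for b b'
      using sV sW by (auto simp: spans_def)
    show ?thesis
      unfolding spans_def
    proof (intro conjI ballI)
      fix x assume x: "x \<in> carrier ?S"
      then have x': "fst x \<in> carrier V" "snd x \<in> carrier W" by auto
      obtain c where c: "fst x = (\<Oplus>\<^bsub>V\<^esub>i\<in>some_basis V. c i \<odot>\<^bsub>V\<^esub> i)" using spansE[OF sV x'(1)] .
      obtain d where d: "snd x = (\<Oplus>\<^bsub>W\<^esub>i\<in>some_basis W. d i \<odot>\<^bsub>W\<^esub> i)" using spansE[OF sW x'(2)] .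
      let ?g = "\<lambda>s. case_sum c d s \<odot>\<^bsub>?S\<^esub> case_sum ?i ?j s"
      have cl: "?g s \<in> carrier ?S" if "s \<in> some_basis V <+> some_basis W" for s
        using that b V'(2) W'(2) by (auto elim!: PlusE)
      have "(\<Oplus>\<^bsub>?S\<^esub>b\<in>some_basis V. ?g (Inl b)) = (\<Oplus>\<^bsub>?S\<^esub>b\<in>some_basis V. ?i (c b \<odot>\<^bsub>V\<^esub> b))"
        by (rule ks_finsum_cong[OF S refl]) (use b V'(2) W'(2) in auto)
      also have "\<dots> = ?i (fst x)"
        unfolding c by (rule add_hom_finsum[OF V'(2) S lin_homD(4)[OF i], symmetric]) (use b V'(2) in auto)
      finally have gl: "(\<Oplus>\<^bsub>?S\<^esub>b\<in>some_basis V. ?g (Inl b)) = ?i (fst x)" .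
      have "(\<Oplus>\<^bsub>?S\<^esub>b\<in>some_basis W. ?g (Inr b)) = (\<Oplus>\<^bsub>?S\<^esub>b\<in>some_basis W. ?j (d b \<odot>\<^bsub>W\<^esub> b))"
        by (rule ks_finsum_cong[OF S refl]) (use b V'(2) W'(2) in auto)
      also have "\<dots> = ?j (snd x)"
        unfolding d by (rule add_hom_finsum[OF W'(2) S lin_homD(4)[OF j], symmetric]) (use b W'(2) in auto)
      finally have gr: "(\<Oplus>\<^bsub>?S\<^esub>b\<in>some_basis W. ?g (Inr b)) = ?j (snd x)" .
      have "x = (\<Oplus>\<^bsub>?S\<^esub>s\<in>some_basis V <+> some_basis W. ?g s)"
        by (rule trans[OF split[OF x]]) (rule trans[OF _ ks_finsum_Plus[OF S f cl, symmetric]], simp only: gl gr, assumption)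
      then show "\<exists>c. x = (\<Oplus>\<^bsub>?S\<^esub>s\<in>some_basis V <+> some_basis W. c s \<odot>\<^bsub>?S\<^esub> case_sum ?i ?j s)"
        by (rule exI[of _ "case_sum c d"])
    qed (use f b V'(2) W'(2) in \<open>auto elim!: PlusE\<close>)
  qed
  ultimately show "diff_rep H (sum_rep V W)"
    by (intro diff_repI[of _ "some_basis V <+> some_basis W" "case_sum ?i ?j"]) (simp_all add: sum_rep_def)
qed

section \<open>Comodules on coordinate spaces\<close>

text \<open>Functions on the whole index type that vanish off \<open>I\<close>, so that a vector is
  determined by its coordinates in \<open>I\<close>.\<close>

definition coord_space :: "'i set \<Rightarrow> ('k, 'i \<Rightarrow> 'k) module" where
  "coord_space I = mk_space {x. \<forall>i. i \<notin> I \<longrightarrow> x i = 0} (\<lambda>_. 0) (\<lambda>x y i. x i + y i) (\<lambda>c x i. c * x i)"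

lemma coord_space_simps [simp]:
  "carrier (coord_space I) = {x. \<forall>i. i \<notin> I \<longrightarrow> x i = 0}" "\<zero>\<^bsub>coord_space I\<^esub> = (\<lambda>_. 0)"
  "x \<oplus>\<^bsub>coord_space I\<^esub> y = (\<lambda>i. x i + y i)" "c \<odot>\<^bsub>coord_space I\<^esub> x = (\<lambda>i. c * x i)"
  by (simp_all add: coord_space_def mk_space_def)

lemma kspace_coord_space [simp]: "kspace (coord_space I)"
  by (rule kspaceI) (auto simp: algebra_simps)

definition unit_coord :: "'i \<Rightarrow> 'i \<Rightarrow> 'k" where
  "unit_coord j i = (if i = j then 1 else 0)"

lemma unit_coord_closed [simp]: "j \<in> I \<Longrightarrow> unit_coord j \<in> carrier (coord_space I)"
  by (auto simp: unit_coord_def)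

lemma coord_lin_hom:
  assumes N: "kspace N" and I: "finite I" "\<And>i. i \<in> I \<Longrightarrow> e i \<in> carrier N"
  shows "lin_hom (coord_space I) N (\<lambda>x. \<Oplus>\<^bsub>N\<^esub>i\<in>I. x i \<odot>\<^bsub>N\<^esub> e i)"
proof (rule lin_homI)
  show "(\<Oplus>\<^bsub>N\<^esub>i\<in>I. (x \<oplus>\<^bsub>coord_space I\<^esub> y) i \<odot>\<^bsub>N\<^esub> e i) = (\<Oplus>\<^bsub>N\<^esub>i\<in>I. x i \<odot>\<^bsub>N\<^esub> e i) \<oplus>\<^bsub>N\<^esub> (\<Oplus>\<^bsub>N\<^esub>i\<in>I. y i \<odot>\<^bsub>N\<^esub> e i)" for x y
    using I N by (simp add: ks_finsum_add[symmetric]) (intro ks_finsum_cong; simp add: ks_smult_ldistr)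
  show "(\<Oplus>\<^bsub>N\<^esub>i\<in>I. (c \<odot>\<^bsub>coord_space I\<^esub> x) i \<odot>\<^bsub>N\<^esub> e i) = c \<odot>\<^bsub>N\<^esub> (\<Oplus>\<^bsub>N\<^esub>i\<in>I. x i \<odot>\<^bsub>N\<^esub> e i)" for c x
    using I N by (simp add: ks_finsum_smult) (intro ks_finsum_cong; simp add: ks_smult_assoc)
qed (use I N in auto)

lemma coord_finsum_unit:
  assumes N: "kspace N" and I: "finite I" "\<And>i. i \<in> I \<Longrightarrow> e i \<in> carrier N" and j: "j \<in> I"
  shows "(\<Oplus>\<^bsub>N\<^esub>i\<in>I. unit_coord j i \<odot>\<^bsub>N\<^esub> e i) = e j"
  using N I j by (subst ks_finsum_delta[of N _ j]) (auto simp: unit_coord_def)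

lemma coord_spans:
  assumes I: "finite I"
  shows "spans (coord_space I) I unit_coord"
  unfolding spans_def
proof (intro conjI ballI)
  fix x assume x: "x \<in> carrier (coord_space I)"
  have "(\<Oplus>\<^bsub>coord_space I\<^esub>i\<in>J. c i \<odot>\<^bsub>coord_space I\<^esub> unit_coord i) = (\<lambda>i. if i \<in> J then c i else 0)"
    if "finite J" "J \<subseteq> I" for J c
    using that
  proof (induction J rule: finite_induct)
    case (insert a J)
    have "(\<Oplus>\<^bsub>coord_space I\<^esub>i\<in>insert a J. c i \<odot>\<^bsub>coord_space I\<^esub> unit_coord i) =
        c a \<odot>\<^bsub>coord_space I\<^esub> unit_coord a \<oplus>\<^bsub>coord_space I\<^esub> (\<Oplus>\<^bsub>coord_space I\<^esub>i\<in>J. c i \<odot>\<^bsub>coord_space I\<^esub> unit_coord i)"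
      using insert by (intro ks_finsum_insert) (auto simp: unit_coord_def)
    then show ?case using insert by (auto simp: unit_coord_def fun_eq_iff)
  qed auto
  from this[OF I subset_refl, of x] have "x = (\<Oplus>\<^bsub>coord_space I\<^esub>i\<in>I. x i \<odot>\<^bsub>coord_space I\<^esub> unit_coord i)"
    using x by (auto simp: fun_eq_iff)
  then show "\<exists>c. x = (\<Oplus>\<^bsub>coord_space I\<^esub>i\<in>I. c i \<odot>\<^bsub>coord_space I\<^esub> unit_coord i)" by (rule exI[of _ x])
qed (use I in \<open>auto simp: unit_coord_def\<close>)

text \<open>The comodule with matrix \<open>a\<close> on the coordinate space. It stands in for the
  subspace spanned by a family in \<open>V\<close> with this matrix, and so avoids comparing a
  subspace tensored with \<open>H\<close> to a subspace of V \<otimes> H.\<close>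

definition coord_rep :: "'i set \<Rightarrow> ('i \<Rightarrow> 'i \<Rightarrow> 'a) \<Rightarrow> ('k, 'i \<Rightarrow> 'k, 'a) comod" where
  "coord_rep I a = mk_comod (coord_space I)
     (\<lambda>x. \<Oplus>\<^bsub>tensor (coord_space I) H\<^esub>j\<in>I. x j \<odot>\<^bsub>tensor (coord_space I) H\<^esub>
        (\<Oplus>\<^bsub>tensor (coord_space I) H\<^esub>i\<in>I. tens (coord_space I) H (unit_coord i) (a i j)))"

text \<open>The unit vectors carry the same matrix as the family \<open>e\<close>. This makes the
  coordinate space a comodule, and it makes the map sending unit vectors to the e_i a morphism, even
  where the e_i are dependent.\<close>

lemma coord_rep:
  assumes V: "kspace V" and \<rho>: "lin_hom V (tensor V H) \<rho>" and m: "matrix_comodule V \<rho> I e a"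
  shows "diff_rep H (coord_rep I a)"
    and "comod_hom (coord_space I) (coact (coord_rep I a)) V \<rho> (\<lambda>x. \<Oplus>\<^bsub>V\<^esub>i\<in>I. x i \<odot>\<^bsub>V\<^esub> e i)"
proof -
  let ?K = "coord_space I" and ?\<sigma> = "coact (coord_rep I a)"
  let ?\<theta> = "\<lambda>x. \<Oplus>\<^bsub>V\<^esub>i\<in>I. x i \<odot>\<^bsub>V\<^esub> e i"
  note M = matrix_comoduleD[OF m]
  have K: "kspace ?K" and KH: "kspace (tensor ?K H)" and VH: "kspace (tensor V H)" using H V by simp_all
  have c: "(\<Oplus>\<^bsub>tensor ?K H\<^esub>i\<in>I. tens ?K H (unit_coord i) (a i j)) \<in> carrier (tensor ?K H)" if "j \<in> I" for j
    using that K H KH M(3) by (intro ks_finsum_closed) (simp_all del: coord_space_simps)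
  have \<sigma>: "lin_hom ?K (tensor ?K H) ?\<sigma>"
    unfolding coord_rep_def mk_comod_simps by (rule coord_lin_hom[OF KH M(1) c])
  have \<sigma>u: "?\<sigma> (unit_coord j) = (\<Oplus>\<^bsub>tensor ?K H\<^esub>i\<in>I. tens ?K H (unit_coord i) (a i j))" if "j \<in> I" for j
    unfolding coord_rep_def mk_comod_simps by (rule coord_finsum_unit[OF KH M(1) c that])
  have mK: "matrix_comodule ?K ?\<sigma> I unit_coord a"
    unfolding matrix_comodule_def using M \<sigma>u by (auto simp del: coord_space_simps)
  have "comodule ?K ?\<sigma>" by (rule comoduleI_matrix[OF K \<sigma> coord_spans[OF M(1)] mK])
  then show "diff_rep H (coord_rep I a)"
    by (intro diff_repI[of _ I unit_coord]) (simp_all add: coord_rep_def coord_spans[OF M(1)])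
  have \<theta>: "lin_hom ?K V ?\<theta>" by (rule coord_lin_hom[OF V M(1,2)])
  show "comod_hom ?K ?\<sigma> V \<rho> ?\<theta>"
    unfolding comod_hom_def
  proof (intro conjI ballI \<theta>)
    fix x assume x: "x \<in> carrier ?K"
    note tm = tensor_map_lin_hom[OF K H V H \<theta> lin_hom_ident]
    show "\<rho> (?\<theta> x) = tensor_map ?K H V H ?\<theta> (\<lambda>x. x) (?\<sigma> x)"
    proof (rule spans_hom_eqI[OF K VH coord_spans[OF M(1)] lin_hom_comp[OF \<theta> \<rho>] lin_hom_comp[OF \<sigma> tm] _ x])
      fix j assume j: "j \<in> I"
      have "tensor_map ?K H V H ?\<theta> (\<lambda>x. x) (?\<sigma> (unit_coord j)) =
          (\<Oplus>\<^bsub>tensor V H\<^esub>i\<in>I. tensor_map ?K H V H ?\<theta> (\<lambda>x. x) (tens ?K H (unit_coord i) (a i j)))"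
        unfolding \<sigma>u[OF j] using j K H M(3)
        by (intro add_hom_finsum[OF KH VH lin_homD(4)[OF tm]]) (simp del: coord_space_simps)
      also have "\<dots> = (\<Oplus>\<^bsub>tensor V H\<^esub>i\<in>I. tens V H (e i) (a i j))"
        using j H V M(2,3)
        by (intro ks_finsum_cong[OF VH refl])
          (simp_all add: tensor_map_tens[OF K H V H \<theta> lin_hom_ident] coord_finsum_unit[OF V M(1,2)] del: coord_space_simps)
      finally show "\<rho> (?\<theta> (unit_coord j)) = tensor_map ?K H V H ?\<theta> (\<lambda>x. x) (?\<sigma> (unit_coord j))"
        using M(4)[OF j] coord_finsum_unit[OF V M(1,2) j] by simp
    qed
  qed
qed

end

section \<open>Direct sums\<close>

lemma direct_sum_space_simps [simp]:
  "carrier (direct_sum_space I M) = {f \<in> (\<Pi>\<^sub>E i\<in>I. carrier (M i)). finite {i \<in> I. f i \<noteq> \<zero>\<^bsub>M i\<^esub>}}"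
  "\<zero>\<^bsub>direct_sum_space I M\<^esub> = (\<lambda>i\<in>I. \<zero>\<^bsub>M i\<^esub>)"
  "f \<oplus>\<^bsub>direct_sum_space I M\<^esub> g = (\<lambda>i\<in>I. f i \<oplus>\<^bsub>M i\<^esub> g i)"
  "c \<odot>\<^bsub>direct_sum_space I M\<^esub> f = (\<lambda>i\<in>I. c \<odot>\<^bsub>M i\<^esub> f i)"
  by (simp_all add: direct_sum_space_def mk_space_def)

context
  fixes I :: "'i set" and M :: "'i \<Rightarrow> ('k::field, 'v) module"
  assumes M: "\<And>i. i \<in> I \<Longrightarrow> kspace (M i)"
begin

lemma direct_sum_mem:
  "f \<in> carrier (direct_sum_space I M) \<Longrightarrow> i \<in> I \<Longrightarrow> f i \<in> carrier (M i)"
  "f \<in> carrier (direct_sum_space I M) \<Longrightarrow> finite {i \<in> I. f i \<noteq> \<zero>\<^bsub>M i\<^esub>}"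
  "f \<in> carrier (direct_sum_space I M) \<Longrightarrow> f \<in> extensional I"
  by (auto simp: PiE_iff)

lemma direct_sum_carrierI:
  assumes "\<And>i. i \<in> I \<Longrightarrow> f i \<in> carrier (M i)" "f \<in> extensional I" "finite A" "\<And>i. i \<in> I \<Longrightarrow> i \<notin> A \<Longrightarrow> f i = \<zero>\<^bsub>M i\<^esub>"
  shows "f \<in> carrier (direct_sum_space I M)"
proof -
  have "{i \<in> I. f i \<noteq> \<zero>\<^bsub>M i\<^esub>} \<subseteq> A" using assms(4) by auto
  then show ?thesis using assms by (auto simp: PiE_iff intro: finite_subset)
qed

lemma kspace_direct_sum: "kspace (direct_sum_space I M)"
proof (rule kspaceI)
  fix f g assume f: "f \<in> carrier (direct_sum_space I M)" and g: "g \<in> carrier (direct_sum_space I M)"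
  show "f \<oplus>\<^bsub>direct_sum_space I M\<^esub> g \<in> carrier (direct_sum_space I M)"
    by (rule direct_sum_carrierI[of _ "{i \<in> I. f i \<noteq> \<zero>\<^bsub>M i\<^esub>} \<union> {i \<in> I. g i \<noteq> \<zero>\<^bsub>M i\<^esub>}"])
       (use M direct_sum_mem[OF f] direct_sum_mem[OF g] in auto)
next
  fix f c assume f: "f \<in> carrier (direct_sum_space I M)"
  show "c \<odot>\<^bsub>direct_sum_space I M\<^esub> f \<in> carrier (direct_sum_space I M)"
    by (rule direct_sum_carrierI[of _ "{i \<in> I. f i \<noteq> \<zero>\<^bsub>M i\<^esub>}"])
       (use M direct_sum_mem[OF f] in auto)
next
  show "\<zero>\<^bsub>direct_sum_space I M\<^esub> \<in> carrier (direct_sum_space I M)"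
    by (rule direct_sum_carrierI[of _ "{}"]) (use M in auto)
qed (use M in \<open>auto simp: PiE_iff ks_ac ks_smult_assoc ks_smult_ldistr ks_smult_rdistr
      intro!: extensionalityI[of _ I] restrict_ext\<close>)

lemma direct_sum_inj_lin_hom:
  assumes i: "i \<in> I"
  shows "lin_hom (M i) (direct_sum_space I M) (direct_sum_inj I M i)"
proof (rule lin_homI)
  show "direct_sum_inj I M i x \<in> carrier (direct_sum_space I M)" if "x \<in> carrier (M i)" for x
    by (rule direct_sum_carrierI[of _ "{i}"]) (use that M in \<open>auto simp: direct_sum_inj_def\<close>)
qed (use M in \<open>auto simp: direct_sum_inj_def intro!: extensionalityI[of _ I] restrict_ext\<close>)

lemma direct_sum_induct [consumes 1, case_names zero inj add]:
  assumes "f \<in> carrier (direct_sum_space I M)"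
    and z: "P \<zero>\<^bsub>direct_sum_space I M\<^esub>"
    and inj: "\<And>i x. i \<in> I \<Longrightarrow> x \<in> carrier (M i) \<Longrightarrow> P (direct_sum_inj I M i x)"
    and add: "\<And>f g. f \<in> carrier (direct_sum_space I M) \<Longrightarrow> g \<in> carrier (direct_sum_space I M) \<Longrightarrow>
       P f \<Longrightarrow> P g \<Longrightarrow> P (f \<oplus>\<^bsub>direct_sum_space I M\<^esub> g)"
  shows "P f"
proof -
  have "P f" if "finite A" "f \<in> carrier (direct_sum_space I M)" "{i \<in> I. f i \<noteq> \<zero>\<^bsub>M i\<^esub>} \<subseteq> A" "A \<subseteq> I" for A f
    using that
  proof (induction A arbitrary: f rule: finite_induct)
    case empty
    then have "f = \<zero>\<^bsub>direct_sum_space I M\<^esub>"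
      using direct_sum_mem[OF empty(1)] by (intro extensionalityI[of _ I]) auto
    then show ?case using z by (simp only:)
  next
    case (insert a A)
    note f = direct_sum_mem[OF insert.prems(1)]
    have a: "a \<in> I" using insert by simp
    define g where "g = (\<lambda>i\<in>I. if i = a then \<zero>\<^bsub>M i\<^esub> else f i)"
    have g: "g \<in> carrier (direct_sum_space I M)"
      by (rule direct_sum_carrierI[of _ A]) (use f M insert in \<open>auto simp: g_def\<close>)
    have "f = g \<oplus>\<^bsub>direct_sum_space I M\<^esub> direct_sum_inj I M a (f a)"
      using f M by (intro extensionalityI[of _ I]) (auto simp: g_def direct_sum_inj_def)
    moreover have "P g" using insert g by (intro insert.IH) (auto simp: g_def)
    ultimately show ?case
      using add[OF g lin_homD(1)[OF direct_sum_inj_lin_hom[OF a] f(1)[OF a]]] inj[OF a f(1)[OF a]] by simp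
  qed
  from this[OF direct_sum_mem(2)[OF assms(1)] assms(1)] show ?thesis by auto
qed

text \<open>The lift sums over the support, and zero components may be added to the index set
  freely. Additivity then follows by summing over the union of two supports.\<close>

lemma direct_sum_lift:
  fixes N :: "('k, 'n, 'c) module_scheme"
  assumes N: "kspace N" and h: "\<And>i. i \<in> I \<Longrightarrow> lin_hom (M i) N (h i)"
  obtains L where "lin_hom (direct_sum_space I M) N L"
    "\<And>i x. i \<in> I \<Longrightarrow> x \<in> carrier (M i) \<Longrightarrow> L (direct_sum_inj I M i x) = h i x"
proof
  define L where "L f = (\<Oplus>\<^bsub>N\<^esub>i\<in>{i \<in> I. f i \<noteq> \<zero>\<^bsub>M i\<^esub>}. h i (f i))" for f
  have h0: "h i \<zero>\<^bsub>M i\<^esub> = \<zero>\<^bsub>N\<^esub>" if "i \<in> I" for i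
    using add_hom_zero[OF M[OF that] N lin_homD(4)[OF h[OF that]]] .
  have sup: "L f = (\<Oplus>\<^bsub>N\<^esub>i\<in>A. h i (f i))"
    if "f \<in> carrier (direct_sum_space I M)" "finite A" "A \<subseteq> I" "{i \<in> I. f i \<noteq> \<zero>\<^bsub>M i\<^esub>} \<subseteq> A" for f A
    unfolding L_def
    by (rule ks_finsum_mono_neutral[OF N that(2,4)]) (use that direct_sum_mem[OF that(1)] lin_homD(1)[OF h] h0 in auto)
  show "lin_hom (direct_sum_space I M) N L"
  proof (rule lin_homI)
    fix f assume f: "f \<in> carrier (direct_sum_space I M)"
    note fm = direct_sum_mem[OF f]
    show "L f \<in> carrier N" unfolding L_def by (rule ks_finsum_closed[OF N]) (use fm lin_homD(1)[OF h] in auto)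
    let ?A = "{i \<in> I. f i \<noteq> \<zero>\<^bsub>M i\<^esub>}"
    show "L (c \<odot>\<^bsub>direct_sum_space I M\<^esub> f) = c \<odot>\<^bsub>N\<^esub> L f" for c
    proof -
      have "L (c \<odot>\<^bsub>direct_sum_space I M\<^esub> f) = (\<Oplus>\<^bsub>N\<^esub>i\<in>?A. h i ((c \<odot>\<^bsub>direct_sum_space I M\<^esub> f) i))"
        by (rule sup) (use f fm M ks_smult_closed[OF kspace_direct_sum f] in auto)
      also have "\<dots> = (\<Oplus>\<^bsub>N\<^esub>i\<in>?A. c \<odot>\<^bsub>N\<^esub> h i (f i))"
        by (rule ks_finsum_cong[OF N refl]) (use fm N lin_homD(1,3)[OF h] in auto)
      also have "\<dots> = c \<odot>\<^bsub>N\<^esub> L f"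
        unfolding L_def by (rule ks_finsum_smult[OF N, symmetric]) (use fm lin_homD(1)[OF h] in auto)
      finally show ?thesis .
    qed
    fix g assume g: "g \<in> carrier (direct_sum_space I M)"
    note gm = direct_sum_mem[OF g]
    let ?B = "{i \<in> I. f i \<noteq> \<zero>\<^bsub>M i\<^esub>} \<union> {i \<in> I. g i \<noteq> \<zero>\<^bsub>M i\<^esub>}"
    have "L (f \<oplus>\<^bsub>direct_sum_space I M\<^esub> g) = (\<Oplus>\<^bsub>N\<^esub>i\<in>?B. h i ((f \<oplus>\<^bsub>direct_sum_space I M\<^esub> g) i))"
      by (rule sup) (use f g fm gm M ks_add_closed[OF kspace_direct_sum f g] in auto)
    also have "\<dots> = (\<Oplus>\<^bsub>N\<^esub>i\<in>?B. h i (f i) \<oplus>\<^bsub>N\<^esub> h i (g i))"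
      by (rule ks_finsum_cong[OF N refl]) (use fm gm N lin_homD(1,2)[OF h] in auto)
    also have "\<dots> = (\<Oplus>\<^bsub>N\<^esub>i\<in>?B. h i (f i)) \<oplus>\<^bsub>N\<^esub> (\<Oplus>\<^bsub>N\<^esub>i\<in>?B. h i (g i))"
      by (rule ks_finsum_add[OF N]) (use fm gm lin_homD(1)[OF h] in auto)
    also have "(\<Oplus>\<^bsub>N\<^esub>i\<in>?B. h i (f i)) = L f"
      by (rule sup[symmetric]) (use f fm gm in auto)
    also have "(\<Oplus>\<^bsub>N\<^esub>i\<in>?B. h i (g i)) = L g"
      by (rule sup[symmetric]) (use g fm gm in auto)
    finally show "L (f \<oplus>\<^bsub>direct_sum_space I M\<^esub> g) = L f \<oplus>\<^bsub>N\<^esub> L g" .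
  qed
  fix i x assume i: "i \<in> I" and x: "x \<in> carrier (M i)"
  have "L (direct_sum_inj I M i x) = (\<Oplus>\<^bsub>N\<^esub>j\<in>{i}. h j (direct_sum_inj I M i x j))"
    by (rule sup[OF lin_homD(1)[OF direct_sum_inj_lin_hom[OF i] x]]) (use i in \<open>auto simp: direct_sum_inj_def\<close>)
  also have "\<dots> = h i x"
    using N i x lin_homD(1)[OF h[OF i] x] by (subst ks_finsum_delta[of N _ i]) (auto simp: direct_sum_inj_def)
  finally show "L (direct_sum_inj I M i x) = h i x" .
qed

end

section \<open>The space of matrix coefficients\<close>

locale rep_hopf_large = rep_hopf dk H for dk :: "'k::field \<Rightarrow> 'k" and H :: "('k, 'a) hopf" +
  fixes large :: "'k list \<Rightarrow> 'v"
  assumes inj_large: "inj large"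
begin

text \<open>Listing the coordinates in a finite spanning family encodes a vector as a list of
  scalars, which \<open>large\<close> embeds into \<open>'v\<close>. Hence the choice in
  \<open>copy_map\<close> finds an injection.\<close>

lemma copy_map_inj:
  fixes V :: "('k, 'x, 'c) module_scheme"
  assumes V: "kspace V" and s: "spans V I e"
  shows "inj_on (copy_map V :: 'x \<Rightarrow> 'v) (carrier V)"
proof -
  have I: "finite I" "\<And>i. i \<in> I \<Longrightarrow> e i \<in> carrier V" using s by (simp_all add: spans_def)
  obtain xs where xs: "set xs = I" using finite_list[OF I(1)] by (elim exE)
  \<comment> \<open>Coordinates are chosen because the family only spans; an arbitrary choice is
    still injective, since a vector is recovered from its coordinates.\<close>
  define c where "c v = (SOME c. v = (\<Oplus>\<^bsub>V\<^esub>i\<in>I. c i \<odot>\<^bsub>V\<^esub> e i))" for v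
  have c: "v = (\<Oplus>\<^bsub>V\<^esub>i\<in>I. c v i \<odot>\<^bsub>V\<^esub> e i)" if v: "v \<in> carrier V" for v
  proof -
    obtain d where "v = (\<Oplus>\<^bsub>V\<^esub>i\<in>I. d i \<odot>\<^bsub>V\<^esub> e i)" using spansE[OF s v] .
    then show ?thesis unfolding c_def by (rule someI[of "\<lambda>c. v = (\<Oplus>\<^bsub>V\<^esub>i\<in>I. c i \<odot>\<^bsub>V\<^esub> e i)"])
  qed
  have "inj_on (\<lambda>v. large (map (c v) xs)) (carrier V)"
  proof (rule inj_onI)
    fix v w assume vw: "v \<in> carrier V" "w \<in> carrier V" "large (map (c v) xs) = large (map (c w) xs)"
    then have "map (c v) xs = map (c w) xs" using inj_large by (simp add: inj_eq)
    then have eq: "c v i = c w i" if "i \<in> I" for i using that xs by auto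
    have "(\<Oplus>\<^bsub>V\<^esub>i\<in>I. c v i \<odot>\<^bsub>V\<^esub> e i) = (\<Oplus>\<^bsub>V\<^esub>i\<in>I. c w i \<odot>\<^bsub>V\<^esub> e i)"
      using V I eq by (intro ks_finsum_cong) simp_all
    then show "v = w" using c[OF vw(1)] c[OF vw(2)] by simp
  qed
  then show ?thesis unfolding copy_map_def by (rule someI[of "\<lambda>e. inj_on e (carrier V)"])
qed

lemma copy_space_simps:
  fixes V :: "('k, 'x, 'c) module_scheme"
  assumes "inj_on (copy_map V :: 'x \<Rightarrow> 'v) (carrier V)"
  shows "carrier (copy_space V :: ('k, 'v) module) = copy_map V ` carrier V"
    "\<zero>\<^bsub>copy_space V :: ('k, 'v) module\<^esub> = copy_map V \<zero>\<^bsub>V\<^esub>"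
    "x \<in> carrier V \<Longrightarrow> y \<in> carrier V \<Longrightarrow>
      copy_map V x \<oplus>\<^bsub>copy_space V :: ('k, 'v) module\<^esub> copy_map V y = copy_map V (x \<oplus>\<^bsub>V\<^esub> y)"
    "x \<in> carrier V \<Longrightarrow> c \<odot>\<^bsub>copy_space V :: ('k, 'v) module\<^esub> copy_map V x = copy_map V (c \<odot>\<^bsub>V\<^esub> x)"
  using assms by (simp_all add: copy_space_def Let_def mk_space_def)

context
  fixes V :: "('k, 'x, 'a) comod"
  assumes V: "diff_rep H V"
begin

abbreviation (input) "CR \<equiv> (copy_rep H V :: ('k, 'v, 'a) comod)"
abbreviation (input) "CM \<equiv> (copy_map V :: 'x \<Rightarrow> 'v)"

lemma copy_rep_inj: "inj_on CM (carrier V)"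
  by (rule copy_map_inj[OF diff_rep_comodule(2)[OF V] frame_spans[OF diff_rep_comodule(5)[OF V]]])

lemma copy_rep_simps:
  "carrier CR = CM ` carrier V" "\<zero>\<^bsub>CR\<^esub> = CM \<zero>\<^bsub>V\<^esub>"
  "x \<in> carrier V \<Longrightarrow> y \<in> carrier V \<Longrightarrow> CM x \<oplus>\<^bsub>CR\<^esub> CM y = CM (x \<oplus>\<^bsub>V\<^esub> y)"
  "x \<in> carrier V \<Longrightarrow> c \<odot>\<^bsub>CR\<^esub> CM x = CM (c \<odot>\<^bsub>V\<^esub> x)"
  using copy_space_simps[OF copy_rep_inj] by (simp_all add: copy_rep_def)

lemma copy_rep_kspace: "kspace CR"
  by (rule kspace_image[OF diff_rep_comodule(2)[OF V] copy_rep_simps(1)]) (simp_all add: copy_rep_simps)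

lemma copy_map_lin_hom: "lin_hom V CR CM"
  by (rule lin_homI) (simp_all add: copy_rep_simps)

lemma copy_rep_coact: "v \<in> carrier V \<Longrightarrow> coact CR (CM v) = tensor_map V H CR H CM (\<lambda>x. x) (coact V v)"
  using copy_rep_inj by (simp add: copy_rep_def id_def)

lemma copy_rep_coact_lin_hom: "lin_hom CR (tensor CR H) (coact CR)"
proof -
  note K = diff_rep_comodule(2)[OF V] and C = comoduleD(2)[OF diff_rep_comodule(1)[OF V]]
  note h = lin_hom_comp[OF C tensor_map_lin_hom[OF K H copy_rep_kspace H copy_map_lin_hom lin_hom_ident]]
  show ?thesis
    by (rule lin_homI)
       (auto simp: copy_rep_simps copy_rep_coact lin_homD(1)[OF h] lin_homD(2)[OF h, symmetric]
          lin_homD(3)[OF h, symmetric] K)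
qed

lemma copy_map_comod_hom: "comod_hom V (coact V) CR (coact CR) CM"
  using copy_map_lin_hom copy_rep_coact by (simp add: comod_hom_def)

lemma copy_rep_diff_rep: "diff_rep H CR"
proof (rule diff_repI)
  note K = diff_rep_comodule(2)[OF V]
  show "comodule CR (coact CR)"
    by (rule comodule_image_surj[OF diff_rep_comodule(1)[OF V] copy_rep_kspace copy_rep_coact_lin_hom
          copy_map_comod_hom copy_rep_simps(1)[symmetric]])
  note s = frame_spans[OF diff_rep_comodule(5)[OF V]]
  have b: "b \<in> carrier V" if "b \<in> some_basis V" for b using s that by (auto simp: spans_def)
  show "spans CR (some_basis V) CM"
    unfolding spans_def
  proof (intro conjI ballI)
    fix x assume "x \<in> carrier CR"
    then obtain v where v: "v \<in> carrier V" "x = CM v" by (auto simp: copy_rep_simps)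
    obtain c where c: "v = (\<Oplus>\<^bsub>V\<^esub>i\<in>some_basis V. c i \<odot>\<^bsub>V\<^esub> i)" using spansE[OF s v(1)] .
    have "x = (\<Oplus>\<^bsub>CR\<^esub>i\<in>some_basis V. CM (c i \<odot>\<^bsub>V\<^esub> i))"
      unfolding v(2) c by (rule add_hom_finsum[OF K copy_rep_kspace lin_homD(4)[OF copy_map_lin_hom]]) (use b K in simp)
    also have "\<dots> = (\<Oplus>\<^bsub>CR\<^esub>i\<in>some_basis V. c i \<odot>\<^bsub>CR\<^esub> CM i)"
      by (rule ks_finsum_cong[OF copy_rep_kspace refl])
         (use b K lin_homD(1)[OF copy_map_lin_hom] copy_rep_kspace in \<open>simp_all add: copy_rep_simps(4)\<close>)
    finally show "\<exists>c. x = (\<Oplus>\<^bsub>CR\<^esub>i\<in>some_basis V. c i \<odot>\<^bsub>CR\<^esub> CM i)" by (rule exI[of _ c])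
  qed (use s b in \<open>auto simp: spans_def copy_rep_simps\<close>)
qed

lemma copy_functional_apply: "x \<in> carrier V \<Longrightarrow> copy_functional V u (CM x) = u x"
  using copy_rep_inj by (simp add: copy_functional_def)

lemma copy_functional_closed:
  assumes "functional V u"
  shows "(copy_functional V u :: 'v \<Rightarrow> 'k) \<in> carrier (dual_space CR)"
proof -
  have "functional CR (copy_functional V u)"
    using functionalD[OF assms] diff_rep_comodule(2)[OF V]
    by (intro functionalI) (auto simp: copy_rep_simps copy_functional_apply)
  moreover have "(copy_functional V u :: 'v \<Rightarrow> 'k) \<in> extensional (carrier CR)"
    by (simp add: copy_functional_def copy_rep_simps)
  ultimately show ?thesis by simp
qed

text \<open>A morphism out of a representation on any type becomes a morphism out of an object of
  the category.\<close>

lemma copy_inverse_comod_hom: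
  assumes W: "kspace W" and \<sigma>: "lin_hom W (tensor W H) \<sigma>" and \<theta>: "comod_hom V (coact V) W \<sigma> \<theta>"
  shows "comod_hom CR (coact CR) W \<sigma> (\<lambda>x. \<theta> (inv_into (carrier V) CM x))"
proof -
  let ?\<eta> = "\<lambda>x. \<theta> (inv_into (carrier V) CM x)"
  note K = diff_rep_comodule(2)[OF V] and C = comoduleD(2)[OF diff_rep_comodule(1)[OF V]]
  have inv: "inv_into (carrier V) CM (CM v) = v" if "v \<in> carrier V" for v
    using copy_rep_inj that by simp
  note T = comod_homD[OF \<theta>]
  have l: "lin_hom CR W ?\<eta>"
    using K lin_homD[OF T(1)] by (intro lin_homI) (auto simp: copy_rep_simps inv)
  show ?thesis
    unfolding comod_hom_def
  proof (intro conjI ballI l)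
    fix x assume "x \<in> carrier CR"
    then obtain v where v: "v \<in> carrier V" "x = CM v" by (auto simp: copy_rep_simps)
    have \<rho>v: "coact V v \<in> carrier (tensor V H)" using lin_homD(1)[OF C v(1)] .
    have "\<sigma> (?\<eta> x) = tensor_map V H W H \<theta> (\<lambda>x. x) (coact V v)" using T(2)[OF v(1)] v inv by simp
    also have "\<dots> = tensor_map V H W H (\<lambda>v. ?\<eta> (CM v)) (\<lambda>x. x) (coact V v)"
      by (rule tensor_map_cong[OF K H W H _ lin_hom_ident _ _ \<rho>v, symmetric])
         (use T(1) inv in auto)
    also have "\<dots> = tensor_map CR H W H ?\<eta> (\<lambda>x. x) (tensor_map V H CR H CM (\<lambda>x. x) (coact V v))"
      by (rule tensor_map_comp[OF K H copy_rep_kspace H W H copy_map_lin_hom lin_hom_ident l lin_hom_ident \<rho>v, symmetric])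
    also have "\<dots> = tensor_map CR H W H ?\<eta> (\<lambda>x. x) (coact CR x)"
      using copy_rep_coact[OF v(1)] v(2) by simp
    finally show "\<sigma> (?\<eta> x) = tensor_map CR H W H ?\<eta> (\<lambda>x. x) (coact CR x)" .
  qed
qed

end

section \<open>Relations, induction and extension of maps on the quotient\<close>

abbreviation "Q \<equiv> (rep_quot H :: ('k, ('k, 'v, 'a) rep_elt) module)"
abbreviation "F \<equiv> (rep_sum_space H :: ('k, ('k, 'v, 'a) rep_sum) module)"
abbreviation "\<R> \<equiv> (rep_rel H :: ('k, 'v, 'a) rep_sum set)"
abbreviation "Reps \<equiv> (Rep H :: ('k, 'v, 'a) comod set)"

lemma RepD:
  assumes "V \<in> Reps"
  shows "diff_rep H V" "kspace V" "kspace (dual_space V)" "kspace (tensor V (dual_space V))" "comodule V (coact V)"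
  using assms diff_rep_comodule[of V] by (simp_all add: Rep_def)

lemma pullback_lin_hom:
  assumes "lin_hom V W \<phi>" "kspace V" "kspace W"
  shows "lin_hom (dual_space W) (dual_space V) (\<lambda>t. \<lambda>v\<in>carrier V. t (\<phi> v))"
proof (rule lin_homI)
  show "(\<lambda>v\<in>carrier V. t (\<phi> v)) \<in> carrier (dual_space V)" if "t \<in> carrier (dual_space W)" for t
    using that lin_hom_comp[OF assms(1), of field_space t] assms(2) by (simp add: functional_restrict)
qed (use lin_homD(1)[OF assms(1)] in \<open>auto intro!: restrict_ext\<close>)

lemma F_kspace: "kspace F"
  unfolding rep_sum_space_def by (rule kspace_direct_sum) (rule RepD(4))

lemma rep_inj_lin_hom: "V \<in> Reps \<Longrightarrow> lin_hom (tensor V (dual_space V)) F (rep_sum_inj H V)"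
  unfolding rep_sum_space_def rep_sum_inj_def by (rule direct_sum_inj_lin_hom) (rule RepD(4))

definition rep_gens :: "('k, 'v, 'a) rep_sum set" where
  "rep_gens = {rep_sum_inj H V
        (tensor_map V (dual_space W) V (dual_space V) id (\<lambda>t. \<lambda>v\<in>carrier V. t (\<phi> v)) z)
      \<ominus>\<^bsub>rep_sum_space H\<^esub>
      rep_sum_inj H W
        (tensor_map V (dual_space W) W (dual_space W) \<phi> id z)
      | V W \<phi> z. V \<in> Rep H \<and> W \<in> Rep H \<and> \<phi> \<in> rep_hom H V W \<and>
          z \<in> carrier (tensor V (dual_space W))}"

lemma rep_hom_tensor_maps:
  assumes "V \<in> Reps" "W \<in> Reps" "\<phi> \<in> rep_hom H V W"
  shows "lin_hom (tensor V (dual_space W)) (tensor V (dual_space V))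
      (tensor_map V (dual_space W) V (dual_space V) (\<lambda>x. x) (\<lambda>t. \<lambda>v\<in>carrier V. t (\<phi> v)))"
    "lin_hom (tensor V (dual_space W)) (tensor W (dual_space W))
      (tensor_map V (dual_space W) W (dual_space W) \<phi> (\<lambda>x. x))"
  using assms(3) RepD[OF assms(1)] RepD[OF assms(2)]
  by (simp_all add: tensor_map_lin_hom pullback_lin_hom rep_hom_iff comod_homD(1) del: dual_space_simps)

lemma rep_gens_subset: "rep_gens \<subseteq> carrier F"
proof
  fix x assume "x \<in> rep_gens"
  then obtain V W \<phi> z where x: "x = rep_sum_inj H V
        (tensor_map V (dual_space W) V (dual_space V) (\<lambda>x. x) (\<lambda>t. \<lambda>v\<in>carrier V. t (\<phi> v)) z)
      \<ominus>\<^bsub>F\<^esub> rep_sum_inj H W (tensor_map V (dual_space W) W (dual_space W) \<phi> (\<lambda>x. x) z)"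
    and VW: "V \<in> Reps" "W \<in> Reps" "\<phi> \<in> rep_hom H V W" and z: "z \<in> carrier (tensor V (dual_space W))"
    unfolding rep_gens_def id_def by (elim CollectE exE conjE) (rule that)
  show "x \<in> carrier F"
    unfolding x
    by (intro ks_minus_closed[OF F_kspace] lin_homD(1)[OF rep_inj_lin_hom] VW(1,2)
          lin_homD(1)[OF rep_hom_tensor_maps(1)[OF VW]] lin_homD(1)[OF rep_hom_tensor_maps(2)[OF VW]] z)
qed

lemma rep_rel_span: "\<R> = module.span class_ring F rep_gens"
  by (simp add: rep_rel_def rep_gens_def)

lemma rep_rel_ksub: "ksub F \<R>"
  unfolding rep_rel_span by (rule ksub_span[OF F_kspace rep_gens_subset])

lemma Q_kspace: "kspace Q"
  unfolding rep_quot_def by (rule kspace_quot[OF F_kspace rep_rel_ksub])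

lemma Q_coset_lin_hom: "lin_hom F Q (\<lambda>x. \<R> +>\<^bsub>F\<^esub> x)"
  unfolding rep_quot_def
  by (rule lin_homI) (simp_all only: coset_closed[OF F_kspace rep_rel_ksub] coset_add[OF F_kspace rep_rel_ksub]
      coset_smult[OF F_kspace rep_rel_ksub])

lemma coeff_bilinear:
  assumes "V \<in> Reps"
  shows "bilinear V (dual_space V) Q (rep_coeff0 H V)"
proof -
  note R = RepD[OF assms]
  note h = lin_hom_comp[OF rep_inj_lin_hom[OF assms] Q_coset_lin_hom]
  show ?thesis
    unfolding rep_coeff0_def
    by (rule bilinearI) (use R in \<open>simp_all add: tens_add_left tens_add_right tens_smult_left tens_smult_right
        lin_homD[OF h] del: dual_space_simps\<close>)
qed

lemma coeff_closed: "V \<in> Reps \<Longrightarrow> v \<in> carrier V \<Longrightarrow> u \<in> carrier (dual_space V) \<Longrightarrow> rep_coeff0 H V v u \<in> carrier Q"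
  by (rule balancedD(1)[OF bilinear_balanced[OF coeff_bilinear]])

text \<open>The generator of R at the pure tensor v \<otimes> t. Coefficients of different
  representations are identified below only through this equation.\<close>

lemma coeff_rel:
  assumes VW: "V \<in> Reps" "W \<in> Reps" and \<phi>: "comod_hom V (coact V) W (coact W) \<phi>"
    and v: "v \<in> carrier V" and t: "t \<in> carrier (dual_space W)"
  shows "rep_coeff0 H V v (\<lambda>v\<in>carrier V. t (\<phi> v)) = rep_coeff0 H W (\<phi> v) t"
proof -
  note RV = RepD[OF VW(1)] and RW = RepD[OF VW(2)]
  have \<phi>': "\<phi> \<in> rep_hom H V W" using \<phi> by (simp add: rep_hom_iff)
  note l = comod_homD(1)[OF \<phi>]
  let ?u = "\<lambda>v\<in>carrier V. t (\<phi> v)"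
  let ?z = "tens V (dual_space W) v t"
  note pb = pullback_lin_hom[OF l RV(2) RW(2)]
  have z: "?z \<in> carrier (tensor V (dual_space W))" using v t RV RW by (simp del: dual_space_simps)
  have 1: "tensor_map V (dual_space W) V (dual_space V) id (\<lambda>t. \<lambda>v\<in>carrier V. t (\<phi> v)) ?z = tens V (dual_space V) v ?u"
    unfolding id_def using tensor_map_tens[OF RV(2) RW(3) RV(2,3) lin_hom_ident pb v t] by simp
  have 2: "tensor_map V (dual_space W) W (dual_space W) \<phi> id ?z = tens W (dual_space W) (\<phi> v) t"
    unfolding id_def using tensor_map_tens[OF RV(2) RW(3) RW(2,3) l lin_hom_ident v t] by simp
  have "rep_sum_inj H V (tens V (dual_space V) v ?u) \<ominus>\<^bsub>F\<^esub> rep_sum_inj H W (tens W (dual_space W) (\<phi> v) t) \<in> rep_gens"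
    unfolding rep_gens_def 1[symmetric] 2[symmetric] using VW \<phi>' z
    by (intro CollectI exI[of _ V] exI[of _ W] exI[of _ \<phi>] exI[of _ ?z]) simp
  then have "rep_sum_inj H V (tens V (dual_space V) v ?u) \<ominus>\<^bsub>F\<^esub> rep_sum_inj H W (tens W (dual_space W) (\<phi> v) t) \<in> \<R>"
    using span_superset[OF F_kspace rep_gens_subset] unfolding rep_rel_span by (rule subsetD[rotated])
  then show ?thesis
    unfolding rep_coeff0_def
    using v t RV RW lin_homD(1)[OF pb t] lin_homD(1)[OF l v]
    by (subst coset_eq_iff[OF F_kspace rep_rel_ksub])
       (simp_all add: lin_homD(1)[OF rep_inj_lin_hom] VW del: dual_space_simps)
qed

lemma F_induct [consumes 1, case_names zero inj add]:
  assumes f: "f \<in> carrier F" and z: "P \<zero>\<^bsub>F\<^esub>"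
    and i: "\<And>V x. V \<in> Reps \<Longrightarrow> x \<in> carrier (tensor V (dual_space V)) \<Longrightarrow> P (rep_sum_inj H V x)"
    and a: "\<And>f g. f \<in> carrier F \<Longrightarrow> g \<in> carrier F \<Longrightarrow> P f \<Longrightarrow> P g \<Longrightarrow> P (f \<oplus>\<^bsub>F\<^esub> g)"
  shows "P f"
proof (rule direct_sum_induct[where I = Reps and M = "\<lambda>V. tensor V (dual_space V)"])
  show "f \<in> carrier (direct_sum_space Reps (\<lambda>V. tensor V (dual_space V)))"
    using f unfolding rep_sum_space_def .
qed (use z i a in \<open>simp_all only: rep_sum_space_def rep_sum_inj_def RepD(4)\<close>)

lemma Q_induct [consumes 1, case_names zero coeff add]:
  assumes x: "x \<in> carrier Q" and z: "P \<zero>\<^bsub>Q\<^esub>"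
    and c: "\<And>V v u. V \<in> Reps \<Longrightarrow> v \<in> carrier V \<Longrightarrow> u \<in> carrier (dual_space V) \<Longrightarrow> P (rep_coeff0 H V v u)"
    and a: "\<And>x y. x \<in> carrier Q \<Longrightarrow> y \<in> carrier Q \<Longrightarrow> P x \<Longrightarrow> P y \<Longrightarrow> P (x \<oplus>\<^bsub>Q\<^esub> y)"
  shows "P x"
proof -
  note h = Q_coset_lin_hom
  obtain f where f: "f \<in> carrier F" "x = \<R> +>\<^bsub>F\<^esub> f"
    using x unfolding rep_quot_def carrier_quot[OF F_kspace rep_rel_ksub] by (elim imageE)
  have "P (\<R> +>\<^bsub>F\<^esub> f)"
    using f(1)
  proof (induction rule: F_induct)
    case zero
    show ?case using z add_hom_zero[OF F_kspace Q_kspace lin_homD(4)[OF h]] by simp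
  next
    case (inj V y)
    note i = lin_hom_comp[OF rep_inj_lin_hom[OF inj(1)] h]
    show ?case
      using inj(2)
    proof (induction rule: tensor_induct[OF RepD(2,3)[OF inj(1)], consumes 1])
      case (1 v w)
      show ?case using c[OF inj(1) 1] unfolding rep_coeff0_def .
    next
      case (2 y y')
      show ?case
        using a[OF lin_homD(1)[OF i 2(1)] lin_homD(1)[OF i 2(2)] 2(3,4)] lin_homD(2)[OF i 2(1,2)] by simp
    qed
  next
    case (add f g)
    show ?case
      using a[OF lin_homD(1)[OF h add(1)] lin_homD(1)[OF h add(2)] add(3,4)] lin_homD(2)[OF h add(1,2)] by simp
  qed
  then show ?thesis using f(2) by simp
qed

text \<open>All operations of \<A> are defined through \<open>rep_coeff_ext\<close>. To compute one
  of them it suffices to exhibit an additive map on \<open>Q\<close> with the prescribed values on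
  generators; uniqueness is induction over sums of coefficients.\<close>

lemma coeff_ext_eq:
  fixes N :: "('k, 'n, 'e) module_scheme"
  assumes N: "kspace N" and f: "add_hom Q N f"
    and y: "\<And>V v u. V \<in> Reps \<Longrightarrow> v \<in> carrier V \<Longrightarrow> u \<in> carrier (dual_space V) \<Longrightarrow> f (rep_coeff0 H V v u) = y V v u"
    and z: "z \<in> carrier Q"
  shows "rep_coeff_ext H N y z = f z"
  unfolding rep_coeff_ext_def
proof (rule additive_ext_eq[OF Q_kspace f _ _ _ z])
  fix g z
  let ?I = "{(V, v, u). V \<in> Reps \<and> v \<in> carrier V \<and> u \<in> carrier (dual_space V)}"
  assume g: "add_hom Q N g" and z: "z \<in> carrier Q"
    and eq: "\<And>i. i \<in> ?I \<Longrightarrow> g (case i of (V, v, u) \<Rightarrow> rep_coeff0 H V v u) = f (case i of (V, v, u) \<Rightarrow> rep_coeff0 H V v u)"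
  show "g z = f z"
    using z
  proof (induction rule: Q_induct)
    case zero
    show ?case using add_hom_zero[OF Q_kspace N f] add_hom_zero[OF Q_kspace N g] by simp
  next
    case (coeff V v u)
    then show ?case using eq[of "(V, v, u)"] by simp
  next
    case (add x y)
    then show ?case using add_homD(2)[OF f] add_homD(2)[OF g] by simp
  qed
qed (use y coeff_closed in \<open>auto simp del: dual_space_simps\<close>)

text \<open>A family of bilinear maps on the summands descends to \<A> if it respects the relations.
  As the maps induced on V \<otimes> V* are additive, this has to be verified on pure tensors only.
  The use of this lemma is the construction of \<Phi>.\<close>

lemma coeff_lift:
  fixes N :: "('k, 'n, 'e) module_scheme"
  assumes N: "kspace N" and b: "\<And>V. V \<in> Reps \<Longrightarrow> bilinear V (dual_space V) N (y V)"
    and rel: "\<And>V W \<phi> v t. V \<in> Reps \<Longrightarrow> W \<in> Reps \<Longrightarrow> comod_hom V (coact V) W (coact W) \<phi> \<Longrightarrow> v \<in> carrier V \<Longrightarrow>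
      t \<in> carrier (dual_space W) \<Longrightarrow> y V v (\<lambda>v\<in>carrier V. t (\<phi> v)) = y W (\<phi> v) t"
  obtains f where "add_hom Q N f"
    "\<And>V v u. V \<in> Reps \<Longrightarrow> v \<in> carrier V \<Longrightarrow> u \<in> carrier (dual_space V) \<Longrightarrow> f (rep_coeff0 H V v u) = y V v u"
proof -
  let ?h = "\<lambda>V. tensor_ext V (dual_space V) N (y V)"
  have h: "lin_hom (tensor V (dual_space V)) N (?h V)" if "V \<in> Reps" for V
    by (rule tensor_ext_lin_hom[OF RepD(2,3)[OF that] N b[OF that]])
  have ht: "?h V (tens V (dual_space V) v u) = y V v u"
    if "V \<in> Reps" "v \<in> carrier V" "u \<in> carrier (dual_space V)" for V v u
    by (rule tensor_ext_tens[OF RepD(2,3)[OF that(1)] N bilinear_balanced[OF b[OF that(1)]] that(2,3)])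
  obtain L where L': "lin_hom (direct_sum_space Reps (\<lambda>V. tensor V (dual_space V))) N L"
    and Li': "\<And>V x. V \<in> Reps \<Longrightarrow> x \<in> carrier (tensor V (dual_space V)) \<Longrightarrow>
      L (direct_sum_inj Reps (\<lambda>V. tensor V (dual_space V)) V x) = ?h V x"
    by (rule direct_sum_lift[where I = Reps and M = "\<lambda>V. tensor V (dual_space V)" and h = ?h and N = N])
       (erule RepD(4), rule N, erule h, rule that)
  note L = L'[folded rep_sum_space_def] and Li = Li'[folded rep_sum_inj_def]
  have L0: "L x = \<zero>\<^bsub>N\<^esub>" if "x \<in> \<R>" for x
  proof -
    let ?K = "{x \<in> carrier F. L x = \<zero>\<^bsub>N\<^esub>}"
    have "ksub F ?K"
      using F_kspace N lin_homD[OF L] add_hom_zero[OF F_kspace N lin_homD(4)[OF L]] by (simp add: ksub_def subset_iff)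
    moreover have "rep_gens \<subseteq> ?K"
    proof
      fix x assume xg: "x \<in> rep_gens"
      then obtain V W \<phi> z where x: "x = rep_sum_inj H V
            (tensor_map V (dual_space W) V (dual_space V) (\<lambda>x. x) (\<lambda>t. \<lambda>v\<in>carrier V. t (\<phi> v)) z)
          \<ominus>\<^bsub>F\<^esub> rep_sum_inj H W (tensor_map V (dual_space W) W (dual_space W) \<phi> (\<lambda>x. x) z)"
        and VW: "V \<in> Reps" "W \<in> Reps" "\<phi> \<in> rep_hom H V W" and z: "z \<in> carrier (tensor V (dual_space W))"
        unfolding rep_gens_def id_def by (elim CollectE exE conjE) (rule that)
      note RV = RepD[OF VW(1)] and RW = RepD[OF VW(2)] and m = rep_hom_tensor_maps[OF VW]
      have c: "comod_hom V (coact V) W (coact W) \<phi>" using VW(3) by (simp add: rep_hom_iff)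
      note l = comod_homD(1)[OF c]
      note pb = pullback_lin_hom[OF l RV(2) RW(2)]
      have "?h V (tensor_map V (dual_space W) V (dual_space V) (\<lambda>x. x) (\<lambda>t. \<lambda>v\<in>carrier V. t (\<phi> v)) z) =
          ?h W (tensor_map V (dual_space W) W (dual_space W) \<phi> (\<lambda>x. x) z)"
        by (rule tensor_hom_eqI[OF RV(2) RW(3) add_hom_comp[OF lin_homD(4)[OF m(1)] lin_homD(4)[OF h[OF VW(1)]]]
              add_hom_comp[OF lin_homD(4)[OF m(2)] lin_homD(4)[OF h[OF VW(2)]]] _ z])
           (simp only: tensor_map_tens[OF RV(2) RW(3) RV(2,3) lin_hom_ident pb]
              tensor_map_tens[OF RV(2) RW(3) RW(2,3) l lin_hom_ident] ht[OF VW(1)] ht[OF VW(2)]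
              lin_homD(1)[OF pb] lin_homD(1)[OF l] rel[OF VW(1,2) c])
      then have "L x = \<zero>\<^bsub>N\<^esub>"
        unfolding x using N VW(1,2) z lin_homD(1)[OF h] lin_homD(1)[OF m(1) z] lin_homD(1)[OF m(2) z]
        by (subst add_hom_minus[OF F_kspace N lin_homD(4)[OF L]])
           (simp_all only: Li lin_homD(1)[OF rep_inj_lin_hom] ks_minus_self)
      then show "x \<in> ?K" using rep_gens_subset xg by auto
    qed
    ultimately have "\<R> \<subseteq> ?K" unfolding rep_rel_span by (rule span_le_ksub[OF F_kspace])
    then show ?thesis using that by auto
  qed
  obtain f where f': "add_hom (quot_module F \<R>) N f" "\<And>x. x \<in> carrier F \<Longrightarrow> f (\<R> +>\<^bsub>F\<^esub> x) = L x"
    by (rule quot_factor[OF F_kspace rep_rel_ksub N lin_homD(4)[OF L] L0]) (assumption, rule that)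
  note f = f'(1)[folded rep_quot_def] f'(2)
  show thesis
  proof (rule that[OF f(1)])
    fix V v u assume "V \<in> Reps" "v \<in> carrier V" "u \<in> carrier (dual_space V)"
    then show "f (rep_coeff0 H V v u) = y V v u"
      using RepD[of V] unfolding rep_coeff0_def
      by (simp add: f(2) lin_homD(1)[OF rep_inj_lin_hom] Li ht del: dual_space_simps)
  qed
qed

end

lemma balanced_zero_right:
  assumes "kspace V" "kspace W" "kspace N" "balanced V W N \<beta>" "v \<in> carrier V"
  shows "\<beta> v \<zero>\<^bsub>W\<^esub> = \<zero>\<^bsub>N\<^esub>"
  using add_hom_zero[OF assms(2,3), of "\<beta> v"] balancedD[OF assms(4)] assms(5) by (simp add: add_hom_def)

text \<open>The sum appears as a separate functional \<open>r\<close> that agrees with u + t on the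
  carrier, because the operations of the dual space return functions restricted to it.\<close>

lemma slice_functional_add:
  assumes V: "kspace V" and W: "kspace W" and u: "functional V u" and t: "functional V t"
    and r: "functional V r" "\<And>v. v \<in> carrier V \<Longrightarrow> r v = u v + t v" and z: "z \<in> carrier (tensor V W)"
  shows "slice V W r z = slice V W u z \<oplus>\<^bsub>W\<^esub> slice V W t z"
  using z
  by (induction rule: tensor_induct[OF V W, consumes 1])
     (use W in \<open>simp_all add: slice_tens[OF V W] slice_add[OF V W] slice_closed[OF V W] u t r ks_smult_ldistr ks_ac\<close>)

lemma slice_functional_smult:
  assumes V: "kspace V" and W: "kspace W" and u: "functional V u"
    and r: "functional V r" "\<And>v. v \<in> carrier V \<Longrightarrow> r v = c * u v" and z: "z \<in> carrier (tensor V W)"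
  shows "slice V W r z = c \<odot>\<^bsub>W\<^esub> slice V W u z"
  using z
  by (induction rule: tensor_induct[OF V W, consumes 1])
     (use W in \<open>simp_all add: slice_tens[OF V W] slice_add[OF V W] slice_closed[OF V W] u r ks_smult_rdistr ks_smult_assoc\<close>)

context rep_hopf
begin

lemma comod_hom_mk_comod [simp]:
  "comod_hom (mk_comod V \<rho>') \<rho> W \<sigma> \<theta> = comod_hom V \<rho> W \<sigma> \<theta>"
  "comod_hom V \<rho> (mk_comod W \<sigma>') \<sigma> \<theta> = comod_hom V \<rho> W \<sigma> \<theta>"
  by (simp_all add: comod_hom_def)

lemma matrix_coeff_bilinear:
  assumes V: "diff_rep H V"
  shows "bilinear V (dual_space V) H (matrix_coeff H V)"
proof -
  note K = diff_rep_comodule(2)[OF V] and C = comoduleD(2)[OF diff_rep_comodule(1)[OF V]]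
  have l: "lin_hom V H (\<lambda>v. slice V H u (coact V v))" if "functional V u" for u
    by (rule lin_hom_comp[OF C slice_lin_hom[OF K H that]])
  note D = kspace_dual_space[OF K]
  have f: "functional V u" if "u \<in> carrier (dual_space V)" for u using that by simp
  show ?thesis
    unfolding matrix_coeff_slice
  proof (rule bilinearI)
    fix v u assume v: "v \<in> carrier V" and u: "u \<in> carrier (dual_space V)"
    note \<rho>v = lin_homD(1)[OF C v]
    show "slice V H (u \<oplus>\<^bsub>dual_space V\<^esub> t) (coact V v) = slice V H u (coact V v) \<oplus>\<^bsub>H\<^esub> slice V H t (coact V v)"
      if t: "t \<in> carrier (dual_space V)" for t
      by (rule slice_functional_add[OF K H f[OF u] f[OF t] f[OF ks_add_closed[OF D u t]] _ \<rho>v]) simp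
    show "slice V H (c \<odot>\<^bsub>dual_space V\<^esub> u) (coact V v) = c \<odot>\<^bsub>H\<^esub> slice V H u (coact V v)" for c
      by (rule slice_functional_smult[OF K H f[OF u] f[OF ks_smult_closed[OF D u]] _ \<rho>v]) simp
  qed (use lin_homD(1-3)[OF l] in simp_all)
qed

end

context rep_hopf_large
begin

section \<open>Bijectivity of \<Phi>\<close>

abbreviation "\<Phi> \<equiv> (rep_coeff_map H :: ('k, 'v, 'a) rep_elt \<Rightarrow> 'a)"

text \<open>The relations are respected because a morphism \<phi> commutes with the coactions:
  contracting \<rho>(\<phi>(v)) with t is contracting \<rho>(v) with t \<circ> \<phi>.\<close>

lemma Phi_props:
  shows Phi_add_hom: "add_hom Q H \<Phi>"
    and Phi_coeff: "V \<in> Reps \<Longrightarrow> v \<in> carrier V \<Longrightarrow> u \<in> carrier (dual_space V) \<Longrightarrow>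
      \<Phi> (rep_coeff0 H V v u) = matrix_coeff H V v u"
proof -
  obtain f where f: "add_hom Q H f"
    "\<And>V v u. V \<in> Reps \<Longrightarrow> v \<in> carrier V \<Longrightarrow> u \<in> carrier (dual_space V) \<Longrightarrow> f (rep_coeff0 H V v u) = matrix_coeff H V v u"
  proof (rule coeff_lift[where y = "matrix_coeff H", OF H])
    show "bilinear V (dual_space V) H (matrix_coeff H V)" if "V \<in> Reps" for V
      by (rule matrix_coeff_bilinear[OF RepD(1)[OF that]])
    show "matrix_coeff H V v (\<lambda>v\<in>carrier V. t (\<phi> v)) = matrix_coeff H W (\<phi> v) t"
      if "V \<in> Reps" "W \<in> Reps" "comod_hom V (coact V) W (coact W) \<phi>" "v \<in> carrier V" "t \<in> carrier (dual_space W)"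
      for V W \<phi> v t
    proof -
      note RV = RepD[OF that(1)] and RW = RepD[OF that(2)]
      note C = comoduleD(2)[OF RV(5)]
      have t: "functional W t" using that(5) by simp
      have "functional V (\<lambda>v. t (\<phi> v))" by (rule lin_hom_comp[OF comod_homD(1)[OF that(3)] t])
      then show ?thesis
        unfolding matrix_coeff_slice
        using slice_comod_hom[OF RV(2) RW(2) C that(3) t that(4)]
          slice_cong[OF RV(2), of "\<lambda>v. t (\<phi> v)" "\<lambda>v\<in>carrier V. t (\<phi> v)", OF _ _ lin_homD(1)[OF C that(4)]]
        by simp
    qed
  qed (rule that; assumption)
  have eq: "\<Phi> z = f z" if "z \<in> carrier Q" for z
    unfolding rep_coeff_map_def by (rule coeff_ext_eq[OF H f that])
  show "add_hom Q H \<Phi>" using f(1) Q_kspace by (simp add: add_hom_def eq)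
  show "\<Phi> (rep_coeff0 H V v u) = matrix_coeff H V v u"
    if "V \<in> Reps" "v \<in> carrier V" "u \<in> carrier (dual_space V)" for V v u
    using eq[OF coeff_closed[OF that]] f(2)[OF that] by simp
qed

lemma Phi_lin_hom: "lin_hom Q H \<Phi>"
  unfolding lin_hom_def
proof (intro conjI allI ballI Phi_add_hom)
  fix c x assume "x \<in> carrier Q"
  then show "\<Phi> (c \<odot>\<^bsub>Q\<^esub> x) = c \<odot>\<^bsub>H\<^esub> \<Phi> x"
  proof (induction rule: Q_induct)
    case zero
    show ?case using add_hom_zero[OF Q_kspace H Phi_add_hom] Q_kspace H by simp
  next
    case (coeff V v u)
    have "c \<odot>\<^bsub>Q\<^esub> rep_coeff0 H V v u = rep_coeff0 H V (c \<odot>\<^bsub>V\<^esub> v) u"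
      using coeff_bilinear[OF coeff(1)] coeff(2,3) by (simp add: bilinear_def)
    moreover have "matrix_coeff H V (c \<odot>\<^bsub>V\<^esub> v) u = c \<odot>\<^bsub>H\<^esub> matrix_coeff H V v u"
      using matrix_coeff_bilinear[OF RepD(1)[OF coeff(1)]] coeff(2,3) by (simp add: bilinear_def)
    ultimately show ?case
      using coeff RepD(2)[OF coeff(1)] by (simp add: Phi_coeff del: dual_space_simps)
  next
    case (add x y)
    then show ?case
      using add_homD[OF Phi_add_hom] Q_kspace H by (simp add: ks_smult_rdistr)
  qed
qed

text \<open>Passing to the copy leaves the matrix coefficient unchanged, since the copy map is a
  morphism along which the copied functional pulls back to u.\<close>

lemma rep_coeff_props:
  fixes V :: "('k, 'x, 'a) comod"
  assumes V: "diff_rep H V" and v: "v \<in> carrier V" and u: "functional V u"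
  shows rep_coeff_closed: "rep_coeff H V v u \<in> carrier Q"
    and Phi_rep_coeff: "\<Phi> (rep_coeff H V v u) = matrix_coeff H V v u"
proof -
  let ?C = "copy_rep H V :: ('k, 'v, 'a) comod" and ?m = "copy_map V :: 'x \<Rightarrow> 'v"
  note K = diff_rep_comodule(2)[OF V] and C = comoduleD(2)[OF diff_rep_comodule(1)[OF V]]
  have R: "?C \<in> Reps" using copy_rep_diff_rep[OF V] by (simp add: Rep_def)
  have m: "?m v \<in> carrier ?C" using v by (simp add: copy_rep_simps[OF V])
  note cf = copy_functional_closed[OF V u]
  show "rep_coeff H V v u \<in> carrier Q"
    unfolding rep_coeff_def by (rule coeff_closed[OF R m cf])
  have "\<Phi> (rep_coeff H V v u) = slice ?C H (copy_functional V u) (coact ?C (?m v))"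
    unfolding rep_coeff_def matrix_coeff_slice[symmetric] by (rule Phi_coeff[OF R m cf])
  also have "\<dots> = slice V H (\<lambda>x. copy_functional V u (?m x)) (coact V v)"
    using cf by (intro slice_comod_hom[OF K copy_rep_kspace[OF V] C copy_map_comod_hom[OF V] _ v]) simp
  also have "\<dots> = slice V H u (coact V v)"
    by (rule slice_cong[OF K u _ lin_homD(1)[OF C v]]) (simp add: copy_functional_apply[OF V])
  finally show "\<Phi> (rep_coeff H V v u) = matrix_coeff H V v u" by (simp add: matrix_coeff_slice)
qed

text \<open>Repackages \<open>finite_subcomodule\<close> as an object of the category: the
  coordinate comodule of the matrix, copied into \<open>'v\<close>. The map \<open>\<eta>\<close>
  plays the part of the inclusion of the subcomodule generated by v.\<close>

lemma finite_subrep: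
  assumes V: "comodule V \<rho>" and v: "v \<in> carrier V"
  obtains C x \<eta> where "C \<in> Reps" "x \<in> carrier C" "comod_hom C (coact C) V \<rho> \<eta>" "\<eta> x = v"
    "\<And>u y. functional V u \<Longrightarrow> slice V H u (\<rho> v) = \<zero>\<^bsub>H\<^esub> \<Longrightarrow> y \<in> carrier C \<Longrightarrow> u (\<eta> y) = 0"
proof -
  note CV = comoduleD[OF V]
  obtain I e a c where m: "matrix_comodule V \<rho> (I :: nat set) e a" and vc: "v = (\<Oplus>\<^bsub>V\<^esub>i\<in>I. c i \<odot>\<^bsub>V\<^esub> e i)"
    and z: "\<And>u i. functional V u \<Longrightarrow> slice V H u (\<rho> v) = \<zero>\<^bsub>H\<^esub> \<Longrightarrow> i \<in> I \<Longrightarrow> u (e i) = 0"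
    by (rule finite_subcomodule[OF V v]) (rule that)
  note M = matrix_comoduleD[OF m]
  let ?K = "coord_rep I a"
  let ?\<theta> = "\<lambda>x. \<Oplus>\<^bsub>V\<^esub>i\<in>I. x i \<odot>\<^bsub>V\<^esub> e i"
  note K = coord_rep(1)[OF CV(1,2) m]
  have \<theta>: "comod_hom ?K (coact ?K) V \<rho> ?\<theta>"
    using coord_rep(2)[OF CV(1,2) m] by (simp add: coord_rep_def)
  let ?C = "copy_rep H ?K :: ('k, 'v, 'a) comod" and ?m = "copy_map ?K :: (nat \<Rightarrow> 'k) \<Rightarrow> 'v"
  let ?\<eta> = "\<lambda>x. ?\<theta> (inv_into (carrier ?K) ?m x)"
  have inv: "inv_into (carrier ?K) ?m (?m x) = x" if "x \<in> carrier ?K" for x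
    using copy_rep_inj[OF K] that by simp
  \<comment> \<open>The coefficients of v, set to 0 off \<open>I\<close> as membership in the
    coordinate space demands.\<close>
  define x0 where "x0 = (\<lambda>i. if i \<in> I then c i else 0)"
  have x0: "x0 \<in> carrier ?K" by (simp add: coord_rep_def x0_def)
  show thesis
  proof (rule that)
    show "?C \<in> Reps" using copy_rep_diff_rep[OF K] by (simp add: Rep_def)
    show "?m x0 \<in> carrier ?C" using x0 by (simp add: copy_rep_simps[OF K])
    show "comod_hom ?C (coact ?C) V \<rho> ?\<eta>" by (rule copy_inverse_comod_hom[OF K CV(1,2) \<theta>])
    show "?\<eta> (?m x0) = v"
      unfolding inv[OF x0] vc by (rule ks_finsum_cong[OF CV(1) refl]) (use M(2) CV(1) in \<open>simp_all add: x0_def\<close>)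
    show "u (?\<eta> y) = 0" if u: "functional V u" "slice V H u (\<rho> v) = \<zero>\<^bsub>H\<^esub>" and y: "y \<in> carrier ?C" for u y
    proof -
      have "u (?\<eta> y) = (\<Sum>i\<in>I. u (inv_into (carrier ?K) ?m y i \<odot>\<^bsub>V\<^esub> e i))"
        by (rule functional_finsum[OF CV(1) u(1)]) (use M(2) CV(1) in simp)
      also have "\<dots> = 0"
        by (rule sum.neutral) (use z[OF u] functionalD(2)[OF u(1)] M(2) in simp)
      finally show ?thesis .
    qed
  qed
qed

text \<open>Composing \<theta> with the copy map gives a morphism between objects, to which
  \<open>coeff_rel\<close> applies. Thus a coefficient of an object can be rewritten as one of a
  representation on another type.\<close>

lemma coeff_comp_copy:
  fixes S :: "('k, 'x, 'a) comod"
  assumes V: "V \<in> Reps" and S: "diff_rep H S" and \<theta>: "comod_hom V (coact V) S (coact S) \<theta>"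
    and v: "v \<in> carrier V" and t: "functional S t"
    and u: "u \<in> carrier (dual_space V)" "\<And>x. x \<in> carrier V \<Longrightarrow> u x = t (\<theta> x)"
  shows "rep_coeff0 H V v u = rep_coeff H S (\<theta> v) t"
proof -
  let ?C = "copy_rep H S :: ('k, 'v, 'a) comod" and ?m = "copy_map S :: 'x \<Rightarrow> 'v"
  note RV = RepD[OF V] and K = diff_rep_comodule(2)[OF S]
  have R: "?C \<in> Reps" using copy_rep_diff_rep[OF S] by (simp add: Rep_def)
  have h: "comod_hom V (coact V) ?C (coact ?C) (\<lambda>x. ?m (\<theta> x))"
    by (rule comod_hom_comp[OF RV(2) K copy_rep_kspace[OF S] comoduleD(2)[OF RV(5)] \<theta> copy_map_comod_hom[OF S]])
  have "u = (\<lambda>x\<in>carrier V. copy_functional S t (?m (\<theta> x)))"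
    using u lin_homD(1)[OF comod_homD(1)[OF \<theta>]]
    by (intro extensionalityI[of _ "carrier V"]) (auto simp: copy_functional_apply[OF S])
  then show ?thesis
    unfolding rep_coeff_def using coeff_rel[OF V R h v copy_functional_closed[OF S t]] by simp
qed

text \<open>Along the two injections into the direct sum of V and W, the one functional (v, w)
  \<mapsto> u(v) + t(w) restricts to u and to t. Both summands thereby become coefficients of the
  same representation at the same functional, and they add in the vector argument.\<close>

lemma coeff_single:
  assumes "x \<in> carrier Q"
  shows "\<exists>V\<in>Reps. \<exists>v\<in>carrier V. \<exists>u\<in>carrier (dual_space V). x = rep_coeff0 H V v u"
  using assms
proof (induction rule: Q_induct)
  case zero
  \<comment> \<open>The zero element is a coefficient of zero vectors once some object exists; local
    finiteness at 0 in \<open>H\<close> provides one.\<close>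
  obtain C x \<eta> where C: "C \<in> Reps" "x \<in> carrier C"
    by (rule finite_subrep[OF comodule_self ks_zero_closed[OF H]]) (rule that)
  note R = RepD[OF C(1)]
  have "\<zero>\<^bsub>Q\<^esub> = rep_coeff0 H C \<zero>\<^bsub>C\<^esub> \<zero>\<^bsub>dual_space C\<^esub>"
    using balanced_zero[OF R(2,3) Q_kspace bilinear_balanced[OF coeff_bilinear[OF C(1)]] ks_zero_closed[OF R(3)]] by simp
  then show ?case
    by (intro bexI[of _ C] bexI[of _ "\<zero>\<^bsub>C\<^esub>"] bexI[of _ "\<zero>\<^bsub>dual_space C\<^esub>"])
       (use C(1) R ks_zero_closed[OF R(3)] in \<open>simp_all del: dual_space_simps\<close>)
next
  case (coeff V v u)
  show ?case by (intro bexI[of _ V] bexI[of _ v] bexI[of _ u] refl coeff)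
next
  case (add x y)
  obtain V v u where V: "V \<in> Reps" "v \<in> carrier V" "u \<in> carrier (dual_space V)" and x: "x = rep_coeff0 H V v u"
    using add(3) by (elim bexE)
  obtain W w t where W: "W \<in> Reps" "w \<in> carrier W" "t \<in> carrier (dual_space W)" and y: "y = rep_coeff0 H W w t"
    using add(4) by (elim bexE)
  note RV = RepD[OF V(1)] and RW = RepD[OF W(1)]
  let ?S = "sum_rep V W"
  note S = sum_rep[OF RV(1) RW(1)]
  have S2: "comod_hom V (coact V) ?S (coact ?S) (\<lambda>v. (v, \<zero>\<^bsub>W\<^esub>))"
    and S3: "comod_hom W (coact W) ?S (coact ?S) (\<lambda>w. (\<zero>\<^bsub>V\<^esub>, w))"
    using S(2,3) by (simp_all add: sum_rep_def)
  let ?s = "\<lambda>x. u (fst x) + t (snd x)"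
  have u: "functional V u" and t: "functional W t" using V(3) W(3) by simp_all
  have u0: "u \<zero>\<^bsub>V\<^esub> = 0" using add_hom_zero[OF RV(2) kspace_field_space lin_homD(4)[OF u]] by simp
  have t0: "t \<zero>\<^bsub>W\<^esub> = 0" using add_hom_zero[OF RW(2) kspace_field_space lin_homD(4)[OF t]] by simp
  have s: "functional ?S ?s"
    unfolding sum_rep_def lin_hom_mk_comod
    by (rule functionalI) (auto simp: functionalD[OF u] functionalD[OF t] algebra_simps)
  let ?C = "copy_rep H ?S :: ('k, 'v, 'a) comod" and ?m = "copy_map ?S :: 'v \<times> 'v \<Rightarrow> 'v"
  have R: "?C \<in> Reps" using copy_rep_diff_rep[OF S(1)] by (simp add: Rep_def)
  note cf = copy_functional_closed[OF S(1) s]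
  have x': "x = rep_coeff0 H ?C (?m (v, \<zero>\<^bsub>W\<^esub>)) (copy_functional ?S ?s)"
    unfolding x rep_coeff_def[symmetric]
    by (rule coeff_comp_copy[OF V(1) S(1) S2 V(2) s V(3)]) (simp add: t0)
  have y': "y = rep_coeff0 H ?C (?m (\<zero>\<^bsub>V\<^esub>, w)) (copy_functional ?S ?s)"
    unfolding y rep_coeff_def[symmetric]
    by (rule coeff_comp_copy[OF W(1) S(1) S3 W(2) s W(3)]) (simp add: u0)
  have c: "?m (v, \<zero>\<^bsub>W\<^esub>) \<in> carrier ?C" "?m (\<zero>\<^bsub>V\<^esub>, w) \<in> carrier ?C"
    using V(2) W(2) RV(2) RW(2) by (simp_all add: copy_rep_simps(1)[OF S(1)]) (simp_all add: sum_rep_def)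
  have "x \<oplus>\<^bsub>Q\<^esub> y = rep_coeff0 H ?C (?m (v, \<zero>\<^bsub>W\<^esub>) \<oplus>\<^bsub>?C\<^esub> ?m (\<zero>\<^bsub>V\<^esub>, w)) (copy_functional ?S ?s)"
    unfolding x' y' using balancedD(2)[OF bilinear_balanced[OF coeff_bilinear[OF R]] c cf] by simp
  then show ?case
    using R cf c ks_add_closed[OF copy_rep_kspace[OF S(1)] c]
    by (intro bexI[of _ ?C] bexI[of _ "?m (v, \<zero>\<^bsub>W\<^esub>) \<oplus>\<^bsub>?C\<^esub> ?m (\<zero>\<^bsub>V\<^esub>, w)"] bexI[of _ "copy_functional ?S ?s"])
qed

text \<open>The additive \<Phi> is tested on x - y, which is a single coefficient. Moving that
  coefficient along \<eta> pulls its functional back to zero.\<close>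

lemma Phi_inj: "inj_on \<Phi> (carrier Q)"
proof (rule inj_onI)
  fix x y assume x: "x \<in> carrier Q" and y: "y \<in> carrier Q" and eq: "\<Phi> x = \<Phi> y"
  have z: "x \<ominus>\<^bsub>Q\<^esub> y \<in> carrier Q" using x y Q_kspace by simp
  have P0: "\<Phi> (x \<ominus>\<^bsub>Q\<^esub> y) = \<zero>\<^bsub>H\<^esub>"
    using add_hom_minus[OF Q_kspace H Phi_add_hom x y] add_homD(1)[OF Phi_add_hom y] H eq by simp
  obtain V v u where V: "V \<in> Reps" "v \<in> carrier V" "u \<in> carrier (dual_space V)" and xy: "x \<ominus>\<^bsub>Q\<^esub> y = rep_coeff0 H V v u"
    using coeff_single[OF z] by (elim bexE)
  note R = RepD[OF V(1)]
  have sl: "slice V H u (coact V v) = \<zero>\<^bsub>H\<^esub>"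
    using P0 Phi_coeff[OF V] by (simp add: xy matrix_coeff_slice)
  have u: "functional V u" using V(3) by simp
  obtain C c \<eta> where C: "C \<in> Reps" "c \<in> carrier C" "comod_hom C (coact C) V (coact V) \<eta>" "\<eta> c = v"
    "\<And>u y. functional V u \<Longrightarrow> slice V H u (coact V v) = \<zero>\<^bsub>H\<^esub> \<Longrightarrow> y \<in> carrier C \<Longrightarrow> u (\<eta> y) = 0"
    by (rule finite_subrep[OF R(5) V(2)]) (rule that)
  note RC = RepD[OF C(1)]
  have "rep_coeff0 H V v u = rep_coeff0 H C c (\<lambda>y\<in>carrier C. u (\<eta> y))"
    using coeff_rel[OF C(1) V(1) C(3,2) V(3)] C(4) by simp
  also have "(\<lambda>y\<in>carrier C. u (\<eta> y)) = \<zero>\<^bsub>dual_space C\<^esub>"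
    using C(5)[OF u sl] by (auto intro!: restrict_ext)
  also have "rep_coeff0 H C c \<zero>\<^bsub>dual_space C\<^esub> = \<zero>\<^bsub>Q\<^esub>"
    by (rule balanced_zero_right[OF RC(2,3) Q_kspace bilinear_balanced[OF coeff_bilinear[OF C(1)]] C(2)])
  finally show "x = y" using xy x y Q_kspace by (simp add: ks_minus_eq_zero)
qed

text \<open>By the counit axiom h is the contraction of \<Delta>(h) with \<epsilon>. Since \<eta> is
  a comodule map into \<open>H\<close>, this is also the coefficient of c at the functional
  \<epsilon> \<circ> \<eta>.\<close>

lemma Phi_surj: "\<Phi> ` carrier Q = carrier H"
proof
  show "\<Phi> ` carrier Q \<subseteq> carrier H" using add_homD(1)[OF Phi_add_hom] by auto
  show "carrier H \<subseteq> \<Phi> ` carrier Q"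
  proof
    fix h assume h: "h \<in> carrier H"
    obtain C c \<eta> where C: "C \<in> Reps" "c \<in> carrier C" "comod_hom C (coact C) H (comult H) \<eta>" "\<eta> c = h"
      by (rule finite_subrep[OF comodule_self h]) (rule that)
    note RC = RepD[OF C(1)] and cl = comoduleD(2)[OF RC(5)]
    let ?u = "\<lambda>y\<in>carrier C. counit H (\<eta> y)"
    have fu: "functional C (\<lambda>y. counit H (\<eta> y))"
      by (rule lin_hom_comp[OF comod_homD(1)[OF C(3)] counit_functional])
    then have u: "?u \<in> carrier (dual_space C)" using RC(2) by (simp add: functional_restrict)
    have "\<Phi> (rep_coeff0 H C c ?u) = slice C H ?u (coact C c)"
      using Phi_coeff[OF C(1,2) u] by (simp only: matrix_coeff_slice)
    also have "\<dots> = slice C H (\<lambda>y. counit H (\<eta> y)) (coact C c)"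
      by (rule slice_cong[OF RC(2) fu _ lin_homD(1)[OF cl C(2)]]) simp
    also have "\<dots> = slice H H (counit H) (comult H h)"
      using slice_comod_hom[OF RC(2) H cl C(3) counit_functional C(2)] C(4) by simp
    also have "\<dots> = h" using A.counit_left[OF h] by (simp add: slice_def)
    finally show "h \<in> \<Phi> ` carrier Q" using coeff_closed[OF C(1,2) u] by (intro image_eqI) auto
  qed
qed

end

lemma ks_finsum_Times:
  assumes V: "kspace V" and A: "finite A" and B: "finite B"
    and f: "\<And>a b. a \<in> A \<Longrightarrow> b \<in> B \<Longrightarrow> f (a, b) \<in> carrier V"
  shows "finsum V f (A \<times> B) = (\<Oplus>\<^bsub>V\<^esub>a\<in>A. \<Oplus>\<^bsub>V\<^esub>b\<in>B. f (a, b))"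
  using A f
proof (induction A rule: finite_induct)
  case empty
  then show ?case using V by simp
next
  case (insert a A)
  have 1: "finsum V f (Pair a ` B) = (\<Oplus>\<^bsub>V\<^esub>b\<in>B. f (a, b))"
    by (rule ks_finsum_reindex[OF V]) (use insert.prems in \<open>auto simp: inj_on_def\<close>)
  have "insert a A \<times> B = Pair a ` B \<union> A \<times> B" by auto
  then have "finsum V f (insert a A \<times> B) = finsum V f (Pair a ` B \<union> A \<times> B)" by simp
  also have "\<dots> = finsum V f (Pair a ` B) \<oplus>\<^bsub>V\<^esub> finsum V f (A \<times> B)"
    by (rule ks_finsum_Un_disjoint[OF V]) (use insert B in auto)
  also have "\<dots> = (\<Oplus>\<^bsub>V\<^esub>b\<in>B. f (a, b)) \<oplus>\<^bsub>V\<^esub> (\<Oplus>\<^bsub>V\<^esub>a\<in>A. \<Oplus>\<^bsub>V\<^esub>b\<in>B. f (a, b))"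
    using insert 1 by simp
  also have "\<dots> = (\<Oplus>\<^bsub>V\<^esub>a\<in>insert a A. \<Oplus>\<^bsub>V\<^esub>b\<in>B. f (a, b))"
    by (rule ks_finsum_insert[OF V, symmetric]) (use insert V in \<open>auto intro!: ks_finsum_closed\<close>)
  finally show ?case .
qed

text \<open>Spanning expressed by subspaces, which suits induction over tensors better than explicit
  coefficients do.\<close>

lemma spansI:
  assumes V: "kspace V" and I: "finite I" "\<And>i. i \<in> I \<Longrightarrow> e i \<in> carrier V"
    and U: "\<And>U v. ksub V U \<Longrightarrow> (\<And>i. i \<in> I \<Longrightarrow> e i \<in> U) \<Longrightarrow> v \<in> carrier V \<Longrightarrow> v \<in> U"
  shows "spans V I e"
  unfolding spans_def
proof (intro conjI ballI I)
  let ?U = "{\<Oplus>\<^bsub>V\<^esub>i\<in>I. c i \<odot>\<^bsub>V\<^esub> e i |c. True}"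
  fix v assume v: "v \<in> carrier V"
  have "e j \<in> ?U" if j: "j \<in> I" for j
  proof -
    have "e j = (\<Oplus>\<^bsub>V\<^esub>i\<in>I. (if i = j then 1 else 0) \<odot>\<^bsub>V\<^esub> e i)"
      using V I j by (subst ks_finsum_delta[of V _ j]) auto
    then show ?thesis by (intro CollectI exI[of _ "\<lambda>i. if i = j then 1 else 0"]) simp
  qed
  from U[OF ksub_combinations[OF V I] this v] have "v \<in> ?U" by simp
  then show "\<exists>c. v = (\<Oplus>\<^bsub>V\<^esub>i\<in>I. c i \<odot>\<^bsub>V\<^esub> e i)" by (elim CollectE exE conjE) (rule exI)
qed

lemma spans_ksub:
  assumes V: "kspace V" and s: "spans V I e" and U: "ksub V U" "\<And>i. i \<in> I \<Longrightarrow> e i \<in> U" and v: "v \<in> carrier V"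
  shows "v \<in> U"
proof -
  obtain c where c: "v = (\<Oplus>\<^bsub>V\<^esub>i\<in>I. c i \<odot>\<^bsub>V\<^esub> e i)" using spansE[OF s v] .
  show ?thesis unfolding c by (rule ksub_finsum[OF V U(1)]) (use U in \<open>simp add: ksub_def\<close>)
qed

lemma ksub_preimage:
  assumes V: "kspace V" and W: "kspace W" and U: "ksub W U" and f: "lin_hom V W f"
  shows "ksub V {v \<in> carrier V. f v \<in> U}"
  using U V lin_homD[OF f] add_hom_zero[OF V W lin_homD(4)[OF f]] by (simp add: ksub_def subset_iff)

section \<open>The algebra H \<otimes> H and the coinverse of a matrix\<close>

context dhopf
begin

abbreviation HH_mult (infixl \<open>\<star>\<close> 70) where "x \<star> y \<equiv> x \<otimes>\<^bsub>tensor_dalg H H\<^esub> y"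

lemmas HH_mult_tens = tensor_mult_tens[OF H H mult_bilinear mult_bilinear]
lemmas HH_mult_left = lin_homD(4)[OF tensor_mult_hom_left[OF H H mult_bilinear mult_bilinear]]
lemmas HH_mult_right = tensor_mult_hom_right[OF H H mult_bilinear mult_bilinear]

lemma HH_mult_closed: "x \<in> carrier (tensor H H) \<Longrightarrow> y \<in> carrier (tensor H H) \<Longrightarrow> x \<star> y \<in> carrier (tensor H H)"
  by (rule add_homD(1)[OF HH_mult_left])

lemma HH_mult_assoc:
  assumes x: "x \<in> carrier (tensor H H)" and y: "y \<in> carrier (tensor H H)" and z: "z \<in> carrier (tensor H H)"
  shows "(x \<star> y) \<star> z = x \<star> (y \<star> z)"
  using x
proof (induction rule: tensor_induct[OF H H, consumes 1])
  case (1 a b)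
  have ab: "tens H H a b \<in> carrier (tensor H H)" using 1 H by simp
  show ?case
    using y
  proof (induction rule: tensor_induct[OF H H, consumes 1])
    case (1 c d)
    note cd = 1
    have cd': "tens H H c d \<in> carrier (tensor H H)" using 1 H by simp
    show ?case
      using z
    proof (induction rule: tensor_induct[OF H H, consumes 1])
      case (1 e f)
      then show ?case using cd \<open>a \<in> carrier H\<close> \<open>b \<in> carrier H\<close> by (simp add: HH_mult_tens A.m_assoc)
    next
      case (2 p q)
      then show ?case
        using ab cd' HH by (simp add: HH_mult_closed add_homD(2)[OF HH_mult_right])
    qed
  next
    case (2 p q)
    then show ?case
      using ab z HH by (simp add: HH_mult_closed add_homD(2)[OF HH_mult_right] add_homD(2)[OF HH_mult_left])
  qed
next
  case (2 p q)
  then show ?case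
    using y z HH by (simp add: HH_mult_closed add_homD(2)[OF HH_mult_left])
qed

lemma HH_one:
  assumes x: "x \<in> carrier (tensor H H)"
  shows "tens H H \<one>\<^bsub>H\<^esub> \<one>\<^bsub>H\<^esub> \<star> x = x" "x \<star> tens H H \<one>\<^bsub>H\<^esub> \<one>\<^bsub>H\<^esub> = x"
proof -
  have o: "tens H H \<one>\<^bsub>H\<^esub> \<one>\<^bsub>H\<^esub> \<in> carrier (tensor H H)" using H by simp
  show "tens H H \<one>\<^bsub>H\<^esub> \<one>\<^bsub>H\<^esub> \<star> x = x"
    using x by (induction rule: tensor_induct[OF H H, consumes 1])
      (simp_all add: HH_mult_tens add_homD(2)[OF HH_mult_right[OF o]])
  show "x \<star> tens H H \<one>\<^bsub>H\<^esub> \<one>\<^bsub>H\<^esub> = x"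
    using x by (induction rule: tensor_induct[OF H H, consumes 1])
      (simp_all add: HH_mult_tens add_homD(2)[OF HH_mult_left[OF o]])
qed

lemma mult_add_hom: "x \<in> carrier H \<Longrightarrow> add_hom H H (\<lambda>y. x \<otimes>\<^bsub>H\<^esub> y)" "x \<in> carrier H \<Longrightarrow> add_hom H H (\<lambda>y. y \<otimes>\<^bsub>H\<^esub> x)"
  by (rule add_homI; simp add: A.r_distr A.l_distr)+

lemma coinv_bilinear:
  "bilinear H H H (\<lambda>a b. coinv H a \<otimes>\<^bsub>H\<^esub> b)" "bilinear H H H (\<lambda>a b. a \<otimes>\<^bsub>H\<^esub> coinv H b)"
  by (rule bilinearI; simp add: lin_homD(1-3)[OF coinv_lin_hom] A.r_distr A.l_distr A.smult_assoc2 mult_smult_right)+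

text \<open>The matrix \<open>m\<close> is invertible with inverse \<open>coinv \<circ> m\<close>, so that the image of \<open>coinv \<circ> m\<close> under the
  algebra homomorphism \<open>comult\<close> is the inverse of the image of \<open>m\<close>.\<close>

lemma coinv_matrix:
  assumes I: "finite I" and m: "\<And>i j. i \<in> I \<Longrightarrow> j \<in> I \<Longrightarrow> m i j \<in> carrier H"
    and co: "\<And>i j. i \<in> I \<Longrightarrow> j \<in> I \<Longrightarrow> comult H (m i j) = (\<Oplus>\<^bsub>tensor H H\<^esub>k\<in>I. tens H H (m i k) (m k j))"
    and cu: "\<And>i j. i \<in> I \<Longrightarrow> j \<in> I \<Longrightarrow> counit H (m i j) = (if i = j then 1 else 0)"
    and i: "i \<in> I" and p: "p \<in> I"
  shows "comult H (coinv H (m i p)) = (\<Oplus>\<^bsub>tensor H H\<^esub>k\<in>I. tens H H (coinv H (m k p)) (coinv H (m i k)))"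
    and "counit H (coinv H (m i p)) = (if i = p then 1 else 0)"
proof -
  let ?T = "tensor H H" and ?S = "\<lambda>i j. coinv H (m i j)" and ?one = "tens H H \<one>\<^bsub>H\<^esub> \<one>\<^bsub>H\<^esub>"
  let ?d = "\<lambda>i j. (if i = j then \<one>\<^bsub>H\<^esub> else \<zero>\<^bsub>H\<^esub>)"
  have S: "?S i j \<in> carrier H" if "i \<in> I" "j \<in> I" for i j using lin_homD(1)[OF coinv_lin_hom m[OF that]] .
  have d: "?d i j \<in> carrier H" for i j using H by simp
  have cd: "counit H (m i j) \<odot>\<^bsub>H\<^esub> \<one>\<^bsub>H\<^esub> = ?d i j" if "i \<in> I" "j \<in> I" for i j
    using H by (simp add: cu[OF that])
  note te = tensor_ext_add_hom[OF H H H bilinear_balanced[OF coinv_bilinear(1)]]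
    tensor_ext_add_hom[OF H H H bilinear_balanced[OF coinv_bilinear(2)]]
  note tt = tensor_ext_tens[OF H H H bilinear_balanced[OF coinv_bilinear(1)]]
    tensor_ext_tens[OF H H H bilinear_balanced[OF coinv_bilinear(2)]]
  \<comment> \<open>Written for the entries of m, the two coinverse axioms are the matrix identities
    S(m) m = 1 and, next, m S(m) = 1.\<close>
  have Sm: "(\<Oplus>\<^bsub>H\<^esub>k\<in>I. ?S i k \<otimes>\<^bsub>H\<^esub> m k j) = ?d i j" if ij: "i \<in> I" "j \<in> I" for i j
  proof -
    have "?d i j = tensor_ext H H H (\<lambda>a b. coinv H a \<otimes>\<^bsub>H\<^esub> b) (\<Oplus>\<^bsub>?T\<^esub>k\<in>I. tens H H (m i k) (m k j))"
      using A.coinv_left[OF m[OF ij]] by (simp only: co[OF ij] cd[OF ij])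
    also have "\<dots> = (\<Oplus>\<^bsub>H\<^esub>k\<in>I. tensor_ext H H H (\<lambda>a b. coinv H a \<otimes>\<^bsub>H\<^esub> b) (tens H H (m i k) (m k j)))"
      by (rule add_hom_finsum[OF HH H te(1)]) (use m ij H in simp)
    also have "\<dots> = (\<Oplus>\<^bsub>H\<^esub>k\<in>I. ?S i k \<otimes>\<^bsub>H\<^esub> m k j)"
      by (rule ks_finsum_cong[OF H refl]) (use m S ij in \<open>simp_all add: tt\<close>)
    finally show ?thesis by simp
  qed
  have mS: "(\<Oplus>\<^bsub>H\<^esub>k\<in>I. m i k \<otimes>\<^bsub>H\<^esub> ?S k j) = ?d i j" if ij: "i \<in> I" "j \<in> I" for i j
  proof -
    have "?d i j = tensor_ext H H H (\<lambda>a b. a \<otimes>\<^bsub>H\<^esub> coinv H b) (\<Oplus>\<^bsub>?T\<^esub>k\<in>I. tens H H (m i k) (m k j))"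
      using A.coinv_right[OF m[OF ij]] by (simp only: co[OF ij] cd[OF ij])
    also have "\<dots> = (\<Oplus>\<^bsub>H\<^esub>k\<in>I. tensor_ext H H H (\<lambda>a b. a \<otimes>\<^bsub>H\<^esub> coinv H b) (tens H H (m i k) (m k j)))"
      by (rule add_hom_finsum[OF HH H te(2)]) (use m ij H in simp)
    also have "\<dots> = (\<Oplus>\<^bsub>H\<^esub>k\<in>I. m i k \<otimes>\<^bsub>H\<^esub> ?S k j)"
      by (rule ks_finsum_cong[OF H refl]) (use m S ij in \<open>simp_all add: tt\<close>)
    finally show ?thesis by simp
  qed
  have c0: "counit H \<zero>\<^bsub>H\<^esub> = 0"
    using add_hom_zero[OF H kspace_field_space lin_homD(4)[OF counit_functional]] by simp
  show "counit H (?S i p) = (if i = p then 1 else 0)"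
  proof -
    have "counit H (\<Oplus>\<^bsub>H\<^esub>k\<in>I. ?S i k \<otimes>\<^bsub>H\<^esub> m k p) = (\<Sum>k\<in>I. counit H (?S i k \<otimes>\<^bsub>H\<^esub> m k p))"
      by (rule functional_finsum[OF H counit_functional]) (use S m i p in simp)
    also have "\<dots> = (\<Sum>k\<in>I. if k = p then counit H (?S i k) else 0)"
      by (rule sum.cong) (use S m i p in \<open>simp_all add: counit_mult cu\<close>)
    also have "\<dots> = counit H (?S i p)" using I p by simp
    finally have "counit H (?d i p) = counit H (?S i p)" by (simp only: Sm[OF i p])
    then show ?thesis by (cases "i = p") (simp_all add: counit_one c0)
  qed
  \<comment> \<open>X and Y are the images of m and S(m) under the comultiplication. Z is the
    asserted value of Y, with the order of the tensor factors reversed.\<close>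
  define X where "X j l = comult H (m j l)" for j l
  define Y where "Y i j = comult H (?S i j)" for i j
  define Z where "Z l p = (\<Oplus>\<^bsub>?T\<^esub>k\<in>I. tens H H (?S k p) (?S l k))" for l p
  let ?D = "\<lambda>i j. (if i = j then ?one else \<zero>\<^bsub>?T\<^esub>)"
  have oT: "?one \<in> carrier ?T" using H by simp
  have DT: "?D i j \<in> carrier ?T" for i j using oT HH by simp
  have XT: "X j l \<in> carrier ?T" if "j \<in> I" "l \<in> I" for j l unfolding X_def using lin_homD(1)[OF comult_hom m[OF that]] .
  have YT: "Y j l \<in> carrier ?T" if "j \<in> I" "l \<in> I" for j l unfolding Y_def using lin_homD(1)[OF comult_hom S[OF that]] .
  have ZT: "Z j l \<in> carrier ?T" if "j \<in> I" "l \<in> I" for j l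
    unfolding Z_def by (rule ks_finsum_closed[OF HH]) (use S that H in simp)
  have z0: "comult H \<zero>\<^bsub>H\<^esub> = \<zero>\<^bsub>?T\<^esub>" by (rule add_hom_zero[OF H HH lin_homD(4)[OF comult_hom]])
  have YX: "(\<Oplus>\<^bsub>?T\<^esub>j\<in>I. Y i j \<star> X j l) = ?D i l" if il: "i \<in> I" "l \<in> I" for i l
  proof -
    have "(\<Oplus>\<^bsub>?T\<^esub>j\<in>I. Y i j \<star> X j l) = (\<Oplus>\<^bsub>?T\<^esub>j\<in>I. comult H (?S i j \<otimes>\<^bsub>H\<^esub> m j l))"
      by (rule ks_finsum_cong[OF HH refl])
         (use S m il lin_homD(1)[OF comult_hom] in \<open>simp_all add: comult_mult[symmetric] X_def Y_def\<close>)
    also have "\<dots> = comult H (\<Oplus>\<^bsub>H\<^esub>j\<in>I. ?S i j \<otimes>\<^bsub>H\<^esub> m j l)"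
      by (rule add_hom_finsum[OF H HH lin_homD(4)[OF comult_hom], symmetric]) (use S m il in simp)
    also have "\<dots> = ?D i l" by (simp add: Sm[OF il] comult_one z0)
    finally show ?thesis .
  qed
  have XZ: "(\<Oplus>\<^bsub>?T\<^esub>l\<in>I. X j l \<star> Z l p) = ?D j p" if jp: "j \<in> I" "p \<in> I" for j p
  proof -
    let ?a = "\<lambda>q k. m j q \<otimes>\<^bsub>H\<^esub> ?S k p" and ?b = "\<lambda>q l k. m q l \<otimes>\<^bsub>H\<^esub> ?S l k"
    have "X j l \<star> Z l p = (\<Oplus>\<^bsub>?T\<^esub>q\<in>I. \<Oplus>\<^bsub>?T\<^esub>k\<in>I. tens H H (?a q k) (?b q l k))" if l: "l \<in> I" for l
    proof -
      have "X j l \<star> Z l p = (\<Oplus>\<^bsub>?T\<^esub>q\<in>I. tens H H (m j q) (m q l) \<star> Z l p)"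
        unfolding X_def co[OF jp(1) l]
        by (rule add_hom_finsum[OF HH HH HH_mult_left[OF ZT[OF l jp(2)]]]) (use m jp l H in simp)
      also have "\<dots> = (\<Oplus>\<^bsub>?T\<^esub>q\<in>I. \<Oplus>\<^bsub>?T\<^esub>k\<in>I. tens H H (?a q k) (?b q l k))"
      proof (rule ks_finsum_cong[OF HH refl])
        fix q assume q: "q \<in> I"
        have t: "tens H H (m j q) (m q l) \<in> carrier ?T" using m jp l q H by simp
        have "tens H H (m j q) (m q l) \<star> Z l p = (\<Oplus>\<^bsub>?T\<^esub>k\<in>I. tens H H (m j q) (m q l) \<star> tens H H (?S k p) (?S l k))"
          unfolding Z_def by (rule add_hom_finsum[OF HH HH HH_mult_right[OF t]]) (use S jp l H in simp)
        also have "\<dots> = (\<Oplus>\<^bsub>?T\<^esub>k\<in>I. tens H H (?a q k) (?b q l k))"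
          by (rule ks_finsum_cong[OF HH refl]) (use S m jp l q H in \<open>simp_all add: HH_mult_tens\<close>)
        finally show "tens H H (m j q) (m q l) \<star> Z l p = (\<Oplus>\<^bsub>?T\<^esub>k\<in>I. tens H H (?a q k) (?b q l k))" .
        show "(\<Oplus>\<^bsub>?T\<^esub>k\<in>I. tens H H (?a q k) (?b q l k)) \<in> carrier ?T"
          by (rule ks_finsum_closed[OF HH]) (use S m jp l q H in simp)
      qed
      finally show ?thesis .
    qed
    then have "(\<Oplus>\<^bsub>?T\<^esub>l\<in>I. X j l \<star> Z l p) = (\<Oplus>\<^bsub>?T\<^esub>l\<in>I. \<Oplus>\<^bsub>?T\<^esub>q\<in>I. \<Oplus>\<^bsub>?T\<^esub>k\<in>I. tens H H (?a q k) (?b q l k))"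
      by (intro ks_finsum_cong[OF HH refl]) (use S m jp H HH in \<open>simp_all\<close>)
    \<comment> \<open>With the sum over l innermost, m S(m) = 1 reduces the right factor to
      \<delta>_qk. This leaves k = q, and the sum over q reduces the left factor to
      \<delta>_jp.\<close>
    also have "\<dots> = (\<Oplus>\<^bsub>?T\<^esub>q\<in>I. \<Oplus>\<^bsub>?T\<^esub>l\<in>I. \<Oplus>\<^bsub>?T\<^esub>k\<in>I. tens H H (?a q k) (?b q l k))"
      by (rule ks_finsum_swap[OF HH I I]) (use S m jp H HH in simp)
    also have "\<dots> = (\<Oplus>\<^bsub>?T\<^esub>q\<in>I. tens H H (?a q q) \<one>\<^bsub>H\<^esub>)"
    proof (rule ks_finsum_cong[OF HH refl])
      fix q assume q: "q \<in> I"
      have "(\<Oplus>\<^bsub>?T\<^esub>l\<in>I. \<Oplus>\<^bsub>?T\<^esub>k\<in>I. tens H H (?a q k) (?b q l k)) = (\<Oplus>\<^bsub>?T\<^esub>k\<in>I. \<Oplus>\<^bsub>?T\<^esub>l\<in>I. tens H H (?a q k) (?b q l k))"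
        by (rule ks_finsum_swap[OF HH I I]) (use S m jp q H in simp)
      also have "\<dots> = (\<Oplus>\<^bsub>?T\<^esub>k\<in>I. tens H H (?a q k) (?d q k))"
      proof (rule ks_finsum_cong[OF HH refl])
        fix k assume k: "k \<in> I"
        have a: "?a q k \<in> carrier H" using m S jp q k by simp
        have "(\<Oplus>\<^bsub>?T\<^esub>l\<in>I. tens H H (?a q k) (?b q l k)) = tens H H (?a q k) (\<Oplus>\<^bsub>H\<^esub>l\<in>I. ?b q l k)"
          by (rule add_hom_finsum[OF H HH lin_homD(4)[OF tens_hom_right[OF H H a]], symmetric]) (use m S q k in simp)
        then show "(\<Oplus>\<^bsub>?T\<^esub>l\<in>I. tens H H (?a q k) (?b q l k)) = tens H H (?a q k) (?d q k)"
          using mS[OF q k] by simp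
        show "tens H H (?a q k) (?d q k) \<in> carrier ?T" using a d H by simp
      qed
      also have "\<dots> = tens H H (?a q q) (?d q q)"
      proof (rule ks_finsum_delta[OF HH I q])
        have a: "?a q k \<in> carrier H" if "k \<in> I" for k using m S jp q that by simp
        show "tens H H (?a q q) (?d q q) \<in> carrier ?T" using a[OF q] H by simp
        show "tens H H (?a q k) (?d q k) = \<zero>\<^bsub>?T\<^esub>" if "k \<in> I" "k \<noteq> q" for k
          using that add_hom_zero[OF H HH lin_homD(4)[OF tens_hom_right[OF H H a[OF that(1)]]]] by auto
      qed
      finally show "(\<Oplus>\<^bsub>?T\<^esub>l\<in>I. \<Oplus>\<^bsub>?T\<^esub>k\<in>I. tens H H (?a q k) (?b q l k)) = tens H H (?a q q) \<one>\<^bsub>H\<^esub>" by simp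
      show "tens H H (?a q q) \<one>\<^bsub>H\<^esub> \<in> carrier ?T" using m S jp q H by simp
    qed
    also have "\<dots> = tens H H (\<Oplus>\<^bsub>H\<^esub>q\<in>I. ?a q q) \<one>\<^bsub>H\<^esub>"
      by (rule add_hom_finsum[OF H HH lin_homD(4)[OF tens_hom_left[OF H H A.one_closed]], symmetric]) (use m S jp in simp)
    also have "\<dots> = ?D j p"
      using mS[OF jp] add_hom_zero[OF H HH lin_homD(4)[OF tens_hom_left[OF H H A.one_closed]]] by simp
    finally show ?thesis .
  qed
  \<comment> \<open>As matrices over H \<otimes> H: Y = Y (X Z) = (Y X) Z = Z.\<close>
  have "Y i p = (\<Oplus>\<^bsub>?T\<^esub>j\<in>I. Y i j \<star> ?D j p)"
  proof (rule ks_finsum_delta[OF HH I p, THEN trans, symmetric])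
    show "Y i p \<star> ?D p p \<in> carrier ?T" using HH_mult_closed[OF YT[OF i p] DT] .
    show "Y i j \<star> ?D j p = \<zero>\<^bsub>?T\<^esub>" if "j \<in> I" "j \<noteq> p" for j
      using that add_hom_zero[OF HH HH HH_mult_right[OF YT[OF i that(1)]]] by simp
    show "Y i p \<star> ?D p p = Y i p" using HH_one(2)[OF YT[OF i p]] by simp
  qed
  also have "\<dots> = (\<Oplus>\<^bsub>?T\<^esub>j\<in>I. \<Oplus>\<^bsub>?T\<^esub>l\<in>I. (Y i j \<star> X j l) \<star> Z l p)"
  proof (rule ks_finsum_cong[OF HH refl])
    fix j assume j: "j \<in> I"
    have "Y i j \<star> ?D j p = (\<Oplus>\<^bsub>?T\<^esub>l\<in>I. Y i j \<star> (X j l \<star> Z l p))"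
      unfolding XZ[OF j p, symmetric]
      by (rule add_hom_finsum[OF HH HH HH_mult_right[OF YT[OF i j]]]) (use XT ZT j p in \<open>simp add: HH_mult_closed\<close>)
    also have "\<dots> = (\<Oplus>\<^bsub>?T\<^esub>l\<in>I. (Y i j \<star> X j l) \<star> Z l p)"
      by (rule ks_finsum_cong[OF HH refl]) (use XT YT ZT i j p in \<open>simp_all add: HH_mult_assoc HH_mult_closed\<close>)
    finally show "Y i j \<star> ?D j p = (\<Oplus>\<^bsub>?T\<^esub>l\<in>I. (Y i j \<star> X j l) \<star> Z l p)" .
    show "(\<Oplus>\<^bsub>?T\<^esub>l\<in>I. (Y i j \<star> X j l) \<star> Z l p) \<in> carrier ?T"
      by (rule ks_finsum_closed[OF HH]) (use XT YT ZT i j p in \<open>simp add: HH_mult_closed\<close>)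
  qed
  also have "\<dots> = (\<Oplus>\<^bsub>?T\<^esub>l\<in>I. \<Oplus>\<^bsub>?T\<^esub>j\<in>I. (Y i j \<star> X j l) \<star> Z l p)"
    by (rule ks_finsum_swap[OF HH I I]) (use XT YT ZT i p in \<open>simp add: HH_mult_closed\<close>)
  also have "\<dots> = (\<Oplus>\<^bsub>?T\<^esub>l\<in>I. ?D i l \<star> Z l p)"
  proof (rule ks_finsum_cong[OF HH refl])
    fix l assume l: "l \<in> I"
    have "(\<Oplus>\<^bsub>?T\<^esub>j\<in>I. (Y i j \<star> X j l) \<star> Z l p) = (\<Oplus>\<^bsub>?T\<^esub>j\<in>I. Y i j \<star> X j l) \<star> Z l p"
      by (rule add_hom_finsum[OF HH HH HH_mult_left[OF ZT[OF l p]], symmetric]) (use XT YT i l in \<open>simp add: HH_mult_closed\<close>)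
    then show "(\<Oplus>\<^bsub>?T\<^esub>j\<in>I. (Y i j \<star> X j l) \<star> Z l p) = ?D i l \<star> Z l p" using YX[OF i l] by simp
    show "?D i l \<star> Z l p \<in> carrier ?T" using HH_mult_closed[OF DT ZT[OF l p]] .
  qed
  also have "\<dots> = Z i p"
  proof (rule ks_finsum_delta[OF HH I i, THEN trans])
    show "?D i i \<star> Z i p \<in> carrier ?T" using HH_mult_closed[OF DT ZT[OF i p]] .
    show "?D i l \<star> Z l p = \<zero>\<^bsub>?T\<^esub>" if "l \<in> I" "l \<noteq> i" for l
      using that add_hom_zero[OF HH HH HH_mult_left[OF ZT[OF that(1) p]]] by simp
    show "?D i i \<star> Z i p = Z i p" using HH_one(1)[OF ZT[OF i p]] by simp
  qed
  finally show "comult H (?S i p) = (\<Oplus>\<^bsub>?T\<^esub>k\<in>I. tens H H (?S k p) (?S i k))"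
    by (simp only: Y_def Z_def)
qed

end

context rep_hopf
begin

text \<open>The common last step for the trivial representation, tensor products, duals and
  prolongations: finite dimension and the comodule axioms both follow from a spanning family with
  its matrix.\<close>

lemma diff_rep_mk_comod:
  assumes M: "kspace M" and \<rho>: "lin_hom M (tensor M H) \<rho>" and s: "spans M I e" and m: "matrix_comodule M \<rho> I e a"
  shows "diff_rep H (mk_comod M \<rho>)"
  using comoduleI_matrix[OF M \<rho> s m] s by (intro diff_repI[of _ I e]) simp_all

lemma diff_rep_matrix:
  assumes "diff_rep H V"
  defines "m \<equiv> \<lambda>i j. matrix_coeff H V j (dual_vec V (some_basis V) i)"
  shows "matrix_comodule V (coact V) (some_basis V) (\<lambda>b. b) m"
  using comodule_matrix[OF diff_rep_comodule(1,5)[OF assms(1)]] by (simp add: m_def matrix_coeff_slice)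

lemma trivial_rep:
  "diff_rep H (trivial_rep H)" "matrix_coeff H (trivial_rep H) 1 id = \<one>\<^bsub>H\<^esub>" "functional (trivial_rep H) id"
proof -
  let ?K = "field_space :: ('k, 'k) module"
  have K: "kspace ?K" and KH: "kspace (tensor ?K H)" using H by simp_all
  have s: "spans ?K {()} (\<lambda>_. 1)"
    by (rule spansI[OF K]) (auto simp: ksub_def dest!: spec[of _ "_ :: 'k"])
  have m: "matrix_comodule ?K (\<lambda>c. tens ?K H c \<one>\<^bsub>H\<^esub>) {()} (\<lambda>_. 1) (\<lambda>_ _. \<one>\<^bsub>H\<^esub>)"
    unfolding matrix_comodule_def using K H KH HH by (simp add: ks_finsum_insert comult_one counit_one)
  show "diff_rep H (trivial_rep H)"
    unfolding trivial_rep_def by (rule diff_rep_mk_comod[OF K tens_hom_left[OF K H A.one_closed] s m])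
  have i: "functional ?K id" by (rule functionalI) simp_all
  then show "functional (trivial_rep H) id" by (simp add: trivial_rep_def)
  show "matrix_coeff H (trivial_rep H) 1 id = \<one>\<^bsub>H\<^esub>"
    unfolding matrix_coeff_slice trivial_rep_def slice_mk_comod mk_comod_simps
    using H by (subst slice_tens[OF K H i]) simp_all
qed

section \<open>Tensor products of representations\<close>

text \<open>The map from (V \<otimes> H) \<otimes> (W \<otimes> H) to (V \<otimes> W) \<otimes> H
  that multiplies the two components in \<open>H\<close>. The coaction of the tensor product is its
  value at a pair of coactions.\<close>

definition coact_mult ::
  "('k, 'v, 'c) module_scheme \<Rightarrow> ('k, 'w, 'd) module_scheme \<Rightarrow>
   ('k, 'v, 'a) tensor \<Rightarrow> ('k, 'w, 'a) tensor \<Rightarrow> ('k, ('k, 'v, 'w) tensor, 'a) tensor" where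
  "coact_mult V W x y = tensor_ext V H (tensor (tensor V W) H)
     (\<lambda>v' a. tensor_ext W H (tensor (tensor V W) H)
        (\<lambda>w' b. tens (tensor V W) H (tens V W v' w') (a \<otimes>\<^bsub>H\<^esub> b)) y) x"

context
  fixes V :: "('k, 'v, 'c) module_scheme" and W :: "('k, 'w, 'd) module_scheme"
  assumes V: "kspace V" and W: "kspace W"
begin

abbreviation (input) "VWH \<equiv> tensor (tensor V W) H"

lemma VWH: "kspace VWH" and VW: "kspace (tensor V W)"
  using V W H by simp_all

lemma coact_mult_inner:
  assumes "v \<in> carrier V" "a \<in> carrier H"
  shows "bilinear W H VWH (\<lambda>w b. tens (tensor V W) H (tens V W v w) (a \<otimes>\<^bsub>H\<^esub> b))"
  by (rule bilinearI)
     (use assms V W H VW in \<open>simp_all add: tens_add_left tens_add_right tens_smult_left tens_smult_right A.r_distr mult_smult_right\<close>)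

lemma coact_mult_outer:
  assumes y: "y \<in> carrier (tensor W H)"
  shows "bilinear V H VWH (\<lambda>v a. tensor_ext W H VWH (\<lambda>w b. tens (tensor V W) H (tens V W v w) (a \<otimes>\<^bsub>H\<^esub> b)) y)"
proof -
  let ?f = "\<lambda>v a. tensor_ext W H VWH (\<lambda>w b. tens (tensor V W) H (tens V W v w) (a \<otimes>\<^bsub>H\<^esub> b))"
  note h = tensor_ext_lin_hom[OF W H VWH coact_mult_inner]
  note t = tensor_ext_tens[OF W H VWH bilinear_balanced[OF coact_mult_inner]]
  have 1: "?f (v \<oplus>\<^bsub>V\<^esub> v') a y = ?f v a y \<oplus>\<^bsub>VWH\<^esub> ?f v' a y"
    if "v \<in> carrier V" "v' \<in> carrier V" "a \<in> carrier H" for v v' a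
    using y by (induction rule: tensor_induct[OF W H, consumes 1])
      (use that V W H VW in \<open>simp_all add: t tens_add_left lin_homD(1,2)[OF h] ks_ac[OF VWH]\<close>)
  have 2: "?f v (a \<oplus>\<^bsub>H\<^esub> b) y = ?f v a y \<oplus>\<^bsub>VWH\<^esub> ?f v b y"
    if "v \<in> carrier V" "b \<in> carrier H" "a \<in> carrier H" for v a b
    using y by (induction rule: tensor_induct[OF W H, consumes 1])
      (use that V W H VW in \<open>simp_all add: t tens_add_right A.l_distr lin_homD(1,2)[OF h] ks_ac[OF VWH]\<close>)
  have 3: "?f (c \<odot>\<^bsub>V\<^esub> v) a y = c \<odot>\<^bsub>VWH\<^esub> ?f v a y" if "v \<in> carrier V" "a \<in> carrier H" for v a c
    using y by (induction rule: tensor_induct[OF W H, consumes 1])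
      (use that V W H VW in \<open>simp_all add: t tens_smult_left lin_homD(1,2)[OF h] ks_smult_rdistr[OF VWH]\<close>)
  have 4: "?f v (c \<odot>\<^bsub>H\<^esub> a) y = c \<odot>\<^bsub>VWH\<^esub> ?f v a y" if "v \<in> carrier V" "a \<in> carrier H" for v a c
    using y by (induction rule: tensor_induct[OF W H, consumes 1])
      (use that V W H VW in \<open>simp_all add: t tens_smult_right A.smult_assoc2 lin_homD(1,2)[OF h] ks_smult_rdistr[OF VWH]\<close>)
  show ?thesis
    by (rule bilinearI) (simp_all add: 1 2 3 4 y lin_homD(1)[OF h])
qed

lemma coact_mult_tens:
  assumes "v \<in> carrier V" "a \<in> carrier H" "w \<in> carrier W" "b \<in> carrier H"
  shows "coact_mult V W (tens V H v a) (tens W H w b) = tens (tensor V W) H (tens V W v w) (a \<otimes>\<^bsub>H\<^esub> b)"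
  using assms V W H unfolding coact_mult_def
  by (subst tensor_ext_tens[OF V H VWH bilinear_balanced[OF coact_mult_outer]];
      (subst tensor_ext_tens[OF W H VWH bilinear_balanced[OF coact_mult_inner]])?) simp_all

lemma coact_mult_left:
  assumes "y \<in> carrier (tensor W H)"
  shows "lin_hom (tensor V H) VWH (\<lambda>x. coact_mult V W x y)"
  unfolding coact_mult_def by (rule tensor_ext_lin_hom[OF V H VWH coact_mult_outer[OF assms]])

lemma coact_mult_right:
  assumes x: "x \<in> carrier (tensor V H)"
  shows "lin_hom (tensor W H) VWH (\<lambda>y. coact_mult V W x y)"
proof (rule lin_homI)
  note h = coact_mult_left
  show "coact_mult V W x y \<in> carrier VWH" if "y \<in> carrier (tensor W H)" for y
    using lin_homD(1)[OF h[OF that] x] .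
  note t = tensor_ext_tens[OF V H VWH bilinear_balanced[OF coact_mult_outer]]
  note i = lin_homD(2,3)[OF tensor_ext_lin_hom[OF W H VWH coact_mult_inner]]
  have WH: "kspace (tensor W H)" using W H by simp
  show "coact_mult V W x (y \<oplus>\<^bsub>tensor W H\<^esub> z) = coact_mult V W x y \<oplus>\<^bsub>VWH\<^esub> coact_mult V W x z"
    if yz: "y \<in> carrier (tensor W H)" "z \<in> carrier (tensor W H)" for y z
    using x
  proof (induction rule: tensor_induct[OF V H, consumes 1])
    case (1 v a)
    then show ?case unfolding coact_mult_def using yz WH by (simp add: t i)
  next
    case (2 p q)
    then show ?case using yz WH VWH by (simp add: lin_homD(1,2)[OF h] ks_ac[OF VWH])
  qed
  show "coact_mult V W x (c \<odot>\<^bsub>tensor W H\<^esub> y) = c \<odot>\<^bsub>VWH\<^esub> coact_mult V W x y" if y: "y \<in> carrier (tensor W H)" for c y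
    using x
  proof (induction rule: tensor_induct[OF V H, consumes 1])
    case (1 v a)
    then show ?case unfolding coact_mult_def using y WH by (simp add: t i)
  next
    case (2 p q)
    then show ?case using y WH VWH by (simp add: lin_homD(1,2)[OF h] ks_smult_rdistr[OF VWH])
  qed
qed

lemma tensor_functional_bilinear:
  "functional V u \<Longrightarrow> functional W t \<Longrightarrow> bilinear V W field_space (\<lambda>v w. u v * t w)"
  by (rule bilinearI) (simp_all add: functionalD algebra_simps)

lemma functional_tensor_functional:
  assumes "functional V u" "functional W t"
  shows "functional (tensor V W) (tensor_functional V W u t)"
  unfolding tensor_functional_def by (rule tensor_ext_lin_hom[OF V W kspace_field_space tensor_functional_bilinear[OF assms]])

text \<open>Contracting V \<otimes> W with u \<otimes> t while the components in \<open>H\<close>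
  are multiplied separates the two factors. At coactions this says that a coefficient of the tensor
  product is the product of the coefficients.\<close>

lemma slice_coact_mult:
  assumes u: "functional V u" and t: "functional W t"
    and x: "x \<in> carrier (tensor V H)" and y: "y \<in> carrier (tensor W H)"
  shows "slice (tensor V W) H (tensor_functional V W u t) (coact_mult V W x y) = slice V H u x \<otimes>\<^bsub>H\<^esub> slice W H t y"
proof -
  note ut = functional_tensor_functional[OF u t]
  note s = slice_lin_hom[OF VW H ut]
  have tf: "tensor_functional V W u t (tens V W v w) = u v * t w" if "v \<in> carrier V" "w \<in> carrier W" for v w
    unfolding tensor_functional_def
    by (rule tensor_ext_tens[OF V W kspace_field_space bilinear_balanced[OF tensor_functional_bilinear[OF u t]] that])
  show ?thesis
    using x
  proof (induction rule: tensor_induct[OF V H, consumes 1])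
    case (1 v a)
    note va = 1
    have va': "tens V H v a \<in> carrier (tensor V H)" using 1 V H by simp
    show ?case
      using y
    proof (induction rule: tensor_induct[OF W H, consumes 1])
      case (1 w b)
      then show ?case
        using va V W H VW u t
        by (simp add: coact_mult_tens slice_tens[OF VW H ut] slice_tens tf A.smult_assoc2 mult_smult_right ks_smult_assoc mult.commute)
    next
      case (2 p q)
      then show ?case
        using va V W H u t
        by (simp add: lin_homD(1,2)[OF coact_mult_right[OF va']] lin_homD(2)[OF s] slice_add slice_closed
            slice_tens A.r_distr)
    qed
  next
    case (2 p q)
    then show ?case
      using V W H u t y
      by (simp add: lin_homD(1,2)[OF coact_mult_left[OF y]] lin_homD(2)[OF s] slice_add slice_closed A.l_distr)
  qed
qed

end

text \<open>In the product basis the matrix is the Kronecker product of the two matrices. Its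
  comultiplication and counit come from the multiplicativity of \<Delta> and \<epsilon>.\<close>

lemma tensor_rep:
  assumes V: "diff_rep H V" and W: "diff_rep H W"
  shows "diff_rep H (tensor_rep H V W)"
    and "functional V u \<Longrightarrow> functional W t \<Longrightarrow> functional (tensor_rep H V W) (tensor_functional V W u t)"
    and "functional V u \<Longrightarrow> functional W t \<Longrightarrow> v \<in> carrier V \<Longrightarrow> w \<in> carrier W \<Longrightarrow>
      matrix_coeff H (tensor_rep H V W) (tens V W v w) (tensor_functional V W u t) =
      matrix_coeff H V v u \<otimes>\<^bsub>H\<^esub> matrix_coeff H W w t"
proof -
  let ?B = "some_basis V" and ?C = "some_basis W" and ?T = "tensor V W"
  note KV = diff_rep_comodule(2)[OF V] and CV = comoduleD(2)[OF diff_rep_comodule(1)[OF V]]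
  note KW = diff_rep_comodule(2)[OF W] and CW = comoduleD(2)[OF diff_rep_comodule(1)[OF W]]
  note T = VW[OF KV KW] and TH = VWH[OF KV KW]
  have VH: "kspace (tensor V H)" and WH: "kspace (tensor W H)" using KV KW H by simp_all
  note cl = coact_mult_left[OF KV KW] and cr = coact_mult_right[OF KV KW] and ct = coact_mult_tens[OF KV KW]
  note vc = lin_homD(1)[OF CV] and wc = lin_homD(1)[OF CW]
  let ?\<beta> = "\<lambda>v w. coact_mult V W (coact V v) (coact W w)"
  have b: "bilinear V W (tensor ?T H) ?\<beta>"
    by (rule bilinearI)
       (simp_all add: vc wc lin_homD(2,3)[OF CV] lin_homD(2,3)[OF CW] lin_homD(1-3)[OF cl] lin_homD(2,3)[OF cr])
  define \<rho> where "\<rho> = tensor_ext V W (tensor ?T H) ?\<beta>"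
  have \<rho>: "lin_hom ?T (tensor ?T H) \<rho>" unfolding \<rho>_def by (rule tensor_ext_lin_hom[OF KV KW TH b])
  have \<rho>t: "\<rho> (tens V W v w) = ?\<beta> v w" if "v \<in> carrier V" "w \<in> carrier W" for v w
    unfolding \<rho>_def by (rule tensor_ext_tens[OF KV KW TH bilinear_balanced[OF b] that])
  have R: "tensor_rep H V W = mk_comod ?T \<rho>"
    by (simp add: tensor_rep_def \<rho>_def coact_mult_def)
  define m where "m i j = matrix_coeff H V j (dual_vec V ?B i)" for i j
  define n where "n i j = matrix_coeff H W j (dual_vec W ?C i)" for i j
  note M = matrix_comoduleD[OF diff_rep_matrix[OF V, folded m_def]]
  note N = matrix_comoduleD[OF diff_rep_matrix[OF W, folded n_def]]
  let ?e = "\<lambda>(b, c). tens V W b c" and ?a = "\<lambda>(b, c) (b', c'). m b b' \<otimes>\<^bsub>H\<^esub> n c c'"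
  have fin: "finite (?B \<times> ?C)" using M(1) N(1) by simp
  have s: "spans ?T (?B \<times> ?C) ?e"
  proof (rule spansI[OF T fin])
    show "?e i \<in> carrier ?T" if "i \<in> ?B \<times> ?C" for i using that KV KW M(2) N(2) by auto
    fix U z assume U: "ksub ?T U" and e: "\<And>i. i \<in> ?B \<times> ?C \<Longrightarrow> ?e i \<in> U" and z: "z \<in> carrier ?T"
    note sV = frame_spans[OF diff_rep_comodule(5)[OF V]] and sW = frame_spans[OF diff_rep_comodule(5)[OF W]]
    show "z \<in> U"
      using z
    proof (induction rule: tensor_induct[OF KV KW, consumes 1])
      case (1 v w)
      \<comment> \<open>One factor is extended at a time: for fixed c the v with v \<otimes> c in
        \<open>U\<close> form a subspace containing a basis, and afterwards the same is done for w
        with v fixed.\<close>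
      have "tens V W v c \<in> U" if c: "c \<in> ?C" for c
      proof -
        have "v \<in> {v \<in> carrier V. tens V W v c \<in> U}"
          by (rule spans_ksub[OF KV sV ksub_preimage[OF KV T U tens_hom_left[OF KV KW N(2)[OF c]]] _ 1(1)])
             (use e[of "(_, c)"] c M(2) in simp)
        then show ?thesis by simp
      qed
      then have "w \<in> {w \<in> carrier W. tens V W v w \<in> U}"
        by (intro spans_ksub[OF KW sW ksub_preimage[OF KW T U tens_hom_right[OF KV KW 1(1)]] _ 1(2)]) (use N(2) in simp)
      then show ?case by simp
    next
      case (2 x y)
      then show ?case using U by (simp add: ksub_def)
    qed
  qed
  have mat: "matrix_comodule ?T \<rho> (?B \<times> ?C) ?e ?a"
    unfolding matrix_comodule_def
  proof (intro conjI ballI fin)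
    show "?e i \<in> carrier ?T" if "i \<in> ?B \<times> ?C" for i using that KV KW M(2) N(2) by auto
    show "?a i j \<in> carrier H" if "i \<in> ?B \<times> ?C" "j \<in> ?B \<times> ?C" for i j using that M(3) N(3) by auto
    show "\<rho> (?e j) = (\<Oplus>\<^bsub>tensor ?T H\<^esub>i\<in>?B \<times> ?C. tens ?T H (?e i) (?a i j))" if j: "j \<in> ?B \<times> ?C" for j
    proof -
      obtain b c where bc: "j = (b, c)" "b \<in> ?B" "c \<in> ?C" using j by auto
      have "\<rho> (?e j) = coact_mult V W (coact V b) (coact W c)" using bc \<rho>t M(2) N(2) by simp
      also have "\<dots> = (\<Oplus>\<^bsub>tensor ?T H\<^esub>i\<in>?B. coact_mult V W (tens V H i (m i b)) (coact W c))"
        unfolding M(4)[OF bc(2)]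
        by (rule add_hom_finsum[OF VH TH lin_homD(4)[OF cl[OF wc[OF N(2)[OF bc(3)]]]]]) (use KV H M bc in simp)
      also have "\<dots> = (\<Oplus>\<^bsub>tensor ?T H\<^esub>i\<in>?B. \<Oplus>\<^bsub>tensor ?T H\<^esub>k\<in>?C. tens ?T H (?e (i, k)) (?a (i, k) j))"
      proof (rule ks_finsum_cong[OF TH refl])
        fix i assume i: "i \<in> ?B"
        have ti: "tens V H i (m i b) \<in> carrier (tensor V H)" using KV H M(2,3) bc i by simp
        have "coact_mult V W (tens V H i (m i b)) (coact W c) =
            (\<Oplus>\<^bsub>tensor ?T H\<^esub>k\<in>?C. coact_mult V W (tens V H i (m i b)) (tens W H k (n k c)))"
          unfolding N(4)[OF bc(3)]
          by (rule add_hom_finsum[OF WH TH lin_homD(4)[OF cr[OF ti]]]) (use KW H N bc in simp)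
        also have "\<dots> = (\<Oplus>\<^bsub>tensor ?T H\<^esub>k\<in>?C. tens ?T H (?e (i, k)) (?a (i, k) j))"
          by (rule ks_finsum_cong[OF TH refl]) (use KV KW H T M(2,3) N(2,3) bc i in \<open>simp_all add: ct\<close>)
        finally show "coact_mult V W (tens V H i (m i b)) (coact W c) =
          (\<Oplus>\<^bsub>tensor ?T H\<^esub>k\<in>?C. tens ?T H (?e (i, k)) (?a (i, k) j))" .
        show "(\<Oplus>\<^bsub>tensor ?T H\<^esub>k\<in>?C. tens ?T H (?e (i, k)) (?a (i, k) j)) \<in> carrier (tensor ?T H)"
          by (rule ks_finsum_closed[OF TH]) (use KV KW H T M(2,3) N(2,3) bc i in simp)
      qed
      also have "\<dots> = (\<Oplus>\<^bsub>tensor ?T H\<^esub>i\<in>?B \<times> ?C. tens ?T H (?e i) (?a i j))"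
        by (rule ks_finsum_Times[OF TH M(1) N(1), symmetric]) (use KV KW H T M(2,3) N(2,3) bc in simp)
      finally show ?thesis .
    qed
    fix i j assume i: "i \<in> ?B \<times> ?C" and j: "j \<in> ?B \<times> ?C"
    obtain b c where bc: "i = (b, c)" "b \<in> ?B" "c \<in> ?C" using i by auto
    obtain b' c' where bc': "j = (b', c')" "b' \<in> ?B" "c' \<in> ?C" using j by auto
    show "counit H (?a i j) = (if i = j then 1 else 0)"
      using bc bc' M(3,6) N(3,6) by (simp add: counit_mult)
    show "comult H (?a i j) = (\<Oplus>\<^bsub>tensor H H\<^esub>k\<in>?B \<times> ?C. tens H H (?a i k) (?a k j))"
    proof -
      have nc: "comult H (n c c') \<in> carrier (tensor H H)"
        using lin_homD(1)[OF comult_hom N(3)[OF bc(3) bc'(3)]] .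
      have "comult H (?a i j) = comult H (m b b') \<star> comult H (n c c')"
        using bc bc' M(3) N(3) by (simp add: comult_mult)
      also have "\<dots> = (\<Oplus>\<^bsub>tensor H H\<^esub>k\<in>?B. tens H H (m b k) (m k b') \<star> comult H (n c c'))"
        unfolding M(5)[OF bc(2) bc'(2)]
        by (rule add_hom_finsum[OF HH HH HH_mult_left[OF nc]]) (use H M(3) bc bc' in simp)
      also have "\<dots> = (\<Oplus>\<^bsub>tensor H H\<^esub>k\<in>?B. \<Oplus>\<^bsub>tensor H H\<^esub>l\<in>?C. tens H H (?a i (k, l)) (?a (k, l) j))"
      proof (rule ks_finsum_cong[OF HH refl])
        fix k assume k: "k \<in> ?B"
        have t: "tens H H (m b k) (m k b') \<in> carrier (tensor H H)" using H M(3) bc bc' k by simp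
        have "tens H H (m b k) (m k b') \<star> comult H (n c c') =
            (\<Oplus>\<^bsub>tensor H H\<^esub>l\<in>?C. tens H H (m b k) (m k b') \<star> tens H H (n c l) (n l c'))"
          unfolding N(5)[OF bc(3) bc'(3)]
          by (rule add_hom_finsum[OF HH HH HH_mult_right[OF t]]) (use H N(3) bc bc' in simp)
        also have "\<dots> = (\<Oplus>\<^bsub>tensor H H\<^esub>l\<in>?C. tens H H (?a i (k, l)) (?a (k, l) j))"
          by (rule ks_finsum_cong[OF HH refl]) (use H M(3) N(3) bc bc' k in \<open>simp_all add: HH_mult_tens\<close>)
        finally show "tens H H (m b k) (m k b') \<star> comult H (n c c') =
          (\<Oplus>\<^bsub>tensor H H\<^esub>l\<in>?C. tens H H (?a i (k, l)) (?a (k, l) j))" .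
        show "(\<Oplus>\<^bsub>tensor H H\<^esub>l\<in>?C. tens H H (?a i (k, l)) (?a (k, l) j)) \<in> carrier (tensor H H)"
          by (rule ks_finsum_closed[OF HH]) (use H M(3) N(3) bc bc' k in simp)
      qed
      also have "\<dots> = (\<Oplus>\<^bsub>tensor H H\<^esub>k\<in>?B \<times> ?C. tens H H (?a i k) (?a k j))"
        by (rule ks_finsum_Times[OF HH M(1) N(1), symmetric]) (use H M(3) N(3) bc bc' in simp)
      finally show ?thesis .
    qed
  qed
  show "diff_rep H (tensor_rep H V W)" unfolding R by (rule diff_rep_mk_comod[OF T \<rho> s mat])
  show "functional (tensor_rep H V W) (tensor_functional V W u t)" if "functional V u" "functional W t"
    using functional_tensor_functional[OF KV KW that] by (simp add: R)
  show "matrix_coeff H (tensor_rep H V W) (tens V W v w) (tensor_functional V W u t) =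
      matrix_coeff H V v u \<otimes>\<^bsub>H\<^esub> matrix_coeff H W w t"
    if "functional V u" "functional W t" "v \<in> carrier V" "w \<in> carrier W"
    using slice_coact_mult[OF KV KW that(1,2) vc[OF that(3)] wc[OF that(4)]] \<rho>t[OF that(3,4)]
    by (simp add: matrix_coeff_slice R)
qed

section \<open>Dual representations\<close>

text \<open>In the dual basis the matrix is the transpose of S(m). By \<open>coinv_matrix\<close>
  the coinverse reverses the order of the factors under \<Delta>, and the transposition restores
  it.\<close>

lemma dual_rep:
  assumes V: "diff_rep H V"
  shows "diff_rep H (dual_rep H V)"
    and "v \<in> carrier V \<Longrightarrow> functional (dual_rep H V) (\<lambda>t\<in>carrier (dual_space V). t v)"
    and "u \<in> carrier (dual_space V) \<Longrightarrow> v \<in> carrier V \<Longrightarrow>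
      matrix_coeff H (dual_rep H V) u (\<lambda>t\<in>carrier (dual_space V). t v) = coinv H (matrix_coeff H V v u)"
proof -
  let ?B = "some_basis V" and ?D = "dual_space V"
  let ?d = "dual_vec V ?B"
  note R = diff_rep_comodule[OF V] and C = comoduleD(2)[OF diff_rep_comodule(1)[OF V]]
  note fr = frameD[OF R(5)]
  have D: "kspace ?D" and DH: "kspace (tensor ?D H)" using R(2) H by simp_all
  have dD: "?d b \<in> carrier ?D" if "b \<in> ?B" for b by (rule frame_some_basis(2)[OF R(3,4) that])
  define m where "m i j = matrix_coeff H V j (?d i)" for i j
  note M = matrix_comoduleD[OF diff_rep_matrix[OF V, folded m_def]]
  note mb = matrix_coeff_bilinear[OF V]
  note mbD = balancedD[OF bilinear_balanced[OF mb]]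
  have mr: "lin_hom ?D H (\<lambda>u. matrix_coeff H V v u)" if "v \<in> carrier V" for v
  proof (rule lin_homI)
    show "matrix_coeff H V v (c \<odot>\<^bsub>?D\<^esub> u) = c \<odot>\<^bsub>H\<^esub> matrix_coeff H V v u" if "u \<in> carrier ?D" for c u
      using mbD(4)[OF \<open>v \<in> carrier V\<close> that, of c] mb \<open>v \<in> carrier V\<close> that unfolding bilinear_def by metis
  qed (use mbD that in \<open>simp_all del: dual_space_simps\<close>)
  have ml: "lin_hom V H (\<lambda>v. matrix_coeff H V v u)" if "u \<in> carrier ?D" for u
    by (rule lin_homI) (use mbD mb that in \<open>simp_all add: bilinear_def del: dual_space_simps\<close>)
  define \<rho> where "\<rho> u = (\<Oplus>\<^bsub>tensor ?D H\<^esub>b\<in>?B. tens ?D H (?d b) (coinv H (matrix_coeff H V b u)))" for u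
  have RD: "dual_rep H V = mk_comod ?D \<rho>" by (simp add: dual_rep_def \<rho>_def[abs_def])
  have h: "lin_hom ?D (tensor ?D H) (\<lambda>u. tens ?D H (?d b) (coinv H (matrix_coeff H V b u)))" if b: "b \<in> ?B" for b
    by (rule lin_hom_comp[OF lin_hom_comp[OF mr[OF M(2)[OF b]] coinv_lin_hom] tens_hom_right[OF D H dD[OF b]]])
  have \<rho>: "lin_hom ?D (tensor ?D H) \<rho>"
  proof (rule lin_homI)
    show "\<rho> u \<in> carrier (tensor ?D H)" if "u \<in> carrier ?D" for u
      unfolding \<rho>_def by (rule ks_finsum_closed[OF DH]) (rule lin_homD(1)[OF h that])
    show "\<rho> (u \<oplus>\<^bsub>?D\<^esub> t) = \<rho> u \<oplus>\<^bsub>tensor ?D H\<^esub> \<rho> t" if "u \<in> carrier ?D" "t \<in> carrier ?D" for u t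
      unfolding \<rho>_def
      by (subst ks_finsum_add[OF DH, symmetric])
         (auto intro!: ks_finsum_cong[OF DH refl] ks_add_closed[OF DH] lin_homD(1)[OF h] that lin_homD(2)[OF h that] simp del: dual_space_simps)
    show "\<rho> (c \<odot>\<^bsub>?D\<^esub> u) = c \<odot>\<^bsub>tensor ?D H\<^esub> \<rho> u" if "u \<in> carrier ?D" for c u
      unfolding \<rho>_def
      by (subst ks_finsum_smult[OF DH M(1)])
         (auto intro!: ks_finsum_cong[OF DH refl] ks_smult_closed[OF DH] lin_homD(1)[OF h] that lin_homD(3)[OF h that] simp del: dual_space_simps)
  qed
  have ev: "functional ?D (\<lambda>t\<in>carrier ?D. t v)" if "v \<in> carrier V" for v
  proof -
    have "functional ?D (\<lambda>t. t v)" by (rule functionalI) (use that in simp_all)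
    then show ?thesis using functional_restrict[OF D] by blast
  qed
  \<comment> \<open>The coordinates of a functional in the dual basis are its values on the basis,
    so the dual basis spans.\<close>
  have expand: "u = (\<Oplus>\<^bsub>?D\<^esub>b\<in>?B. u b \<odot>\<^bsub>?D\<^esub> ?d b)" if u: "u \<in> carrier ?D" for u
  proof -
    let ?s = "\<Oplus>\<^bsub>?D\<^esub>b\<in>?B. u b \<odot>\<^bsub>?D\<^esub> ?d b"
    have s: "?s \<in> carrier ?D" by (rule ks_finsum_closed[OF D]) (rule ks_smult_closed[OF D dD])
    have "?s v = u v" if v: "v \<in> carrier V" for v
    proof (rule spans_hom_eqI[OF R(2) kspace_field_space frame_spans[OF R(5)] _ _ _ v])
      show "functional V ?s" "functional V u" using s u by simp_all
      fix j assume j: "j \<in> ?B"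
      have jV: "j \<in> carrier V" using fr(2)[OF j] by simp
      have "?s j = (\<lambda>t\<in>carrier ?D. t j) ?s" using s by simp
      also have "\<dots> = (\<Sum>b\<in>?B. (\<lambda>t\<in>carrier ?D. t j) (u b \<odot>\<^bsub>?D\<^esub> ?d b))"
        by (rule functional_finsum[OF D ev[OF jV]]) (rule ks_smult_closed[OF D dD])
      also have "\<dots> = (\<Sum>b\<in>?B. if b = j then u b else 0)"
      proof (rule sum.cong[OF refl])
        fix b assume b: "b \<in> ?B"
        have "(\<lambda>t\<in>carrier ?D. t j) (u b \<odot>\<^bsub>?D\<^esub> ?d b) = u b * ?d b j"
          using ks_smult_closed[OF D dD[OF b], of "u b"] jV by simp
        then show "(\<lambda>t\<in>carrier ?D. t j) (u b \<odot>\<^bsub>?D\<^esub> ?d b) = (if b = j then u b else 0)"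
          using fr(4)[OF b j] by simp
      qed
      also have "\<dots> = u j" using fr(1) j by simp
      finally show "?s j = u j" .
    qed
    then show ?thesis using s u by (intro extensionalityI[of _ "carrier V"]) auto
  qed
  have s: "spans ?D ?B ?d"
    unfolding spans_def
  proof (intro conjI ballI fr(1) dD)
    fix u assume "u \<in> carrier ?D"
    then show "\<exists>c. u = (\<Oplus>\<^bsub>?D\<^esub>b\<in>?B. c b \<odot>\<^bsub>?D\<^esub> ?d b)" by (intro exI[of _ u] expand)
  qed
  have mat: "matrix_comodule ?D \<rho> ?B ?d (\<lambda>b c. coinv H (m c b))"
    unfolding matrix_comodule_def
  proof (intro conjI ballI)
    show "finite ?B" by (rule M(1))
    show "?d i \<in> carrier ?D" if "i \<in> ?B" for i by (rule dD[OF that])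
    show "\<rho> (?d j) = (\<Oplus>\<^bsub>tensor ?D H\<^esub>i\<in>?B. tens ?D H (?d i) (coinv H (m j i)))" for j
      by (simp add: \<rho>_def m_def)
    fix i j assume i: "i \<in> ?B" and j: "j \<in> ?B"
    show "coinv H (m j i) \<in> carrier H" using lin_homD(1)[OF coinv_lin_hom M(3)[OF j i]] .
    show "comult H (coinv H (m j i)) = (\<Oplus>\<^bsub>tensor H H\<^esub>k\<in>?B. tens H H (coinv H (m k i)) (coinv H (m j k)))"
      by (rule coinv_matrix(1)[OF M(1,3,5,6) j i])
    show "counit H (coinv H (m j i)) = (if i = j then 1 else 0)"
      using coinv_matrix(2)[OF M(1,3,5,6) j i] by (simp add: eq_commute)
  qed
  show "diff_rep H (dual_rep H V)" unfolding RD by (rule diff_rep_mk_comod[OF D \<rho> s mat])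
  show "functional (dual_rep H V) (\<lambda>t\<in>carrier ?D. t v)" if "v \<in> carrier V"
    using ev[OF that] unfolding RD by (simp only: lin_hom_mk_comod)
  show "matrix_coeff H (dual_rep H V) u (\<lambda>t\<in>carrier ?D. t v) = coinv H (matrix_coeff H V v u)"
    if u: "u \<in> carrier ?D" and v: "v \<in> carrier V"
  proof -
    note Sm = lin_hom_comp[OF ml[OF u] coinv_lin_hom]
    let ?ev = "\<lambda>t\<in>carrier ?D. t v"
    have "matrix_coeff H (dual_rep H V) u ?ev = slice ?D H ?ev (\<rho> u)"
      unfolding matrix_coeff_slice RD by (simp only: slice_mk_comod mk_comod_simps)
    also have "\<dots> = (\<Oplus>\<^bsub>H\<^esub>b\<in>?B. slice ?D H ?ev (tens ?D H (?d b) (coinv H (matrix_coeff H V b u))))"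
      unfolding \<rho>_def by (rule add_hom_finsum[OF DH H lin_homD(4)[OF slice_lin_hom[OF D H ev[OF v]]]]) (rule lin_homD(1)[OF h u])
    \<comment> \<open>Evaluation at v turns the dual vector of b into the b-th coordinate of v. By
      linearity the sum reassembles v inside the coefficient.\<close>
    also have "\<dots> = (\<Oplus>\<^bsub>H\<^esub>b\<in>?B. coinv H (matrix_coeff H V (?d b v \<odot>\<^bsub>V\<^esub> b) u))"
    proof (rule ks_finsum_cong[OF H refl])
      fix b assume b: "b \<in> ?B"
      have bV: "b \<in> carrier V" using fr(2)[OF b] by simp
      show "slice ?D H ?ev (tens ?D H (?d b) (coinv H (matrix_coeff H V b u))) = coinv H (matrix_coeff H V (?d b v \<odot>\<^bsub>V\<^esub> b) u)"
        using slice_tens[OF D H ev[OF v] dD[OF b] lin_homD(1)[OF Sm bV]] lin_homD(3)[OF Sm bV, of "?d b v"] dD[OF b]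
        by simp
      show "coinv H (matrix_coeff H V (?d b v \<odot>\<^bsub>V\<^esub> b) u) \<in> carrier H"
        by (rule lin_homD(1)[OF Sm ks_smult_closed[OF R(2) bV]])
    qed
    also have "\<dots> = coinv H (matrix_coeff H V (\<Oplus>\<^bsub>V\<^esub>b\<in>?B. ?d b v \<odot>\<^bsub>V\<^esub> b) u)"
      by (rule add_hom_finsum[OF R(2) H lin_homD(4)[OF Sm], symmetric]) (use fr(2) R(2) in simp)
    also have "(\<Oplus>\<^bsub>V\<^esub>b\<in>?B. ?d b v \<odot>\<^bsub>V\<^esub> b) = v" by (rule fr(5)[OF v])
    finally show ?thesis .
  qed
qed

end

section \<open>Prolongations\<close>

lemma diff_ops1_simps [simp]:
  "carrier (diff_ops1 dk) = UNIV" "\<zero>\<^bsub>diff_ops1 dk\<^esub> = (0, 0)"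
  "x \<oplus>\<^bsub>diff_ops1 dk\<^esub> y = (fst x + fst y, snd x + snd y)"
  "c \<odot>\<^bsub>diff_ops1 dk\<^esub> x = (fst x * c + snd x * dk c, snd x * c)"
  by (simp_all add: diff_ops1_def mk_space_def split_beta)

text \<open>The Leibniz expression is not linear, but it is balanced: the extra term \<partial>(c)
  (a \<otimes> b) arises whether the scalar c is attached to a or to b.\<close>

lemma tensor_deriv_balanced:
  assumes A: "kspace A" and d: "add_hom A A (deriv A)"
    and s: "\<And>c x. x \<in> carrier A \<Longrightarrow> deriv A (c \<odot>\<^bsub>A\<^esub> x) = dk c \<odot>\<^bsub>A\<^esub> x \<oplus>\<^bsub>A\<^esub> c \<odot>\<^bsub>A\<^esub> deriv A x"
  shows "balanced A A (tensor A A) (\<lambda>a b. tens A A (deriv A a) b \<oplus>\<^bsub>tensor A A\<^esub> tens A A a (deriv A b))"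
proof (rule balancedI)
  have AA: "kspace (tensor A A)" using A by simp
  fix c a b assume "a \<in> carrier A" "b \<in> carrier A"
  then show "tens A A (deriv A (c \<odot>\<^bsub>A\<^esub> a)) b \<oplus>\<^bsub>tensor A A\<^esub> tens A A (c \<odot>\<^bsub>A\<^esub> a) (deriv A b) =
      tens A A (deriv A a) (c \<odot>\<^bsub>A\<^esub> b) \<oplus>\<^bsub>tensor A A\<^esub> tens A A a (deriv A (c \<odot>\<^bsub>A\<^esub> b))"
    using A AA by (simp add: add_homD[OF d] s tens_add_left tens_add_right tens_smult_left tens_smult_right ks_ac)
qed (use A in \<open>simp_all add: add_homD[OF d] tens_add_left tens_add_right ks_ac\<close>)

locale rep_hopf_deriv = rep_hopf dk H for dk :: "'k::field \<Rightarrow> 'k" and H :: "('k, 'a) hopf" +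
  assumes derivation_dk: "derivation class_ring dk"
begin

lemma dk_add: "dk (x + y) = dk x + dk y" and dk_mult: "dk (x * y) = dk x * y + x * dk y"
  using derivation_dk by (auto simp: derivation_def)

lemma dk_0: "dk 0 = 0" and dk_1: "dk 1 = 0"
  using dk_add[of 0 0] dk_mult[of 1 1]
  unfolding mult_1_left mult_1_right add_0_left add_cancel_right_right by this

abbreviation "D1 \<equiv> diff_ops1 dk"

text \<open>Associativity of the right scalar action is the Leibniz rule for \<open>dk\<close>, and
  its unit law is \<partial>(1) = 0.\<close>

lemma D1: "kspace D1"
  by (rule kspaceI) (auto simp: dk_0 dk_1 dk_add dk_mult algebra_simps)

text \<open>The map \<Sum> w_i \<otimes> a_i \<mapsto> \<Sum> (\<partial>w_i \<otimes> a_i + w_i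
  \<otimes> \<partial>a_i), which sends \<rho>(v) to the coaction of the prolongation at
  \<partial>v.\<close>

definition R1 :: "('k, 'v, 'c) module_scheme \<Rightarrow> ('k, 'v, 'a) tensor \<Rightarrow> ('k, ('k, 'k \<times> 'k, 'v) tensor, 'a) tensor" where
  "R1 V = tensor_ext V H (tensor (prolong_space dk V) H)
     (\<lambda>w a. tens (prolong_space dk V) H (prol1 dk V w) a \<oplus>\<^bsub>tensor (prolong_space dk V) H\<^esub>
        tens (prolong_space dk V) H (prol0 dk V w) (deriv H a))"

context
  fixes V :: "('k, 'v, 'c) module_scheme"
  assumes V: "kspace V"
begin

abbreviation (input) "P0 \<equiv> tensor D1 V"
abbreviation (input) "P \<equiv> prolong_space dk V"
abbreviation (input) "p0 \<equiv> prol0 dk V"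
abbreviation (input) "p1 \<equiv> prol1 dk V"

lemma P0: "kspace P0"
  using D1 V by simp

lemma prolong_space_simps:
  "carrier P = carrier P0" "add P = add P0" "\<zero>\<^bsub>P\<^esub> = \<zero>\<^bsub>P0\<^esub>"
  by (simp_all add: prolong_space_def)

lemma prolong_smult_balanced: "balanced D1 V P0 (\<lambda>(a, b) v. tens D1 V (c * a, c * b) v)"
proof (rule balancedI)
  show "(case d \<odot>\<^bsub>D1\<^esub> x of (a, b) \<Rightarrow> \<lambda>v. tens D1 V (c * a, c * b) v) v =
      (case x of (a, b) \<Rightarrow> \<lambda>v. tens D1 V (c * a, c * b) v) (d \<odot>\<^bsub>V\<^esub> v)"
    if "x \<in> carrier D1" "v \<in> carrier V" for d x v
    using that D1 V tens_smult_left[OF D1 V, of "(c * fst x, c * snd x)" v d]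
      tens_smult_right[OF D1 V, of "(c * fst x, c * snd x)" v d]
    by (simp add: split_beta algebra_simps)
  show "(case x \<oplus>\<^bsub>D1\<^esub> y of (a, b) \<Rightarrow> \<lambda>v. tens D1 V (c * a, c * b) v) v =
      (case x of (a, b) \<Rightarrow> \<lambda>v. tens D1 V (c * a, c * b) v) v \<oplus>\<^bsub>P0\<^esub> (case y of (a, b) \<Rightarrow> \<lambda>v. tens D1 V (c * a, c * b) v) v"
    if "v \<in> carrier V" for x y v
    using that tens_add_left[OF D1 V, of "(c * fst x, c * snd x)" "(c * fst y, c * snd y)" v]
    by (simp add: split_beta algebra_simps)
qed (use D1 V in \<open>simp_all add: split_beta tens_add_right\<close>)

lemma prolong_smult_add_hom: "add_hom P0 P0 (\<lambda>x. c \<odot>\<^bsub>P\<^esub> x)"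
  unfolding prolong_space_def using tensor_ext_add_hom[OF D1 V P0 prolong_smult_balanced] by simp

lemma prolong_smult_tens: "v \<in> carrier V \<Longrightarrow> c \<odot>\<^bsub>P\<^esub> tens D1 V (a, b) v = tens D1 V (c * a, c * b) v"
  unfolding prolong_space_def using tensor_ext_tens[OF D1 V P0 prolong_smult_balanced, of "(a, b)" v] by simp

lemma tens_D1_closed: "v \<in> carrier V \<Longrightarrow> tens D1 V x v \<in> carrier P0"
  using D1 V by simp

text \<open>Carrier and addition are those of the tensor product, but scalars act by the left
  structure on differential operators, so the laws involving scalars are proved afresh by induction
  over tensors.\<close>

lemma P: "kspace P"
proof (rule kspaceI)
  note s = prolong_smult_tens and ad = add_homD[OF prolong_smult_add_hom]
  have tz: "tens D1 V (0, 0) v = \<zero>\<^bsub>P0\<^esub>" if "v \<in> carrier V" for v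
    using add_hom_zero[OF D1 P0 lin_homD(4)[OF tens_hom_left[OF D1 V that]]] by simp
  fix x assume "x \<in> carrier P"
  then have x: "x \<in> carrier P0" by (simp add: prolong_space_simps)
  show "0 \<odot>\<^bsub>P\<^esub> x = \<zero>\<^bsub>P\<^esub>"
    using x by (induction rule: tensor_induct[OF D1 V, consumes 1])
      (auto simp: prolong_space_simps s ad tz ks_add_0[OF P0 ks_zero_closed[OF P0]])
  show "1 \<odot>\<^bsub>P\<^esub> x = x"
    using x by (induction rule: tensor_induct[OF D1 V, consumes 1]) (auto simp: s ad)
  show "(c * d) \<odot>\<^bsub>P\<^esub> x = c \<odot>\<^bsub>P\<^esub> (d \<odot>\<^bsub>P\<^esub> x)" for c d
    using x by (induction rule: tensor_induct[OF D1 V, consumes 1]) (auto simp: s ad mult.assoc)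
  show "(c + d) \<odot>\<^bsub>P\<^esub> x = c \<odot>\<^bsub>P\<^esub> x \<oplus>\<^bsub>P\<^esub> d \<odot>\<^bsub>P\<^esub> x" for c d
    using x
  proof (induction rule: tensor_induct[OF D1 V, consumes 1])
    case (1 y v)
    then show ?case
      using tens_add_left[OF D1 V, of "(c * fst y, c * snd y)" "(d * fst y, d * snd y)" v]
      by (cases y) (simp add: s prolong_space_simps algebra_simps)
  next
    case (2 y z)
    then show ?case using P0 by (simp add: prolong_space_simps ad ks_ac)
  qed
qed (use P0 add_homD[OF prolong_smult_add_hom] in \<open>auto simp: prolong_space_simps ks_ac\<close>)

lemma prol_closed: "v \<in> carrier V \<Longrightarrow> p0 v \<in> carrier P" "v \<in> carrier V \<Longrightarrow> p1 v \<in> carrier P"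
  unfolding prol0_def prol1_def prolong_space_simps by (rule tens_D1_closed; simp)+

lemma prol_decomp: "v \<in> carrier V \<Longrightarrow> tens D1 V (a, b) v = a \<odot>\<^bsub>P\<^esub> p0 v \<oplus>\<^bsub>P\<^esub> b \<odot>\<^bsub>P\<^esub> p1 v"
  using tens_add_left[OF D1 V, of "(a, 0)" "(0, b)" v] by (simp add: prol0_def prol1_def prolong_smult_tens prolong_space_simps)

lemma prol0_lin_hom: "lin_hom V P p0"
proof (rule lin_homI)
  show "p0 (c \<odot>\<^bsub>V\<^esub> v) = c \<odot>\<^bsub>P\<^esub> p0 v" if "v \<in> carrier V" for c v
    using that tens_smult_right[OF D1 V, of "(1, 0)" v c] tens_smult_left[OF D1 V, of "(1, 0)" v c]
    by (simp add: prol0_def prolong_smult_tens)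
qed (use D1 V in \<open>simp_all add: prol_closed\<close>, simp add: prol0_def prolong_space_simps tens_add_right)

lemma prol1_add: "v \<in> carrier V \<Longrightarrow> w \<in> carrier V \<Longrightarrow> p1 (v \<oplus>\<^bsub>V\<^esub> w) = p1 v \<oplus>\<^bsub>P\<^esub> p1 w"
  using D1 V by (simp add: prol1_def prolong_space_simps tens_add_right)

text \<open>Crossing the tensor sign, c acts on \<partial> from the right, where \<partial>c =
  c\<partial> + \<partial>(c).\<close>

lemma prol1_smult:
  assumes "v \<in> carrier V"
  shows "p1 (c \<odot>\<^bsub>V\<^esub> v) = dk c \<odot>\<^bsub>P\<^esub> p0 v \<oplus>\<^bsub>P\<^esub> c \<odot>\<^bsub>P\<^esub> p1 v"
proof -
  have "p1 (c \<odot>\<^bsub>V\<^esub> v) = tens D1 V (dk c, c) v"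
    using assms tens_smult_right[OF D1 V, of "(0, 1)" v c] tens_smult_left[OF D1 V, of "(0, 1)" v c]
    by (simp add: prol1_def)
  then show ?thesis using prol_decomp[OF assms] by simp
qed

lemma PH: "kspace (tensor P H)"
  using P H by simp

lemma deriv_closed: "a \<in> carrier H \<Longrightarrow> deriv H a \<in> carrier H"
  by (rule add_homD(1)[OF deriv_add_hom])

lemmas prol_rules = prol_closed lin_homD(2,3)[OF prol0_lin_hom] prol1_add prol1_smult deriv_closed
  add_homD(2)[OF deriv_add_hom] A.deriv_smult

text \<open>The extra term \<partial>(c) (v \<otimes> a) appears on both sides, on the left from
  \<partial>(cv) and on the right from the derivative of ca.\<close>

lemma R1_balanced: "balanced V H (tensor P H) (\<lambda>w a. tens P H (p1 w) a \<oplus>\<^bsub>tensor P H\<^esub> tens P H (p0 w) (deriv H a))"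
proof (rule balancedI)
  fix c v a assume va: "v \<in> carrier V" "a \<in> carrier H"
  then show "tens P H (p1 (c \<odot>\<^bsub>V\<^esub> v)) a \<oplus>\<^bsub>tensor P H\<^esub> tens P H (p0 (c \<odot>\<^bsub>V\<^esub> v)) (deriv H a) =
      tens P H (p1 v) (c \<odot>\<^bsub>H\<^esub> a) \<oplus>\<^bsub>tensor P H\<^esub> tens P H (p0 v) (deriv H (c \<odot>\<^bsub>H\<^esub> a))"
    using V P H PH
    by (simp add: prol_rules tens_add_left tens_add_right tens_smult_left tens_smult_right ks_ac)
qed (use V P H PH in \<open>simp_all add: prol_rules tens_add_left tens_add_right ks_ac\<close>)

lemma R1_tens: "v \<in> carrier V \<Longrightarrow> a \<in> carrier H \<Longrightarrow>
    R1 V (tens V H v a) = tens P H (p1 v) a \<oplus>\<^bsub>tensor P H\<^esub> tens P H (p0 v) (deriv H a)"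
  unfolding R1_def by (rule tensor_ext_tens[OF V H PH R1_balanced])

lemma R1_add_hom: "add_hom (tensor V H) (tensor P H) (R1 V)"
  unfolding R1_def by (rule tensor_ext_add_hom[OF V H PH R1_balanced])

abbreviation (input) "R0 \<equiv> tensor_map V H P H p0 (\<lambda>a. a)"

lemmas R0_lin_hom = tensor_map_lin_hom[OF V H P H prol0_lin_hom lin_hom_ident]
lemmas R0_tens = tensor_map_tens[OF V H P H prol0_lin_hom lin_hom_ident]

text \<open>The deviation from linearity is the coaction without derivatives scaled by
  \<partial>(c). This is exactly the defect of \<partial>(cv), which makes the coaction on the
  prolongation well defined.\<close>

lemma R1_smult:
  assumes "x \<in> carrier (tensor V H)"
  shows "R1 V (c \<odot>\<^bsub>tensor V H\<^esub> x) = dk c \<odot>\<^bsub>tensor P H\<^esub> R0 x \<oplus>\<^bsub>tensor P H\<^esub> c \<odot>\<^bsub>tensor P H\<^esub> R1 V x"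
  using assms
proof (induction rule: tensor_induct[OF V H, consumes 1])
  case (1 v a)
  have "R1 V (tens V H (c \<odot>\<^bsub>V\<^esub> v) a) =
      tens P H (p1 (c \<odot>\<^bsub>V\<^esub> v)) a \<oplus>\<^bsub>tensor P H\<^esub> tens P H (p0 (c \<odot>\<^bsub>V\<^esub> v)) (deriv H a)"
    using 1 V by (intro R1_tens) simp_all
  also have "\<dots> = dk c \<odot>\<^bsub>tensor P H\<^esub> R0 (tens V H v a) \<oplus>\<^bsub>tensor P H\<^esub> c \<odot>\<^bsub>tensor P H\<^esub> R1 V (tens V H v a)"
    using 1 V P H PH
    by (simp add: R1_tens R0_tens prol_rules tens_add_left tens_smult_left ks_smult_rdistr ks_add_assoc)
  finally show ?case using 1 V H by (simp add: tens_smult_left)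
next
  case (2 x y)
  have VH: "kspace (tensor V H)" using V H by simp
  show ?case
    using 2 PH VH by (simp add: ks_smult_rdistr[OF VH] add_homD[OF R1_add_hom] lin_homD(1,2)[OF R0_lin_hom]
        ks_smult_rdistr ks_ac[OF PH])
qed

lemma prolong_functional_balanced:
  assumes u: "functional V u"
  shows "balanced D1 V field_space (\<lambda>(a, b) v. a * u v + b * dk (u v))"
  by (rule balancedI) (simp_all add: functionalD[OF u] split_beta dk_add dk_mult algebra_simps)

lemma prolong_functional_tens:
  assumes u: "functional V u" and v: "v \<in> carrier V"
  shows "prolong_functional dk V u (tens D1 V (a, b) v) = a * u v + b * dk (u v)"
  unfolding prolong_functional_def
  using tensor_ext_tens[OF D1 V kspace_field_space prolong_functional_balanced[OF u], of "(a, b)" v] v by simp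

lemma prolong_functional_functional:
  assumes u: "functional V u"
  shows "functional P (prolong_functional dk V u)"
proof (rule functionalI)
  have a: "add_hom P0 field_space (prolong_functional dk V u)"
    unfolding prolong_functional_def by (rule tensor_ext_add_hom[OF D1 V kspace_field_space prolong_functional_balanced[OF u]])
  show "prolong_functional dk V u (x \<oplus>\<^bsub>P\<^esub> y) = prolong_functional dk V u x + prolong_functional dk V u y"
    if "x \<in> carrier P" "y \<in> carrier P" for x y
    using add_homD(2)[OF a, of x y] that by (simp add: prolong_space_simps)
  show "prolong_functional dk V u (c \<odot>\<^bsub>P\<^esub> x) = c * prolong_functional dk V u x" if "x \<in> carrier P" for c x
    using that[unfolded prolong_space_simps]
  proof (induction rule: tensor_induct[OF D1 V, consumes 1])
    case (1 y v)
    then show ?case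
      by (cases y) (simp add: prolong_smult_tens prolong_functional_tens[OF u] algebra_simps)
  next
    case (2 x y)
    then show ?case
      using add_homD(2)[OF a] by (simp add: add_homD[OF prolong_smult_add_hom] algebra_simps)
  qed
qed

text \<open>On v \<otimes> a the left side is \<partial>(u(v)) a + u(v) \<partial>a, the Leibniz
  rule for u(v) a. At x = \<rho>(v) this gives \<psi>(\<partial>v \<otimes> F(u)) =
  \<partial>\<psi>(v \<otimes> u).\<close>

lemma slice_R1:
  assumes u: "functional V u" and x: "x \<in> carrier (tensor V H)"
  shows "slice P H (prolong_functional dk V u) (R1 V x) = deriv H (slice V H u x)"
proof -
  note F = prolong_functional_functional[OF u]
  have F0: "prolong_functional dk V u (p0 v) = u v" and F1: "prolong_functional dk V u (p1 v) = dk (u v)"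
    if "v \<in> carrier V" for v
    using prolong_functional_tens[OF u that] by (simp_all add: prol0_def prol1_def)
  note s = slice_lin_hom[OF P H F]
  show ?thesis
    using x
  proof (induction rule: tensor_induct[OF V H, consumes 1])
    case (1 v a)
    then show ?case
      using V H P PH by (simp add: R1_tens lin_homD(2)[OF s] slice_tens[OF P H F] slice_tens[OF V H u] F0 F1 prol_rules)
  next
    case (2 x y)
    then show ?case
      using V H u by (simp add: add_homD[OF R1_add_hom] lin_homD(2)[OF s] slice_add slice_closed add_homD(2)[OF deriv_add_hom])
  qed
qed

end

lemmas HH_deriv_balanced = tensor_deriv_balanced[OF H deriv_add_hom A.deriv_smult]

lemma HH_deriv_tens: "a \<in> carrier H \<Longrightarrow> b \<in> carrier H \<Longrightarrow>
    deriv (tensor_dalg H H) (tens H H a b) = tens H H (deriv H a) b \<oplus>\<^bsub>tensor H H\<^esub> tens H H a (deriv H b)"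
  unfolding tensor_dalg_def mk_dalg_simps by (rule tensor_ext_tens[OF H H HH HH_deriv_balanced])

lemma HH_deriv_add_hom: "add_hom (tensor H H) (tensor H H) (deriv (tensor_dalg H H))"
  unfolding tensor_dalg_def mk_dalg_simps by (rule tensor_ext_add_hom[OF H H HH HH_deriv_balanced])

text \<open>On the vectors b and \<partial>b the matrix is block triangular, with m on the diagonal
  and \<partial>m above it. Its comultiplication formula holds because \<Delta> commutes with the
  derivation.\<close>

lemma prolong_rep:
  assumes V: "diff_rep H V"
  shows "diff_rep H (prolong_rep dk H V)"
    and "functional V u \<Longrightarrow> functional (prolong_rep dk H V) (prolong_functional dk V u)"
    and "functional V u \<Longrightarrow> v \<in> carrier V \<Longrightarrow>
      matrix_coeff H (prolong_rep dk H V) (prol1 dk V v) (prolong_functional dk V u) = deriv H (matrix_coeff H V v u)"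
proof -
  let ?B = "some_basis V" and ?P = "prolong_space dk V" and ?p0 = "prol0 dk V" and ?p1 = "prol1 dk V"
  note R = diff_rep_comodule[OF V] and C = comoduleD(2)[OF diff_rep_comodule(1)[OF V]]
  note K = R(2)
  note P = P[OF K] and PH = PH[OF K] and P0 = P0[OF K]
  have VH: "kspace (tensor V H)" using K H by simp
  let ?r0 = "tensor_map V H ?P H ?p0 (\<lambda>a. a)"
  note r0 = R0_lin_hom[OF K] and r0t = R0_tens[OF K] and r1 = R1_add_hom[OF K] and r1t = R1_tens[OF K]
  define \<rho>0 where "\<rho>0 v = ?r0 (coact V v)" for v
  define \<rho>1 where "\<rho>1 v = R1 V (coact V v)" for v
  note cc = lin_homD[OF C]
  have \<rho>0: "lin_hom V (tensor ?P H) \<rho>0" unfolding \<rho>0_def by (rule lin_hom_comp[OF C r0])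
  have \<rho>1: "add_hom V (tensor ?P H) \<rho>1" unfolding \<rho>1_def by (rule add_hom_comp[OF cc(4) r1])
  have \<rho>1s: "\<rho>1 (c \<odot>\<^bsub>V\<^esub> v) = dk c \<odot>\<^bsub>tensor ?P H\<^esub> \<rho>0 v \<oplus>\<^bsub>tensor ?P H\<^esub> c \<odot>\<^bsub>tensor ?P H\<^esub> \<rho>1 v"
    if "v \<in> carrier V" for c v
    using R1_smult[OF K cc(1)[OF that]] cc(3)[OF that] by (simp add: \<rho>0_def \<rho>1_def)
  let ?\<beta> = "\<lambda>(a, b) v. a \<odot>\<^bsub>tensor ?P H\<^esub> \<rho>0 v \<oplus>\<^bsub>tensor ?P H\<^esub> b \<odot>\<^bsub>tensor ?P H\<^esub> \<rho>1 v"
  note \<rho>c = lin_homD(1)[OF \<rho>0] add_homD(1)[OF \<rho>1]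
  \<comment> \<open>Right multiplication of a + b\<partial> by c adds b \<partial>(c) to the first
    component, and \<open>\<rho>1s\<close> produces the same term when c is moved to v.\<close>
  have b: "balanced D1 V (tensor ?P H) ?\<beta>"
  proof (rule balancedI)
    fix c x v assume v: "v \<in> carrier V"
    note sm = ks_smult_closed[OF PH \<rho>c(1)[OF v]] ks_smult_closed[OF PH \<rho>c(2)[OF v]]
    show "?\<beta> (c \<odot>\<^bsub>D1\<^esub> x) v = ?\<beta> x (c \<odot>\<^bsub>V\<^esub> v)"
      using v PH by (simp add: split_beta lin_homD(3)[OF \<rho>0] \<rho>1s \<rho>c ks_smult_rdistr[OF PH] ks_smult_ldistr[OF PH]
          ks_smult_assoc[OF PH] ks_add_assoc[OF PH])
  qed (use PH K in \<open>auto simp: split_beta \<rho>c lin_homD(2)[OF \<rho>0] add_homD(2)[OF \<rho>1] ks_smult_rdistr ks_smult_ldistr ks_ac\<close>)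
  define \<rho> where "\<rho> = tensor_ext D1 V (tensor ?P H) ?\<beta>"
  have \<rho>t: "\<rho> (tens D1 V (a, b) v) = a \<odot>\<^bsub>tensor ?P H\<^esub> \<rho>0 v \<oplus>\<^bsub>tensor ?P H\<^esub> b \<odot>\<^bsub>tensor ?P H\<^esub> \<rho>1 v"
    if "v \<in> carrier V" for a b v
    unfolding \<rho>_def using tensor_ext_tens[OF D1 K PH b, of "(a, b)" v] that by simp
  have \<rho>a: "add_hom (tensor D1 V) (tensor ?P H) \<rho>" unfolding \<rho>_def by (rule tensor_ext_add_hom[OF D1 K PH b])
  have \<rho>: "lin_hom ?P (tensor ?P H) \<rho>"
  proof (rule lin_homI)
    show "\<rho> (c \<odot>\<^bsub>?P\<^esub> x) = c \<odot>\<^bsub>tensor ?P H\<^esub> \<rho> x" if "x \<in> carrier ?P" for c x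
      using that[unfolded prolong_space_simps[OF K]]
    proof (induction rule: tensor_induct[OF D1 K, consumes 1])
      case (1 y v)
      then show ?case
        using PH by (cases y) (simp add: prolong_smult_tens[OF K] \<rho>t \<rho>c ks_smult_rdistr[OF PH] ks_smult_assoc[OF PH])
    next
      case (2 x y)
      then show ?case
        using PH by (simp add: add_homD[OF prolong_smult_add_hom[OF K]] add_homD[OF \<rho>a] ks_smult_rdistr[OF PH])
    qed
  qed (use add_homD[OF \<rho>a] in \<open>simp_all add: prolong_space_simps[OF K]\<close>)
  have \<rho>p0: "\<rho> (?p0 v) = \<rho>0 v" and \<rho>p1: "\<rho> (?p1 v) = \<rho>1 v" if "v \<in> carrier V" for v
    using \<rho>t[OF that] PH \<rho>c[OF that] by (simp_all add: prol0_def prol1_def)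
  have RP: "prolong_rep dk H V = mk_comod ?P \<rho>"
    by (simp add: prolong_rep_def Let_def \<rho>_def \<rho>0_def[abs_def] \<rho>1_def[abs_def] R1_def tensor_map_def)
  define m where "m i j = matrix_coeff H V j (dual_vec V ?B i)" for i j
  note M = matrix_comoduleD[OF diff_rep_matrix[OF V, folded m_def]]
  note pc = prol_closed[OF K]
  let ?e = "case_sum ?p0 ?p1"
  \<comment> \<open>\<open>Inl\<close> indexes the vectors b and \<open>Inr\<close> the vectors
    \<partial>b. The zero block records that the coaction at b involves no \<partial>.\<close>
  let ?a = "\<lambda>i j. case i of Inl i' \<Rightarrow> (case j of Inl j' \<Rightarrow> m i' j' | Inr j' \<Rightarrow> deriv H (m i' j'))
     | Inr i' \<Rightarrow> (case j of Inl j' \<Rightarrow> \<zero>\<^bsub>H\<^esub> | Inr j' \<Rightarrow> m i' j')"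
  let ?I = "?B <+> ?B"
  have fin: "finite ?I" using M(1) by simp
  have eP: "?e i \<in> carrier ?P" if "i \<in> ?I" for i using that pc M(2) by (auto elim!: PlusE)
  have dm: "deriv H (m i j) \<in> carrier H" if "i \<in> ?B" "j \<in> ?B" for i j
    using add_homD(1)[OF deriv_add_hom M(3)[OF that]] .
  have aH: "?a i j \<in> carrier H" if "i \<in> ?I" "j \<in> ?I" for i j using that M(3) dm H by (auto elim!: PlusE)
  have s: "spans ?P ?I ?e"
  proof (rule spansI[OF P fin eP])
    fix U z assume U: "ksub ?P U" and e: "\<And>i. i \<in> ?I \<Longrightarrow> ?e i \<in> U" and z: "z \<in> carrier ?P"
    have Ua: "x \<oplus>\<^bsub>?P\<^esub> y \<in> U" if "x \<in> U" "y \<in> U" for x y using U that by (simp add: ksub_def)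
    have Us: "c \<odot>\<^bsub>?P\<^esub> x \<in> U" if "x \<in> U" for c x using U that by (simp add: ksub_def)
    have U0: "\<zero>\<^bsub>?P\<^esub> \<in> U" using U by (simp add: ksub_def)
    note sV = frame_spans[OF R(5)]
    have pz: "?p0 \<zero>\<^bsub>V\<^esub> = \<zero>\<^bsub>?P\<^esub>" by (rule add_hom_zero[OF K P lin_homD(4)[OF prol0_lin_hom[OF K]]])
    have "add_hom V ?P ?p1" by (rule add_homI) (simp_all add: pc prol1_add[OF K])
    then have pz1: "?p1 \<zero>\<^bsub>V\<^esub> = \<zero>\<^bsub>?P\<^esub>" by (rule add_hom_zero[OF K P])
    \<comment> \<open>Both conditions are imposed together, because \<partial>(cv) involves v as
      well as \<partial>v.\<close>
    have kU: "ksub V {v \<in> carrier V. ?p0 v \<in> U \<and> ?p1 v \<in> U}"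
      using K U0 Ua Us
      by (simp add: ksub_def subset_iff pz pz1 lin_homD(2,3)[OF prol0_lin_hom[OF K]] prol1_add[OF K] prol1_smult[OF K])
    have pU: "?p0 v \<in> U \<and> ?p1 v \<in> U" if v: "v \<in> carrier V" for v
    proof -
      have "v \<in> {v \<in> carrier V. ?p0 v \<in> U \<and> ?p1 v \<in> U}"
        by (rule spans_ksub[OF K sV kU _ v]) (use e[of "Inl _"] e[of "Inr _"] M(2) in \<open>auto simp: InlI InrI\<close>)
      then show ?thesis by simp
    qed
    show "z \<in> U"
      using z[unfolded prolong_space_simps[OF K]]
    proof (induction rule: tensor_induct[OF D1 K, consumes 1])
      case (1 y v)
      then show ?case using pU[OF 1(2)] Ua Us by (cases y) (simp add: prol_decomp[OF K])
    next
      case (2 x y)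
      then show ?case using Ua[of x y] by (simp add: prolong_space_simps[OF K])
    qed
  qed
  have mat: "matrix_comodule ?P \<rho> ?I ?e ?a"
    unfolding matrix_comodule_def
  proof (intro conjI ballI fin eP aH)
    fix j assume j: "j \<in> ?I"
    have cl: "tens ?P H (?e i) (?a i j) \<in> carrier (tensor ?P H)" if "i \<in> ?I" for i
      using P H eP[OF that] aH[OF that j] by simp
    have split: "(\<Oplus>\<^bsub>tensor ?P H\<^esub>i\<in>?I. tens ?P H (?e i) (?a i j)) =
        (\<Oplus>\<^bsub>tensor ?P H\<^esub>i\<in>?B. tens ?P H (?p0 i) (?a (Inl i) j)) \<oplus>\<^bsub>tensor ?P H\<^esub> (\<Oplus>\<^bsub>tensor ?P H\<^esub>i\<in>?B. tens ?P H (?p1 i) (?a (Inr i) j))"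
      by (subst ks_finsum_Plus[OF PH M(1) M(1) cl]) simp_all
    show "\<rho> (?e j) = (\<Oplus>\<^bsub>tensor ?P H\<^esub>i\<in>?I. tens ?P H (?e i) (?a i j))"
      using j
    proof (rule PlusE)
      fix b assume b: "b \<in> ?B" "j = Inl b"
      have "\<rho> (?e j) = ?r0 (\<Oplus>\<^bsub>tensor V H\<^esub>i\<in>?B. tens V H i (m i b))"
        using b \<rho>p0 M(2,4) by (simp add: \<rho>0_def)
      also have "\<dots> = (\<Oplus>\<^bsub>tensor ?P H\<^esub>i\<in>?B. ?r0 (tens V H i (m i b)))"
        by (rule add_hom_finsum[OF VH PH lin_homD(4)[OF r0]]) (use M K H b in simp)
      also have "\<dots> = (\<Oplus>\<^bsub>tensor ?P H\<^esub>i\<in>?B. tens ?P H (?p0 i) (?a (Inl i) j))"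
        by (rule ks_finsum_cong[OF PH refl]) (use M P H pc b in \<open>simp_all add: r0t\<close>)
      also have "\<dots> = \<dots> \<oplus>\<^bsub>tensor ?P H\<^esub> (\<Oplus>\<^bsub>tensor ?P H\<^esub>i\<in>?B. tens ?P H (?p1 i) (?a (Inr i) j))"
      proof -
        have "tens ?P H (?p1 i) (?a (Inr i) j) = \<zero>\<^bsub>tensor ?P H\<^esub>" if "i \<in> ?B" for i
          using b add_hom_zero[OF H PH lin_homD(4)[OF tens_hom_right[OF P H pc(2)[OF M(2)[OF that]]]]] by simp
        then have "(\<Oplus>\<^bsub>tensor ?P H\<^esub>i\<in>?B. tens ?P H (?p1 i) (?a (Inr i) j)) = \<zero>\<^bsub>tensor ?P H\<^esub>"
          by (rule ks_finsum_zero[OF PH])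
        moreover have "(\<Oplus>\<^bsub>tensor ?P H\<^esub>i\<in>?B. tens ?P H (?p0 i) (?a (Inl i) j)) \<in> carrier (tensor ?P H)"
          by (rule ks_finsum_closed[OF PH]) (use M P H pc b in simp)
        ultimately show ?thesis using PH by simp
      qed
      finally show ?thesis using split by simp
    next
      fix b assume b: "b \<in> ?B" "j = Inr b"
      have "\<rho> (?e j) = R1 V (\<Oplus>\<^bsub>tensor V H\<^esub>i\<in>?B. tens V H i (m i b))"
        using b \<rho>p1 M(2,4) by (simp add: \<rho>1_def)
      also have "\<dots> = (\<Oplus>\<^bsub>tensor ?P H\<^esub>i\<in>?B. R1 V (tens V H i (m i b)))"
        by (rule add_hom_finsum[OF VH PH r1]) (use M K H b in simp)
      also have "\<dots> = (\<Oplus>\<^bsub>tensor ?P H\<^esub>i\<in>?B. tens ?P H (?p0 i) (?a (Inl i) j) \<oplus>\<^bsub>tensor ?P H\<^esub> tens ?P H (?p1 i) (?a (Inr i) j))"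
        by (rule ks_finsum_cong[OF PH refl]) (use M P H PH pc b dm in \<open>simp_all add: r1t ks_add_comm[OF PH]\<close>)
      also have "\<dots> = (\<Oplus>\<^bsub>tensor ?P H\<^esub>i\<in>?B. tens ?P H (?p0 i) (?a (Inl i) j)) \<oplus>\<^bsub>tensor ?P H\<^esub> (\<Oplus>\<^bsub>tensor ?P H\<^esub>i\<in>?B. tens ?P H (?p1 i) (?a (Inr i) j))"
        by (rule ks_finsum_add[OF PH]) (use M P H pc b dm in simp_all)
      finally show ?thesis using split by simp
    qed
  next
    fix i j assume i: "i \<in> ?I" and j: "j \<in> ?I"
    have c0: "counit H \<zero>\<^bsub>H\<^esub> = 0"
      by (metis add_hom_zero[OF H kspace_field_space lin_homD(4)[OF counit_functional]] field_space_simps(2))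
    show "counit H (?a i j) = (if i = j then 1 else 0)"
      using i j M(3,6) by (auto elim!: PlusE simp: counit_deriv dk_0 dk_1 c0 split: if_splits)
    have cl: "tens H H (?a i k) (?a k j) \<in> carrier (tensor H H)" if "k \<in> ?I" for k
      using H aH[OF i that] aH[OF that j] by simp
    have split: "(\<Oplus>\<^bsub>tensor H H\<^esub>k\<in>?I. tens H H (?a i k) (?a k j)) =
        (\<Oplus>\<^bsub>tensor H H\<^esub>k\<in>?B. tens H H (?a i (Inl k)) (?a (Inl k) j) \<oplus>\<^bsub>tensor H H\<^esub> tens H H (?a i (Inr k)) (?a (Inr k) j))"
      by (subst ks_finsum_Plus[OF HH M(1) M(1) cl], assumption, rule ks_finsum_add[OF HH, symmetric]; rule cl; simp add: InlI InrI)
    have z: "tens H H x \<zero>\<^bsub>H\<^esub> = \<zero>\<^bsub>tensor H H\<^esub>" "tens H H \<zero>\<^bsub>H\<^esub> x = \<zero>\<^bsub>tensor H H\<^esub>" if "x \<in> carrier H" for x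
      using add_hom_zero[OF H HH lin_homD(4)[OF tens_hom_right[OF H H that]]]
        add_hom_zero[OF H HH lin_homD(4)[OF tens_hom_left[OF H H that]]] by simp_all
    have eq: "comult H (?a i j) =
        (\<Oplus>\<^bsub>tensor H H\<^esub>k\<in>?B. tens H H (?a i (Inl k)) (?a (Inl k) j) \<oplus>\<^bsub>tensor H H\<^esub> tens H H (?a i (Inr k)) (?a (Inr k) j))"
    proof -
      obtain b c where bc: "b \<in> ?B" "c \<in> ?B" and ij: "i = Inl b \<or> i = Inr b" "j = Inl c \<or> j = Inr c"
        using i j by (auto elim!: PlusE)
      have zc: "comult H \<zero>\<^bsub>H\<^esub> = \<zero>\<^bsub>tensor H H\<^esub>" by (rule add_hom_zero[OF H HH lin_homD(4)[OF comult_hom]])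
      from ij consider "i = Inr b" "j = Inl c" | "i = Inl b" "j = Inl c" | "i = Inr b" "j = Inr c" | "i = Inl b" "j = Inr c"
        by auto
      then show ?thesis
      proof cases
        case 1
        have "(\<Oplus>\<^bsub>tensor H H\<^esub>k\<in>?B. tens H H (?a i (Inl k)) (?a (Inl k) j) \<oplus>\<^bsub>tensor H H\<^esub> tens H H (?a i (Inr k)) (?a (Inr k) j)) = \<zero>\<^bsub>tensor H H\<^esub>"
          by (rule ks_finsum_zero[OF HH]) (use 1 bc M(3) HH in \<open>simp add: z\<close>)
        then show ?thesis using 1 zc by simp
      next
        case 2
        show ?thesis
          using 2 M(5)[OF bc] by simp
            (rule ks_finsum_cong[OF HH refl]; use bc M(3) dm H HH in \<open>simp add: z\<close>)
      next
        case 3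
        show ?thesis
          using 3 M(5)[OF bc] by simp
            (rule ks_finsum_cong[OF HH refl]; use bc M(3) dm H HH in \<open>simp add: z\<close>)
      next
        case 4
        \<comment> \<open>The off-diagonal block: differentiating \<Sum> m_bk \<otimes> m_kc yields
          the two products of a diagonal block with an off-diagonal one.\<close>
        have "comult H (?a i j) = deriv (tensor_dalg H H) (\<Oplus>\<^bsub>tensor H H\<^esub>k\<in>?B. tens H H (m b k) (m k c))"
          using 4 bc M(3,5) by (simp add: comult_deriv)
        also have "\<dots> = (\<Oplus>\<^bsub>tensor H H\<^esub>k\<in>?B. deriv (tensor_dalg H H) (tens H H (m b k) (m k c)))"
          by (rule add_hom_finsum[OF HH HH HH_deriv_add_hom]) (use bc M(3) H in simp)
        also have "\<dots> = (\<Oplus>\<^bsub>tensor H H\<^esub>k\<in>?B. tens H H (?a i (Inl k)) (?a (Inl k) j) \<oplus>\<^bsub>tensor H H\<^esub> tens H H (?a i (Inr k)) (?a (Inr k) j))"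
          by (rule ks_finsum_cong[OF HH refl]) (use 4 bc M(3) H HH dm in \<open>simp_all add: HH_deriv_tens ks_add_comm[OF HH]\<close>)
        finally show ?thesis .
      qed
    qed
    then show "comult H (?a i j) = (\<Oplus>\<^bsub>tensor H H\<^esub>k\<in>?I. tens H H (?a i k) (?a k j))"
      using split by simp
  qed
  show "diff_rep H (prolong_rep dk H V)" unfolding RP by (rule diff_rep_mk_comod[OF P \<rho> s mat])
  show "functional (prolong_rep dk H V) (prolong_functional dk V u)" if "functional V u"
    using prolong_functional_functional[OF K that] by (simp add: RP)
  show "matrix_coeff H (prolong_rep dk H V) (?p1 v) (prolong_functional dk V u) = deriv H (matrix_coeff H V v u)"
    if "functional V u" "v \<in> carrier V"
    using slice_R1[OF K that(1) cc(1)[OF that(2)]] \<rho>p1[OF that(2)] by (simp add: matrix_coeff_slice RP \<rho>1_def)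
qed

end

section \<open>Transport of the structure\<close>

text \<open>\<open>R\<close> is a mere record of operations, related to those of \<open>H\<close> by
  a linear bijection. Every algebraic law of \<open>R\<close> is an equation that may be checked
  after applying \<Phi> or one of its tensor powers.\<close>

locale hopf_transport = dhopf dk H for dk :: "'k::field \<Rightarrow> 'k" and H :: "('k, 'a, 'c) hopf_scheme" +
  fixes R :: "('k, 'r, 'd) hopf_scheme" and \<Phi> :: "'r \<Rightarrow> 'a"
  assumes R: "kspace R" and \<Phi>: "lin_hom R H \<Phi>" and inj: "inj_on \<Phi> (carrier R)" and surj: "\<Phi> ` carrier R = carrier H"
    and mult_closed: "x \<in> carrier R \<Longrightarrow> y \<in> carrier R \<Longrightarrow> x \<otimes>\<^bsub>R\<^esub> y \<in> carrier R"
    and \<Phi>_mult: "x \<in> carrier R \<Longrightarrow> y \<in> carrier R \<Longrightarrow> \<Phi> (x \<otimes>\<^bsub>R\<^esub> y) = \<Phi> x \<otimes>\<^bsub>H\<^esub> \<Phi> y"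
    and one_closed: "\<one>\<^bsub>R\<^esub> \<in> carrier R" and \<Phi>_one: "\<Phi> \<one>\<^bsub>R\<^esub> = \<one>\<^bsub>H\<^esub>"
    and deriv_closed: "x \<in> carrier R \<Longrightarrow> deriv R x \<in> carrier R"
    and \<Phi>_deriv: "x \<in> carrier R \<Longrightarrow> \<Phi> (deriv R x) = deriv H (\<Phi> x)"
    and comult_closed: "x \<in> carrier R \<Longrightarrow> comult R x \<in> carrier (tensor R R)"
    and \<Phi>_comult: "x \<in> carrier R \<Longrightarrow> tensor_map R R H H \<Phi> \<Phi> (comult R x) = comult H (\<Phi> x)"
    and counit_eq: "x \<in> carrier R \<Longrightarrow> counit R x = counit H (\<Phi> x)"
    and coinv_closed: "x \<in> carrier R \<Longrightarrow> coinv R x \<in> carrier R"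
    and \<Phi>_coinv: "x \<in> carrier R \<Longrightarrow> \<Phi> (coinv R x) = coinv H (\<Phi> x)"
begin

lemmas \<Phi>D = lin_homD[OF \<Phi>]

lemma eqI: "x \<in> carrier R \<Longrightarrow> y \<in> carrier R \<Longrightarrow> \<Phi> x = \<Phi> y \<Longrightarrow> x = y"
  using inj by (simp add: inj_on_eq_iff)

definition \<Psi> :: "'a \<Rightarrow> 'r" where "\<Psi> = inv_into (carrier R) \<Phi>"

lemma \<Psi>_\<Phi>: "x \<in> carrier R \<Longrightarrow> \<Psi> (\<Phi> x) = x"
  using inj by (simp add: \<Psi>_def)

lemma \<Psi>: "lin_hom H R \<Psi>"
  using R by (intro lin_homI; (unfold surj[symmetric])?; elim imageE)
    (simp_all add: \<Psi>_\<Phi> \<Phi>D(2)[symmetric] \<Phi>D(3)[symmetric])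

lemma RR: "kspace (tensor R R)"
  using R by simp

abbreviation "\<Phi>\<Phi> \<equiv> tensor_map R R H H \<Phi> \<Phi>"
lemmas \<Phi>\<Phi>D = lin_homD[OF tensor_map_lin_hom[OF R R H H \<Phi> \<Phi>]]
lemmas \<Phi>\<Phi>_tens = tensor_map_tens[OF R R H H \<Phi> \<Phi>]

text \<open>Injectivity of a tensor product of maps, obtained from left inverses of the factors. It
  applies to \<Phi> \<otimes> \<Phi> and, with \<Phi> \<otimes> \<Phi> as a factor, to three-fold
  tensors.\<close>

lemma tensor_map_\<Phi>_inj:
  assumes V: "kspace V" and W: "kspace W" and V2: "kspace V2" and W2: "kspace W2"
    and f: "lin_hom V V2 f" and g: "lin_hom W W2 g" and f': "lin_hom V2 V f'" and g': "lin_hom W2 W g'"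
    and "\<And>v. v \<in> carrier V \<Longrightarrow> f' (f v) = v" "\<And>w. w \<in> carrier W \<Longrightarrow> g' (g w) = w"
    and x: "x \<in> carrier (tensor V W)"
  shows "tensor_map V2 W2 V W f' g' (tensor_map V W V2 W2 f g x) = x"
  using tensor_map_comp[OF V W V2 W2 V W f g f' g' x] tensor_map_id[OF V W assms(9,10) x] by simp

lemma \<Phi>\<Phi>_eqI:
  assumes "x \<in> carrier (tensor R R)" "y \<in> carrier (tensor R R)" "\<Phi>\<Phi> x = \<Phi>\<Phi> y"
  shows "x = y"
  using tensor_map_\<Phi>_inj[OF R R H H \<Phi> \<Phi> \<Psi> \<Psi> \<Psi>_\<Phi> \<Psi>_\<Phi>] assms by metis

lemma mult_bilinear_R: "bilinear R R R (mult R)"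
  by (rule bilinearI; (rule mult_closed eqI)?)
     (use R in \<open>simp_all add: mult_closed \<Phi>_mult \<Phi>D A.l_distr A.r_distr A.smult_assoc2 mult_smult_right\<close>)

lemma algebra_R: "algebra class_ring R"
proof (rule algebraI)
  have "comm_monoid R"
    by (rule comm_monoidI; (rule eqI)?)
       (simp_all add: mult_closed one_closed \<Phi>_mult \<Phi>_one \<Phi>D A.m_ac)
  then show "cring R"
    by (rule cringI[OF ks_abelian_group[OF R]])
       (rule balancedD(2)[OF bilinear_balanced[OF mult_bilinear_R]])
qed (use R mult_bilinear_R in \<open>simp_all add: cring_class_ring ks_smult_ldistr ks_smult_rdistr ks_smult_assoc bilinear_def\<close>)

lemma deriv_add_hom_R: "add_hom R R (deriv R)"
  by (rule add_homI; (rule deriv_closed eqI)?)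
     (use R in \<open>simp_all add: deriv_closed \<Phi>_deriv \<Phi>D add_homD(2)[OF deriv_add_hom]\<close>)

lemma deriv_smult_R: "x \<in> carrier R \<Longrightarrow> deriv R (c \<odot>\<^bsub>R\<^esub> x) = dk c \<odot>\<^bsub>R\<^esub> x \<oplus>\<^bsub>R\<^esub> c \<odot>\<^bsub>R\<^esub> deriv R x"
  by (rule eqI) (use R in \<open>simp_all add: deriv_closed \<Phi>_deriv \<Phi>D A.deriv_smult\<close>)

lemma derivation_R: "derivation R (deriv R)"
  unfolding derivation_def
  by (intro conjI ballI; (rule funcsetI eqI)?)
    (use R in \<open>simp_all add: deriv_closed mult_closed \<Phi>_deriv \<Phi>_mult \<Phi>D add_homD(2)[OF deriv_add_hom] deriv_mult\<close>)

text \<open>The counit and coinverse axioms contract \<Delta>(x) by a balanced map; this moves all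
  four of them from \<open>R\<close> to \<open>H\<close>.\<close>

lemma transport_ext:
  assumes \<beta>: "balanced R R R \<beta>" and \<gamma>: "balanced H H H \<gamma>"
    and eq: "\<And>a b. a \<in> carrier R \<Longrightarrow> b \<in> carrier R \<Longrightarrow> \<Phi> (\<beta> a b) = \<gamma> (\<Phi> a) (\<Phi> b)"
    and z: "z \<in> carrier (tensor R R)"
  shows "\<Phi> (tensor_ext R R R \<beta> z) = tensor_ext H H H \<gamma> (\<Phi>\<Phi> z)"
  by (rule tensor_hom_eqI[OF R R add_hom_comp[OF tensor_ext_add_hom[OF R R R \<beta>] \<Phi>D(4)]
        add_hom_comp[OF \<Phi>\<Phi>D(4) tensor_ext_add_hom[OF H H H \<gamma>]] _ z])
     (simp add: tensor_ext_tens[OF R R R \<beta>] tensor_ext_tens[OF H H H \<gamma>] \<Phi>\<Phi>_tens \<Phi>D eq)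

lemmas RR_mult_tens = tensor_mult_tens[OF R R mult_bilinear_R mult_bilinear_R]
lemmas RR_mult_left = lin_homD(4)[OF tensor_mult_hom_left[OF R R mult_bilinear_R mult_bilinear_R]]
lemmas RR_mult_right = tensor_mult_hom_right[OF R R mult_bilinear_R mult_bilinear_R]

text \<open>Compatibility with the products on R \<otimes> R and H \<otimes> H is what allows
  multiplicativity of the comultiplication to be checked after \<Phi> \<otimes> \<Phi>.\<close>

lemma \<Phi>\<Phi>_mult:
  assumes x: "x \<in> carrier (tensor R R)" and y: "y \<in> carrier (tensor R R)"
  shows "\<Phi>\<Phi> (x \<otimes>\<^bsub>tensor_dalg R R\<^esub> y) = \<Phi>\<Phi> x \<star> \<Phi>\<Phi> y"
  using x
proof (induction rule: tensor_induct[OF R R, consumes 1])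
  case (1 a b)
  have ab: "tens R R a b \<in> carrier (tensor R R)" using 1 R by simp
  have ab': "tens H H (\<Phi> a) (\<Phi> b) \<in> carrier (tensor H H)" using 1 H \<Phi>D(1) by simp
  show ?case
    using y
  proof (induction rule: tensor_induct[OF R R, consumes 1])
    case (1 c d)
    then show ?case
      using \<open>a \<in> carrier R\<close> \<open>b \<in> carrier R\<close>
      by (simp add: RR_mult_tens HH_mult_tens \<Phi>\<Phi>_tens mult_closed \<Phi>_mult \<Phi>D(1))
  next
    case (2 p q)
    then show ?case
      using ab ab' \<open>a \<in> carrier R\<close> \<open>b \<in> carrier R\<close>
      by (simp add: add_homD[OF RR_mult_right] \<Phi>\<Phi>D(1,2) add_homD(2)[OF HH_mult_right] \<Phi>\<Phi>_tens)
  qed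
next
  case (2 p q)
  then show ?case
    using y by (simp add: add_homD[OF RR_mult_left] \<Phi>\<Phi>D(1,2) add_homD(2)[OF HH_mult_left])
qed

lemmas RR_deriv_balanced = tensor_deriv_balanced[OF R deriv_add_hom_R deriv_smult_R]
lemmas HH_deriv_balanced = tensor_deriv_balanced[OF H deriv_add_hom A.deriv_smult]

lemma deriv_tens:
  "a \<in> carrier R \<Longrightarrow> b \<in> carrier R \<Longrightarrow>
    deriv (tensor_dalg R R) (tens R R a b) = tens R R (deriv R a) b \<oplus>\<^bsub>tensor R R\<^esub> tens R R a (deriv R b)"
  "c \<in> carrier H \<Longrightarrow> d \<in> carrier H \<Longrightarrow>
    deriv (tensor_dalg H H) (tens H H c d) = tens H H (deriv H c) d \<oplus>\<^bsub>tensor H H\<^esub> tens H H c (deriv H d)"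
  unfolding tensor_dalg_def mk_dalg_simps
  by (rule tensor_ext_tens[OF R R RR RR_deriv_balanced] tensor_ext_tens[OF H H HH HH_deriv_balanced]; assumption)+

lemma deriv_tensor_add_hom:
  "add_hom (tensor R R) (tensor R R) (deriv (tensor_dalg R R))"
  "add_hom (tensor H H) (tensor H H) (deriv (tensor_dalg H H))"
  unfolding tensor_dalg_def mk_dalg_simps
  using tensor_ext_add_hom[OF R R RR RR_deriv_balanced] tensor_ext_add_hom[OF H H HH HH_deriv_balanced] by fast+

lemma \<Phi>\<Phi>_deriv:
  assumes z: "z \<in> carrier (tensor R R)"
  shows "\<Phi>\<Phi> (deriv (tensor_dalg R R) z) = deriv (tensor_dalg H H) (\<Phi>\<Phi> z)"
  by (rule tensor_hom_eqI[OF R R add_hom_comp[OF deriv_tensor_add_hom(1) \<Phi>\<Phi>D(4)]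
        add_hom_comp[OF \<Phi>\<Phi>D(4) deriv_tensor_add_hom(2)] _ z])
     (use R H in \<open>simp add: deriv_tens \<Phi>\<Phi>_tens \<Phi>\<Phi>D(2) \<Phi>D(1) \<Phi>_deriv deriv_closed\<close>)

lemma comult_lin_hom_R: "lin_hom R (tensor R R) (comult R)"
  by (rule lin_homI; (rule comult_closed \<Phi>\<Phi>_eqI)?)
     (use R RR in \<open>simp_all add: comult_closed \<Phi>_comult \<Phi>D(1-3) \<Phi>\<Phi>D(2,3) lin_homD(2,3)[OF comult_hom]\<close>)

lemma comult_dalg_hom_R: "comult R \<in> dalg_hom R (tensor_dalg R R)"
proof -
  have m: "comult R (x \<otimes>\<^bsub>R\<^esub> y) = comult R x \<otimes>\<^bsub>tensor_dalg R R\<^esub> comult R y" if "x \<in> carrier R" "y \<in> carrier R" for x y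
    by (rule \<Phi>\<Phi>_eqI)
       (use that in \<open>simp_all add: comult_closed mult_closed add_homD(1)[OF RR_mult_left] \<Phi>_comult \<Phi>\<Phi>_mult \<Phi>_mult comult_mult \<Phi>D(1)\<close>)
  have o: "comult R \<one>\<^bsub>R\<^esub> = tens R R \<one>\<^bsub>R\<^esub> \<one>\<^bsub>R\<^esub>"
    by (rule \<Phi>\<Phi>_eqI) (use R in \<open>simp_all add: comult_closed one_closed \<Phi>_comult \<Phi>\<Phi>_tens \<Phi>_one comult_one\<close>)
  have d: "comult R (deriv R x) = deriv (tensor_dalg R R) (comult R x)" if "x \<in> carrier R" for x
    by (rule \<Phi>\<Phi>_eqI)
       (use that in \<open>simp_all add: comult_closed deriv_closed add_homD(1)[OF deriv_tensor_add_hom(1)] \<Phi>_comult \<Phi>\<Phi>_deriv \<Phi>_deriv comult_deriv \<Phi>D(1)\<close>)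
  have o': "\<one>\<^bsub>tensor_dalg R R\<^esub> = tens R R \<one>\<^bsub>R\<^esub> \<one>\<^bsub>R\<^esub>" and s: "carrier (tensor_dalg R R) = carrier (tensor R R)"
    "add (tensor_dalg R R) = add (tensor R R)" "smult (tensor_dalg R R) = smult (tensor R R)"
    by (simp_all add: tensor_dalg_def mk_dalg_def)
  show ?thesis
    unfolding dalg_hom_def Ring.ring_hom_def module_hom_def
    by (simp add: m o d o' s lin_homD(1-3)[OF comult_lin_hom_R])
qed

text \<open>\<Phi> \<otimes> \<Phi> \<otimes> \<Phi> carries both sides to the two sides of
  coassociativity in \<open>H\<close> at \<Phi>(x), and it has a left inverse.\<close>

lemma coassoc_R:
  assumes x: "x \<in> carrier R"
  shows "tensor_assoc R R R (tensor_map R R (tensor R R) R (comult R) (\<lambda>x. x) (comult R x)) =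
    tensor_map R R R (tensor R R) (\<lambda>x. x) (comult R) (comult R x)" (is "?l = ?r")
proof -
  let ?T = "tensor_map R (tensor R R) H (tensor H H) \<Phi> \<Phi>\<Phi>"
  note \<Delta> = comult_lin_hom_R
  note cx = comult_closed[OF x]
  have l: "?l \<in> carrier (tensor R (tensor R R))"
    by (rule tensor_assoc_closed[OF R R R tensor_map_closed[OF R R RR R \<Delta> lin_hom_ident cx]])
  have r: "?r \<in> carrier (tensor R (tensor R R))"
    by (rule tensor_map_closed[OF R R R RR lin_hom_ident \<Delta> cx])
  note ff = tensor_map_lin_hom[OF R R H H \<Phi> \<Phi>] and pp = tensor_map_lin_hom[OF H H R R \<Psi> \<Psi>]
  note tf = tensor_map_lin_hom[OF R RR H HH \<Phi> ff]
  note tf' = tensor_map_lin_hom[OF RR R HH H ff \<Phi>]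
  \<comment> \<open>Naturality of the associator in all three arguments.\<close>
  have nat: "?T (tensor_assoc R R R z) = tensor_assoc H H H (tensor_map (tensor R R) R (tensor H H) H \<Phi>\<Phi> \<Phi> z)"
    if z: "z \<in> carrier (tensor (tensor R R) R)" for z
    by (rule tensor3_hom_eqI[OF R R R add_hom_comp[OF tensor_assoc_add_hom[OF R R R] lin_homD(4)[OF tf]]
          add_hom_comp[OF lin_homD(4)[OF tf'] tensor_assoc_add_hom[OF H H H]] _ z])
       (use R H HH RR in \<open>simp add: tensor_assoc_tens[OF R R R] tensor_assoc_tens[OF H H H]
          tensor_map_tens[OF R RR H HH \<Phi> ff] tensor_map_tens[OF RR R HH H ff \<Phi>] \<Phi>\<Phi>_tens \<Phi>D(1)\<close>)
  have "?T ?l = tensor_assoc H H H (tensor_map (tensor R R) R (tensor H H) H \<Phi>\<Phi> \<Phi> (tensor_map R R (tensor R R) R (comult R) (\<lambda>x. x) (comult R x)))"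
    by (rule nat[OF tensor_map_closed[OF R R RR R \<Delta> lin_hom_ident cx]])
  also have "tensor_map (tensor R R) R (tensor H H) H \<Phi>\<Phi> \<Phi> (tensor_map R R (tensor R R) R (comult R) (\<lambda>x. x) (comult R x)) =
      tensor_map R R (tensor H H) H (\<lambda>y. \<Phi>\<Phi> (comult R y)) \<Phi> (comult R x)"
    by (rule tensor_map_comp[OF R R RR R HH H \<Delta> lin_hom_ident ff \<Phi> cx])
  also have "\<dots> = tensor_map R R (tensor H H) H (\<lambda>y. comult H (\<Phi> y)) \<Phi> (comult R x)"
    by (rule tensor_map_cong[OF R R HH H lin_hom_comp[OF \<Phi> comult_hom] \<Phi> _ _ cx]) (simp_all add: \<Phi>_comult)
  also have "\<dots> = tensor_map H H (tensor H H) H (comult H) (\<lambda>x. x) (\<Phi>\<Phi> (comult R x))"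
    by (rule tensor_map_comp[OF R R H H HH H \<Phi> \<Phi> comult_hom lin_hom_ident cx, symmetric])
  also have "tensor_assoc H H H \<dots> = tensor_map H H H (tensor H H) (\<lambda>x. x) (comult H) (\<Phi>\<Phi> (comult R x))"
    using A.coassoc[OF \<Phi>D(1)[OF x]] by (simp add: \<Phi>_comult[OF x] id_def)
  also have "\<dots> = tensor_map R R H (tensor H H) \<Phi> (\<lambda>y. comult H (\<Phi> y)) (comult R x)"
    by (rule tensor_map_comp[OF R R H H H HH \<Phi> \<Phi> lin_hom_ident comult_hom cx])
  also have "\<dots> = tensor_map R R H (tensor H H) \<Phi> (\<lambda>y. \<Phi>\<Phi> (comult R y)) (comult R x)"
    by (rule tensor_map_cong[OF R R H HH \<Phi> lin_hom_comp[OF \<Phi> comult_hom] _ _ cx, symmetric]) (simp_all add: \<Phi>_comult)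
  also have "\<dots> = ?T ?r"
    by (rule tensor_map_comp[OF R R R RR H HH lin_hom_ident \<Delta> \<Phi> ff cx, symmetric])
  finally have eq: "?T ?l = ?T ?r" .
  have inv2: "tensor_map H H R R \<Psi> \<Psi> (\<Phi>\<Phi> w) = w" if "w \<in> carrier (tensor R R)" for w
    by (rule tensor_map_\<Phi>_inj[OF R R H H \<Phi> \<Phi> \<Psi> \<Psi> _ _ that]) (simp_all add: \<Psi>_\<Phi>)
  \<comment> \<open>The left inverse of the three-fold tensor power of \<Phi>, built from
    \<Psi>.\<close>
  have inv: "tensor_map H (tensor H H) R (tensor R R) \<Psi> (tensor_map H H R R \<Psi> \<Psi>) (?T z) = z"
    if "z \<in> carrier (tensor R (tensor R R))" for z
    by (rule tensor_map_\<Phi>_inj[OF R RR H HH \<Phi> ff \<Psi> pp _ _ that]) (erule \<Psi>_\<Phi> inv2)+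
  from inv[OF l] inv[OF r] show ?thesis unfolding eq by (rule trans[OF sym])
qed

lemma counit_functional_R: "functional R (counit R)"
  using R by (intro functionalI) (simp_all add: counit_eq \<Phi>D functionalD[OF counit_functional])

lemma coinv_lin_hom_R: "lin_hom R R (coinv R)"
  by (rule lin_homI; (rule coinv_closed eqI)?)
     (use R in \<open>simp_all add: coinv_closed \<Phi>_coinv \<Phi>D lin_homD(2,3)[OF coinv_lin_hom]\<close>)

lemma mult_smult_R:
  "x \<in> carrier R \<Longrightarrow> y \<in> carrier R \<Longrightarrow> (c \<odot>\<^bsub>R\<^esub> x) \<otimes>\<^bsub>R\<^esub> y = c \<odot>\<^bsub>R\<^esub> (x \<otimes>\<^bsub>R\<^esub> y)"
  "x \<in> carrier R \<Longrightarrow> y \<in> carrier R \<Longrightarrow> x \<otimes>\<^bsub>R\<^esub> (c \<odot>\<^bsub>R\<^esub> y) = c \<odot>\<^bsub>R\<^esub> (x \<otimes>\<^bsub>R\<^esub> y)"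
  by (rule eqI; use R in \<open>simp add: mult_closed \<Phi>_mult \<Phi>D A.smult_assoc2 mult_smult_right\<close>)+

lemma coinv_bilinear_R:
  "bilinear R R R (\<lambda>a b. coinv R a \<otimes>\<^bsub>R\<^esub> b)" "bilinear R R R (\<lambda>a b. a \<otimes>\<^bsub>R\<^esub> coinv R b)"
  by (rule bilinearI; simp add: coinv_closed mult_closed lin_homD(2,3)[OF coinv_lin_hom_R]
      balancedD(2,3)[OF bilinear_balanced[OF mult_bilinear_R]] mult_smult_R)+

lemma diff_hopf_hom_transport: "diff_hopf_hom dk R H \<Phi>"
proof (intro diff_hopf_hom.intro diff_hopf_algebra.intro diff_algebra.intro)
  show "algebra class_ring R" by (rule algebra_R)
  show "diff_algebra_axioms dk R"
    by (rule diff_algebra_axioms.intro[OF derivation_R deriv_smult_R])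
  show "diff_hopf_algebra_axioms dk R"
  proof (rule diff_hopf_algebra_axioms.intro)
    show "comult R \<in> dalg_hom R (tensor_dalg R R)" by (rule comult_dalg_hom_R)
    show "counit R \<in> dalg_hom R (field_dalg dk)"
      unfolding dalg_hom_def Ring.ring_hom_def module_hom_def
      using functionalD[OF counit_functional_R]
      by (simp add: field_dalg_def counit_eq mult_closed one_closed deriv_closed \<Phi>_mult \<Phi>_one \<Phi>_deriv \<Phi>D(1)
          counit_mult counit_one counit_deriv)
    have "coinv R (x \<otimes>\<^bsub>R\<^esub> y) = coinv R x \<otimes>\<^bsub>R\<^esub> coinv R y" if "x \<in> carrier R" "y \<in> carrier R" for x y
      using that A.coinv_hom
      by (intro eqI) (simp_all add: coinv_closed mult_closed \<Phi>_coinv \<Phi>_mult \<Phi>D(1) dalg_hom_def Ring.ring_hom_def)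
    moreover have "coinv R \<one>\<^bsub>R\<^esub> = \<one>\<^bsub>R\<^esub>"
      using A.coinv_hom
      by (intro eqI) (simp_all add: coinv_closed one_closed \<Phi>_coinv \<Phi>_one dalg_hom_def Ring.ring_hom_def)
    moreover have "coinv R (deriv R x) = deriv R (coinv R x)" if "x \<in> carrier R" for x
      using that A.coinv_hom
      by (intro eqI) (simp_all add: coinv_closed deriv_closed \<Phi>_coinv \<Phi>_deriv \<Phi>D(1) dalg_hom_def)
    ultimately show "coinv R \<in> dalg_hom R R"
      unfolding dalg_hom_def Ring.ring_hom_def module_hom_def
      using lin_homD(1-3)[OF coinv_lin_hom_R] by simp
    fix x assume x: "x \<in> carrier R"
    note cx = comult_closed[OF x]
    show "tensor_assoc R R R (tensor_map R R (tensor R R) R (comult R) id (comult R x)) =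
        tensor_map R R R (tensor R R) id (comult R) (comult R x)"
      using coassoc_R[OF x] by (simp add: id_def)
    have b1: "balanced R R R (\<lambda>a b. counit R a \<odot>\<^bsub>R\<^esub> b)" "balanced H H H (\<lambda>a b. counit H a \<odot>\<^bsub>H\<^esub> b)"
      by (rule bilinear_balanced[OF slice_bilinear[OF R R counit_functional_R]],
          rule bilinear_balanced[OF slice_bilinear[OF H H counit_functional]])
    have b2: "balanced R R R (\<lambda>a b. counit R b \<odot>\<^bsub>R\<^esub> a)" "balanced H H H (\<lambda>a b. counit H b \<odot>\<^bsub>H\<^esub> a)"
      by (rule bilinear_balanced[OF slice_right_bilinear[OF R R counit_functional_R]],
          rule bilinear_balanced[OF slice_right_bilinear[OF H H counit_functional]])
    note b3 = bilinear_balanced[OF coinv_bilinear_R(1)] bilinear_balanced[OF coinv_bilinear(1)]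
    note b4 = bilinear_balanced[OF coinv_bilinear_R(2)] bilinear_balanced[OF coinv_bilinear(2)]
    have o: "counit R x \<odot>\<^bsub>R\<^esub> \<one>\<^bsub>R\<^esub> \<in> carrier R" "\<Phi> (counit R x \<odot>\<^bsub>R\<^esub> \<one>\<^bsub>R\<^esub>) = counit H (\<Phi> x) \<odot>\<^bsub>H\<^esub> \<one>\<^bsub>H\<^esub>"
      using x R one_closed by (simp_all add: \<Phi>D \<Phi>_one counit_eq)
    show "tensor_ext R R R (\<lambda>a b. counit R a \<odot>\<^bsub>R\<^esub> b) (comult R x) = x"
      by (rule eqI[OF tensor_ext_closed[OF R R R b1(1) cx] x], subst transport_ext[OF b1 _ cx])
         (use x A.counit_left[OF \<Phi>D(1)[OF x]] in \<open>simp_all add: \<Phi>D counit_eq \<Phi>_comult\<close>)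
    show "tensor_ext R R R (\<lambda>a b. counit R b \<odot>\<^bsub>R\<^esub> a) (comult R x) = x"
      by (rule eqI[OF tensor_ext_closed[OF R R R b2(1) cx] x], subst transport_ext[OF b2 _ cx])
         (use x A.counit_right[OF \<Phi>D(1)[OF x]] in \<open>simp_all add: \<Phi>D counit_eq \<Phi>_comult\<close>)
    show "tensor_ext R R R (\<lambda>a b. coinv R a \<otimes>\<^bsub>R\<^esub> b) (comult R x) = counit R x \<odot>\<^bsub>R\<^esub> \<one>\<^bsub>R\<^esub>"
      by (rule eqI[OF tensor_ext_closed[OF R R R b3(1) cx] o(1)], subst transport_ext[OF b3 _ cx])
         (use x A.coinv_left[OF \<Phi>D(1)[OF x]] o(2) in \<open>simp_all add: \<Phi>_mult \<Phi>_coinv coinv_closed \<Phi>_comult\<close>)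
    show "tensor_ext R R R (\<lambda>a b. a \<otimes>\<^bsub>R\<^esub> coinv R b) (comult R x) = counit R x \<odot>\<^bsub>R\<^esub> \<one>\<^bsub>R\<^esub>"
      by (rule eqI[OF tensor_ext_closed[OF R R R b4(1) cx] o(1)], subst transport_ext[OF b4 _ cx])
         (use x A.coinv_right[OF \<Phi>D(1)[OF x]] o(2) in \<open>simp_all add: \<Phi>_mult \<Phi>_coinv coinv_closed \<Phi>_comult\<close>)
  qed
  show "algebra class_ring H" by (rule A.algebra_axioms)
  show "diff_algebra_axioms dk H" by (rule A.diff_algebra_axioms[unfolded diff_algebra_def, THEN conjunct2])
  show "diff_hopf_algebra_axioms dk H" by (rule hopf[unfolded diff_hopf_algebra_def, THEN conjunct2])
  show "diff_hopf_hom_axioms R H \<Phi>"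
  proof (rule diff_hopf_hom_axioms.intro)
    show "\<Phi> \<in> dalg_hom R H"
      unfolding dalg_hom_def Ring.ring_hom_def module_hom_def
      by (simp add: \<Phi>D \<Phi>_mult \<Phi>_one \<Phi>_deriv)
  qed (simp_all add: \<Phi>_comult counit_eq \<Phi>_coinv)
qed

end

section \<open>The operations of \<A> in terms of those of the coordinate ring\<close>

lemma rep_algebra_simps [simp]:
  "carrier (rep_algebra dk H) = carrier (rep_quot H)" "\<zero>\<^bsub>rep_algebra dk H\<^esub> = \<zero>\<^bsub>rep_quot H\<^esub>"
  "add (rep_algebra dk H) = add (rep_quot H)" "smult (rep_algebra dk H) = smult (rep_quot H)"
  by (simp_all add: rep_algebra_def)

lemma tensor_rep_algebra [simp]:
  "tensor (rep_algebra dk H) (rep_algebra dk H) = tensor (rep_quot H) (rep_quot H)"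
  "tens (rep_algebra dk H) (rep_algebra dk H) = tens (rep_quot H) (rep_quot H)"
  by (rule tensor_cong; simp)+

lemma tensor_map_rep_algebra [simp]:
  "tensor_map (rep_algebra dk H) (rep_algebra dk H) A B = tensor_map (rep_quot H) (rep_quot H) A B"
  by (simp add: tensor_map_def tensor_ext_def fun_eq_iff)

locale rep_hopf_full = rep_hopf_large dk H large + rep_hopf_deriv dk H
  for dk :: "'k::field \<Rightarrow> 'k" and H :: "('k, 'a) hopf" and large :: "'k list \<Rightarrow> 'v"
begin

abbreviation "RA \<equiv> (rep_algebra dk H :: ('k, ('k, 'v, 'a) rep_elt) hopf)"

definition \<Psi> :: "'a \<Rightarrow> ('k, 'v, 'a) rep_elt" where "\<Psi> = inv_into (carrier Q) \<Phi>"

lemma \<Psi>_\<Phi>: "x \<in> carrier Q \<Longrightarrow> \<Psi> (\<Phi> x) = x"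
  using Phi_inj by (simp add: \<Psi>_def)

lemma \<Phi>_\<Psi>: "h \<in> carrier H \<Longrightarrow> \<Phi> (\<Psi> h) = h" and \<Psi>_closed: "h \<in> carrier H \<Longrightarrow> \<Psi> h \<in> carrier Q"
  unfolding \<Psi>_def by (simp_all add: f_inv_into_f inv_into_into Phi_surj)

lemmas PhiD = lin_homD[OF Phi_lin_hom]

lemma \<Psi>_lin_hom: "lin_hom H Q \<Psi>"
  by (rule lin_homI; (rule \<Psi>_closed Phi_inj[THEN inj_onD])?)
     (use Q_kspace H in \<open>simp_all add: PhiD \<Psi>_closed \<Phi>_\<Psi>\<close>)

lemma \<Psi>_coeff:
  assumes "V \<in> Reps" "v \<in> carrier V" "u \<in> carrier (dual_space V)"
  shows "\<Psi> (matrix_coeff H V v u) = rep_coeff0 H V v u"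
  using \<Psi>_\<Phi>[OF coeff_closed[OF assms]] by (simp only: Phi_coeff[OF assms])

text \<open>The operations of \<A> are prescribed by coefficients of representations on other types,
  and these are recognized by their matrix coefficients through \<Psi>.\<close>

lemma \<Psi>_rep_coeff:
  assumes "diff_rep H V" "v \<in> carrier V" "functional V u"
  shows "\<Psi> (matrix_coeff H V v u) = rep_coeff H V v u"
  using \<Psi>_\<Phi>[OF rep_coeff_closed[OF assms]] by (simp only: Phi_rep_coeff[OF assms])

lemma dual_functional: "u \<in> carrier (dual_space V) \<Longrightarrow> functional V u"
  by simp

text \<open>\<open>coeff_ext_eq\<close> is used twice, matching the nested definition: first in y
  for a fixed generator in place of x, then in x. The values agree since coefficients of tensor
  products are products.\<close>

lemma RA_mult:
  assumes x: "x \<in> carrier Q" and y: "y \<in> carrier Q"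
  shows "x \<otimes>\<^bsub>RA\<^esub> y = \<Psi> (\<Phi> x \<otimes>\<^bsub>H\<^esub> \<Phi> y)"
proof -
  have inner: "rep_coeff_ext H Q (\<lambda>W w t. rep_coeff H (tensor_rep H V W) (tens V W v w) (tensor_functional V W u t)) y =
      \<Psi> (matrix_coeff H V v u \<otimes>\<^bsub>H\<^esub> \<Phi> y)"
    if V: "V \<in> Reps" "v \<in> carrier V" "u \<in> carrier (dual_space V)" for V v u
  proof (rule coeff_ext_eq[OF Q_kspace _ _ y])
    have m: "matrix_coeff H V v u \<in> carrier H"
      by (rule balancedD(1)[OF bilinear_balanced[OF matrix_coeff_bilinear[OF RepD(1)[OF V(1)]]] V(2,3)])
    show "add_hom Q Q (\<lambda>y. \<Psi> (matrix_coeff H V v u \<otimes>\<^bsub>H\<^esub> \<Phi> y))"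
      by (rule add_hom_comp[OF add_hom_comp[OF PhiD(4) mult_add_hom(1)[OF m]] lin_homD(4)[OF \<Psi>_lin_hom]])
    fix W :: "('k, 'v, 'a) comod" and w t
    assume W: "W \<in> Reps" "w \<in> carrier W" "t \<in> carrier (dual_space W)"
    note RV = RepD[OF V(1)] and RW = RepD[OF W(1)]
    note T = tensor_rep[OF RV(1) RW(1)]
    note u = dual_functional[OF V(3)] and t = dual_functional[OF W(3)]
    have "tens V W v w \<in> carrier (tensor_rep H V W)"
      using V(2) W(2) RV(2) RW(2) by (simp add: tensor_rep_def)
    from \<Psi>_rep_coeff[OF T(1) this T(2)[OF u t]]
    show "\<Psi> (matrix_coeff H V v u \<otimes>\<^bsub>H\<^esub> \<Phi> (rep_coeff0 H W w t)) =
        rep_coeff H (tensor_rep H V W) (tens V W v w) (tensor_functional V W u t)"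
      using T(3)[OF u t V(2) W(2)] Phi_coeff[OF W] by simp
  qed
  have "x \<otimes>\<^bsub>RA\<^esub> y = rep_coeff_ext H Q (\<lambda>V v u. rep_coeff_ext H Q
      (\<lambda>W w t. rep_coeff H (tensor_rep H V W) (tens V W v w) (tensor_functional V W u t)) y) x"
    by (simp add: rep_algebra_def)
  also have "\<dots> = \<Psi> (\<Phi> x \<otimes>\<^bsub>H\<^esub> \<Phi> y)"
  proof (rule coeff_ext_eq[OF Q_kspace _ _ x])
    show "add_hom Q Q (\<lambda>x. \<Psi> (\<Phi> x \<otimes>\<^bsub>H\<^esub> \<Phi> y))"
      by (rule add_hom_comp[OF add_hom_comp[OF PhiD(4) mult_add_hom(2)[OF PhiD(1)[OF y]]] lin_homD(4)[OF \<Psi>_lin_hom]])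
  qed (simp add: inner Phi_coeff del: dual_space_simps)
  finally show ?thesis .
qed

lemma RA_one: "\<one>\<^bsub>RA\<^esub> = \<Psi> \<one>\<^bsub>H\<^esub>"
proof -
  have "(1 :: 'k) \<in> carrier (trivial_rep H)" by (simp add: trivial_rep_def)
  from \<Psi>_rep_coeff[OF trivial_rep(1) this trivial_rep(3)]
  show ?thesis by (simp add: rep_algebra_def trivial_rep(2))
qed

text \<open>The values on generators agree by \<psi>(\<partial>v \<otimes> F(u)) =
  \<partial>\<psi>(v \<otimes> u), the last part of \<open>prolong_rep\<close>.\<close>

lemma RA_deriv:
  assumes x: "x \<in> carrier Q"
  shows "deriv RA x = \<Psi> (deriv H (\<Phi> x))"
proof -
  have "deriv RA x = rep_coeff_ext H Q
      (\<lambda>V v u. rep_coeff H (prolong_rep dk H V) (prol1 dk V v) (prolong_functional dk V u)) x"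
    by (simp add: rep_algebra_def)
  also have "\<dots> = \<Psi> (deriv H (\<Phi> x))"
  proof (rule coeff_ext_eq[OF Q_kspace _ _ x])
    show "add_hom Q Q (\<lambda>x. \<Psi> (deriv H (\<Phi> x)))"
      by (rule add_hom_comp[OF add_hom_comp[OF PhiD(4) deriv_add_hom] lin_homD(4)[OF \<Psi>_lin_hom]])
    fix V :: "('k, 'v, 'a) comod" and v u
    assume V: "V \<in> Reps" "v \<in> carrier V" "u \<in> carrier (dual_space V)"
    note RV = RepD[OF V(1)] and P = prolong_rep[OF RepD(1)[OF V(1)]]
    note u = dual_functional[OF V(3)]
    have "prol1 dk V v \<in> carrier (prolong_rep dk H V)"
      using prol_closed(2)[OF RV(2) V(2)] by (simp add: prolong_rep_def)
    from \<Psi>_rep_coeff[OF P(1) this P(2)[OF u]]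
    show "\<Psi> (deriv H (\<Phi> (rep_coeff0 H V v u))) =
        rep_coeff H (prolong_rep dk H V) (prol1 dk V v) (prolong_functional dk V u)"
      using P(3)[OF u V(2)] Phi_coeff[OF V] by simp
  qed
  finally show ?thesis .
qed

text \<open>The coefficient of the dual representation at u and the evaluation at v is S(\<psi>(v
  \<otimes> u)), by \<open>dual_rep\<close>.\<close>

lemma RA_coinv:
  assumes x: "x \<in> carrier Q"
  shows "coinv RA x = \<Psi> (coinv H (\<Phi> x))"
proof -
  have "coinv RA x = rep_coeff_ext H Q
      (\<lambda>V v u. rep_coeff H (dual_rep H V) u (\<lambda>t\<in>carrier (dual_space V). t v)) x"
    by (simp add: rep_algebra_def)
  also have "\<dots> = \<Psi> (coinv H (\<Phi> x))"
  proof (rule coeff_ext_eq[OF Q_kspace _ _ x])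
    show "add_hom Q Q (\<lambda>x. \<Psi> (coinv H (\<Phi> x)))"
      by (rule lin_homD(4)[OF lin_hom_comp[OF lin_hom_comp[OF Phi_lin_hom coinv_lin_hom] \<Psi>_lin_hom]])
    fix V :: "('k, 'v, 'a) comod" and v u
    assume V: "V \<in> Reps" "v \<in> carrier V" "u \<in> carrier (dual_space V)"
    note D = dual_rep[OF RepD(1)[OF V(1)]]
    have "u \<in> carrier (dual_rep H V)"
      using V(3) unfolding dual_rep_def mk_comod_simps .
    from \<Psi>_rep_coeff[OF D(1) this D(2)[OF V(2)]]
    show "\<Psi> (coinv H (\<Phi> (rep_coeff0 H V v u))) =
        rep_coeff H (dual_rep H V) u (\<lambda>t\<in>carrier (dual_space V). t v)"
      by (simp only: D(3)[OF V(3,2)] Phi_coeff[OF V])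
  qed
  finally show ?thesis .
qed

lemma RA_counit:
  assumes x: "x \<in> carrier Q"
  shows "counit RA x = counit H (\<Phi> x)"
proof -
  have "counit RA x = rep_coeff_ext H (field_space :: ('k, 'k) module) (\<lambda>V v u. u v) x"
    by (simp add: rep_algebra_def)
  also have "\<dots> = counit H (\<Phi> x)"
  proof (rule coeff_ext_eq[OF kspace_field_space _ _ x])
    show "add_hom Q field_space (\<lambda>x. counit H (\<Phi> x))"
      by (rule lin_homD(4)[OF lin_hom_comp[OF Phi_lin_hom counit_functional]])
    fix V :: "('k, 'v, 'a) comod" and v u
    assume V: "V \<in> Reps" "v \<in> carrier V" "u \<in> carrier (dual_space V)"
    show "counit H (\<Phi> (rep_coeff0 H V v u)) = u v"
      using counit_slice[OF RepD(5)[OF V(1)] dual_functional[OF V(3)] V(2)]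
      by (simp only: Phi_coeff[OF V] matrix_coeff_slice)
  qed
  finally show ?thesis .
qed

abbreviation "\<Psi>\<Psi> \<equiv> tensor_map H H Q Q \<Psi> \<Psi>"
lemmas \<Psi>\<Psi>_lin_hom = tensor_map_lin_hom[OF H H Q_kspace Q_kspace \<Psi>_lin_hom \<Psi>_lin_hom]
lemmas \<Psi>\<Psi>_tens = tensor_map_tens[OF H H Q_kspace Q_kspace \<Psi>_lin_hom \<Psi>_lin_hom]

lemma RA_comult:
  assumes x: "x \<in> carrier Q"
  shows "comult RA x = \<Psi>\<Psi> (comult H (\<Phi> x))"
proof -
  have QQ: "kspace (tensor Q Q)" using Q_kspace by simp
  have "comult RA x = rep_coeff_ext H (tensor Q Q)
        (\<lambda>V v u. \<Oplus>\<^bsub>tensor Q Q\<^esub>b\<in>some_basis V.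
           tens Q Q (rep_coeff0 H V b u) (rep_coeff0 H V v (dual_vec V (some_basis V) b))) x"
    by (simp add: rep_algebra_def)
  also have "\<dots> = \<Psi>\<Psi> (comult H (\<Phi> x))"
  proof (rule coeff_ext_eq[OF QQ _ _ x])
    show "add_hom Q (tensor Q Q) (\<lambda>x. \<Psi>\<Psi> (comult H (\<Phi> x)))"
      by (rule lin_homD(4)[OF lin_hom_comp[OF lin_hom_comp[OF Phi_lin_hom comult_hom] \<Psi>\<Psi>_lin_hom]])
    fix V :: "('k, 'v, 'a) comod" and v u
    assume V: "V \<in> Reps" "v \<in> carrier V" "u \<in> carrier (dual_space V)"
    note RV = RepD[OF V(1)] and R = diff_rep_comodule[OF RepD(1)[OF V(1)]]
    note C = comoduleD(2)[OF RV(5)] and fr = frameD[OF R(5)]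
    let ?B = "some_basis V" and ?d = "dual_vec V (some_basis V)"
    have dD: "?d b \<in> carrier (dual_space V)" if "b \<in> ?B" for b by (rule frame_some_basis(2)[OF R(3,4) that])
    note mc = balancedD(1)[OF bilinear_balanced[OF matrix_coeff_bilinear[OF RV(1)]]]
    have VH: "kspace (tensor V H)" using RV(2) H by simp
    have l: "lin_hom V H (\<lambda>w. slice V H u (coact V w))"
      by (rule lin_hom_comp[OF C slice_lin_hom[OF RV(2) H dual_functional[OF V(3)]]])
    have "comult H (\<Phi> (rep_coeff0 H V v u)) = tensor_map V H H H (\<lambda>w. slice V H u (coact V w)) (\<lambda>x. x) (coact V v)"
      using comult_slice[OF RV(5) dual_functional[OF V(3)] V(2)] by (simp only: Phi_coeff[OF V] matrix_coeff_slice)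
    also have "coact V v = (\<Oplus>\<^bsub>tensor V H\<^esub>b\<in>?B. tens V H b (matrix_coeff H V v (?d b)))"
      unfolding matrix_coeff_slice by (rule frame_tensor[OF RV(2) H R(5) lin_homD(1)[OF C V(2)], symmetric])
    also have "tensor_map V H H H (\<lambda>w. slice V H u (coact V w)) (\<lambda>x. x) \<dots> =
        (\<Oplus>\<^bsub>tensor H H\<^esub>b\<in>?B. tensor_map V H H H (\<lambda>w. slice V H u (coact V w)) (\<lambda>x. x) (tens V H b (matrix_coeff H V v (?d b))))"
      by (rule add_hom_finsum[OF VH HH tensor_map_add_hom[OF RV(2) H H H l lin_hom_ident]])
         (use RV(2) H fr(2) mc[OF V(2) dD] in simp)
    also have "\<dots> = (\<Oplus>\<^bsub>tensor H H\<^esub>b\<in>?B. tens H H (matrix_coeff H V b u) (matrix_coeff H V v (?d b)))"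
      by (rule ks_finsum_cong[OF HH refl])
         (use RV(2) H fr(2) mc[OF V(2) dD] mc[OF _ V(3)] in
           \<open>simp_all add: tensor_map_tens[OF RV(2) H H H l lin_hom_ident] matrix_coeff_slice\<close>)
    finally have "\<Psi>\<Psi> (comult H (\<Phi> (rep_coeff0 H V v u))) =
        \<Psi>\<Psi> (\<Oplus>\<^bsub>tensor H H\<^esub>b\<in>?B. tens H H (matrix_coeff H V b u) (matrix_coeff H V v (?d b)))" by simp
    also have "\<dots> = (\<Oplus>\<^bsub>tensor Q Q\<^esub>b\<in>?B. \<Psi>\<Psi> (tens H H (matrix_coeff H V b u) (matrix_coeff H V v (?d b))))"
      by (rule add_hom_finsum[OF HH QQ lin_homD(4)[OF \<Psi>\<Psi>_lin_hom]])
         (use H fr(2) mc[OF V(2) dD] mc[OF _ V(3)] in simp)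
    also have "\<dots> = (\<Oplus>\<^bsub>tensor Q Q\<^esub>b\<in>?B. tens Q Q (rep_coeff0 H V b u) (rep_coeff0 H V v (?d b)))"
    proof (rule ks_finsum_cong[OF QQ refl])
      fix b assume b: "b \<in> ?B"
      have bV: "b \<in> carrier V" using fr(2)[OF b] by simp
      show "\<Psi>\<Psi> (tens H H (matrix_coeff H V b u) (matrix_coeff H V v (?d b))) =
          tens Q Q (rep_coeff0 H V b u) (rep_coeff0 H V v (?d b))"
        by (simp only: \<Psi>\<Psi>_tens mc[OF bV V(3)] mc[OF V(2) dD[OF b]] \<Psi>_coeff[OF V(1) bV V(3)] \<Psi>_coeff[OF V(1,2) dD[OF b]])
      show "tens Q Q (rep_coeff0 H V b u) (rep_coeff0 H V v (?d b)) \<in> carrier (tensor Q Q)"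
        by (rule tens_closed[OF Q_kspace Q_kspace coeff_closed[OF V(1) bV V(3)] coeff_closed[OF V(1,2) dD[OF b]]])
    qed
    finally show "\<Psi>\<Psi> (comult H (\<Phi> (rep_coeff0 H V v u))) =
        (\<Oplus>\<^bsub>tensor Q Q\<^esub>b\<in>?B. tens Q Q (rep_coeff0 H V b u) (rep_coeff0 H V v (?d b)))" .
  qed
  finally show ?thesis .
qed

lemma hopf_transport: "hopf_transport dk H RA \<Phi>"
proof
  show "kspace RA" by (rule kspace_cong[OF Q_kspace]) simp_all
  show "lin_hom RA H \<Phi>" using Phi_lin_hom by (simp add: lin_hom_def add_hom_def)
  show "inj_on \<Phi> (carrier RA)" "\<Phi> ` carrier RA = carrier H" by (simp_all add: Phi_inj Phi_surj)
  show "\<one>\<^bsub>RA\<^esub> \<in> carrier RA" "\<Phi> \<one>\<^bsub>RA\<^esub> = \<one>\<^bsub>H\<^esub>" by (simp_all add: RA_one \<Psi>_closed \<Phi>_\<Psi>)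
  fix x assume "x \<in> carrier RA"
  then have x: "x \<in> carrier Q" by simp
  show "x \<otimes>\<^bsub>RA\<^esub> y \<in> carrier RA" "\<Phi> (x \<otimes>\<^bsub>RA\<^esub> y) = \<Phi> x \<otimes>\<^bsub>H\<^esub> \<Phi> y" if "y \<in> carrier RA" for y
    using x that by (simp_all add: RA_mult \<Psi>_closed \<Phi>_\<Psi> PhiD(1))
  show "deriv RA x \<in> carrier RA" "\<Phi> (deriv RA x) = deriv H (\<Phi> x)"
    using x by (simp_all add: RA_deriv \<Psi>_closed \<Phi>_\<Psi> PhiD(1) add_homD(1)[OF deriv_add_hom])
  show "coinv RA x \<in> carrier RA" "\<Phi> (coinv RA x) = coinv H (\<Phi> x)"
    using x by (simp_all add: RA_coinv \<Psi>_closed \<Phi>_\<Psi> PhiD(1) lin_homD(1)[OF coinv_lin_hom])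
  show "counit RA x = counit H (\<Phi> x)" by (rule RA_counit[OF x])
  have c: "comult H (\<Phi> x) \<in> carrier (tensor H H)" by (rule lin_homD(1)[OF comult_hom PhiD(1)[OF x]])
  show "comult RA x \<in> carrier (tensor RA RA)"
    using lin_homD(1)[OF \<Psi>\<Psi>_lin_hom c] by (simp add: RA_comult[OF x])
  \<comment> \<open>The comultiplication was computed through \<Psi> \<otimes> \<Psi>, and \<Phi>
    \<otimes> \<Phi> undoes it because \<Phi> \<circ> \<Psi> is the identity on
    \<open>H\<close>.\<close>
  have "tensor_map Q Q H H \<Phi> \<Phi> (\<Psi>\<Psi> (comult H (\<Phi> x))) = tensor_map H H H H (\<lambda>h. \<Phi> (\<Psi> h)) (\<lambda>h. \<Phi> (\<Psi> h)) (comult H (\<Phi> x))"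
    by (rule tensor_map_comp[OF H H Q_kspace Q_kspace H H \<Psi>_lin_hom \<Psi>_lin_hom Phi_lin_hom Phi_lin_hom c])
  also have "\<dots> = comult H (\<Phi> x)" by (rule tensor_map_id[OF H H _ _ c]) (simp_all add: \<Phi>_\<Psi>)
  finally show "tensor_map RA RA H H \<Phi> \<Phi> (comult RA x) = comult H (\<Phi> x)" by (simp add: RA_comult[OF x])
qed

end

section \<open>Application to the coordinate ring of G\<close>

theorem proposition5:
  fixes dk :: "'k::field_char_0 \<Rightarrow> 'k"
    and dU :: "'u::field_char_0 \<Rightarrow> 'u"
    and emb :: "'k \<Rightarrow> 'u"
    and n :: nat
    and G :: "'u mat set"
    and H :: "('k, 'k dpoly fract set) hopf"
    and large :: "'k list \<Rightarrow> 'v"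
  assumes "derivation class_ring dk"
    and "semi_universal dk dU emb"
    and "linear_diff_alg_group emb dU n G"
    and "is_coordinate_hopf_algebra dk dU emb n G H"
    and "inj large"
  shows "diff_hopf_hom dk
           (rep_algebra dk H :: ('k, ('k, 'v, 'k dpoly fract set) rep_elt) hopf) H (rep_coeff_map H)"
proof -
  have "diff_hopf_algebra dk H" using assms(4) by (simp add: is_coordinate_hopf_algebra_def)
  then have "rep_hopf_full dk H large"
    using assms(1,5)
    by (intro rep_hopf_full.intro rep_hopf_large.intro rep_hopf.intro dhopf.intro rep_hopf_large_axioms.intro
        rep_hopf_deriv.intro rep_hopf_deriv_axioms.intro)
  then interpret rep_hopf_full dk H large .
  show ?thesis by (rule hopf_transport.diff_hopf_hom_transport[OF hopf_transport])
qed

end
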